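(* Let $\Omega\subset\mathbb{R}^d$ be an open, bounded, convex domain. Let $\mathcal{A}$ be a (nonempty) compact metric space, let $a\in C(\overline{\Omega}\times\mathcal{A};\mathbb{R}^{d\times d}_{\mathrm{sym},+})$ be such that $a(x,\alpha)\in\mathcal{C}(\underline{\nu},\overline{\nu},\varepsilon)$ for all $x\in\overline{\Omega}$, $\alpha\in\mathcal{A}$, for some constants $\overline{\nu}\geq\underline{\nu}>0$ and $\varepsilon\in(0,1]$, and let $f\in C(\overline{\Omega}\times\mathcal{A})$. Let $F\colon L^2(\Omega)\to L^2(\Omega)$ be completely continuous. Let $G\in V^*$ be nonnegative in the sense of distributions. Let $H(x,M):=\sup_{\alpha\in\mathcal{A}}\{-a(x,\alpha):M-f(x,\alpha)\}$, and let $\{H_\lambda\}_{\lambda\in(0,1]}$ be an admissible family of regularizations of $H$ (see context). For each $\lambda\in(0,1]$ let $(u_\lambda,m_\lambda)\in V\times L^2_+(\Omega)$ be a solution of the regularized problem $$H_\lambda[u_\lambda]=F[m_\lambda]\ \text{ a.e. in }\Omega,\qquad \Bigl(m_\lambda,\tfrac{\partial H_\lambda}{\partial M}(x,D^2u_\lambda):D^2v\Bigr)_\Omega=\langle G,v\rangle_{V^*\times V}\quad\forall v\in V.$$ Then there exist a sequence $\{\lambda_j\}_{j\in\mathbb{N}}\subset(0,1]$ with $\lambda_j\to0$, and a solution $(u,m)\in V\times L^2_+(\Omega)$ of the PDI problem, equivalently of the VI problem, such that $u_{\lambda_j}\to u$ strongly in $V$ and $m_{\lambda_j}\rightharpoonup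 m$ weakly in $L^2(\Omega)$ as $j\to\infty$.
   Context: Notation: $\mathbb{R}^{d\times d}_{\mathrm{sym}}$ is the space of real symmetric $d\times d$ matrices, $\mathbb{R}^{d\times d}_{\mathrm{sym},+}$ its subset of positive semidefinite matrices; $A:B=\sum_{i,j}A_{ij}B_{ij}$; $|\cdot|$ is the Frobenius norm. $(\cdot,\cdot)_\Omega$ is the inner product of $L^2(\Omega)$ and $L^2_+(\Omega)$ is the set of functions in $L^2(\Omega)$ that are nonnegative a.e. in $\Omega$. $V:=H^2(\Omega)\cap H^1_0(\Omega)$ with the norm and inner product of $H^2(\Omega)$; $V^*$ is its dual, with duality pairing $\langle\cdot,\cdot\rangle_{V^*\times V}$. $G\in V^*$ is nonnegative in the sense of distributions if $\langle G,v\rangle_{V^*\times V}\geq 0$ for all $v\in V$ with $v\ge 0$ a.e. in $\Omega$. A (possibly nonlinear) operator $F\colon L^2(\Omega)\to L^2(\Omega)$ is completely continuous if $m_j\rightharpoonup m$ weakly in $L^2(\Omega)$ implies $F[m_j]\to F[m]$ strongly in $L^2(\Omega)$. Cordes class: for $\overline{\nu}\geq\underline{\nu}>0$ and $\varepsilon\in(0,1]$, $\mathcal{C}(\underline{\nu},\overline{\nu},\varepsilon)$ is the set of all $\overline{a}\in\mathbb{R}^{d\times d}_{\mathrm{sym},+}$ such that $\underline{\nu}|\xi|^2\leq\xi^T\overline{a}\xi\leq\overline{\nu}|\xi|^2$ for all $\xi\in\mathbb{R}^d$ and $\frac{|\overline{a}|}{\mathrm{Tr}\,\overline{a}}\leq\frac{1}{\sqrt{d-1+\varepsilon}}$.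 For $v\in V$, $H[v](x):=H(x,D^2v(x))$ and $H_\lambda[v](x):=H_\lambda(x,D^2v(x))$ for a.e. $x\in\Omega$. The partial subdifferential is $\partial_M H(x,M):=\{A\in\mathbb{R}^{d\times d}_{\mathrm{sym}}: H(x,M)+A:(\widetilde M-M)\leq H(x,\widetilde M)\ \forall \widetilde M\in\mathbb{R}^{d\times d}_{\mathrm{sym}}\}$. For $v\in V$, $\mathcal{D}H[v]:=\{A\in L^\infty(\Omega;\mathbb{R}^{d\times d}_{\mathrm{sym}}): A(x)\in\partial_M H(x,D^2v(x))\text{ for a.e. }x\in\Omega\}$. Admissible family of regularizations: functions $H_\lambda\colon\overline{\Omega}\times\mathbb{R}^{d\times d}_{\mathrm{sym}}\to\mathbb{R}$, $\lambda\in(0,1]$, such that for each $\lambda\in(0,1]$: (i) $H_\lambda$ is continuous on $\overline{\Omega}\times\mathbb{R}^{d\times d}_{\mathrm{sym}}$ and $|H_\lambda(x,M)-H_\lambda(x,N)|\leq C|M-N|$ for all $x\in\overline{\Omega}$ and $M,N\in\mathbb{R}^{d\times d}_{\mathrm{sym}}$, for some constant $C$ independent of $\lambda$; (ii) for all $x\in\overline{\Omega}$, the map $M\mapsto H_\lambda(x,M)$ is convex and continuously differentiable, with partial derivative $\frac{\partial H_\lambda}{\partial M}\colon\overline{\Omega}\times\mathbb{R}^{d\times d}_{\mathrm{sym}}\to\mathbb{R}^{d\times d}_{\mathrm{sym}}$; (iii) $|H_\lambda(x,M)-H(x,M)|\leq\omega(\lambda)$ for all $(x,M)\in\overline{\Omega}\times\mathbb{R}^{d\times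 d}_{\mathrm{sym}}$, where $\omega\colon[0,1]\to[0,\infty)$ is a continuous function (the same for all $\lambda$) with $\omega(0)=0$; (iv) $-\frac{\partial H_\lambda}{\partial M}(x,M)\in\mathcal{C}(\underline{\nu},\overline{\nu},\varepsilon)$ for all $(x,M)\in\overline{\Omega}\times\mathbb{R}^{d\times d}_{\mathrm{sym}}$, with the same constants $\underline{\nu},\overline{\nu},\varepsilon$ as for $a$. In this setting the paper notes that a solution $(u_\lambda,m_\lambda)\in V\times L^2_+(\Omega)$ of the regularized problem exists for each $\lambda\in(0,1]$. PDI problem: $(u,m)\in V\times L^2(\Omega)$ is a solution of the PDI problem if $H[u]=F[m]$ a.e. in $\Omega$ and there exists $-\overline{a}\in\mathcal{D}H[u]$ such that $(m,-\overline{a}:D^2v)_\Omega=\langle G,v\rangle_{V^*\times V}$ for all $v\in V$. VI problem: $(u,m)\in V\times L^2_+(\Omega)$ is a solution of the VI problem if $H[u]=F[m]$ a.e. in $\Omega$ and $\langle G,v-u\rangle_{V^*\times V}\leq (m,H[v]-H[u])_\Omega$ for all $v\in V$. *)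

theory Defs
  imports "HOL-Analysis.Analysis"
begin

section \<open>Lebesgue and Sobolev spaces\<close>

text \<open>
  Elements of \<open>L\<^sup>2(\<Omega>)\<close> and of the Sobolev spaces are represented by functions on the whole space,
  of which only the values almost everywhere in \<open>\<Omega>\<close> matter.
\<close>

definition L2 :: "(real^'n) set \<Rightarrow> (real^'n \<Rightarrow> real) set" where
  "L2 \<Omega> = {g \<in> borel_measurable (lebesgue_on \<Omega>). integrable (lebesgue_on \<Omega>) (\<lambda>x. (g x)\<^sup>2)}"

definition L2_nonneg :: "(real^'n) set \<Rightarrow> (real^'n \<Rightarrow> real) set" where
  "L2_nonneg \<Omega> = {g \<in> L2 \<Omega>. AE x in lebesgue_on \<Omega>. 0 \<le> g x}"

definition L2_inner :: "(real^'n) set \<Rightarrow> (real^'n \<Rightarrow> real) \<Rightarrow> (real^'n \<Rightarrow> real) \<Rightarrow> real" where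
  "L2_inner \<Omega> g h = (LINT x|lebesgue_on \<Omega>. g x * h x)"

definition L2_norm :: "(real^'n) set \<Rightarrow> (real^'n \<Rightarrow> real) \<Rightarrow> real" where
  "L2_norm \<Omega> g = sqrt (L2_inner \<Omega> g g)"

definition L2_weak_tendsto ::
  "(real^'n) set \<Rightarrow> (nat \<Rightarrow> real^'n \<Rightarrow> real) \<Rightarrow> (real^'n \<Rightarrow> real) \<Rightarrow> bool" where
  "L2_weak_tendsto \<Omega> m m0 \<longleftrightarrow> (\<forall>w\<in>L2 \<Omega>. (\<lambda>j. L2_inner \<Omega> (m j) w) \<longlonglongrightarrow> L2_inner \<Omega> m0 w)"

definition partial_deriv :: "'n \<Rightarrow> (real^'n \<Rightarrow> real) \<Rightarrow> real^'n \<Rightarrow> real" where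
  "partial_deriv i \<phi> x = frechet_derivative \<phi> (at x) (axis i 1)"

text \<open>
  A function is \<open>C\<^sup>\<infinity>\<close> iff all its iterated partial derivatives are (Frechet) differentiable
  everywhere: differentiability of the next order supplies continuity of the previous one.
\<close>

definition smooth :: "(real^'n \<Rightarrow> real) \<Rightarrow> bool" where
  "smooth \<phi> \<longleftrightarrow> (\<forall>is. foldr partial_deriv is \<phi> differentiable_on UNIV)"

definition test_functions :: "(real^'n) set \<Rightarrow> (real^'n \<Rightarrow> real) set" where
  "test_functions \<Omega> =
     {\<phi>. smooth \<phi> \<and> compact (closure {x. \<phi> x \<noteq> 0}) \<and> closure {x. \<phi> x \<noteq> 0} \<subseteq> \<Omega>}"

definition has_weak_partial ::
  "(real^'n) set \<Rightarrow> 'n \<Rightarrow> (real^'n \<Rightarrow> real) \<Rightarrow> (real^'n \<Rightarrow> real) \<Rightarrow> bool" where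
  "has_weak_partial \<Omega> i u g \<longleftrightarrow> u \<in> L2 \<Omega> \<and> g \<in> L2 \<Omega> \<and>
     (\<forall>\<phi>\<in>test_functions \<Omega>. L2_inner \<Omega> u (partial_deriv i \<phi>) = - L2_inner \<Omega> g \<phi>)"

text \<open>Weak derivatives are unique up to null sets, so the choice below is immaterial.\<close>

definition weak_partial :: "(real^'n) set \<Rightarrow> 'n \<Rightarrow> (real^'n \<Rightarrow> real) \<Rightarrow> real^'n \<Rightarrow> real" where
  "weak_partial \<Omega> i u = (SOME g. has_weak_partial \<Omega> i u g)"

definition H1 :: "(real^'n) set \<Rightarrow> (real^'n \<Rightarrow> real) set" where
  "H1 \<Omega> = {u \<in> L2 \<Omega>. \<forall>i. \<exists>g. has_weak_partial \<Omega> i u g}"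

definition H2 :: "(real^'n) set \<Rightarrow> (real^'n \<Rightarrow> real) set" where
  "H2 \<Omega> = {u \<in> H1 \<Omega>. \<forall>i. weak_partial \<Omega> i u \<in> H1 \<Omega>}"

text \<open>The weak Hessian is symmetric only for almost every \<open>x \<in> \<Omega>\<close>.\<close>

definition weak_hessian :: "(real^'n) set \<Rightarrow> (real^'n \<Rightarrow> real) \<Rightarrow> real^'n \<Rightarrow> real^'n^'n" where
  "weak_hessian \<Omega> u x = (\<chi> i j. weak_partial \<Omega> j (weak_partial \<Omega> i u) x)"

definition H1_norm :: "(real^'n) set \<Rightarrow> (real^'n \<Rightarrow> real) \<Rightarrow> real" where
  "H1_norm \<Omega> u = sqrt ((L2_norm \<Omega> u)\<^sup>2 + (\<Sum>i\<in>UNIV. (L2_norm \<Omega> (weak_partial \<Omega> i u))\<^sup>2))"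

definition H2_norm :: "(real^'n) set \<Rightarrow> (real^'n \<Rightarrow> real) \<Rightarrow> real" where
  "H2_norm \<Omega> u = sqrt ((L2_norm \<Omega> u)\<^sup>2
     + (\<Sum>i\<in>UNIV. (L2_norm \<Omega> (weak_partial \<Omega> i u))\<^sup>2)
     + (\<Sum>i\<in>UNIV. \<Sum>j\<in>UNIV. (L2_norm \<Omega> (weak_partial \<Omega> j (weak_partial \<Omega> i u)))\<^sup>2))"

definition H1_zero :: "(real^'n) set \<Rightarrow> (real^'n \<Rightarrow> real) set" where
  "H1_zero \<Omega> = {u \<in> H1 \<Omega>. \<exists>\<phi>. (\<forall>k. \<phi> k \<in> test_functions \<Omega>) \<and>
     (\<lambda>k::nat. H1_norm \<Omega> (\<lambda>x. u x - \<phi> k x)) \<longlonglongrightarrow> 0}"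

definition V_space :: "(real^'n) set \<Rightarrow> (real^'n \<Rightarrow> real) set" where
  "V_space \<Omega> = H2 \<Omega> \<inter> H1_zero \<Omega>"

text \<open>
  Functionals on \<open>V\<close>; the bound forces equal values at functions that agree almost everywhere.
\<close>

definition V_dual :: "(real^'n) set \<Rightarrow> ((real^'n \<Rightarrow> real) \<Rightarrow> real) set" where
  "V_dual \<Omega> = {G.
     (\<forall>u\<in>V_space \<Omega>. \<forall>v\<in>V_space \<Omega>. G (\<lambda>x. u x + v x) = G u + G v) \<and>
     (\<forall>c. \<forall>v\<in>V_space \<Omega>. G (\<lambda>x. c * v x) = c * G v) \<and>
     (\<exists>C. \<forall>v\<in>V_space \<Omega>. \<bar>G v\<bar> \<le> C * H2_norm \<Omega> v)}"

definition nonneg_functional :: "(real^'n) set \<Rightarrow> ((real^'n \<Rightarrow> real) \<Rightarrow> real) \<Rightarrow> bool" where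
  "nonneg_functional \<Omega> G \<longleftrightarrow>
     (\<forall>v\<in>V_space \<Omega>. (AE x in lebesgue_on \<Omega>. 0 \<le> v x) \<longrightarrow> 0 \<le> G v)"

text \<open>The second clause says that the operator is well defined on almost-everywhere classes.\<close>

definition L2_operator :: "(real^'n) set \<Rightarrow> ((real^'n \<Rightarrow> real) \<Rightarrow> real^'n \<Rightarrow> real) \<Rightarrow> bool" where
  "L2_operator \<Omega> F \<longleftrightarrow> (\<forall>m\<in>L2 \<Omega>. F m \<in> L2 \<Omega>) \<and>
     (\<forall>m\<in>L2 \<Omega>. \<forall>m'\<in>L2 \<Omega>. (AE x in lebesgue_on \<Omega>. m x = m' x) \<longrightarrow>
        (AE x in lebesgue_on \<Omega>. F m x = F m' x))"

definition completely_continuous ::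
  "(real^'n) set \<Rightarrow> ((real^'n \<Rightarrow> real) \<Rightarrow> real^'n \<Rightarrow> real) \<Rightarrow> bool" where
  "completely_continuous \<Omega> F \<longleftrightarrow>
     (\<forall>m m0. (\<forall>j. m j \<in> L2 \<Omega>) \<longrightarrow> m0 \<in> L2 \<Omega> \<longrightarrow> L2_weak_tendsto \<Omega> m m0 \<longrightarrow>
        (\<lambda>j. L2_norm \<Omega> (\<lambda>x. F (m j) x - F m0 x)) \<longlonglongrightarrow> 0)"

section \<open>Symmetric matrices and the Cordes class\<close>

text \<open>
  The inner product \<open>A \<bullet> B\<close> of the Euclidean space \<open>real^'n^'n\<close> is \<open>A : B\<close>, hence \<open>norm\<close> is the
  Frobenius norm.
\<close>

lemma inner_matrix_eq_sum:
  fixes A B :: "real^'n^'n"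
  shows "A \<bullet> B = (\<Sum>i\<in>UNIV. \<Sum>j\<in>UNIV. A $ i $ j * B $ i $ j)"
  by (simp add: inner_vec_def)

definition sym_matrices :: "(real^'n^'n) set" where
  "sym_matrices = {A. transpose A = A}"

definition psd_matrices :: "(real^'n^'n) set" where
  "psd_matrices = {A \<in> sym_matrices. \<forall>\<xi>. 0 \<le> \<xi> \<bullet> (A *v \<xi>)}"

definition cordes_class :: "real \<Rightarrow> real \<Rightarrow> real \<Rightarrow> (real^'n^'n) set" where
  "cordes_class \<nu>l \<nu>u \<epsilon> = {A \<in> psd_matrices.
     (\<forall>\<xi>. \<nu>l * (norm \<xi>)\<^sup>2 \<le> \<xi> \<bullet> (A *v \<xi>) \<and> \<xi> \<bullet> (A *v \<xi>) \<le> \<nu>u * (norm \<xi>)\<^sup>2) \<and>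
     norm A / trace A \<le> 1 / sqrt (real CARD('n) - 1 + \<epsilon>)}"

section \<open>Hamiltonians and their regularizations\<close>

text \<open>
  Functions of \<open>(x, M)\<close> with \<open>x\<close> in the closure of \<open>\<Omega>\<close> and \<open>M\<close> symmetric are total functions here,
  whose values at other arguments are irrelevant.
\<close>

definition hamiltonian ::
  "'a set \<Rightarrow> (real^'n \<Rightarrow> 'a \<Rightarrow> real^'n^'n) \<Rightarrow> (real^'n \<Rightarrow> 'a \<Rightarrow> real) \<Rightarrow>
   real^'n \<Rightarrow> real^'n^'n \<Rightarrow> real" where
  "hamiltonian \<A> a f x M = (SUP \<alpha>\<in>\<A>. - (a x \<alpha>) \<bullet> M - f x \<alpha>)"

definition subdifferential_M ::
  "(real^'n \<Rightarrow> real^'n^'n \<Rightarrow> real) \<Rightarrow> real^'n \<Rightarrow> real^'n^'n \<Rightarrow> (real^'n^'n) set" where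
  "subdifferential_M H x M =
     {A \<in> sym_matrices. \<forall>M'\<in>sym_matrices. H x M + A \<bullet> (M' - M) \<le> H x M'}"

definition D_H ::
  "(real^'n) set \<Rightarrow> (real^'n \<Rightarrow> real^'n^'n \<Rightarrow> real) \<Rightarrow> (real^'n \<Rightarrow> real) \<Rightarrow>
   (real^'n \<Rightarrow> real^'n^'n) set" where
  "D_H \<Omega> H v = {A \<in> borel_measurable (lebesgue_on \<Omega>).
     (\<exists>C. AE x in lebesgue_on \<Omega>. norm (A x) \<le> C) \<and>
     (AE x in lebesgue_on \<Omega>. A x \<in> subdifferential_M H x (weak_hessian \<Omega> v x))}"

text \<open>
  The derivative is taken inside the space of symmetric matrices and represented by a symmetric
  matrix, which makes it unique.
\<close>

definition partial_M ::
  "(real^'n \<Rightarrow> real^'n^'n \<Rightarrow> real) \<Rightarrow> real^'n \<Rightarrow> real^'n^'n \<Rightarrow> real^'n^'n" where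
  "partial_M h x M = (THE A. A \<in> sym_matrices \<and>
     ((h x) has_derivative (\<lambda>N. A \<bullet> N)) (at M within sym_matrices))"

definition admissible_regularization ::
  "(real^'n) set \<Rightarrow> (real^'n \<Rightarrow> real^'n^'n \<Rightarrow> real) \<Rightarrow> real \<Rightarrow> real \<Rightarrow> real \<Rightarrow>
   (real \<Rightarrow> real^'n \<Rightarrow> real^'n^'n \<Rightarrow> real) \<Rightarrow> bool" where
  "admissible_regularization \<Omega> H \<nu>l \<nu>u \<epsilon> Hr \<longleftrightarrow>
     (\<forall>l\<in>{0<..1}. continuous_on (closure \<Omega> \<times> sym_matrices) (\<lambda>(x, M). Hr l x M)) \<and>
     (\<exists>C. \<forall>l\<in>{0<..1}. \<forall>x\<in>closure \<Omega>. \<forall>M\<in>sym_matrices. \<forall>N\<in>sym_matrices.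
        \<bar>Hr l x M - Hr l x N\<bar> \<le> C * norm (M - N)) \<and>
     (\<forall>l\<in>{0<..1}. \<forall>x\<in>closure \<Omega>.
        convex_on sym_matrices (Hr l x) \<and>
        (Hr l x) differentiable_on sym_matrices \<and>
        continuous_on sym_matrices (partial_M (Hr l) x)) \<and>
     (\<exists>\<omega>. continuous_on {0..1} \<omega> \<and> (\<forall>t\<in>{0..1}. 0 \<le> \<omega> t) \<and> \<omega> 0 = 0 \<and>
        (\<forall>l\<in>{0<..1}. \<forall>x\<in>closure \<Omega>. \<forall>M\<in>sym_matrices. \<bar>Hr l x M - H x M\<bar> \<le> \<omega> l)) \<and>
     (\<forall>l\<in>{0<..1}. \<forall>x\<in>closure \<Omega>. \<forall>M\<in>sym_matrices.
        - partial_M (Hr l) x M \<in> cordes_class \<nu>l \<nu>u \<epsilon>)"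

section \<open>The mean field game problems\<close>

definition regularized_solution ::
  "(real^'n) set \<Rightarrow> (real^'n \<Rightarrow> real^'n^'n \<Rightarrow> real) \<Rightarrow>
   ((real^'n \<Rightarrow> real) \<Rightarrow> real^'n \<Rightarrow> real) \<Rightarrow> ((real^'n \<Rightarrow> real) \<Rightarrow> real) \<Rightarrow>
   (real^'n \<Rightarrow> real) \<Rightarrow> (real^'n \<Rightarrow> real) \<Rightarrow> bool" where
  "regularized_solution \<Omega> h F G u m \<longleftrightarrow>
     u \<in> V_space \<Omega> \<and> m \<in> L2_nonneg \<Omega> \<and>
     (AE x in lebesgue_on \<Omega>. h x (weak_hessian \<Omega> u x) = F m x) \<and>
     (\<forall>v\<in>V_space \<Omega>.
        L2_inner \<Omega> m (\<lambda>x. partial_M h x (weak_hessian \<Omega> u x) \<bullet> weak_hessian \<Omega> v x) = G v)"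

definition PDI_solution ::
  "(real^'n) set \<Rightarrow> (real^'n \<Rightarrow> real^'n^'n \<Rightarrow> real) \<Rightarrow>
   ((real^'n \<Rightarrow> real) \<Rightarrow> real^'n \<Rightarrow> real) \<Rightarrow> ((real^'n \<Rightarrow> real) \<Rightarrow> real) \<Rightarrow>
   (real^'n \<Rightarrow> real) \<Rightarrow> (real^'n \<Rightarrow> real) \<Rightarrow> bool" where
  "PDI_solution \<Omega> H F G u m \<longleftrightarrow>
     u \<in> V_space \<Omega> \<and> m \<in> L2 \<Omega> \<and>
     (AE x in lebesgue_on \<Omega>. H x (weak_hessian \<Omega> u x) = F m x) \<and>
     (\<exists>a. (\<lambda>x. - a x) \<in> D_H \<Omega> H u \<and>
        (\<forall>v\<in>V_space \<Omega>. L2_inner \<Omega> m (\<lambda>x. - a x \<bullet> weak_hessian \<Omega> v x) = G v))"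

definition VI_solution ::
  "(real^'n) set \<Rightarrow> (real^'n \<Rightarrow> real^'n^'n \<Rightarrow> real) \<Rightarrow>
   ((real^'n \<Rightarrow> real) \<Rightarrow> real^'n \<Rightarrow> real) \<Rightarrow> ((real^'n \<Rightarrow> real) \<Rightarrow> real) \<Rightarrow>
   (real^'n \<Rightarrow> real) \<Rightarrow> (real^'n \<Rightarrow> real) \<Rightarrow> bool" where
  "VI_solution \<Omega> H F G u m \<longleftrightarrow>
     u \<in> V_space \<Omega> \<and> m \<in> L2_nonneg \<Omega> \<and>
     (AE x in lebesgue_on \<Omega>. H x (weak_hessian \<Omega> u x) = F m x) \<and>
     (\<forall>v\<in>V_space \<Omega>. G (\<lambda>x. v x - u x)
        \<le> L2_inner \<Omega> m (\<lambda>x. H x (weak_hessian \<Omega> v x) - H x (weak_hessian \<Omega> u x)))"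

end

theory Submission
  imports Defs "HOL-Library.Diagonal_Subsequence"
begin

text \<open>
  For \<open>A\<close> in the Cordes class and \<open>\<gamma> = Tr A / |A|\<^sup>2\<close> one has \<open>|\<gamma> A - I| \<le> \<surd>(1 - \<epsilon>) < 1\<close>, so the linearized
  operators are perturbations of the Laplacian, and the Miranda-Talenti estimate \<open>|D\<^sup>2 v| \<le> |\<Delta> v|\<close>
  on convex domains, together with the surjectivity of \<open>\<Delta>\<close> from \<open>V\<close> to \<open>L\<^sup>2\<close>, controls everything.
  Testing the equation of \<open>m\<^sub>\<lambda>\<close> with the solution of \<open>\<Delta> v = m\<^sub>\<lambda> / \<gamma>\<close> bounds \<open>m\<^sub>\<lambda>\<close>, and
  \<open>|Tr (M - N)| \<le> c |H\<^sub>\<lambda>(M) - H\<^sub>\<lambda>(N)| + \<surd>(1 - \<epsilon>) |M - N|\<close> makes \<open>u\<^sub>\<lambda>\<close> Cauchy in \<open>V\<close> along a sequence on which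
  \<open>m\<^sub>\<lambda>\<close> converges weakly. With \<open>A\<^sub>\<lambda> = \<partial>H\<^sub>\<lambda>/\<partial>M\<close> at \<open>D\<^sup>2 u\<^sub>\<lambda>\<close>, pass to weak limits \<open>A\<close>, \<open>B\<close> of \<open>A\<^sub>\<lambda>\<close>, \<open>m\<^sub>\<lambda> A\<^sub>\<lambda>\<close> in the
  subgradient inequalities, weighted by \<open>1\<close> and by \<open>m\<^sub>\<lambda>\<close> and integrated over arbitrary measurable sets.
  Then \<open>B / m\<close> where \<open>m > 0\<close>, and \<open>A\<close> elsewhere, lies in \<open>\<D>H[u]\<close>, which gives the PDI problem, and
  convexity gives the VI problem.

  The Miranda-Talenti estimate is obtained without boundary regularity. A compact subset of a convex
  domain lies in a superlevel set \<open>{\<psi> > 0}\<close> inside the domain, with \<open>1 - \<psi>\<close> a sum of exponentials of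
  affine functions. There a cut-off \<open>\<eta>\<close> of \<open>\<psi>\<close> is used in
  \<open>\<integral> \<eta> ((\<Delta>v)\<^sup>2 - |D\<^sup>2v|\<^sup>2) = \<integral> (D\<^sup>2\<eta> - \<Delta>\<eta> I) : \<nabla>v \<otimes> \<nabla>v\<close>. Concavity gives most of the right-hand side a sign; the
  rest sees only the part of \<open>\<nabla>v\<close> tangential to the level sets of \<open>\<psi>\<close>, which is square-integrable with
  weight \<open>1 / \<psi>\<close> by a Hardy-type estimate.
\<close>

text \<open>Two obstacles shape the argument. On an arbitrary convex domain a weak solution
  \<open>w\<close> of the Poisson equation is not known beforehand to have second derivatives. The
  Hessian estimate is therefore proved by duality, as a bound for the functional taking a matrix
  \<Phi> of test functions to the sum of \<integral> w D_i D_j \<Phi>_ij; Riesz representation then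
  yields the Hessian together with its bound. The limits behind that bound do not commute: the
  mollification radius goes to 0 with the cut-off fixed, because the mollified equation fails near
  the boundary; s goes to 0 with K fixed, because the layer term grows with K; then K goes to
  infinity; finally the superlevel set approximates the domain. The other obstacle is that
  \<open>m\<close> and \<open>A\<close> converge only weakly, so the weak limit of their products
  need not be the product of their limits, and \<open>B\<close> is a separate unknown. In each
  limiting inequality every product pairs a weakly convergent factor with a strongly convergent one;
  the strong ones come from the Hessians, the complete continuity of \<open>F\<close> and the
  uniform approximation of \<open>H\<close>.\<close>

section \<open>Hilbert spaces\<close>

text \<open>The functional is given by its graph \<open>P\<close>; the bound makes it single-valued, so it may be
  defined by formulas that depend on chosen representatives.\<close>

lemma riesz_relation:
  fixes P :: "('h::{real_inner,complete_space} \<times> real) set"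
  assumes P: "subspace P" and C: "0 \<le> C" and bd: "\<And>z r. (z, r) \<in> P \<Longrightarrow> \<bar>r\<bar> \<le> C * norm z"
  obtains y where "y \<in> closure (fst ` P)" "\<And>z r. (z, r) \<in> P \<Longrightarrow> inner y z = r" "norm y \<le> C"
proof -
  \<comment> \<open>\<open>J\<close> is the energy |z|^2/2 - r, whose minimiser represents the
    functional. As \<open>P\<close> need not be closed, a minimising sequence is used.\<close>
  define J where "J p = (norm (fst p))\<^sup>2 / 2 - snd p" for p :: "'h \<times> real"
  have J_ge: "- C\<^sup>2 / 2 \<le> J p" if "p \<in> P" for p
  proof -
    have "snd p \<le> C * norm (fst p)" using bd[of "fst p" "snd p"] that by auto
    moreover have "0 \<le> (norm (fst p) - C)\<^sup>2" by simp
    ultimately show ?thesis unfolding J_def power2_diff by (simp add: algebra_simps)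
  qed
  have P0: "0 \<in> P" using P by (simp add: subspace_0)
  define I where "I = Inf (J ` P)"
  have bdd: "bdd_below (J ` P)" using J_ge by (auto intro!: bdd_belowI2)
  have I_le: "I \<le> J p" if "p \<in> P" for p
    unfolding I_def using that bdd by (auto intro: cInf_lower)
  have "\<exists>p\<in>P. J p < I + inverse (real (Suc n))" for n
  proof -
    have "Inf (J ` P) < I + inverse (real (Suc n))" unfolding I_def by simp
    then show ?thesis using bdd P0 by (subst (asm) cInf_less_iff) auto
  qed
  then obtain p where pP: "p n \<in> P" and pJ: "J (p n) < I + inverse (real (Suc n))" for n by metis
  have quad: "J (t *\<^sub>R a + b) = t\<^sup>2 * (norm (fst a))\<^sup>2 / 2 + t * (inner (fst b) (fst a) - snd a) + J b" for a b t
    unfolding J_def power2_norm_eq_inner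
    by (simp add: inner_add_left inner_add_right inner_commute algebra_simps) (simp add: power2_eq_square)
  \<comment> \<open>Parallelogram identity: the midpoint of two near-minimisers has energy at least
    the infimum, so the two are close.\<close>
  have dist_small: "(norm (fst (p m) - fst (p n)))\<^sup>2 \<le> 4 * (inverse (real (Suc m)) + inverse (real (Suc n)))" for m n
  proof -
    have mid: "(1/2) *\<^sub>R (p m + p n) \<in> P" using P pP by (meson subspace_add subspace_scale)
    have "(norm (fst (p m) - fst (p n)))\<^sup>2 / 8 = J (p m) / 2 + J (p n) / 2 - J ((1/2) *\<^sub>R (p m + p n))"
      unfolding J_def power2_norm_eq_inner
      by (simp add: inner_add_left inner_add_right inner_diff_left inner_diff_right inner_commute field_simps)
    then show ?thesis using I_le[OF mid] pJ[of m] pJ[of n] by argo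
  qed
  have "Cauchy (\<lambda>n. fst (p n))"
  proof (rule metric_CauchyI)
    fix e :: real assume e: "e > 0"
    then obtain N where N: "inverse (real (Suc N)) < e\<^sup>2 / 8"
      using reals_Archimedean[of "e\<^sup>2/8"] by auto
    have "dist (fst (p m)) (fst (p n)) < e" if "m \<ge> N" "n \<ge> N" for m n
    proof -
      have "inverse (real (Suc m)) \<le> inverse (real (Suc N))" "inverse (real (Suc n)) \<le> inverse (real (Suc N))"
        using that by (auto intro!: le_imp_inverse_le)
      then have "4 * (inverse (real (Suc m)) + inverse (real (Suc n))) \<le> 8 * inverse (real (Suc N))" by argo
      also have "\<dots> < e\<^sup>2" using N by argo
      finally have "(norm (fst (p m) - fst (p n)))\<^sup>2 < e\<^sup>2" using dist_small[of m n] by (rule le_less_trans[rotated])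
      then show ?thesis using e by (simp add: dist_norm power_less_imp_less_base)
    qed
    then show "\<exists>M. \<forall>m\<ge>M. \<forall>n\<ge>M. dist (fst (p m)) (fst (p n)) < e" by blast
  qed
  then obtain y where y: "(\<lambda>n. fst (p n)) \<longlonglongrightarrow> y" using Cauchy_convergent convergent_def by blast
  have ycl: "y \<in> closure (fst ` P)" unfolding closure_sequential using y pP by (intro exI[of _ "\<lambda>n. fst (p n)"]) auto
  have eq: "inner y z = r" if zr: "(z, r) \<in> P" for z r
  proof -
    \<comment> \<open>First variation at near-minimisers: the quadratic in t is nonnegative for
      every t, which forces its linear coefficient to vanish.\<close>
    have lim: "0 \<le> t\<^sup>2 * (norm z)\<^sup>2 / 2 + t * (inner y z - r)" for t
    proof (rule LIMSEQ_le)
      show "(\<lambda>n. - inverse (real (Suc n))) \<longlonglongrightarrow> 0" using tendsto_minus[OF LIMSEQ_inverse_real_of_nat] by simp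
      show "(\<lambda>n. t\<^sup>2 * (norm z)\<^sup>2 / 2 + t * (inner (fst (p n)) z - r)) \<longlonglongrightarrow> t\<^sup>2 * (norm z)\<^sup>2 / 2 + t * (inner y z - r)"
        by (intro tendsto_intros y)
      have "- inverse (real (Suc n)) \<le> t\<^sup>2 * (norm z)\<^sup>2 / 2 + t * (inner (fst (p n)) z - r)" for n
      proof -
        have "t *\<^sub>R (z, r) + p n \<in> P" using P zr pP by (meson subspace_add subspace_scale)
        then have "I \<le> J (t *\<^sub>R (z, r) + p n)" by (rule I_le)
        then show ?thesis using quad[of t "(z,r)" "p n"] pJ[of n] by simp
      qed
      then show "\<exists>N. \<forall>n\<ge>N. - inverse (real (Suc n)) \<le> t\<^sup>2 * (norm z)\<^sup>2 / 2 + t * (inner (fst (p n)) z - r)" by blast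
    qed
    define d where "d = inner y z - r"
    show ?thesis
    proof (rule ccontr)
      assume "inner y z \<noteq> r"
      then have d: "d \<noteq> 0" by (simp add: d_def)
      \<comment> \<open>The added 1 keeps the choice t = - d / q meaningful when z = 0.\<close>
      define q where "q = (norm z)\<^sup>2 + 1"
      have q: "q > 0" "(norm z)\<^sup>2 < q" by (auto simp: q_def add_nonneg_pos)
      have "0 \<le> (- d / q)\<^sup>2 * (norm z)\<^sup>2 / 2 + (- d / q) * d" using lim[of "- d / q"] by (simp add: d_def)
      also have "\<dots> \<le> (- d / q)\<^sup>2 * q / 2 + (- d / q) * d"
        using q by (intro add_right_mono divide_right_mono mult_left_mono) auto
      also have "\<dots> = - d\<^sup>2 / (2 * q)" using q by (simp add: power2_eq_square field_simps)
      also have "\<dots> < 0" using d q by simp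
      finally show False by simp
    qed
  qed
  have "norm y \<le> C"
  proof -
    have "(\<lambda>n. inner y (fst (p n))) \<longlonglongrightarrow> inner y y" by (intro tendsto_intros y)
    moreover have "(\<lambda>n. C * norm (fst (p n))) \<longlonglongrightarrow> C * norm y" by (intro tendsto_intros y)
    moreover have "inner y (fst (p n)) \<le> C * norm (fst (p n))" for n
      using eq[of "fst (p n)" "snd (p n)"] bd[of "fst (p n)" "snd (p n)"] pP[of n] by auto
    ultimately have "inner y y \<le> C * norm y" using LIMSEQ_le by blast
    then have "norm y * norm y \<le> C * norm y" by (simp add: power2_norm_eq_inner[symmetric] power2_eq_square)
    then show ?thesis using C by (cases "norm y = 0") (auto simp: mult_le_cancel_right)
  qed
  with ycl eq show ?thesis by (intro that)
qed

text \<open>A diagonal subsequence makes the inner products with every \<open>X k\<close> converge.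
  The vectors with convergent inner products form a closed subspace \<open>W\<close> containing all
  \<open>Y n\<close>. The part of a vector orthogonal to \<open>W\<close> is not seen by the
  sequence, so \<open>W\<close> is everything, and Riesz represents the bounded limit
  functional.\<close>

lemma weakly_convergent_subsequence:
  fixes X :: "nat \<Rightarrow> 'h::{real_inner,complete_space}"
  assumes bd: "\<And>n. norm (X n) \<le> C"
  obtains r x where "strict_mono r" "norm x \<le> C" "\<And>y. (\<lambda>n. inner (X (r n)) y) \<longlonglongrightarrow> inner x y"
proof -
  have C0: "0 \<le> C" using bd[of 0] norm_ge_zero order_trans by blast
  interpret subseqs "\<lambda>k s. convergent (\<lambda>n. inner (X (s n)) (X k))"
  proof
    fix k and s :: "nat \<Rightarrow> nat"
    have "bounded (range (\<lambda>n. inner (X (s n)) (X k)))"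
    proof (rule boundedI)
      fix v assume "v \<in> range (\<lambda>n. inner (X (s n)) (X k))"
      then obtain n where "v = inner (X (s n)) (X k)" by auto
      then show "norm v \<le> C * C" using Cauchy_Schwarz_ineq2[of "X (s n)" "X k"] mult_mono[OF bd[of "s n"] bd[of k]] C0 by auto
    qed
    then obtain l r where "strict_mono r" "((\<lambda>n. inner (X (s n)) (X k)) \<circ> r) \<longlonglongrightarrow> l"
      using bounded_imp_convergent_subsequence by blast
    then show "\<exists>r'. strict_mono r' \<and> convergent (\<lambda>n. inner (X ((s \<circ> r') n)) (X k))"
      by (auto simp: o_def convergent_def)
  qed
  define r where "r = diagseq"
  have r: "strict_mono r" unfolding r_def by (rule subseq_diagseq)
  have conv: "convergent (\<lambda>n. inner (X (r n)) (X k))" for k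
  proof -
    have "convergent (\<lambda>n. inner (X ((diagseq \<circ> (+) (Suc k)) n)) (X k))"
    proof (rule diagseq_holds)
      fix s rr :: "nat \<Rightarrow> nat" and n assume "strict_mono rr" "convergent (\<lambda>m. inner (X (s m)) (X n))"
      then show "convergent (\<lambda>m. inner (X ((s \<circ> rr) m)) (X n))"
        using LIMSEQ_subseq_LIMSEQ by (force simp: convergent_def o_def)
    qed
    then have "convergent (\<lambda>n. inner (X (r (n + Suc k))) (X k))" by (simp add: o_def r_def add.commute)
    then show ?thesis by (subst (asm) convergent_ignore_initial_segment)
  qed
  define Y where "Y n = X (r n)" for n
  have Yb: "norm (Y n) \<le> C" for n by (simp add: Y_def bd)
  define W where "W = {y. convergent (\<lambda>n. inner (Y n) y)}"
  have Wsub: "subspace W" unfolding W_def subspace_def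
    by (auto simp: inner_add_right intro: convergent_add convergent_mult convergent_const)
  have Wcl: "y \<in> W" if "y \<in> closure W" for y
  proof -
    have "Cauchy (\<lambda>n. inner (Y n) y)"
    proof (rule metric_CauchyI)
      fix e :: real assume e: "e > 0"
      define d where "d = e / (3 * (C + 1))"
      have d: "d > 0" using e C0 by (simp add: d_def)
      obtain w where w: "w \<in> W" "dist w y < d" using \<open>y \<in> closure W\<close> d by (meson closure_approachable)
      then have "Cauchy (\<lambda>n. inner (Y n) w)" by (simp add: W_def convergent_Cauchy)
      then obtain N where N: "\<And>m n. m \<ge> N \<Longrightarrow> n \<ge> N \<Longrightarrow> dist (inner (Y m) w) (inner (Y n) w) < e / 3"
        using e by (force dest: metric_CauchyD[where e = "e/3"])
      have small: "\<bar>inner (Y n) (y - w)\<bar> \<le> e / 3" for n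
      proof -
        have "\<bar>inner (Y n) (y - w)\<bar> \<le> norm (Y n) * norm (y - w)" by (rule Cauchy_Schwarz_ineq2)
        also have "\<dots> \<le> (C + 1) * d" using w C0 Yb[of n] by (intro mult_mono) (auto simp: dist_norm norm_minus_commute)
        also have "(C + 1) * d = e / 3" using C0 by (simp add: d_def field_simps)
        finally show ?thesis .
      qed
      have "dist (inner (Y m) y) (inner (Y n) y) < e" if "m \<ge> N" "n \<ge> N" for m n
        using N[OF that] small[of m] small[of n] unfolding dist_real_def inner_diff_right abs_le_iff abs_less_iff by linarith
      then show "\<exists>M. \<forall>m\<ge>M. \<forall>n\<ge>M. dist (inner (Y m) y) (inner (Y n) y) < e" by blast
    qed
    then show ?thesis by (simp add: W_def Cauchy_convergent_iff)
  qed
  have YW: "Y k \<in> W" for k unfolding W_def Y_def using conv by simp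
  have "y \<in> W" for y
  proof -
    \<comment> \<open>\<open>p\<close> is the orthogonal projection of \<open>y\<close> onto
      \<open>W\<close>, obtained by representing the functional z \<mapsto> (y, z) on
      \<open>W\<close>.\<close>
    obtain p where p: "p \<in> closure (fst ` (\<lambda>z. (z, inner y z)) ` W)" "\<And>z s. (z, s) \<in> (\<lambda>z. (z, inner y z)) ` W \<Longrightarrow> inner p z = s"
    proof (rule riesz_relation[of "(\<lambda>z. (z, inner y z)) ` W" "norm y"])
      have "linear (\<lambda>z. (z, inner y z))" by (rule linearI) (auto simp: inner_add_right)
      then show "subspace ((\<lambda>z. (z, inner y z)) ` W)" using Wsub by (rule linear_subspace_image)
    qed (auto simp: Cauchy_Schwarz_ineq2)
    have pW: "p \<in> W" using p(1) by (simp add: image_image Wcl)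
    have "inner (Y n) y = inner (Y n) p" for n
      using p(2)[of "Y n" "inner y (Y n)"] YW[of n] by (auto simp: inner_commute)
    then show ?thesis using pW by (simp add: W_def)
  qed
  then have lim: "(\<lambda>n. inner (Y n) y) \<longlonglongrightarrow> lim (\<lambda>n. inner (Y n) y)" for y by (auto simp: W_def convergent_LIMSEQ_iff)
  define L where "L y = lim (\<lambda>n. inner (Y n) y)" for y
  have lim: "(\<lambda>n. inner (Y n) y) \<longlonglongrightarrow> L y" for y unfolding L_def by (rule lim)
  have Llin: "linear L"
  proof (rule linearI)
    fix a b show "L (a + b) = L a + L b"
      using LIMSEQ_unique[OF lim[of "a + b"]] tendsto_add[OF lim[of a] lim[of b]] by (simp add: inner_add_right)
  next
    fix c b show "L (c *\<^sub>R b) = c *\<^sub>R L b"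
      using LIMSEQ_unique[OF lim[of "c *\<^sub>R b"]] tendsto_mult_left[OF lim[of b], of c] by simp
  qed
  have Lb: "\<bar>L z\<bar> \<le> C * norm z" for z
  proof (rule LIMSEQ_le_const2)
    show "(\<lambda>n. \<bar>inner (Y n) z\<bar>) \<longlonglongrightarrow> \<bar>L z\<bar>" by (intro tendsto_intros lim)
    show "\<exists>N. \<forall>n\<ge>N. \<bar>inner (Y n) z\<bar> \<le> C * norm z"
      using Cauchy_Schwarz_ineq2 Yb by (meson mult_right_mono norm_ge_zero order_trans)
  qed
  obtain x where x: "\<And>z s. (z, s) \<in> range (\<lambda>z. (z, L z)) \<Longrightarrow> inner x z = s" "norm x \<le> C"
  proof (rule riesz_relation[of "range (\<lambda>z. (z, L z))" C])
    have "linear (\<lambda>z. (z, L z))" using Llin by (auto intro!: linearI simp: linear_add linear_scale)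
    then show "subspace (range (\<lambda>z. (z, L z)))" using subspace_UNIV by (rule linear_subspace_image)
  qed (use Lb C0 in auto)
  show ?thesis
  proof (rule that[OF r x(2)])
    fix y show "(\<lambda>n. inner (X (r n)) y) \<longlonglongrightarrow> inner x y" using lim[of y] x(1)[of y "L y"] by (auto simp: Y_def)
  qed
qed

section \<open>The Hilbert space of square-integrable functions\<close>

definition sq_int :: "('a::euclidean_space \<Rightarrow> real) set" where
  "sq_int = {f \<in> borel_measurable lebesgue. integrable lebesgue (\<lambda>x. (f x)\<^sup>2)}"

lemma sq_int_meas: "f \<in> sq_int \<Longrightarrow> f \<in> borel_measurable lebesgue"
  by (simp add: sq_int_def)

lemma sq_int_integrable_mult:
  assumes "f \<in> sq_int" "g \<in> sq_int"
  shows "integrable lebesgue (\<lambda>x. f x * g x)"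
proof (rule Bochner_Integration.integrable_bound)
  show "integrable lebesgue (\<lambda>x. (f x)\<^sup>2 + (g x)\<^sup>2)" using assms by (auto simp: sq_int_def)
  show "(\<lambda>x. f x * g x) \<in> borel_measurable lebesgue" using assms by (auto simp: sq_int_def)
  have "\<bar>a * b\<bar> \<le> a\<^sup>2 + b\<^sup>2" for a b :: real
  proof -
    have "2 * \<bar>a\<bar> * \<bar>b\<bar> \<le> \<bar>a\<bar>\<^sup>2 + \<bar>b\<bar>\<^sup>2" by (rule sum_squares_bound)
    moreover have "0 \<le> \<bar>a\<bar> * \<bar>b\<bar>" by simp
    ultimately show ?thesis unfolding abs_mult power2_abs by linarith
  qed
  then show "AE x in lebesgue. norm (f x * g x) \<le> norm ((f x)\<^sup>2 + (g x)\<^sup>2)" by simp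
qed

lemma sq_int_add: "f \<in> sq_int \<Longrightarrow> g \<in> sq_int \<Longrightarrow> (\<lambda>x. f x + g x) \<in> sq_int"
  using sq_int_integrable_mult[of f g] by (auto simp: sq_int_def power2_sum mult.assoc)

lemma sq_int_scale: "f \<in> sq_int \<Longrightarrow> (\<lambda>x. c * f x) \<in> sq_int"
  by (auto simp: sq_int_def power_mult_distrib)

lemma sq_int_uminus: "f \<in> sq_int \<Longrightarrow> (\<lambda>x. - f x) \<in> sq_int"
  using sq_int_scale[of f "-1"] by simp

lemma sq_int_diff: "f \<in> sq_int \<Longrightarrow> g \<in> sq_int \<Longrightarrow> (\<lambda>x. f x - g x) \<in> sq_int"
  using sq_int_add[of f "\<lambda>x. - g x"] sq_int_uminus[of g] by simp

lemma sq_int_0: "(\<lambda>x. 0) \<in> sq_int"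
  by (simp add: sq_int_def)

lemma sq_int_sum: "(\<And>i. i \<in> I \<Longrightarrow> f i \<in> sq_int) \<Longrightarrow> (\<lambda>x. \<Sum>i\<in>I. f i x) \<in> sq_int"
  by (induction I rule: infinite_finite_induct) (auto simp: sq_int_0 sq_int_add)

lemma sq_int_bounded_mult:
  assumes f: "f \<in> sq_int" and c: "c \<in> borel_measurable lebesgue" "AE x in lebesgue. \<bar>c x\<bar> \<le> C"
  shows "(\<lambda>x. c x * f x) \<in> sq_int"
proof -
  have "integrable lebesgue (\<lambda>x. (c x * f x)\<^sup>2)"
  proof (rule Bochner_Integration.integrable_bound)
    show "integrable lebesgue (\<lambda>x. C\<^sup>2 * (f x)\<^sup>2)" using f by (auto simp: sq_int_def)
    show "(\<lambda>x. (c x * f x)\<^sup>2) \<in> borel_measurable lebesgue" using f c by (auto simp: sq_int_def)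
    show "AE x in lebesgue. norm ((c x * f x)\<^sup>2) \<le> norm (C\<^sup>2 * (f x)\<^sup>2)"
      using c(2)
    proof eventually_elim
      case (elim x)
      then have "(c x)\<^sup>2 \<le> C\<^sup>2" using power_mono[of "\<bar>c x\<bar>" C 2] by simp
      then show ?case by (simp add: power_mult_distrib mult_right_mono)
    qed
  qed
  then show ?thesis using f c by (auto simp: sq_int_def)
qed

text \<open>A partial equivalence relation: only square-integrable functions are related to
  themselves, so the quotient below contains nothing else.\<close>

definition eq_l2 :: "('a::euclidean_space \<Rightarrow> real) \<Rightarrow> ('a \<Rightarrow> real) \<Rightarrow> bool" where
  "eq_l2 f g \<longleftrightarrow> f \<in> sq_int \<and> g \<in> sq_int \<and> (AE x in lebesgue. f x = g x)"

lemma part_equivp_eq_l2: "part_equivp (eq_l2 :: ('a::euclidean_space \<Rightarrow> real) \<Rightarrow> _)"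
proof (rule part_equivpI)
  show "\<exists>f. eq_l2 f (f :: 'a \<Rightarrow> real)" using sq_int_0 by (auto simp: eq_l2_def)
  show "symp (eq_l2 :: ('a \<Rightarrow> real) \<Rightarrow> _)" by (rule sympI) (auto simp: eq_l2_def elim: eventually_mono)
  show "transp (eq_l2 :: ('a \<Rightarrow> real) \<Rightarrow> _)"
  proof (rule transpI)
    fix f g h :: "'a \<Rightarrow> real" assume a: "eq_l2 f g" "eq_l2 g h"
    then have "AE x in lebesgue. f x = g x" "AE x in lebesgue. g x = h x" by (auto simp: eq_l2_def)
    then have "AE x in lebesgue. f x = h x" by eventually_elim simp
    then show "eq_l2 f h" using a by (simp add: eq_l2_def)
  qed
qed

\<comment> \<open>With L^2 as a type of class \<open>real_inner\<close> and
  \<open>complete_space\<close>, pairs and finite vectors over it are Hilbert spaces as well;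
  gradients and Hessian matrices are then points of such spaces. Functions on a domain enter through
  their extension by zero.\<close>
quotient_type (overloaded) 'a l2 = "'a::euclidean_space \<Rightarrow> real" / partial: eq_l2
  by (rule part_equivp_eq_l2)

definition l2_of :: "('a::euclidean_space \<Rightarrow> real) \<Rightarrow> 'a l2" where
  "l2_of = abs_l2"

definition fun_of :: "'a::euclidean_space l2 \<Rightarrow> 'a \<Rightarrow> real" where
  "fun_of = rep_l2"

lemma fun_of_sq_int: "fun_of z \<in> sq_int"
  unfolding fun_of_def using Quotient_rep_reflp[OF Quotient_l2] by (auto simp: eq_l2_def)

lemma l2_of_fun_of [simp]: "l2_of (fun_of z) = z"
  unfolding l2_of_def fun_of_def by (rule Quotient_abs_rep[OF Quotient_l2])

lemma l2_of_eq_iff: "f \<in> sq_int \<Longrightarrow> g \<in> sq_int \<Longrightarrow> l2_of f = l2_of g \<longleftrightarrow> (AE x in lebesgue. f x = g x)"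
  unfolding l2_of_def using Quotient_rel[OF Quotient_l2, of f g] by (auto simp: eq_l2_def)

lemma fun_of_l2_of: "f \<in> sq_int \<Longrightarrow> AE x in lebesgue. fun_of (l2_of f) x = f x"
  using l2_of_eq_iff[OF fun_of_sq_int, of f "l2_of f"] by simp

lemma l2_cases:
  obtains f where "f \<in> sq_int" "z = l2_of f"
  using fun_of_sq_int[of z] l2_of_fun_of[of z] by metis

instantiation l2 :: (euclidean_space) real_inner
begin

definition "0 = l2_of (\<lambda>x. 0)"
definition "a + b = l2_of (\<lambda>x. fun_of a x + fun_of b x)"
definition "a - b = l2_of (\<lambda>x. fun_of a x - fun_of b x)"
definition "- a = l2_of (\<lambda>x. - fun_of a x)"
definition "c *\<^sub>R a = l2_of (\<lambda>x. c * fun_of a x)"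
definition "inner a b = (LINT x|lebesgue. fun_of a x * fun_of b x)"
definition "norm (a::'a l2) = sqrt (inner a a)"
definition "dist (a::'a l2) b = norm (a - b)"
definition "sgn (a::'a l2) = inverse (norm a) *\<^sub>R a"
definition [code del]: "(uniformity :: ('a l2 \<times> 'a l2) filter) = (INF e\<in>{0<..}. principal {(x, y). dist x y < e})"
definition [code del]: "open (U :: 'a l2 set) = (\<forall>x\<in>U. eventually (\<lambda>(x', y). x' = x \<longrightarrow> y \<in> U) uniformity)"

lemma l2_of_add: "f \<in> sq_int \<Longrightarrow> g \<in> sq_int \<Longrightarrow> l2_of (\<lambda>x. f x + g x) = l2_of f + l2_of g"
  unfolding plus_l2_def
  using fun_of_l2_of[of f] fun_of_l2_of[of g]
  by (subst l2_of_eq_iff) (auto intro!: sq_int_add fun_of_sq_int elim: eventually_elim2)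

lemma l2_of_diff: "f \<in> sq_int \<Longrightarrow> g \<in> sq_int \<Longrightarrow> l2_of (\<lambda>x. f x - g x) = l2_of f - l2_of g"
  unfolding minus_l2_def
  using fun_of_l2_of[of f] fun_of_l2_of[of g]
  by (subst l2_of_eq_iff) (auto intro!: sq_int_diff fun_of_sq_int elim: eventually_elim2)

lemma l2_of_uminus: "f \<in> sq_int \<Longrightarrow> l2_of (\<lambda>x. - f x) = - l2_of f"
  unfolding uminus_l2_def
  using fun_of_l2_of[of f]
  by (subst l2_of_eq_iff) (auto intro!: sq_int_uminus fun_of_sq_int elim!: eventually_mono)

lemma l2_of_scale: "f \<in> sq_int \<Longrightarrow> l2_of (\<lambda>x. c * f x) = c *\<^sub>R l2_of f"
proof -
  assume f: "f \<in> sq_int"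
  have "AE x in lebesgue. c * f x = c * fun_of (l2_of f) x" using fun_of_l2_of[OF f] by eventually_elim simp
  then show ?thesis unfolding scaleR_l2_def by (simp add: l2_of_eq_iff f sq_int_scale fun_of_sq_int)
qed

lemma inner_l2_of:
  assumes "f \<in> sq_int" "g \<in> sq_int"
  shows "inner (l2_of f) (l2_of g) = (LINT x|lebesgue. f x * g x)"
  unfolding inner_l2_def
proof (rule integral_cong_AE)
  show "AE x in lebesgue. fun_of (l2_of f) x * fun_of (l2_of g) x = f x * g x"
    using fun_of_l2_of[OF assms(1)] fun_of_l2_of[OF assms(2)] by eventually_elim simp
qed (use assms in \<open>intro borel_measurable_times sq_int_meas fun_of_sq_int; simp\<close>)+

instance
proof
  fix a b c :: "'a l2" and r s :: real
  obtain f where f: "f \<in> sq_int" "a = l2_of f" by (rule l2_cases)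
  obtain g where g: "g \<in> sq_int" "b = l2_of g" by (rule l2_cases)
  obtain h where h: "h \<in> sq_int" "c = l2_of h" by (rule l2_cases)
  note [simp] = f g h l2_of_add[symmetric] l2_of_diff[symmetric] l2_of_uminus[symmetric] l2_of_scale[symmetric] sq_int_add sq_int_diff sq_int_uminus
    sq_int_scale sq_int_0 zero_l2_def
  show "dist a b = norm (a - b)" "sgn a = inverse (norm a) *\<^sub>R a" by (rule dist_l2_def, rule sgn_l2_def)
  show "(uniformity :: ('a l2 \<times> 'a l2) filter) = (INF e\<in>{0<..}. principal {(x, y). dist x y < e})" by (rule uniformity_l2_def)
  show "open U = (\<forall>x\<in>U. eventually (\<lambda>(x', y). x' = x \<longrightarrow> y \<in> U) uniformity)" for U :: "'a l2 set" by (rule open_l2_def)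
  show "a + b + c = a + (b + c)" "a + b = b + a" "0 + a = a" "- a + a = 0" "a - b = a + - b" by (simp_all add: algebra_simps)
  show "r *\<^sub>R (a + b) = r *\<^sub>R a + r *\<^sub>R b" "(r + s) *\<^sub>R a = r *\<^sub>R a + s *\<^sub>R a" "r *\<^sub>R s *\<^sub>R a = (r * s) *\<^sub>R a" "1 *\<^sub>R a = a"
    by (simp_all add: algebra_simps)
  show "inner a b = inner b a" by (simp add: inner_l2_of mult.commute)
  show "inner (a + b) c = inner a c + inner b c"
    by (simp add: inner_l2_of sq_int_integrable_mult algebra_simps)
  show "inner (r *\<^sub>R a) b = r * inner a b" by (simp add: inner_l2_of mult.assoc)
  show "0 \<le> inner a a" by (simp add: inner_l2_of)
  have "integrable lebesgue (\<lambda>x. f x * f x)" by (rule sq_int_integrable_mult) auto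
  then show "inner a a = 0 \<longleftrightarrow> a = 0"
    by (simp add: inner_l2_of l2_of_eq_iff integral_nonneg_eq_0_iff_AE)
  show "norm a = sqrt (inner a a)" by (simp add: norm_l2_def)
qed

end

lemma norm_l2_of: "f \<in> sq_int \<Longrightarrow> norm (l2_of f) = sqrt (LINT x|lebesgue. (f x)\<^sup>2)"
  by (simp add: norm_eq_sqrt_inner inner_l2_of power2_eq_square)

lemma norm_l2_of_sq: "f \<in> sq_int \<Longrightarrow> (norm (l2_of f))\<^sup>2 = (LINT x|lebesgue. (f x)\<^sup>2)"
  by (simp add: norm_l2_of)

lemma l2_of_sum: "(\<And>i. i \<in> I \<Longrightarrow> f i \<in> sq_int) \<Longrightarrow> l2_of (\<lambda>x. \<Sum>i\<in>I. f i x) = (\<Sum>i\<in>I. l2_of (f i))"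
  by (induction I rule: infinite_finite_induct) (auto simp: l2_of_add sq_int_sum zero_l2_def)

lemma sq_int_nn_integral:
  assumes "f \<in> sq_int"
  shows "(\<integral>\<^sup>+x. ennreal ((f x)\<^sup>2) \<partial>lebesgue) = ennreal ((norm (l2_of f))\<^sup>2)"
  using assms nn_integral_eq_integral[of lebesgue "\<lambda>x. (f x)\<^sup>2"] by (simp add: norm_l2_of_sq sq_int_def)

lemma sq_intI_nn_integral:
  assumes "f \<in> borel_measurable lebesgue" "(\<integral>\<^sup>+x. ennreal ((f x)\<^sup>2) \<partial>lebesgue) < \<infinity>"
  shows "f \<in> sq_int"
  using assms unfolding sq_int_def by (auto intro!: integrableI_bounded)

text \<open>The sum of 2^n |d_n|^2 has integral at most the sum of 2^n 8^(-n), hence is finite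
  almost everywhere. At such a point the differences decay geometrically with ratio sqrt(1/2), so
  the sequence converges.\<close>

lemma l2_fast_Cauchy_convergent:
  fixes f :: "nat \<Rightarrow> 'a::euclidean_space \<Rightarrow> real"
  assumes f: "\<And>n. f n \<in> sq_int" and fast: "\<And>n. (norm (l2_of (f (Suc n)) - l2_of (f n)))\<^sup>2 \<le> (1/8) ^ n"
  shows "AE x in lebesgue. convergent (\<lambda>n. f n x)"
proof -
  define d where "d n x = f (Suc n) x - f n x" for n x
  have d: "d n \<in> sq_int" for n unfolding d_def by (intro sq_int_diff f)
  have [measurable]: "d n \<in> borel_measurable lebesgue" for n using d by (rule sq_int_meas)
  have dn: "(\<integral>\<^sup>+x. ennreal ((d n x)\<^sup>2) \<partial>lebesgue) \<le> ennreal ((1/8)^n)" for n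
    using fast[of n] by (subst sq_int_nn_integral[OF d]) (simp add: d_def[abs_def] l2_of_diff f ennreal_leI)
  have "(\<integral>\<^sup>+x. (\<Sum>n. ennreal (2^n) * ennreal ((d n x)\<^sup>2)) \<partial>lebesgue) = (\<Sum>n. \<integral>\<^sup>+x. ennreal (2^n) * ennreal ((d n x)\<^sup>2) \<partial>lebesgue)"
    by (intro nn_integral_suminf) measurable
  also have "\<dots> = (\<Sum>n. ennreal (2^n) * \<integral>\<^sup>+x. ennreal ((d n x)\<^sup>2) \<partial>lebesgue)"
    by (subst nn_integral_cmult) (auto intro!: measurable_compose[OF _ measurable_ennreal])
  also have "\<dots> \<le> (\<Sum>n. ennreal ((1/4)^n))"
  proof (rule suminf_le)
    fix n show "ennreal (2^n) * (\<integral>\<^sup>+x. ennreal ((d n x)\<^sup>2) \<partial>lebesgue) \<le> ennreal ((1/4)^n)"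
    proof -
      have "ennreal (2^n) * (\<integral>\<^sup>+x. ennreal ((d n x)\<^sup>2) \<partial>lebesgue) \<le> ennreal (2^n) * ennreal ((1/8)^n)"
        by (intro mult_left_mono dn) simp
      also have "\<dots> = ennreal ((1/4)^n)" by (simp add: ennreal_mult'[symmetric] power_mult_distrib[symmetric])
      finally show ?thesis .
    qed
  qed auto
  also have "\<dots> < \<infinity>" by (subst suminf_ennreal2) (auto intro!: summable_geometric)
  finally have "AE x in lebesgue. (\<Sum>n. ennreal (2^n) * ennreal ((d n x)\<^sup>2)) \<noteq> \<infinity>"
    by (intro nn_integral_noteq_infinite) auto
  then show ?thesis
  proof eventually_elim
    case (elim x)
    then obtain C where C: "C \<ge> 0" "(\<Sum>n. ennreal (2^n) * ennreal ((d n x)\<^sup>2)) = ennreal C"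
      by (cases "\<Sum>n. ennreal (2^n) * ennreal ((d n x)\<^sup>2)" rule: ennreal_cases) auto
    have "\<bar>d n x\<bar> \<le> sqrt C * (sqrt (1/2)) ^ n" for n
    proof -
      have "ennreal (2^n) * ennreal ((d n x)\<^sup>2) \<le> ennreal C"
        unfolding C(2)[symmetric] using sum_le_suminf[of "\<lambda>n. ennreal (2^n) * ennreal ((d n x)\<^sup>2)" "{n}"] by auto
      then have "2^n * (d n x)\<^sup>2 \<le> C" using C(1) by (simp add: ennreal_mult'[symmetric])
      then have "(d n x)\<^sup>2 \<le> C * (1/2)^n" by (simp add: power_one_over field_simps)
      then have "sqrt ((d n x)\<^sup>2) \<le> sqrt (C * (1/2)^n)" by (rule real_sqrt_le_mono)
      moreover have "sqrt (C * (1/2)^n) = sqrt C * (sqrt (1/2)) ^ n" by (simp add: real_sqrt_mult real_sqrt_power)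
      ultimately show ?thesis by (simp only: real_sqrt_abs)
    qed
    moreover have "norm (sqrt (1/2::real)) < 1" by (simp add: real_sqrt_lt_1_iff)
    then have "summable (\<lambda>n. sqrt C * (sqrt (1/2)) ^ n)"
      by (intro summable_mult summable_geometric)
    ultimately have "summable (\<lambda>n. d n x)" using summable_comparison_test'[of "\<lambda>n. sqrt C * (sqrt (1/2)) ^ n" 0 "\<lambda>n. d n x"] by simp
    then have "convergent (\<lambda>n. \<Sum>k<n. d k x)" by (simp add: summable_iff_convergent)
    moreover have "(\<Sum>k<n. d k x) = f n x - f 0 x" for n unfolding d_def by (rule sum_lessThan_telescope)
    ultimately have "convergent (\<lambda>n. f n x - f 0 x)" by simp
    then have "convergent (\<lambda>n. (f n x - f 0 x) + f 0 x)" by (intro convergent_add convergent_const)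
    then show ?case by simp
  qed
qed

lemma Cauchy_fast_subseq:
  fixes X :: "nat \<Rightarrow> 'a::metric_space"
  assumes "Cauchy X" "\<And>n. e n > 0"
  obtains r where "strict_mono r" "\<And>n. dist (X (r (Suc n))) (X (r n)) < e n"
proof -
  have "\<forall>n. \<exists>M. \<forall>m\<ge>M. \<forall>k\<ge>M. dist (X m) (X k) < e n" using assms by (meson metric_CauchyD)
  then obtain N where N: "\<And>n m k. m \<ge> N n \<Longrightarrow> k \<ge> N n \<Longrightarrow> dist (X m) (X k) < e n" by metis
  \<comment> \<open>Adding up the thresholds makes \<open>r\<close> strictly increasing and still at
    least \<open>N n\<close>.\<close>
  define r where "r n = (\<Sum>i\<le>n. Suc (N i))" for n
  have "strict_mono r" unfolding strict_mono_Suc_iff r_def by simp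
  moreover have rN: "r n \<ge> N n" for n
  proof -
    have "Suc (N n) \<le> r n" unfolding r_def by (rule member_le_sum) auto
    then show ?thesis by simp
  qed
  moreover have "dist (X (r (Suc n))) (X (r n)) < e n" for n
    using N[OF _ rN] order_trans[OF rN, of n "r (Suc n)"] \<open>strict_mono r\<close> by (simp add: strict_mono_less_eq)
  ultimately show ?thesis using that by blast
qed

lemma l2_Fatou:
  fixes f :: "nat \<Rightarrow> 'a::euclidean_space \<Rightarrow> real"
  assumes f: "\<And>n. f n \<in> sq_int" and lim: "AE x in lebesgue. (\<lambda>n. f n x) \<longlonglongrightarrow> F x" and F: "F \<in> borel_measurable lebesgue"
    and bd: "eventually (\<lambda>n. norm (l2_of (f n)) \<le> C) sequentially"
  shows "F \<in> sq_int" "norm (l2_of F) \<le> C"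
proof -
  obtain k where "norm (l2_of (f k)) \<le> C" using eventually_happens[OF bd] by auto
  then have C0: "0 \<le> C" using norm_ge_zero order_trans by blast
  have [measurable]: "f n \<in> borel_measurable lebesgue" "F \<in> borel_measurable lebesgue" for n using f F by (auto simp: sq_int_meas)
  have "(\<integral>\<^sup>+x. ennreal ((F x)\<^sup>2) \<partial>lebesgue) = (\<integral>\<^sup>+x. liminf (\<lambda>n. ennreal ((f n x)\<^sup>2)) \<partial>lebesgue)"
  proof (rule nn_integral_cong_AE)
    show "AE x in lebesgue. ennreal ((F x)\<^sup>2) = liminf (\<lambda>n. ennreal ((f n x)\<^sup>2))"
      using lim
    proof eventually_elim
      case (elim x)
      then have L: "(\<lambda>n. ennreal ((f n x)\<^sup>2)) \<longlonglongrightarrow> ennreal ((F x)\<^sup>2)" by (intro tendsto_ennrealI tendsto_power)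
      show ?case by (rule lim_imp_Liminf[OF sequentially_bot L, symmetric])
    qed
  qed
  also have "\<dots> \<le> liminf (\<lambda>n. \<integral>\<^sup>+x. ennreal ((f n x)\<^sup>2) \<partial>lebesgue)" by (rule nn_integral_liminf) measurable
  also have "\<dots> \<le> ennreal (C\<^sup>2)"
  proof -
    have "liminf (\<lambda>n. \<integral>\<^sup>+x. ennreal ((f n x)\<^sup>2) \<partial>lebesgue) \<le> liminf (\<lambda>n::nat. ennreal (C\<^sup>2))"
    proof (rule Liminf_mono)
      show "eventually (\<lambda>n. (\<integral>\<^sup>+x. ennreal ((f n x)\<^sup>2) \<partial>lebesgue) \<le> ennreal (C\<^sup>2)) sequentially"
        using bd by eventually_elim (simp add: sq_int_nn_integral f ennreal_leI power_mono)
    qed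
    then show ?thesis by (simp add: Liminf_const)
  qed
  finally have le: "(\<integral>\<^sup>+x. ennreal ((F x)\<^sup>2) \<partial>lebesgue) \<le> ennreal (C\<^sup>2)" .
  show F: "F \<in> sq_int" using le by (intro sq_intI_nn_integral) (auto intro: le_less_trans)
  show "norm (l2_of F) \<le> C" using le C0 by (simp add: sq_int_nn_integral[OF F] power2_le_iff_abs_le)
qed

text \<open>Riesz-Fischer: a fast subsequence converges almost everywhere, and Fatou applied to the
  differences \<open>f m x - f n x\<close> turns the pointwise limit into a limit in norm.\<close>

instance l2 :: (euclidean_space) complete_space
proof
  fix X :: "nat \<Rightarrow> 'a l2" assume X: "Cauchy X"
  obtain r where r: "strict_mono r" and fast: "\<And>n. dist (X (r (Suc n))) (X (r n)) < sqrt ((1/8)^n)"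
    by (rule Cauchy_fast_subseq[OF X, of "\<lambda>n. sqrt ((1/8)^n)"]) auto
  define f where "f n = fun_of (X (r n))" for n
  have f: "f n \<in> sq_int" for n by (simp add: f_def fun_of_sq_int)
  have [measurable]: "f n \<in> borel_measurable lebesgue" for n using f by (rule sq_int_meas)
  have lf: "l2_of (f n) = X (r n)" for n by (simp add: f_def)
  have "(norm (l2_of (f (Suc n)) - l2_of (f n)))\<^sup>2 \<le> (1/8) ^ n" for n
  proof -
    have "(norm (l2_of (f (Suc n)) - l2_of (f n)))\<^sup>2 \<le> (sqrt ((1/8)^n))\<^sup>2"
      using fast[of n] by (intro power_mono) (auto simp: lf dist_norm)
    then show ?thesis by simp
  qed
  then have conv: "AE x in lebesgue. convergent (\<lambda>n. f n x)" by (intro l2_fast_Cauchy_convergent f)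
  define F where "F x = lim (\<lambda>n. f n x)" for x
  have [measurable]: "F \<in> borel_measurable lebesgue" unfolding F_def by measurable
  have Flim: "AE x in lebesgue. (\<lambda>n. f n x) \<longlonglongrightarrow> F x"
    using conv by eventually_elim (simp add: F_def convergent_LIMSEQ_iff)
  have CX: "Cauchy (\<lambda>n. X (r n))" using X r Cauchy_subseq_Cauchy[of X r] by (simp add: o_def)
  have main: "\<exists>N. \<forall>n\<ge>N. F \<in> sq_int \<and> norm (X (r n) - l2_of F) \<le> e" if e: "e > 0" for e
  proof -
    obtain N where N: "\<And>m n. m \<ge> N \<Longrightarrow> n \<ge> N \<Longrightarrow> dist (X (r m)) (X (r n)) < e" using CX e by (meson metric_CauchyD)
    have "F \<in> sq_int \<and> norm (X (r n) - l2_of F) \<le> e" if n: "n \<ge> N" for n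
    proof -
      have A: "(\<lambda>x. f m x - f n x) \<in> sq_int" for m by (intro sq_int_diff f)
      have B: "AE x in lebesgue. (\<lambda>m. f m x - f n x) \<longlonglongrightarrow> F x - f n x"
        using Flim by eventually_elim (intro tendsto_intros)
      have C: "eventually (\<lambda>m. norm (l2_of (\<lambda>x. f m x - f n x)) \<le> e) sequentially"
        using eventually_ge_at_top[of N]
      proof eventually_elim
        case (elim m) then show ?case using N[OF elim n] by (simp add: l2_of_diff f lf dist_norm)
      qed
      have D: "(\<lambda>x. F x - f n x) \<in> sq_int" "norm (l2_of (\<lambda>x. F x - f n x)) \<le> e"
        by (rule l2_Fatou[OF A B _ C]; measurable)+
      have "(\<lambda>x. (F x - f n x) + f n x) \<in> sq_int" by (intro sq_int_add D f)
      then have "F \<in> sq_int" by simp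
      then show ?thesis using D by (simp add: l2_of_diff f lf norm_minus_commute)
    qed
    then show ?thesis by blast
  qed
  have "(\<lambda>n. X (r n)) \<longlonglongrightarrow> l2_of F"
  proof (rule metric_LIMSEQ_I)
    fix e :: real assume "e > 0"
    then obtain N where "\<forall>n\<ge>N. norm (X (r n) - l2_of F) \<le> e/2" using main[of "e/2"] by auto
    then show "\<exists>no. \<forall>n\<ge>no. dist (X (r n)) (l2_of F) < e" using \<open>e > 0\<close> by (intro exI[of _ N]) (force simp: dist_norm)
  qed
  then have "X \<longlonglongrightarrow> l2_of F" using X r Cauchy_converges_subseq[of X r "l2_of F"] by (simp add: o_def)
  then show "convergent X" by (auto simp: convergent_def)
qed

section \<open>Smooth functions and test functions\<close>

lemma partial_deriv_eq: "(\<phi> has_derivative D) (at x) \<Longrightarrow> partial_deriv i \<phi> x = D (axis i 1)"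
  unfolding partial_deriv_def by (metis frechet_derivative_at)

lemma smooth_differentiable: "smooth \<phi> \<Longrightarrow> \<phi> differentiable (at x)"
  unfolding smooth_def by (drule spec[of _ "[]"]) (simp add: differentiable_on_def)

lemma smooth_partial: "smooth \<phi> \<Longrightarrow> smooth (partial_deriv i \<phi>)"
  unfolding smooth_def
proof
  fix "is" assume "\<forall>is. foldr partial_deriv is \<phi> differentiable_on UNIV"
  from spec[OF this, of "is @ [i]"] show "foldr partial_deriv is (partial_deriv i \<phi>) differentiable_on UNIV" by simp
qed

lemma smooth_coinduct:
  assumes "\<phi> \<in> S" and diff: "\<And>\<phi> x. \<phi> \<in> S \<Longrightarrow> \<phi> differentiable (at x)"
    and partial: "\<And>\<phi> i. \<phi> \<in> S \<Longrightarrow> partial_deriv i \<phi> \<in> S"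
  shows "smooth \<phi>"
proof -
  have "foldr partial_deriv is \<phi> \<in> S" for "is" by (induction "is") (auto simp: assms)
  then show ?thesis unfolding smooth_def differentiable_on_def using diff by auto
qed

lemma partial_deriv_const: "partial_deriv i (\<lambda>x. c) = (\<lambda>x. 0)"
  by (rule ext) (rule partial_deriv_eq, rule has_derivative_const)

lemma partial_deriv_add:
  assumes "f differentiable (at x)" "g differentiable (at x)"
  shows "partial_deriv i (\<lambda>x. f x + g x) x = partial_deriv i f x + partial_deriv i g x"
  using assms unfolding frechet_derivative_works partial_deriv_def[of i f] partial_deriv_def[of i g]
  by (intro partial_deriv_eq) (auto intro!: derivative_eq_intros)

lemma partial_deriv_mult:
  assumes "f differentiable (at x)" "g differentiable (at x)"
  shows "partial_deriv i (\<lambda>x. f x * g x) x = f x * partial_deriv i g x + partial_deriv i f x * g x"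
  using assms unfolding frechet_derivative_works partial_deriv_def[of i f] partial_deriv_def[of i g]
  by (intro partial_deriv_eq) (auto intro!: derivative_eq_intros)

lemma partial_deriv_compose:
  assumes g: "g differentiable (at x)" and s: "(s has_real_derivative s') (at (g x))"
  shows "partial_deriv i (\<lambda>x. s (g x)) x = s' * partial_deriv i g x" "(\<lambda>x. s (g x)) differentiable (at x)"
proof -
  have D: "((\<lambda>x. s (g x)) has_derivative (\<lambda>h. frechet_derivative g (at x) h * s')) (at x)"
    using DERIV_compose_FDERIV[where f = s and g = g and x = x, OF s] g unfolding frechet_derivative_works by blast
  show "partial_deriv i (\<lambda>x. s (g x)) x = s' * partial_deriv i g x"
    using partial_deriv_eq[OF D, of i] unfolding partial_deriv_def by (simp add: mult.commute)
  show "(\<lambda>x. s (g x)) differentiable (at x)" using D by (rule differentiableI)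
qed

lemma partial_deriv_reflect:
  assumes g: "g differentiable (at (c - x))"
  shows "partial_deriv i (\<lambda>x. g (c - x)) x = - partial_deriv i g (c - x)" "(\<lambda>x. g (c - x)) differentiable (at x)"
proof -
  have "((\<lambda>x. c - x) has_derivative (\<lambda>h. - h)) (at x)" by (auto intro!: derivative_eq_intros)
  moreover have "(g has_derivative frechet_derivative g (at (c - x))) (at (c - x))"
    using g unfolding frechet_derivative_works .
  ultimately have D: "((\<lambda>x. g (c - x)) has_derivative (\<lambda>h. frechet_derivative g (at (c - x)) (- h))) (at x)"
    using has_derivative_compose by blast
  have lin: "linear (frechet_derivative g (at (c - x)))" using g linear_frechet_derivative by blast
  show "partial_deriv i (\<lambda>x. g (c - x)) x = - partial_deriv i g (c - x)"
    using partial_deriv_eq[OF D, of i] unfolding partial_deriv_def by (simp add: linear_neg[OF lin])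
  show "(\<lambda>x. g (c - x)) differentiable (at x)" using D by (rule differentiableI)
qed

text \<open>The flat functions \<open>t \<mapsto> t\<^sup>-\<^sup>n e\<^sup>-\<^sup>1\<^sup>/\<^sup>t\<close>, extended by \<open>0\<close>; this family is closed under differentiation.\<close>

definition flat :: "nat \<Rightarrow> real \<Rightarrow> real" where
  "flat n t = (if t > 0 then inverse t ^ n * exp (- inverse t) else 0)"

lemma flat_nonneg: "0 \<le> flat n t" and flat_pos: "0 < t \<Longrightarrow> 0 < flat n t" and flat_le_0: "t \<le> 0 \<Longrightarrow> flat n t = 0"
  by (auto simp: flat_def)

lemma flat_tendsto_0: "(flat n \<longlongrightarrow> 0) (at 0)"
proof -
  have "((\<lambda>t. inverse t ^ n / exp (inverse t)) \<longlongrightarrow> 0) (at_right (0::real))"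
    using filterlim_compose[OF tendsto_power_div_exp_0 filterlim_inverse_at_top_right] .
  then have "(flat n \<longlongrightarrow> 0) (at_right 0)"
    by (rule filterlim_cong[THEN iffD1, rotated 3]) (auto simp: flat_def exp_minus field_simps eventually_at_filter)
  moreover have "(flat n \<longlongrightarrow> 0) (at_left 0)"
    by (rule filterlim_cong[THEN iffD1, OF refl refl _ tendsto_const[of 0]]) (auto simp: flat_def eventually_at_filter)
  ultimately show ?thesis by (simp add: filterlim_at_split)
qed

lemma DERIV_flat: "(flat n has_real_derivative (flat (n + 2) t - real n * flat (n + 1) t)) (at t)"
proof -
  consider "t > 0" | "t < 0" | "t = 0" by linarith
  then show ?thesis
  proof cases
    case 1
    have A: "((\<lambda>t. inverse t ^ n * exp (- inverse t)) has_real_derivative (flat (n + 2) t - real n * flat (n + 1) t)) (at t)"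
      using 1 by (auto intro!: derivative_eq_intros simp: flat_def power2_eq_square)
        (cases n; simp add: field_simps power2_eq_square)
    have E: "eventually (\<lambda>t. inverse t ^ n * exp (- inverse t) = flat n t) (nhds t)"
      using eventually_nhds_in_open[of "{0<..}" t] 1 by (auto simp: flat_def elim: eventually_mono)
    show ?thesis by (rule DERIV_cong_ev[OF refl E refl, THEN iffD1, OF A])
  next
    case 2
    have A: "((\<lambda>t. 0) has_real_derivative (flat (n + 2) t - real n * flat (n + 1) t)) (at t)"
      using 2 by (auto simp: flat_def)
    have E: "eventually (\<lambda>t. 0 = flat n t) (nhds t)"
      using eventually_nhds_in_open[of "{..<0}" t] 2 by (auto simp: flat_def elim: eventually_mono)
    show ?thesis by (rule DERIV_cong_ev[OF refl E refl, THEN iffD1, OF A])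
  next
    case 3
    \<comment> \<open>The difference quotient of \<open>flat n\<close> at 0 is
      \<open>flat (Suc n)\<close>, which tends to 0.\<close>
    have "((\<lambda>h. (flat n (0 + h) - flat n 0) / h) \<longlongrightarrow> 0) (at 0)"
      by (rule filterlim_cong[THEN iffD1, OF refl refl _ flat_tendsto_0[of "Suc n"]])
        (auto simp: flat_def eventually_at_filter field_simps)
    then show ?thesis using 3 by (simp add: DERIV_def flat_def)
  qed
qed

text \<open>Closure under the operations used to build test functions. The derivative of a function
  produced by any rule is again produced by the rules, so the set is stable under partial
  derivatives and consists of smooth functions. The free index \<open>n\<close> in the rule for
  \<open>flat\<close> is what keeps that rule stable.\<close>

inductive_set smooth_closure :: "(real^'n \<Rightarrow> real) set" where
  base: "smooth \<phi> \<Longrightarrow> \<phi> \<in> smooth_closure"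
| const: "(\<lambda>x. c) \<in> smooth_closure"
| coord: "(\<lambda>x. x $ i) \<in> smooth_closure"
| add: "f \<in> smooth_closure \<Longrightarrow> g \<in> smooth_closure \<Longrightarrow> (\<lambda>x. f x + g x) \<in> smooth_closure"
| mult: "f \<in> smooth_closure \<Longrightarrow> g \<in> smooth_closure \<Longrightarrow> (\<lambda>x. f x * g x) \<in> smooth_closure"
| exp: "g \<in> smooth_closure \<Longrightarrow> (\<lambda>x. exp (g x)) \<in> smooth_closure"
| flat: "g \<in> smooth_closure \<Longrightarrow> (\<lambda>x. flat n (g x)) \<in> smooth_closure"
| inverse: "g \<in> smooth_closure \<Longrightarrow> (\<And>x. g x \<noteq> 0) \<Longrightarrow> (\<lambda>x. inverse (g x)) \<in> smooth_closure"
| reflect: "g \<in> smooth_closure \<Longrightarrow> (\<lambda>x. g (c - x)) \<in> smooth_closure"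

lemma partial_deriv_coord: "partial_deriv j (\<lambda>x. x $ i) = (\<lambda>x. if i = j then 1 else 0)"
  by (rule ext, subst partial_deriv_eq[OF bounded_linear_imp_has_derivative[OF bounded_linear_vec_nth]])
    (auto simp: axis_def)

lemma smooth_closure_derivative:
  "\<phi> \<in> smooth_closure \<Longrightarrow> (\<forall>x. \<phi> differentiable (at x)) \<and> (\<forall>i. partial_deriv i \<phi> \<in> smooth_closure)"
proof (induction rule: smooth_closure.induct)
  case (base \<phi>)
  then show ?case by (auto intro: smooth_differentiable smooth_partial smooth_closure.base)
next
  case (const c)
  then show ?case by (simp add: partial_deriv_const smooth_closure.const)
next
  case (coord i)
  then show ?case
    by (auto simp: partial_deriv_coord intro!: smooth_closure.const bounded_linear_imp_differentiable bounded_linear_vec_nth)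
next
  case (add f g)
  then have "partial_deriv i (\<lambda>x. f x + g x) = (\<lambda>x. partial_deriv i f x + partial_deriv i g x)" for i
    by (intro ext partial_deriv_add) auto
  then show ?case using add by (auto intro: smooth_closure.add)
next
  case (mult f g)
  then have "partial_deriv i (\<lambda>x. f x * g x) = (\<lambda>x. f x * partial_deriv i g x + partial_deriv i f x * g x)" for i
    by (intro ext partial_deriv_mult) auto
  then show ?case using mult by (auto intro!: smooth_closure.add smooth_closure.mult)
next
  case (exp g)
  have "partial_deriv i (\<lambda>x. exp (g x)) = (\<lambda>x. exp (g x) * partial_deriv i g x)" for i
    using exp by (intro ext partial_deriv_compose(1)) auto
  moreover have "(\<lambda>x. exp (g x)) differentiable (at x)" for x
    using exp by (intro partial_deriv_compose(2)[where s = exp, OF _ DERIV_exp]) auto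
  moreover have "(\<lambda>x. exp (g x) * partial_deriv i g x) \<in> smooth_closure" for i
    using exp by (intro smooth_closure.mult smooth_closure.exp) auto
  ultimately show ?case by simp
next
  case (flat g n)
  have "partial_deriv i (\<lambda>x. flat n (g x)) = (\<lambda>x. (flat (n + 2) (g x) + (- real n) * flat (n + 1) (g x)) * partial_deriv i g x)" for i
    using flat DERIV_flat[of n] by (intro ext partial_deriv_compose(1)) auto
  moreover have "(\<lambda>x. flat n (g x)) differentiable (at x)" for x
    using flat by (intro partial_deriv_compose(2)[where s = "flat n", OF _ DERIV_flat]) auto
  moreover have "(\<lambda>x. (flat (n + 2) (g x) + (- real n) * flat (n + 1) (g x)) * partial_deriv i g x) \<in> smooth_closure" for i
    using flat by (intro smooth_closure.mult smooth_closure.add smooth_closure.const smooth_closure.flat) auto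
  ultimately show ?case by simp
next
  case (inverse g)
  have D: "(inverse has_real_derivative (- 1) * (inverse (g x) * inverse (g x))) (at (g x))" for x
    using DERIV_inverse[OF inverse(2), of x] by (simp add: numeral_2_eq_2)
  have "partial_deriv i (\<lambda>x. inverse (g x)) = (\<lambda>x. ((- 1) * (inverse (g x) * inverse (g x))) * partial_deriv i g x)" for i
    using inverse D by (intro ext partial_deriv_compose(1)) auto
  moreover have "(\<lambda>x. inverse (g x)) differentiable (at x)" for x
    using inverse by (intro partial_deriv_compose(2)[where s = inverse, OF _ D]) auto
  moreover have "(\<lambda>x. ((- 1) * (inverse (g x) * inverse (g x))) * partial_deriv i g x) \<in> smooth_closure" for i
    using inverse by (intro smooth_closure.mult smooth_closure.const smooth_closure.inverse) auto
  ultimately show ?case by simp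
next
  case (reflect g c)
  then have "partial_deriv i (\<lambda>x. g (c - x)) = (\<lambda>x. (- 1) * partial_deriv i g (c - x))" for i
    by (auto simp: fun_eq_iff partial_deriv_reflect)
  moreover have "(\<lambda>x. (- 1) * partial_deriv i g (c - x)) \<in> smooth_closure" for i
    using reflect by (intro smooth_closure.mult smooth_closure.const smooth_closure.reflect[of "partial_deriv i g"]) auto
  ultimately show ?case using reflect by (auto simp: partial_deriv_reflect)
qed

lemma smooth_closure_smooth: "\<phi> \<in> smooth_closure \<Longrightarrow> smooth \<phi>"
  by (rule smooth_coinduct[of _ smooth_closure]) (auto simp: smooth_closure_derivative)

named_theorems smooth_intros

lemma smooth_const [smooth_intros]: "smooth (\<lambda>x. c)"
  and smooth_coord [smooth_intros]: "smooth (\<lambda>x. x $ i)"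
  and smooth_add [smooth_intros]: "smooth f \<Longrightarrow> smooth g \<Longrightarrow> smooth (\<lambda>x. f x + g x)"
  and smooth_mult [smooth_intros]: "smooth f \<Longrightarrow> smooth g \<Longrightarrow> smooth (\<lambda>x. f x * g x)"
  and smooth_exp [smooth_intros]: "smooth g \<Longrightarrow> smooth (\<lambda>x. exp (g x))"
  and smooth_flat [smooth_intros]: "smooth g \<Longrightarrow> smooth (\<lambda>x. flat n (g x))"
  and smooth_inverse: "smooth g \<Longrightarrow> (\<And>x. g x \<noteq> 0) \<Longrightarrow> smooth (\<lambda>x. inverse (g x))"
  by (auto intro!: smooth_closure_smooth intro: smooth_closure.intros)

lemma smooth_reflect: "smooth g \<Longrightarrow> smooth (\<lambda>x. g (c - x))"
  by (auto intro!: smooth_closure_smooth intro: smooth_closure.intros)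

lemma smooth_uminus [smooth_intros]: "smooth f \<Longrightarrow> smooth (\<lambda>x. - f x)"
  using smooth_mult[OF smooth_const[of "-1"]] by simp

lemma smooth_diff [smooth_intros]: "smooth f \<Longrightarrow> smooth g \<Longrightarrow> smooth (\<lambda>x. f x - g x)"
  using smooth_add[OF _ smooth_uminus] by simp

lemma smooth_power [smooth_intros]: "smooth f \<Longrightarrow> smooth (\<lambda>x. f x ^ n)"
  by (induction n) (auto intro: smooth_intros)

lemma smooth_sum [smooth_intros]: "(\<And>i. i \<in> I \<Longrightarrow> smooth (f i)) \<Longrightarrow> smooth (\<lambda>x. \<Sum>i\<in>I. f i x)"
  by (induction I rule: infinite_finite_induct) (auto intro: smooth_intros)

lemma smooth_prod [smooth_intros]: "(\<And>i. i \<in> I \<Longrightarrow> smooth (f i)) \<Longrightarrow> smooth (\<lambda>x. \<Prod>i\<in>I. f i x)"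
  by (induction I rule: infinite_finite_induct) (auto intro: smooth_intros)

lemma partial_deriv_sum:
  assumes "\<And>k. k \<in> I \<Longrightarrow> smooth (f k)"
  shows "partial_deriv i (\<lambda>x. \<Sum>k\<in>I. f k x) x = (\<Sum>k\<in>I. partial_deriv i (f k) x)"
  using assms
proof (induction I rule: infinite_finite_induct)
  case (insert k I)
  then have "smooth (f k)" "smooth (\<lambda>x. \<Sum>k\<in>I. f k x)" by (auto intro: smooth_intros)
  then show ?case using insert by (simp add: partial_deriv_add smooth_differentiable)
qed (auto simp: partial_deriv_const)

lemma partial_deriv_cmult: "smooth f \<Longrightarrow> partial_deriv i (\<lambda>x. c * f x) x = c * partial_deriv i f x"
  by (simp add: partial_deriv_mult smooth_differentiable partial_deriv_const)

lemma partial_deriv_diff: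
  "smooth f \<Longrightarrow> smooth g \<Longrightarrow> partial_deriv i (\<lambda>x. f x - g x) x = partial_deriv i f x - partial_deriv i g x"
  using partial_deriv_add[of f x "\<lambda>x. (- 1) * g x" i] partial_deriv_cmult[of g i "-1" x]
    smooth_differentiable[OF smooth_mult[OF smooth_const[of "-1"], of g]]
  by (simp add: smooth_differentiable)

lemma smooth_continuous: "smooth \<phi> \<Longrightarrow> continuous_on S \<phi>"
  by (meson continuous_at_imp_continuous_on differentiable_imp_continuous_within smooth_differentiable)

lemma smooth_borel [measurable_dest]: "smooth \<phi> \<Longrightarrow> \<phi> \<in> borel_measurable borel"
  by (rule borel_measurable_continuous_onI) (rule smooth_continuous)

lemma smooth_lebesgue [measurable_dest]: "smooth \<phi> \<Longrightarrow> \<phi> \<in> borel_measurable lebesgue"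
  using smooth_borel by (simp add: measurable_completion)

section \<open>Symmetry of second derivatives\<close>

lemma frechet_derivative_sum_partial:
  assumes "\<phi> differentiable (at x)"
  shows "frechet_derivative \<phi> (at x) h = (\<Sum>i\<in>UNIV. h $ i * partial_deriv i \<phi> x)"
proof -
  have lin: "linear (frechet_derivative \<phi> (at x))" using assms linear_frechet_derivative by blast
  have "h = (\<Sum>i\<in>UNIV. h $ i *\<^sub>R axis i 1)" by (simp add: vec_eq_iff axis_def if_distrib cong: if_cong)
  then have "frechet_derivative \<phi> (at x) h = frechet_derivative \<phi> (at x) (\<Sum>i\<in>UNIV. h $ i *\<^sub>R axis i 1)" by simp
  then show ?thesis by (simp add: linear_sum[OF lin] linear_scale[OF lin] partial_deriv_def)
qed

lemma has_real_derivative_along_axis: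
  assumes "\<phi> differentiable (at (x + s *\<^sub>R axis i 1))"
  shows "((\<lambda>s. \<phi> (x + s *\<^sub>R axis i 1)) has_real_derivative partial_deriv i \<phi> (x + s *\<^sub>R axis i 1)) (at s)"
proof -
  let ?D = "frechet_derivative \<phi> (at (x + s *\<^sub>R axis i 1))"
  have lin: "linear ?D" using assms linear_frechet_derivative by blast
  have "(\<phi> has_derivative ?D) (at (x + s *\<^sub>R axis i 1))"
    using assms unfolding frechet_derivative_works .
  moreover have "((\<lambda>s. x + s *\<^sub>R axis i 1) has_derivative (\<lambda>h. h *\<^sub>R axis i 1)) (at s)"
    by (auto intro!: derivative_eq_intros)
  ultimately have "((\<lambda>s. \<phi> (x + s *\<^sub>R axis i 1)) has_derivative (\<lambda>h. ?D (h *\<^sub>R axis i 1))) (at s)"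
    using has_derivative_compose[of "\<lambda>s. x + s *\<^sub>R axis i 1"] by blast
  then show ?thesis unfolding has_field_derivative_def
    by (rule has_derivative_eq_rhs) (auto simp: linear_scale[OF lin] partial_deriv_def)
qed

text \<open>Mean value theorem applied twice: along axis \<open>i\<close> to the increment in
  direction \<open>j\<close>, then along \<open>j\<close> to the derivative in direction
  \<open>i\<close>. The left-hand side is symmetric in \<open>i\<close> and \<open>j\<close>, so
  exchanging them and letting h tend to 0 gives Schwarz's theorem.\<close>

lemma second_difference_mvt:
  fixes \<phi> :: "real^'n \<Rightarrow> real"
  assumes "smooth \<phi>" "h > 0"
  obtains s t where "0 < s" "s < h" "0 < t" "t < h"
    "\<phi> (x + h *\<^sub>R axis i 1 + h *\<^sub>R axis j 1) - \<phi> (x + h *\<^sub>R axis i 1) - \<phi> (x + h *\<^sub>R axis j 1) + \<phi> x =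
     h\<^sup>2 * partial_deriv j (partial_deriv i \<phi>) (x + s *\<^sub>R axis i 1 + t *\<^sub>R axis j 1)"
proof -
  have dx: "((\<lambda>s. \<phi> (y + s *\<^sub>R axis i 1)) has_real_derivative partial_deriv i \<phi> (y + s *\<^sub>R axis i 1)) (at s)" for y s
    by (intro has_real_derivative_along_axis smooth_differentiable assms)
  have dy: "((\<lambda>s. partial_deriv i \<phi> (y + s *\<^sub>R axis j 1)) has_real_derivative partial_deriv j (partial_deriv i \<phi>) (y + s *\<^sub>R axis j 1)) (at s)" for y s
    by (intro has_real_derivative_along_axis smooth_differentiable smooth_partial assms)
  define F where "F s = \<phi> ((x + h *\<^sub>R axis j 1) + s *\<^sub>R axis i 1) - \<phi> (x + s *\<^sub>R axis i 1)" for s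
  have "\<exists>s. 0 < s \<and> s < h \<and> F h - F 0 = (h - 0) * (partial_deriv i \<phi> ((x + h *\<^sub>R axis j 1) + s *\<^sub>R axis i 1) - partial_deriv i \<phi> (x + s *\<^sub>R axis i 1))"
    unfolding F_def using \<open>h > 0\<close> by (intro MVT2 DERIV_diff dx)
  then obtain s where s: "0 < s" "s < h" "F h - F 0 = h * (partial_deriv i \<phi> ((x + h *\<^sub>R axis j 1) + s *\<^sub>R axis i 1) - partial_deriv i \<phi> (x + s *\<^sub>R axis i 1))"
    by auto
  have "\<exists>t. 0 < t \<and> t < h \<and> partial_deriv i \<phi> ((x + s *\<^sub>R axis i 1) + h *\<^sub>R axis j 1) - partial_deriv i \<phi> ((x + s *\<^sub>R axis i 1) + 0 *\<^sub>R axis j 1)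
     = (h - 0) * partial_deriv j (partial_deriv i \<phi>) ((x + s *\<^sub>R axis i 1) + t *\<^sub>R axis j 1)"
    using \<open>h > 0\<close> by (intro MVT2 dy)
  then obtain t where t: "0 < t" "t < h" "partial_deriv i \<phi> ((x + s *\<^sub>R axis i 1) + h *\<^sub>R axis j 1) - partial_deriv i \<phi> (x + s *\<^sub>R axis i 1)
     = h * partial_deriv j (partial_deriv i \<phi>) ((x + s *\<^sub>R axis i 1) + t *\<^sub>R axis j 1)" by auto
  have "F h - F 0 = h * (h * partial_deriv j (partial_deriv i \<phi>) ((x + s *\<^sub>R axis i 1) + t *\<^sub>R axis j 1))"
    using s(3) t(3) by (simp add: add.assoc add.commute add.left_commute)
  then show ?thesis using s t by (intro that[of s t]) (auto simp: F_def power2_eq_square algebra_simps)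
qed

lemma partial_deriv_commute:
  assumes "smooth \<phi>"
  shows "partial_deriv i (partial_deriv j \<phi>) = partial_deriv j (partial_deriv i \<phi>)"
proof
  fix x
  let ?u = "partial_deriv i (partial_deriv j \<phi>)" and ?v = "partial_deriv j (partial_deriv i \<phi>)"
  define h where "h n = inverse (real (Suc n))" for n
  have h: "h n > 0" for n by (simp add: h_def)
  have h0: "h \<longlonglongrightarrow> 0" unfolding h_def by (rule LIMSEQ_inverse_real_of_nat)
  define \<Delta> where "\<Delta> n = \<phi> (x + h n *\<^sub>R axis i 1 + h n *\<^sub>R axis j 1) - \<phi> (x + h n *\<^sub>R axis i 1) - \<phi> (x + h n *\<^sub>R axis j 1) + \<phi> x" for n
  have "\<exists>s t. 0 < s \<and> s < h n \<and> 0 < t \<and> t < h n \<and> \<Delta> n = (h n)\<^sup>2 * ?v (x + s *\<^sub>R axis i 1 + t *\<^sub>R axis j 1)" for n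
    using second_difference_mvt[OF assms h[of n], of x i j] unfolding \<Delta>_def by metis
  then obtain s t where st: "\<And>n. 0 < s n \<and> s n < h n \<and> 0 < t n \<and> t n < h n \<and> \<Delta> n = (h n)\<^sup>2 * ?v (x + s n *\<^sub>R axis i 1 + t n *\<^sub>R axis j 1)" by metis
  have "\<exists>s t. 0 < s \<and> s < h n \<and> 0 < t \<and> t < h n \<and> \<Delta> n = (h n)\<^sup>2 * ?u (x + s *\<^sub>R axis j 1 + t *\<^sub>R axis i 1)" for n
  proof -
    obtain s t where "0 < s" "s < h n" "0 < t" "t < h n"
      "\<phi> (x + h n *\<^sub>R axis j 1 + h n *\<^sub>R axis i 1) - \<phi> (x + h n *\<^sub>R axis j 1) - \<phi> (x + h n *\<^sub>R axis i 1) + \<phi> x =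
        (h n)\<^sup>2 * ?u (x + s *\<^sub>R axis j 1 + t *\<^sub>R axis i 1)"
      by (rule second_difference_mvt[OF assms h[of n], of x j i])
    moreover have "x + h n *\<^sub>R axis j 1 + h n *\<^sub>R axis i 1 = x + h n *\<^sub>R axis i 1 + h n *\<^sub>R axis j 1" by simp
    ultimately show ?thesis by (intro exI[of _ s] exI[of _ t]) (simp add: \<Delta>_def)
  qed
  then obtain s' t' where st': "\<And>n. 0 < s' n \<and> s' n < h n \<and> 0 < t' n \<and> t' n < h n \<and> \<Delta> n = (h n)\<^sup>2 * ?u (x + s' n *\<^sub>R axis j 1 + t' n *\<^sub>R axis i 1)" by metis
  have lim0: "r \<longlonglongrightarrow> 0" if "\<And>n. 0 < r n \<and> r n < h n" for r
    by (rule tendsto_sandwich[OF _ _ tendsto_const h0]) (auto intro!: always_eventually less_imp_le simp: that)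
  have cont: "continuous (at x) ?u" "continuous (at x) ?v"
    using smooth_continuous[OF smooth_partial[OF smooth_partial[OF assms]], of UNIV] by (auto simp: continuous_on_eq_continuous_at)
  have "(\<lambda>n. x + s n *\<^sub>R axis i 1 + t n *\<^sub>R axis j 1) \<longlonglongrightarrow> x + 0 *\<^sub>R axis i 1 + 0 *\<^sub>R axis j 1"
    using st by (intro tendsto_intros lim0) blast+
  then have L1: "(\<lambda>n. ?v (x + s n *\<^sub>R axis i 1 + t n *\<^sub>R axis j 1)) \<longlonglongrightarrow> ?v x"
    using continuous_within_tendsto_compose'[OF cont(2)] by simp
  have "(\<lambda>n. x + s' n *\<^sub>R axis j 1 + t' n *\<^sub>R axis i 1) \<longlonglongrightarrow> x + 0 *\<^sub>R axis j 1 + 0 *\<^sub>R axis i 1"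
    using st' by (intro tendsto_intros lim0) blast+
  then have L2: "(\<lambda>n. ?u (x + s' n *\<^sub>R axis j 1 + t' n *\<^sub>R axis i 1)) \<longlonglongrightarrow> ?u x"
    using continuous_within_tendsto_compose'[OF cont(1)] by simp
  have "?v (x + s n *\<^sub>R axis i 1 + t n *\<^sub>R axis j 1) = ?u (x + s' n *\<^sub>R axis j 1 + t' n *\<^sub>R axis i 1)" for n
  proof -
    have "(h n)\<^sup>2 * ?v (x + s n *\<^sub>R axis i 1 + t n *\<^sub>R axis j 1) = (h n)\<^sup>2 * ?u (x + s' n *\<^sub>R axis j 1 + t' n *\<^sub>R axis i 1)"
      using st[of n] st'[of n] by linarith
    then show ?thesis using h[of n] by simp
  qed
  then show "?u x = ?v x" using L1 L2 LIMSEQ_unique by auto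
qed

section \<open>Compactly supported test functions\<close>

lemma test_functions_iff:
  "\<phi> \<in> test_functions \<Omega> \<longleftrightarrow> smooth \<phi> \<and> (\<exists>K. compact K \<and> K \<subseteq> \<Omega> \<and> (\<forall>x. x \<notin> K \<longrightarrow> \<phi> x = 0))"
proof
  assume "\<phi> \<in> test_functions \<Omega>"
  then show "smooth \<phi> \<and> (\<exists>K. compact K \<and> K \<subseteq> \<Omega> \<and> (\<forall>x. x \<notin> K \<longrightarrow> \<phi> x = 0))"
    unfolding test_functions_def using closure_subset[of "{x. \<phi> x \<noteq> 0}"] by (auto intro!: exI[of _ "closure {x. \<phi> x \<noteq> 0}"])
next
  assume "smooth \<phi> \<and> (\<exists>K. compact K \<and> K \<subseteq> \<Omega> \<and> (\<forall>x. x \<notin> K \<longrightarrow> \<phi> x = 0))"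
  then obtain K where K: "smooth \<phi>" "compact K" "K \<subseteq> \<Omega>" "\<And>x. x \<notin> K \<Longrightarrow> \<phi> x = 0" by blast
  have "closure {x. \<phi> x \<noteq> 0} \<subseteq> K" using K by (intro closure_minimal compact_imp_closed) auto
  moreover have "compact (closure {x. \<phi> x \<noteq> 0})"
    using \<open>closure {x. \<phi> x \<noteq> 0} \<subseteq> K\<close> K(2) by (meson bounded_subset closed_closure compact_eq_bounded_closed)
  ultimately show "\<phi> \<in> test_functions \<Omega>" using K by (auto simp: test_functions_def)
qed

lemma partial_deriv_zero_outside:
  assumes "closed K" "\<And>x. x \<notin> K \<Longrightarrow> \<phi> x = 0" "x \<notin> K"
  shows "partial_deriv i \<phi> x = 0"
proof -
  have "(\<phi> has_derivative (\<lambda>h. 0)) (at x)"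
    by (rule has_derivative_transform_within_open[of "\<lambda>x. 0" _ x _ "- K"]) (use assms in auto)
  from partial_deriv_eq[OF this] show ?thesis by simp
qed

lemma test_smooth: "\<phi> \<in> test_functions \<Omega> \<Longrightarrow> smooth \<phi>"
  by (simp add: test_functions_def)

lemma test_outside: "\<phi> \<in> test_functions \<Omega> \<Longrightarrow> x \<notin> \<Omega> \<Longrightarrow> \<phi> x = 0"
  by (auto simp: test_functions_iff)

lemma test_partial:
  assumes "\<phi> \<in> test_functions \<Omega>" shows "partial_deriv i \<phi> \<in> test_functions \<Omega>"
proof -
  obtain K where K: "smooth \<phi>" "compact K" "K \<subseteq> \<Omega>" "\<And>x. x \<notin> K \<Longrightarrow> \<phi> x = 0" using assms by (auto simp: test_functions_iff)
  have "partial_deriv i \<phi> x = 0" if "x \<notin> K" for x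
    using K that by (intro partial_deriv_zero_outside[of K]) (auto intro: compact_imp_closed)
  then show ?thesis using K by (auto simp: test_functions_iff smooth_partial)
qed

lemma test_mono: "\<phi> \<in> test_functions \<Omega> \<Longrightarrow> \<Omega> \<subseteq> \<Omega>' \<Longrightarrow> \<phi> \<in> test_functions \<Omega>'"
  by (auto simp: test_functions_def)

lemma test_mult: "\<phi> \<in> test_functions \<Omega> \<Longrightarrow> smooth g \<Longrightarrow> (\<lambda>x. \<phi> x * g x) \<in> test_functions \<Omega>"
  unfolding test_functions_iff by (auto intro: smooth_mult)

lemma test_mult2: "\<phi> \<in> test_functions \<Omega> \<Longrightarrow> smooth g \<Longrightarrow> (\<lambda>x. g x * \<phi> x) \<in> test_functions \<Omega>"
  using test_mult[of \<phi> \<Omega> g] by (simp add: mult.commute)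

lemma test_add:
  assumes "\<phi> \<in> test_functions \<Omega>" "\<psi> \<in> test_functions \<Omega>"
  shows "(\<lambda>x. \<phi> x + \<psi> x) \<in> test_functions \<Omega>"
proof -
  obtain K K' where "compact K" "K \<subseteq> \<Omega>" "\<And>x. x \<notin> K \<Longrightarrow> \<phi> x = 0" "compact K'" "K' \<subseteq> \<Omega>" "\<And>x. x \<notin> K' \<Longrightarrow> \<psi> x = 0"
    using assms unfolding test_functions_iff by metis
  then show ?thesis using assms unfolding test_functions_iff
    by (intro conjI exI[of _ "K \<union> K'"]) (auto intro: smooth_intros)
qed

lemma test_cmult: "\<phi> \<in> test_functions \<Omega> \<Longrightarrow> (\<lambda>x. c * \<phi> x) \<in> test_functions \<Omega>"
  by (rule test_mult2[OF _ smooth_const])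

lemma test_zero: "(\<lambda>x. 0) \<in> test_functions \<Omega>"
  unfolding test_functions_iff by (auto intro: smooth_const exI[of _ "{}"])

lemma test_diff: "\<phi> \<in> test_functions \<Omega> \<Longrightarrow> \<psi> \<in> test_functions \<Omega> \<Longrightarrow> (\<lambda>x. \<phi> x - \<psi> x) \<in> test_functions \<Omega>"
  using test_add[of \<phi> \<Omega> "\<lambda>x. (-1) * \<psi> x"] test_cmult[of \<psi> \<Omega> "-1"] by simp

lemma test_sum: "(\<And>k. k \<in> I \<Longrightarrow> f k \<in> test_functions \<Omega>) \<Longrightarrow> (\<lambda>x. \<Sum>k\<in>I. f k x) \<in> test_functions \<Omega>"
  by (induction I rule: infinite_finite_induct) (auto intro: test_zero test_add)

lemma test_bounded:
  assumes "\<phi> \<in> test_functions \<Omega>"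
  obtains C where "C > 0" "\<And>x. \<bar>\<phi> x\<bar> \<le> C"
proof -
  obtain K where K: "smooth \<phi>" "compact K" "\<And>x. x \<notin> K \<Longrightarrow> \<phi> x = 0" using assms by (auto simp: test_functions_iff)
  have "bounded (\<phi> ` K)" using K by (intro compact_imp_bounded compact_continuous_image smooth_continuous)
  then obtain C where "C > 0" "\<And>y. y \<in> \<phi> ` K \<Longrightarrow> norm y \<le> C" unfolding bounded_pos by blast
  then show ?thesis using K(3) by (intro that[of C]) (metis abs_zero image_eqI less_eq_real_def real_norm_def)+
qed

section \<open>Integration by parts against smooth functions\<close>

lemma integrable_bounded_compact:
  fixes g :: "'a::euclidean_space \<Rightarrow> real"
  assumes "g \<in> borel_measurable lebesgue" "compact K" "\<And>x. x \<notin> K \<Longrightarrow> g x = 0" "\<And>x. \<bar>g x\<bar> \<le> C"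
  shows "integrable lebesgue g"
proof (rule integrableI_bounded_set[where A = K and B = C])
  show "K \<in> sets lebesgue" using assms(2) by (simp add: compact_imp_closed)
  show "emeasure lebesgue K < \<infinity>" using lmeasurable_compact[OF assms(2)] by (auto simp only: fmeasurable_def infinity_ennreal_def mem_Collect_eq)
qed (use assms in auto)

lemma test_integrable:
  assumes "\<phi> \<in> test_functions \<Omega>" shows "integrable lebesgue \<phi>"
proof -
  obtain K where K: "smooth \<phi>" "compact K" "\<And>x. x \<notin> K \<Longrightarrow> \<phi> x = 0" using assms by (auto simp: test_functions_iff)
  obtain C where "\<And>x. \<bar>\<phi> x\<bar> \<le> C" using test_bounded[OF assms] by metis
  then show ?thesis using K by (intro integrable_bounded_compact[of \<phi> K C]) (auto intro: smooth_lebesgue)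
qed

lemma test_sq_int:
  assumes "\<phi> \<in> test_functions \<Omega>" shows "\<phi> \<in> sq_int"
  using test_integrable[OF test_mult[OF assms test_smooth[OF assms]]] assms
  by (auto simp: sq_int_def power2_eq_square intro: smooth_lebesgue test_smooth)

lemma integral_lebesgue_translation:
  fixes f :: "'a::euclidean_space \<Rightarrow> real"
  assumes "f \<in> borel_measurable borel"
  shows "(LINT x|lebesgue. f (c + x)) = (LINT x|lebesgue. f x)"
proof -
  have [measurable]: "f \<in> borel_measurable borel" by fact
  have "(LINT x|lborel. f x) = (LINT x|distr lborel borel ((+) c). f x)" by (simp add: lborel_distr_plus)
  also have "\<dots> = (LINT x|lborel. f (c + x))" by (intro integral_distr) auto
  finally show ?thesis by (simp add: integral_completion)
qed

text \<open>The difference quotients along the axis have integral zero by translation invariance of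
  Lebesgue measure. They are bounded by the supremum of the derivative and vanish outside a fixed
  ball, so dominated convergence applies.\<close>

lemma integral_partial_deriv:
  assumes \<phi>: "\<phi> \<in> test_functions \<Omega>"
  shows "(LINT x|lebesgue. partial_deriv i \<phi> x) = 0"
proof -
  have sm: "smooth \<phi>" using \<phi> by (rule test_smooth)
  obtain K where K: "compact K" "\<And>x. x \<notin> K \<Longrightarrow> \<phi> x = 0" using \<phi> by (auto simp: test_functions_iff)
  obtain C where C: "C > 0" "\<And>x. \<bar>partial_deriv i \<phi> x\<bar> \<le> C" using test_bounded[OF test_partial[OF \<phi>]] by metis
  obtain R where R: "\<And>x. x \<in> K \<Longrightarrow> norm x \<le> R" using K(1) compact_imp_bounded bounded_iff by metis
  define h where "h n = inverse (real (Suc n))" for n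
  have h: "0 < h n" "h n \<le> 1" for n by (auto simp: h_def field_simps)
  have h0: "filterlim h (at 0) sequentially"
    unfolding filterlim_at h_def using LIMSEQ_inverse_real_of_nat by auto
  define q where "q n x = (\<phi> (x + h n *\<^sub>R axis i 1) - \<phi> x) / h n" for n x
  have deriv: "((\<lambda>s. \<phi> (x + s *\<^sub>R axis i 1)) has_real_derivative partial_deriv i \<phi> (x + s *\<^sub>R axis i 1)) (at s)" for x s
    by (intro has_real_derivative_along_axis smooth_differentiable sm)
  have qb: "\<bar>q n x\<bar> \<le> C" for n x
  proof -
    obtain s where "\<phi> (x + h n *\<^sub>R axis i 1) - \<phi> (x + 0 *\<^sub>R axis i 1) = (h n - 0) * partial_deriv i \<phi> (x + s *\<^sub>R axis i 1)"
      using MVT2[OF h(1)[of n], where f = "\<lambda>s. \<phi> (x + s *\<^sub>R axis i 1)" and f' = "\<lambda>s. partial_deriv i \<phi> (x + s *\<^sub>R axis i 1)"] deriv by blast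
    then show ?thesis using C(2) h(1)[of n] by (simp add: q_def)
  qed
  \<comment> \<open>The increments \<open>h n\<close> are at most 1, so enlarging the radius by 1
    covers all translates.\<close>
  have q0: "q n x = 0" if "x \<notin> cball 0 (R + 1)" for n x
  proof -
    have "norm x > R + 1" using that by simp
    moreover have "norm x \<le> norm (x + h n *\<^sub>R axis i 1) + norm (h n *\<^sub>R axis i (1::real))" 
      using norm_triangle_ineq4[of "x + h n *\<^sub>R axis i 1" "h n *\<^sub>R axis i (1::real)"] by simp
    ultimately have "norm (x + h n *\<^sub>R axis i 1) > R" using h[of n] by simp
    then have "x \<notin> K" "x + h n *\<^sub>R axis i 1 \<notin> K" using R \<open>norm x > R + 1\<close> by force+
    then show ?thesis using K(2) by (simp add: q_def)
  qed
  have [measurable]: "\<phi> \<in> borel_measurable borel" using sm by (rule smooth_borel)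
  have qm: "q n \<in> borel_measurable lebesgue" for n
    unfolding q_def by (intro measurable_completion) measurable
  have qint: "(LINT x|lebesgue. q n x) = 0" for n
  proof -
    have i1: "integrable lebesgue \<phi>" using \<phi> by (rule test_integrable)
    have m: "(\<lambda>x. \<phi> (x + h n *\<^sub>R axis i 1)) \<in> borel_measurable borel" by measurable
    have i2: "integrable lebesgue (\<lambda>x. \<phi> (x + h n *\<^sub>R axis i 1))"
    proof -
      have "integrable lebesgue (\<lambda>x. h n * q n x + \<phi> x)"
        using i1 qb q0 qm by (intro Bochner_Integration.integrable_add integrable_mult_right integrable_bounded_compact[of "q n" "cball 0 (R+1)" C]) auto
      then show ?thesis using h(1)[of n] by (simp add: q_def)
    qed
    have "(LINT x|lebesgue. q n x) = ((LINT x|lebesgue. \<phi> (h n *\<^sub>R axis i 1 + x)) - (LINT x|lebesgue. \<phi> x)) / h n"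
      unfolding q_def using i1 i2 by (simp add: add.commute)
    then show ?thesis by (simp add: integral_lebesgue_translation)
  qed
  have "(\<lambda>n. LINT x|lebesgue. q n x) \<longlonglongrightarrow> (LINT x|lebesgue. partial_deriv i \<phi> x)"
  proof (rule integral_dominated_convergence[where w = "\<lambda>x. C * indicator (cball 0 (R+1)) x"])
    show "integrable lebesgue (\<lambda>x. C * indicat_real (cball (0::real^'n) (R + 1)) x)"
      using lmeasurable_compact[OF compact_cball] by (intro integrable_mult_right integrable_real_indicator) (auto simp: fmeasurable_def)
    show "AE x in lebesgue. (\<lambda>n. q n x) \<longlonglongrightarrow> partial_deriv i \<phi> x"
    proof (rule AE_I2)
      fix x
      have "((\<lambda>s. (\<phi> (x + (0 + s) *\<^sub>R axis i 1) - \<phi> (x + 0 *\<^sub>R axis i 1)) / s) \<longlongrightarrow> partial_deriv i \<phi> (x + 0 *\<^sub>R axis i 1)) (at 0)"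
        using deriv[of x 0] unfolding DERIV_def .
      from filterlim_compose[OF this h0] show "(\<lambda>n. q n x) \<longlonglongrightarrow> partial_deriv i \<phi> x" by (simp add: q_def)
    qed
    show "AE x in lebesgue. norm (q n x) \<le> C * indicat_real (cball 0 (R + 1)) x" for n
      using qb[of n] q0[of _ n] by (auto simp: indicator_def)
    show "partial_deriv i \<phi> \<in> borel_measurable lebesgue" using sm by (intro smooth_lebesgue smooth_partial)
    show "q n \<in> borel_measurable lebesgue" for n by (rule qm)
  qed
  then show ?thesis using LIMSEQ_unique[OF _ tendsto_const] by (simp add: qint LIMSEQ_const_iff)
qed

lemma integral_by_parts:
  assumes "\<phi> \<in> test_functions \<Omega>" "smooth g"
  shows "(LINT x|lebesgue. partial_deriv i \<phi> x * g x) = - (LINT x|lebesgue. \<phi> x * partial_deriv i g x)"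
proof -
  have "(LINT x|lebesgue. partial_deriv i (\<lambda>x. \<phi> x * g x) x) = 0"
    by (rule integral_partial_deriv[OF test_mult[OF assms]])
  moreover have "partial_deriv i (\<lambda>x. \<phi> x * g x) x = \<phi> x * partial_deriv i g x + partial_deriv i \<phi> x * g x" for x
    using assms by (intro partial_deriv_mult smooth_differentiable) (auto intro: test_smooth)
  moreover have "integrable lebesgue (\<lambda>x. \<phi> x * partial_deriv i g x)" "integrable lebesgue (\<lambda>x. partial_deriv i \<phi> x * g x)"
    using assms by (auto intro!: test_integrable test_mult test_partial smooth_partial)
  ultimately show ?thesis by simp
qed

lemma l2_norm_mono:
  assumes "f \<in> sq_int" "g \<in> sq_int" "AE x in lebesgue. \<bar>f x\<bar> \<le> \<bar>g x\<bar>"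
  shows "norm (l2_of f) \<le> norm (l2_of g)"
proof -
  have "(LINT x|lebesgue. (f x)\<^sup>2) \<le> (LINT x|lebesgue. (g x)\<^sup>2)"
    using assms by (intro integral_mono_AE) (auto simp: sq_int_def abs_le_square_iff)
  then show ?thesis using assms by (simp add: norm_l2_of)
qed

lemma sq_int_dominated:
  assumes "f \<in> borel_measurable lebesgue" "g \<in> sq_int" "AE x in lebesgue. \<bar>f x\<bar> \<le> \<bar>g x\<bar>"
  shows "f \<in> sq_int"
  using assms unfolding sq_int_def
  by (auto simp: abs_le_square_iff intro!: Bochner_Integration.integrable_bound[where f = "\<lambda>x. (g x)\<^sup>2" and g = "\<lambda>x. (f x)\<^sup>2"])

lemma l2_norm_bounded_mult:
  assumes "f \<in> sq_int" "c \<in> borel_measurable lebesgue" "AE x in lebesgue. \<bar>c x\<bar> \<le> C" "0 \<le> C"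
  shows "norm (l2_of (\<lambda>x. c x * f x)) \<le> C * norm (l2_of f)"
proof -
  have "AE x in lebesgue. \<bar>c x * f x\<bar> \<le> \<bar>C * f x\<bar>"
    using assms(3) by eventually_elim (use assms(4) in \<open>simp add: abs_mult mult_right_mono\<close>)
  then have "norm (l2_of (\<lambda>x. c x * f x)) \<le> norm (l2_of (\<lambda>x. C * f x))"
    using assms by (intro l2_norm_mono sq_int_bounded_mult sq_int_scale)
  then show ?thesis using assms by (simp add: l2_of_scale)
qed

lemma l2_tendsto_bounded_mult:
  assumes "\<And>k. g k \<in> sq_int" "g0 \<in> sq_int" "(\<lambda>k. l2_of (g k)) \<longlonglongrightarrow> l2_of g0"
    "c \<in> borel_measurable lebesgue" "AE x in lebesgue. \<bar>c x\<bar> \<le> C"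
  shows "(\<lambda>k. l2_of (\<lambda>x. c x * g k x)) \<longlonglongrightarrow> l2_of (\<lambda>x. c x * g0 x)"
proof -
  define C' where "C' = max C 0"
  have C': "AE x in lebesgue. \<bar>c x\<bar> \<le> C'" "0 \<le> C'" using assms(5) by (auto simp: C'_def elim: eventually_mono)
  note sq = sq_int_bounded_mult[OF _ assms(4) C'(1)]
  have "norm (l2_of (\<lambda>x. c x * g k x) - l2_of (\<lambda>x. c x * g0 x)) \<le> C' * norm (l2_of (g k) - l2_of g0)" for k
  proof -
    have "l2_of (\<lambda>x. c x * g k x) - l2_of (\<lambda>x. c x * g0 x) = l2_of (\<lambda>x. c x * (g k x - g0 x))"
      using sq assms by (simp add: l2_of_diff[symmetric] right_diff_distrib)
    then show ?thesis using l2_norm_bounded_mult[OF sq_int_diff[OF assms(1,2), of k] assms(4) C'] assms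
      by (simp add: l2_of_diff)
  qed
  moreover have "(\<lambda>k. C' * norm (l2_of (g k) - l2_of g0)) \<longlonglongrightarrow> C' * norm (l2_of g0 - l2_of g0)"
    by (intro tendsto_intros assms(3))
  then have "(\<lambda>k. C' * norm (l2_of (g k) - l2_of g0)) \<longlonglongrightarrow> 0" by simp
  ultimately have "(\<lambda>k. l2_of (\<lambda>x. c x * g k x) - l2_of (\<lambda>x. c x * g0 x)) \<longlonglongrightarrow> 0"
    using Lim_null_comparison[OF always_eventually, of "\<lambda>k. l2_of (\<lambda>x. c x * g k x) - l2_of (\<lambda>x. c x * g0 x)"
      "\<lambda>k. C' * norm (l2_of (g k) - l2_of g0)" sequentially] by blast
  then show ?thesis by (rule LIM_zero_cancel)
qed

lemma integral_tendsto_weighted: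
  assumes "\<And>k. g k \<in> sq_int" "g0 \<in> sq_int" "(\<lambda>k. l2_of (g k)) \<longlonglongrightarrow> l2_of g0"
    and "\<And>k. h k \<in> sq_int" "h0 \<in> sq_int" "(\<lambda>k. l2_of (h k)) \<longlonglongrightarrow> l2_of h0"
    and "c \<in> borel_measurable lebesgue" "AE x in lebesgue. \<bar>c x\<bar> \<le> C"
  shows "(\<lambda>k. LINT x|lebesgue. c x * (g k x * h k x)) \<longlonglongrightarrow> (LINT x|lebesgue. c x * (g0 x * h0 x))"
proof -
  have "(\<lambda>k. inner (l2_of (\<lambda>x. c x * g k x)) (l2_of (h k))) \<longlonglongrightarrow> inner (l2_of (\<lambda>x. c x * g0 x)) (l2_of h0)"
    by (intro tendsto_intros l2_tendsto_bounded_mult[OF assms(1,2,3,7,8)] assms(6))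
  then show ?thesis using assms by (simp add: inner_l2_of sq_int_bounded_mult[OF _ assms(7,8)] mult.assoc)
qed

lemma integrable_weighted:
  assumes "g \<in> sq_int" "h \<in> sq_int" "c \<in> borel_measurable lebesgue" "AE x in lebesgue. \<bar>c x\<bar> \<le> C"
  shows "integrable lebesgue (\<lambda>x. c x * (g x * h x))"
  using sq_int_integrable_mult[OF sq_int_bounded_mult[OF assms(1,3,4)] assms(2)] by (simp add: mult.assoc)

text \<open>The square of \<phi> is integrated by parts against the coordinate x_i, whose derivative
  is 1: the squared norm equals - 2 \<integral> x_i \<phi> D_i \<phi>, and |x_i| \<le> R on the
  domain.\<close>

lemma poincare_inequality:
  fixes \<phi> :: "real^'n \<Rightarrow> real"
  assumes \<phi>: "\<phi> \<in> test_functions \<Omega>" and R: "\<Omega> \<subseteq> cball 0 R"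
  shows "norm (l2_of \<phi>) \<le> 2 * R * norm (l2_of (partial_deriv i \<phi>))"
proof (cases "\<Omega> = {}")
  case True
  then have "\<phi> = (\<lambda>x. 0)" using test_outside[OF \<phi>] by auto
  then show ?thesis by (simp add: partial_deriv_const zero_l2_def[symmetric])
next
  case False
  then have R0: "R \<ge> 0" using R by (metis cball_empty linorder_not_le subset_empty)
  let ?d = "partial_deriv i \<phi>"
  have sm: "smooth \<phi>" using \<phi> by (rule test_smooth)
  have sq: "\<phi> \<in> sq_int" "?d \<in> sq_int" using \<phi> by (auto intro: test_sq_int test_partial)
  have xsq: "(\<lambda>x. x $ i * \<phi> x) \<in> sq_int" using test_sq_int[OF test_mult2[OF \<phi> smooth_coord]] .
  have xn: "norm (l2_of (\<lambda>x. x $ i * \<phi> x)) \<le> R * norm (l2_of \<phi>)"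
  proof -
    have "\<bar>x $ i * \<phi> x\<bar> \<le> \<bar>R * \<phi> x\<bar>" for x
    proof (cases "x \<in> \<Omega>")
      case True
      then have "\<bar>x $ i\<bar> \<le> R" using R component_le_norm_cart[of x i] by force
      then show ?thesis using R0 by (simp add: abs_mult mult_right_mono)
    qed (simp add: test_outside[OF \<phi>])
    then have "norm (l2_of (\<lambda>x. x $ i * \<phi> x)) \<le> norm (l2_of (\<lambda>x. R * \<phi> x))"
      using xsq sq by (intro l2_norm_mono) (auto intro: sq_int_scale)
    then show ?thesis using sq R0 by (simp add: l2_of_scale)
  qed
  have "(LINT x|lebesgue. partial_deriv i (\<lambda>x. \<phi> x * \<phi> x) x * (x $ i)) = - (LINT x|lebesgue. (\<phi> x * \<phi> x) * partial_deriv i (\<lambda>x. x $ i) x)"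
    by (rule integral_by_parts[OF test_mult[OF \<phi> sm] smooth_coord])
  moreover have "partial_deriv i (\<lambda>x. \<phi> x * \<phi> x) x * (x $ i) = 2 * ((x $ i * \<phi> x) * ?d x)" for x
    using sm by (simp add: partial_deriv_mult smooth_differentiable)
  ultimately have "(norm (l2_of \<phi>))\<^sup>2 = - 2 * inner (l2_of (\<lambda>x. x $ i * \<phi> x)) (l2_of ?d)"
    using sq xsq by (simp add: partial_deriv_coord power2_norm_eq_inner inner_l2_of)
  also have "\<dots> \<le> 2 * (norm (l2_of (\<lambda>x. x $ i * \<phi> x)) * norm (l2_of ?d))"
    using Cauchy_Schwarz_ineq2[of "l2_of (\<lambda>x. x $ i * \<phi> x)" "l2_of ?d"] by linarith
  also have "\<dots> \<le> 2 * ((R * norm (l2_of \<phi>)) * norm (l2_of ?d))"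
    by (intro mult_left_mono mult_right_mono xn) auto
  finally have "norm (l2_of \<phi>) * norm (l2_of \<phi>) \<le> (2 * R * norm (l2_of ?d)) * norm (l2_of \<phi>)"
    by (simp add: power2_eq_square mult_ac)
  then show ?thesis using R0 by (cases "norm (l2_of \<phi>) = 0") (auto simp: mult_le_cancel_right)
qed

text \<open>Products of one-dimensional profiles built from \<open>flat 0\<close> converge boundedly
  to the indicator of the box and vanish outside slightly smaller closed boxes, so they are
  admissible test functions.\<close>

lemma integral_box_eq_0:
  fixes g :: "real^'n \<Rightarrow> real"
  assumes g: "integrable lebesgue g" and test: "\<And>\<phi>. \<phi> \<in> test_functions \<Omega> \<Longrightarrow> (LINT x|lebesgue. g x * \<phi> x) = 0"
    and sub: "box a b \<subseteq> \<Omega>"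
  shows "(LINT x|lebesgue. indicator (box a b) x * g x) = 0"
proof -
  define e where "e n = inverse (real (Suc n))" for n
  have e0: "e \<longlonglongrightarrow> 0" unfolding e_def by (rule LIMSEQ_inverse_real_of_nat)
  have epos: "e n > 0" for n by (simp add: e_def)
  \<comment> \<open>The margin \<open>e n\<close> makes the support compact inside the open box; the
    factor \<open>Suc n\<close> sends the arguments to infinity at each interior point, where
    \<open>flat 0\<close> tends to 1.\<close>
  define \<phi> where "\<phi> n x = (\<Prod>i\<in>UNIV. flat 0 (real (Suc n) * (x $ i - a $ i - e n)) * flat 0 (real (Suc n) * (b $ i - e n - x $ i)))" for n and x :: "real^'n"
  have flat1: "0 \<le> flat 0 t \<and> flat 0 t \<le> 1" for t by (auto simp: flat_def)
  have bound: "\<bar>\<phi> n x\<bar> \<le> 1" for n x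
    unfolding \<phi>_def abs_prod by (intro prod_le_1) (auto simp: flat1 abs_mult intro!: mult_le_one)
  have out: "\<phi> n x = 0" if "x \<notin> cbox (a + (\<chi> i. e n)) (b - (\<chi> i. e n))" for n x
  proof -
    obtain i where "\<not> ((a + (\<chi> i. e n)) $ i \<le> x $ i \<and> x $ i \<le> (b - (\<chi> i. e n)) $ i)"
      using \<open>x \<notin> _\<close> unfolding mem_box_cart by blast
    then have "x $ i < a $ i + e n \<or> b $ i - e n < x $ i" by auto
    then have "real (Suc n) * (x $ i - a $ i - e n) \<le> 0 \<or> real (Suc n) * (b $ i - e n - x $ i) \<le> 0"
      by (auto intro!: mult_nonneg_nonpos)
    then show ?thesis unfolding \<phi>_def by (intro prod_zero) (auto simp: flat_le_0 intro!: exI[of _ i])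
  qed
  have inner_box: "cbox (a + (\<chi> i. e n)) (b - (\<chi> i. e n)) \<subseteq> box a b" for n
  proof
    fix x assume x: "x \<in> cbox (a + (\<chi> i. e n)) (b - (\<chi> i. e n))"
    have "a $ i < x $ i \<and> x $ i < b $ i" for i
    proof -
      have "a $ i + e n \<le> x $ i \<and> x $ i \<le> b $ i - e n" using x by (simp add: mem_box_cart)
      then show ?thesis using epos[of n] by linarith
    qed
    then show "x \<in> box a b" by (simp add: mem_box_cart)
  qed
  have "\<phi> n \<in> test_functions \<Omega>" for n
    unfolding test_functions_iff
  proof (intro conjI exI)
    show "smooth (\<phi> n)" unfolding \<phi>_def by (intro smooth_intros)
    show "compact (cbox (a + (\<chi> i. e n)) (b - (\<chi> i. e n)))" by simp
    show "cbox (a + (\<chi> i. e n)) (b - (\<chi> i. e n)) \<subseteq> \<Omega>" using inner_box sub by blast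
    show "\<forall>x. x \<notin> cbox (a + (\<chi> i. e n)) (b - (\<chi> i. e n)) \<longrightarrow> \<phi> n x = 0" using out by blast
  qed
  then have z: "(LINT x|lebesgue. g x * \<phi> n x) = 0" and sm: "smooth (\<phi> n)" for n using test by (auto intro: test_smooth)
  have flim: "(\<lambda>n. flat 0 (real (Suc n) * (t - e n))) \<longlonglongrightarrow> 1" if "t > 0" for t
  proof -
    have "(\<lambda>n. t - e n) \<longlonglongrightarrow> t - 0" by (intro tendsto_intros e0)
    then have "filterlim (\<lambda>n. (t - e n) * real (Suc n)) at_top sequentially"
      using that by (intro filterlim_tendsto_pos_mult_at_top[of _ "t - 0"] filterlim_compose[OF filterlim_real_sequentially filterlim_Suc]) auto
    then have T: "filterlim (\<lambda>n. real (Suc n) * (t - e n)) at_top sequentially" by (simp add: mult.commute)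
    have "((\<lambda>s::real. exp (- inverse s)) \<longlongrightarrow> exp (- 0)) at_top"
      by (rule tendsto_exp[OF tendsto_minus[OF tendsto_inverse_0_at_top[OF filterlim_ident]]])
    then have "((\<lambda>s::real. flat 0 s) \<longlongrightarrow> 1) at_top"
      by (rule filterlim_cong[THEN iffD1, rotated 3]) (auto simp: flat_def intro: eventually_mono[OF eventually_gt_at_top[of 0]])
    then show ?thesis using T by (rule filterlim_compose)
  qed
  have lim: "(\<lambda>n. \<phi> n x) \<longlonglongrightarrow> indicator (box a b) x" for x
  proof (cases "x \<in> box a b")
    case True
    have "(\<lambda>n. \<phi> n x) \<longlonglongrightarrow> (\<Prod>i\<in>(UNIV::'n set). 1 * 1)"
      unfolding \<phi>_def
    proof (intro tendsto_prod tendsto_mult)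
      fix i
      show "(\<lambda>n. flat 0 (real (Suc n) * (x $ i - a $ i - e n))) \<longlonglongrightarrow> 1" using flim[of "x $ i - a $ i"] True by (simp add: mem_box_cart)
      have "(\<lambda>n. flat 0 (real (Suc n) * ((b $ i - x $ i) - e n))) \<longlonglongrightarrow> 1" using flim[of "b $ i - x $ i"] True by (simp add: mem_box_cart)
      moreover have "b $ i - x $ i - e n = b $ i - e n - x $ i" for n by simp
      ultimately show "(\<lambda>n. flat 0 (real (Suc n) * (b $ i - e n - x $ i))) \<longlonglongrightarrow> 1" by simp
    qed
    then show ?thesis using True by simp
  next
    case False
    have "\<phi> n x = 0" for n using out inner_box False by blast
    then show ?thesis using False by simp
  qed
  have "(\<lambda>n. LINT x|lebesgue. g x * \<phi> n x) \<longlonglongrightarrow> (LINT x|lebesgue. g x * indicator (box a b) x)"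
  proof (rule integral_dominated_convergence[where w = "\<lambda>x. \<bar>g x\<bar>"])
    show "integrable lebesgue (\<lambda>x. \<bar>g x\<bar>)" using g by simp
    show "AE x in lebesgue. (\<lambda>n. g x * \<phi> n x) \<longlonglongrightarrow> g x * indicat_real (box a b) x"
      by (intro AE_I2 tendsto_intros lim)
    show "AE x in lebesgue. norm (g x * \<phi> n x) \<le> \<bar>g x\<bar>" for n
      using bound[of n] by (auto simp: abs_mult mult_left_le)
    show "(\<lambda>x. g x * \<phi> n x) \<in> borel_measurable lebesgue" for n
      using g smooth_lebesgue[OF sm[of n]] by (intro borel_measurable_times) auto
    show "(\<lambda>x. g x * indicat_real (box a b) x) \<in> borel_measurable lebesgue"
      using g by (intro borel_measurable_times borel_measurable_indicator) auto
  qed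
  then show ?thesis using LIMSEQ_unique[OF _ tendsto_const[of 0]] by (simp add: z mult.commute)
qed

text \<open>Boxes form an intersection-stable generator of the Borel sets. All sets are cut down to
  one fixed box, because only its sub-boxes carry information, and complements are formed inside
  it.\<close>

lemma integral_Borel_box_eq_0:
  fixes g :: "real^'n \<Rightarrow> real"
  assumes g: "integrable lebesgue g" and box0: "\<And>c d. box c d \<subseteq> box a b \<Longrightarrow> (LINT x|lebesgue. indicator (box c d) x * g x) = 0"
    and A: "A \<in> sets borel"
  shows "(LINT x|lebesgue. indicator (A \<inter> box a b) x * g x) = 0"
proof -
  have int: "integrable lebesgue (\<lambda>x. indicator B x * g x)" if "B \<in> sets borel" for B
    using integrable_mult_indicator[OF _ g, of B] that by simp
  have "Int_stable (range (\<lambda>(a, b). box a b :: (real^'n) set))" by (auto simp: Int_stable_def box_Int_box)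
  moreover have "range (\<lambda>(a, b). box a b :: (real^'n) set) \<subseteq> Pow UNIV" by auto
  moreover have "A \<in> sigma_sets UNIV (range (\<lambda>(a, b). box a b))" using A unfolding borel_eq_box by simp
  ultimately show ?thesis
  proof (induction rule: sigma_sets_induct_disjoint)
    case (basic A)
    then obtain c d where cd: "A = box c d" by auto
    obtain c' d' where eq: "box c d \<inter> box a b = box c' d'" using box_Int_box[of c d a b] by blast
    then have "box c' d' \<subseteq> box a b" by blast
    then show ?case unfolding cd eq by (rule box0)
  next
    case empty then show ?case by simp
  next
    case (compl A)
    then have [measurable]: "A \<in> sets borel" by (simp add: borel_eq_box)
    have "indicator ((UNIV - A) \<inter> box a b) x * g x = indicator (box a b) x * g x - indicator (A \<inter> box a b) x * g x" for x
      by (auto simp: indicator_def)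
    then show ?case using compl box0[of a b] int by simp
  next
    case (union A)
    then have m: "A i \<in> sets borel" for i by (auto simp: borel_eq_box subset_eq)
    have eq: "(\<Union>i. A i) \<inter> box a b = (\<Union>i. A i \<inter> box a b)" by auto
    have "(LINT x:(\<Union>i. A i \<inter> box a b)|lebesgue. g x) = (\<Sum>i. (LINT x:(A i \<inter> box a b)|lebesgue. g x))"
    proof (rule lebesgue_integral_countable_add)
      show "set_integrable lebesgue (\<Union>i. A i \<inter> box a b) g"
        unfolding set_integrable_def using int[of "\<Union>i. A i \<inter> box a b"] m by simp
      show "(A i \<inter> box a b) \<inter> (A j \<inter> box a b) = {}" if "i \<noteq> j" for i j using union(1) that by (auto simp: disjoint_family_on_def)
    qed (use m in auto)
    then show ?case using union(3) unfolding eq set_lebesgue_integral_def by simp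
  qed
qed

text \<open>On each box inside the domain the integrals of \<open>g\<close> over all Borel sets
  vanish, in particular over the sets where a Borel representative is positive or negative.
  Countably many boxes cover an open set.\<close>

lemma fundamental_lemma:
  fixes g :: "real^'n \<Rightarrow> real"
  assumes g: "integrable lebesgue g" and \<Omega>: "open \<Omega>"
    and test: "\<And>\<phi>. \<phi> \<in> test_functions \<Omega> \<Longrightarrow> (LINT x|lebesgue. g x * \<phi> x) = 0"
  shows "AE x in lebesgue. x \<in> \<Omega> \<longrightarrow> g x = 0"
proof -
  obtain g' where g' [measurable]: "g' \<in> borel_measurable lborel" and ae: "AE x in lborel. g x = g' x"
    using completion_ex_borel_measurable_real[of g lborel] g by auto
  have ae: "AE x in lebesgue. g x = g' x" using ae by (rule AE_completion)
  have box: "AE x in lebesgue. x \<in> box a b \<longrightarrow> g x = 0" if sub: "box a b \<subseteq> \<Omega>" for a b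
  proof -
    have z: "(LINT x|lebesgue. indicator (A \<inter> box a b) x * g x) = 0" if "A \<in> sets borel" for A
      using integral_box_eq_0[OF g test] sub that by (intro integral_Borel_box_eq_0[OF g]) auto
    have int: "integrable lebesgue (\<lambda>x. indicator B x * g x)" if "B \<in> sets borel" for B
      using integrable_mult_indicator[OF _ g, of B] that by simp
    have half: "AE x in lebesgue. \<not> (x \<in> box a b \<and> 0 < s * g x)" for s :: real
    proof -
      let ?A = "{x. 0 < s * g' x}"
      have A: "?A \<in> sets borel" by measurable
      have i: "integrable lebesgue (\<lambda>x. s * (indicator (?A \<inter> box a b) x * g x))"
        using int A by (intro integrable_mult_right) auto
      have nn: "AE x in lebesgue. 0 \<le> s * (indicator (?A \<inter> box a b) x * g x)"
        using ae by eventually_elim (auto simp: indicator_def)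
      have "(LINT x|lebesgue. s * (indicator (?A \<inter> box a b) x * g x)) = 0" using z[OF A] by simp
      then have "AE x in lebesgue. s * (indicator (?A \<inter> box a b) x * g x) = 0"
        using integral_nonneg_eq_0_iff_AE[OF i nn] by blast
      then show ?thesis using ae by eventually_elim (auto simp: indicator_def)
    qed
    show ?thesis using half[of 1] half[of "-1"] by eventually_elim auto
  qed
  obtain \<D> where D: "countable \<D>" "\<D> \<subseteq> Pow \<Omega>" "\<And>X. X \<in> \<D> \<Longrightarrow> \<exists>a b. X = box a b" "\<Union>\<D> = \<Omega>"
    using open_countable_Union_open_box[OF \<Omega>] by metis
  have "AE x in lebesgue. \<forall>X\<in>\<D>. x \<in> X \<longrightarrow> g x = 0"
  proof (rule AE_ball_countable')
    fix X assume "X \<in> \<D>"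
    then show "AE x in lebesgue. x \<in> X \<longrightarrow> g x = 0" using D(2,3) box by blast
  qed (rule D(1))
  then show ?thesis using D(4) by (auto elim: eventually_mono)
qed

section \<open>Mollification\<close>

lemma LIMSEQ_norm_0:
  assumes "\<And>n::nat. norm (f n) \<le> g n" "g \<longlonglongrightarrow> 0"
  shows "f \<longlonglongrightarrow> 0"
  by (rule Lim_null_comparison[OF always_eventually assms(2)]) (use assms(1) in blast)

lemma test_lipschitz:
  fixes \<phi> :: "real^'n \<Rightarrow> real"
  assumes \<phi>: "\<phi> \<in> test_functions \<Omega>"
  obtains L where "L > 0" "\<And>x y. \<bar>\<phi> x - \<phi> y\<bar> \<le> L * norm (x - y)"
proof -
  have "\<exists>C. \<forall>i x. \<bar>partial_deriv i \<phi> x\<bar> \<le> C"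
  proof -
    have "\<forall>i. \<exists>C. \<forall>x. \<bar>partial_deriv i \<phi> x\<bar> \<le> C" using test_bounded[OF test_partial[OF \<phi>]] by metis
    then obtain C where C: "\<And>i x. \<bar>partial_deriv i \<phi> x\<bar> \<le> C i" by metis
    have "C i \<le> Max (range C)" for i by simp
    then show ?thesis using C order_trans by blast
  qed
  then obtain C where C: "\<And>i x. \<bar>partial_deriv i \<phi> x\<bar> \<le> C" by blast
  then have C0: "0 \<le> C" using abs_ge_zero order_trans by blast
  let ?L = "real CARD('n) * C"
  have sm: "smooth \<phi>" using \<phi> by (rule test_smooth)
  have onorm: "onorm (frechet_derivative \<phi> (at x)) \<le> ?L" for x
  proof (rule onorm_le)
    fix h
    have "norm (frechet_derivative \<phi> (at x) h) = \<bar>\<Sum>i\<in>UNIV. h $ i * partial_deriv i \<phi> x\<bar>"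
      by (simp add: frechet_derivative_sum_partial smooth_differentiable sm)
    also have "\<dots> \<le> (\<Sum>i\<in>(UNIV::'n set). \<bar>h $ i * partial_deriv i \<phi> x\<bar>)" by (rule sum_abs)
    also have "\<dots> \<le> (\<Sum>i\<in>(UNIV::'n set). norm h * C)"
      unfolding abs_mult by (intro sum_mono mult_mono C component_le_norm_cart) auto
    finally show "norm (frechet_derivative \<phi> (at x) h) \<le> ?L * norm h" by (simp add: mult_ac)
  qed
  have D: "(\<phi> has_derivative frechet_derivative \<phi> (at x)) (at x within UNIV)" for x
    using smooth_differentiable[OF sm] unfolding frechet_derivative_works by simp
  have "norm (\<phi> x - \<phi> y) \<le> ?L * norm (x - y)" for x y
    by (rule differentiable_bound[OF convex_UNIV D onorm]) auto
  then have "\<bar>\<phi> x - \<phi> y\<bar> \<le> (?L + 1) * norm (x - y)" for x y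
    by (smt (verit) mult_right_mono norm_ge_zero real_norm_def)
  moreover have "?L + 1 > 0" using C0 by (simp add: add_nonneg_pos)
  ultimately show ?thesis using that by blast
qed

lemma test_reflect:
  assumes "\<rho> \<in> test_functions UNIV"
  shows "(\<lambda>y. \<rho> (x - y)) \<in> test_functions UNIV"
proof -
  obtain K where K: "compact K" "\<And>x. x \<notin> K \<Longrightarrow> \<rho> x = 0" using assms by (auto simp: test_functions_iff)
  have "compact ((\<lambda>y. x - y) ` K)" using K(1) by (intro compact_continuous_image continuous_intros)
  moreover have "\<rho> (x - y) = 0" if "y \<notin> (\<lambda>y. x - y) ` K" for y
    using that K(2)[of "x - y"] by (force intro: image_eqI[of _ _ "x - y"])
  ultimately show ?thesis unfolding test_functions_iff using smooth_reflect[OF test_smooth[OF assms]] by blast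
qed

definition conv :: "('a::euclidean_space \<Rightarrow> real) \<Rightarrow> ('a \<Rightarrow> real) \<Rightarrow> 'a \<Rightarrow> real" where
  "conv \<rho> g x = (LINT y|lebesgue. \<rho> (x - y) * g y)"

lemma conv_l2: "\<rho> \<in> test_functions UNIV \<Longrightarrow> g \<in> sq_int \<Longrightarrow> conv \<rho> g x = inner (l2_of (\<lambda>y. \<rho> (x - y))) (l2_of g)"
  unfolding conv_def by (simp add: inner_l2_of test_sq_int[OF test_reflect])

lemma integrable_test_mult:
  assumes "\<rho> \<in> test_functions UNIV" "integrable lebesgue g"
  shows "integrable lebesgue (\<lambda>y. \<rho> (x - y) * g y)"
proof -
  obtain C where "\<And>x. \<bar>\<rho> x\<bar> \<le> C" using test_bounded[OF assms(1)] by metis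
  then have b: "norm (\<rho> (x - y) * g y) \<le> norm (C * g y)" for y
    unfolding real_norm_def abs_mult by (intro mult_right_mono) (auto intro: order_trans[OF _ abs_ge_self])
  show ?thesis
  proof (rule Bochner_Integration.integrable_bound[of _ "\<lambda>y. C * g y"])
    show "(\<lambda>y. \<rho> (x - y) * g y) \<in> borel_measurable lebesgue"
      using assms(2) smooth_lebesgue[OF test_smooth[OF test_reflect[OF assms(1)]]] by (intro borel_measurable_times) auto
  qed (use b assms(2) in auto)
qed

text \<open>The first-order Taylor remainder of \<rho> is at most a constant times |h|^2, uniformly
  in the base point, because the partial derivatives of \<rho> are Lipschitz. Integrated against
  \<open>g\<close> it stays of order |h|^2, with the L^1 norm of \<open>g\<close> as a
  factor.\<close>

lemma conv_has_derivative:
  fixes g :: "real^'n \<Rightarrow> real"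
  assumes \<rho>: "\<rho> \<in> test_functions UNIV" and g: "integrable lebesgue g"
  shows "(conv \<rho> g has_derivative (\<lambda>h. \<Sum>i\<in>UNIV. h $ i * conv (partial_deriv i \<rho>) g x)) (at x)"
proof -
  have sm: "smooth \<rho>" using \<rho> by (rule test_smooth)
  obtain L where L: "L > 0" "\<And>i x y. \<bar>partial_deriv i \<rho> x - partial_deriv i \<rho> y\<bar> \<le> L * norm (x - y)"
  proof -
    have "\<forall>i. \<exists>L. \<forall>x y. \<bar>partial_deriv i \<rho> x - partial_deriv i \<rho> y\<bar> \<le> L * norm (x - y)"
      using test_lipschitz[OF test_partial[OF \<rho>]] by metis
    then obtain C where C: "\<And>i x y. \<bar>partial_deriv i \<rho> x - partial_deriv i \<rho> y\<bar> \<le> C i * norm (x - y)" by metis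
    have "C i \<le> max 1 (Max (range C))" for i by (simp add: le_max_iff_disj)
    then have "\<bar>partial_deriv i \<rho> x - partial_deriv i \<rho> y\<bar> \<le> max 1 (Max (range C)) * norm (x - y)" for i x y
      by (rule order_trans[OF C mult_right_mono[OF _ norm_ge_zero]])
    then show ?thesis by (intro that[of "max 1 (Max (range C))"]) auto
  qed
  have remainder: "\<bar>\<rho> (z + h) - \<rho> z - (\<Sum>i\<in>UNIV. h $ i * partial_deriv i \<rho> z)\<bar> \<le> (real CARD('n) * L) * (norm h)\<^sup>2" for z h
  proof -
    have d: "((\<lambda>t. \<rho> (z + t *\<^sub>R h)) has_real_derivative (\<Sum>i\<in>UNIV. h $ i * partial_deriv i \<rho> (z + t *\<^sub>R h))) (at t)" for t
    proof -
      let ?D = "frechet_derivative \<rho> (at (z + t *\<^sub>R h))"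
      have "(\<rho> has_derivative ?D) (at (z + t *\<^sub>R h))" using smooth_differentiable[OF sm] unfolding frechet_derivative_works .
      moreover have "((\<lambda>t. z + t *\<^sub>R h) has_derivative (\<lambda>s. s *\<^sub>R h)) (at t)" by (auto intro!: derivative_eq_intros)
      ultimately have "((\<lambda>t. \<rho> (z + t *\<^sub>R h)) has_derivative (\<lambda>s. ?D (s *\<^sub>R h))) (at t)"
        using has_derivative_compose[of "\<lambda>t. z + t *\<^sub>R h"] by blast
      then show ?thesis unfolding has_field_derivative_def
        by (rule has_derivative_eq_rhs)
          (auto simp: frechet_derivative_sum_partial smooth_differentiable sm sum_distrib_left mult_ac intro!: sum.cong)
    qed
    obtain t where t: "0 < t" "t < 1" and e: "\<rho> (z + 1 *\<^sub>R h) - \<rho> (z + 0 *\<^sub>R h) = (1 - 0) * (\<Sum>i\<in>UNIV. h $ i * partial_deriv i \<rho> (z + t *\<^sub>R h))"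
      using MVT2[of 0 1 "\<lambda>t. \<rho> (z + t *\<^sub>R h)" "\<lambda>t. \<Sum>i\<in>UNIV. h $ i * partial_deriv i \<rho> (z + t *\<^sub>R h)"] d by auto
    have "\<bar>\<rho> (z + h) - \<rho> z - (\<Sum>i\<in>UNIV. h $ i * partial_deriv i \<rho> z)\<bar> = \<bar>\<Sum>i\<in>UNIV. h $ i * (partial_deriv i \<rho> (z + t *\<^sub>R h) - partial_deriv i \<rho> z)\<bar>"
      using e by (simp add: sum_subtractf right_diff_distrib)
    also have "\<dots> \<le> (\<Sum>i\<in>UNIV. \<bar>h $ i * (partial_deriv i \<rho> (z + t *\<^sub>R h) - partial_deriv i \<rho> z)\<bar>)" by (rule sum_abs)
    also have "\<dots> \<le> (\<Sum>i\<in>(UNIV::'n set). norm h * (L * norm h))"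
    proof (rule sum_mono)
      fix i
      have "\<bar>partial_deriv i \<rho> (z + t *\<^sub>R h) - partial_deriv i \<rho> z\<bar> \<le> L * norm (t *\<^sub>R h)" using L(2)[of i "z + t *\<^sub>R h" z] by simp
      also have "\<dots> \<le> L * norm h" using t L(1) by (simp add: mult_left_le_one_le)
      finally show "\<bar>h $ i * (partial_deriv i \<rho> (z + t *\<^sub>R h) - partial_deriv i \<rho> z)\<bar> \<le> norm h * (L * norm h)"
        unfolding abs_mult by (intro mult_mono component_le_norm_cart) auto
    qed
    finally show ?thesis by (simp add: power2_eq_square mult_ac)
  qed
  define B where "B = (real CARD('n) * L) * (LINT y|lebesgue. \<bar>g y\<bar>)"
  have B0: "B \<ge> 0" unfolding B_def using L(1) by (intro mult_nonneg_nonneg integral_nonneg_AE) auto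
  have bound: "\<bar>conv \<rho> g (x + h) - conv \<rho> g x - (\<Sum>i\<in>UNIV. h $ i * conv (partial_deriv i \<rho>) g x)\<bar> \<le> B * (norm h)\<^sup>2" for h
  proof -
    note [simp] = integrable_test_mult[OF \<rho> g] integrable_test_mult[OF test_partial[OF \<rho>] g]
    have "conv \<rho> g (x + h) - conv \<rho> g x - (\<Sum>i\<in>UNIV. h $ i * conv (partial_deriv i \<rho>) g x)
      = (LINT y|lebesgue. \<rho> (x + h - y) * g y - \<rho> (x - y) * g y - (\<Sum>i\<in>UNIV. h $ i * (partial_deriv i \<rho> (x - y) * g y)))"
      unfolding conv_def by (subst Bochner_Integration.integral_diff; simp)
    also have "\<dots> = (LINT y|lebesgue. (\<rho> ((x - y) + h) - \<rho> (x - y) - (\<Sum>i\<in>UNIV. h $ i * partial_deriv i \<rho> (x - y))) * g y)"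
      by (rule Bochner_Integration.integral_cong) (auto simp: sum_distrib_right sum_distrib_left algebra_simps)
    finally have "\<bar>conv \<rho> g (x + h) - conv \<rho> g x - (\<Sum>i\<in>UNIV. h $ i * conv (partial_deriv i \<rho>) g x)\<bar>
      \<le> (LINT y|lebesgue. \<bar>(\<rho> ((x - y) + h) - \<rho> (x - y) - (\<Sum>i\<in>UNIV. h $ i * partial_deriv i \<rho> (x - y))) * g y\<bar>)"
      by (simp add: integral_abs_bound)
    also have "\<dots> \<le> (LINT y|lebesgue. ((real CARD('n) * L) * (norm h)\<^sup>2) * \<bar>g y\<bar>)"
    proof (rule integral_mono')
      show "integrable lebesgue (\<lambda>y. ((real CARD('n) * L) * (norm h)\<^sup>2) * \<bar>g y\<bar>)" using g by simp
    qed (use L(1) in \<open>auto simp: abs_mult intro!: mult_right_mono mult_nonneg_nonneg remainder\<close>)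
    also have "\<dots> = B * (norm h)\<^sup>2" by (simp add: B_def)
    finally show ?thesis .
  qed
  show ?thesis
    unfolding has_derivative_at_alt
  proof (intro conjI allI impI)
    show "bounded_linear (\<lambda>h. \<Sum>i\<in>UNIV. h $ i * conv (partial_deriv i \<rho>) g x)"
      by (intro bounded_linear_sum bounded_linear_mult_left[THEN bounded_linear_compose] bounded_linear_vec_nth)
    fix e :: real assume e: "e > 0"
    define d where "d = e / (B + 1)"
    have d: "d > 0" using e B0 by (simp add: d_def)
    show "\<exists>d>0. \<forall>y. norm (y - x) < d \<longrightarrow> norm (conv \<rho> g y - conv \<rho> g x - (\<Sum>i\<in>UNIV. (y - x) $ i * conv (partial_deriv i \<rho>) g x)) \<le> e * norm (y - x)"
    proof (intro exI[of _ d] conjI d allI impI)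
      fix y assume y: "norm (y - x) < d"
      have "norm (conv \<rho> g y - conv \<rho> g x - (\<Sum>i\<in>UNIV. (y - x) $ i * conv (partial_deriv i \<rho>) g x)) \<le> B * (norm (y - x))\<^sup>2"
        using bound[of "y - x"] by simp
      also have "\<dots> = (B * norm (y - x)) * norm (y - x)" by (simp add: power2_eq_square)
      also have "\<dots> \<le> e * norm (y - x)"
      proof (intro mult_right_mono norm_ge_zero)
        have "B * norm (y - x) \<le> (B + 1) * d" using y B0 by (intro mult_mono) auto
        also have "\<dots> = e" using B0 by (simp add: d_def)
        finally show "B * norm (y - x) \<le> e" .
      qed
      finally show "norm (conv \<rho> g y - conv \<rho> g x - (\<Sum>i\<in>UNIV. (y - x) $ i * conv (partial_deriv i \<rho>) g x)) \<le> e * norm (y - x)" .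
    qed
  qed
qed

lemma partial_deriv_conv:
  assumes "\<rho> \<in> test_functions UNIV" "integrable lebesgue g"
  shows "partial_deriv i (conv \<rho> g) = conv (partial_deriv i \<rho>) g"
proof
  fix x
  have "(\<Sum>k\<in>UNIV. axis i 1 $ k * conv (partial_deriv k \<rho>) g x) = conv (partial_deriv i \<rho>) g x"
    by (subst sum.remove[of _ i]) (auto simp: axis_def intro!: sum.neutral)
  then show "partial_deriv i (conv \<rho> g) x = conv (partial_deriv i \<rho>) g x"
    using partial_deriv_eq[OF conv_has_derivative[OF assms]] by simp
qed

text \<open>Every partial derivative falls on the kernel, which remains a test function, so the
  convolutions with a fixed \<open>g\<close> form a class stable under differentiation.\<close>

lemma smooth_conv:
  assumes "\<rho> \<in> test_functions UNIV" "integrable lebesgue g"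
  shows "smooth (conv \<rho> g)"
proof (rule smooth_coinduct[of _ "{conv \<rho> g | \<rho>. \<rho> \<in> test_functions UNIV}"])
  show "conv \<rho> g \<in> {conv \<rho> g | \<rho>. \<rho> \<in> test_functions UNIV}" using assms by blast
  fix \<phi> :: "real^'a \<Rightarrow> real" and x i
  assume "\<phi> \<in> {conv \<rho> g | \<rho>. \<rho> \<in> test_functions UNIV}"
  then obtain \<rho>' where r: "\<phi> = conv \<rho>' g" "\<rho>' \<in> test_functions UNIV" by blast
  then show "\<phi> differentiable (at x)" using conv_has_derivative[OF r(2) assms(2)] by (auto intro: differentiableI)
  show "partial_deriv i \<phi> \<in> {conv \<rho> g | \<rho>. \<rho> \<in> test_functions UNIV}"
    unfolding r(1) partial_deriv_conv[OF r(2) assms(2)] using test_partial[OF r(2)] by blast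
qed

text \<open>Jensen's inequality for the probability density y \<mapsto> \<rho>(x - y), followed by
  Tonelli. A Borel representative of \<open>g\<close> makes the integrand measurable on the product
  space.\<close>

lemma conv_contraction:
  fixes g :: "real^'n \<Rightarrow> real"
  assumes \<rho>: "\<rho> \<in> test_functions UNIV" "\<And>x. 0 \<le> \<rho> x" "\<And>x. \<rho> (- x) = \<rho> x" "(LINT x|lebesgue. \<rho> x) = 1"
    and g: "g \<in> sq_int" "integrable lebesgue g"
  shows "conv \<rho> g \<in> sq_int" "norm (l2_of (conv \<rho> g)) \<le> norm (l2_of g)"
proof -
  have [measurable]: "\<rho> \<in> borel_measurable borel" using \<rho>(1) by (intro smooth_borel test_smooth)
  obtain g' where g' [measurable]: "g' \<in> borel_measurable lborel" and ae: "AE x in lborel. g x = g' x"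
    using completion_ex_borel_measurable_real[of g lborel] g by auto
  have ae: "AE x in lebesgue. g x = g' x" using ae by (rule AE_completion)
  have g'm: "g' \<in> borel_measurable lebesgue" using g' by (rule measurable_completion)
  have sq': "g' \<in> sq_int" using g(1) g'm ae
    by (intro sq_int_dominated[OF g'm g(1)]) (auto elim!: eventually_mono)
  have int': "integrable lebesgue g'" using g(2) g'm ae by (subst integrable_cong_AE[of _ _ g]) (auto elim: eventually_mono)
  have sym: "\<rho> (x - y) = \<rho> (- x + y)" for x y using \<rho>(3)[of "x - y"] by simp
  have one: "(LINT y|lebesgue. \<rho> (x - y)) = 1" for x
    unfolding sym using integral_lebesgue_translation[of \<rho> "- x"] \<rho>(4) by simp
  have one': "(LINT x|lebesgue. \<rho> (x - y)) = 1" for y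
    using integral_lebesgue_translation[of \<rho> "- y"] \<rho>(4) by (simp add: add.commute)
  have conv_eq: "conv \<rho> g x = conv \<rho> g' x" for x
    unfolding conv_def
  proof (rule integral_cong_AE)
    show "AE y in lebesgue. \<rho> (x - y) * g y = \<rho> (x - y) * g' y" using ae by eventually_elim simp
  qed (use borel_measurable_integrable[OF integrable_test_mult[OF \<rho>(1) g(2)]] borel_measurable_integrable[OF integrable_test_mult[OF \<rho>(1) int']] in auto)
  have int_sq: "integrable lebesgue (\<lambda>y. \<rho> (x - y) * (g' y)\<^sup>2)" for x
    using sq' by (intro integrable_test_mult[OF \<rho>(1)]) (simp add: sq_int_def)
  have jensen: "(conv \<rho> g x)\<^sup>2 \<le> (LINT y|lebesgue. \<rho> (x - y) * (g' y)\<^sup>2)" for x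
  proof -
    let ?c = "conv \<rho> g' x"
    have i: "integrable lebesgue (\<lambda>y. \<rho> (x - y))" by (rule test_integrable[OF test_reflect[OF \<rho>(1)]])
    \<comment> \<open>Nonnegativity of the variance of \<open>g'\<close> under this density is
      Jensen's inequality for the square.\<close>
    have "0 \<le> (LINT y|lebesgue. \<rho> (x - y) * (g' y - ?c)\<^sup>2)" using \<rho>(2) by (intro integral_nonneg_AE) auto
    also have "\<dots> = (LINT y|lebesgue. \<rho> (x - y) * (g' y)\<^sup>2 - (2 * ?c) * (\<rho> (x - y) * g' y) + ?c\<^sup>2 * \<rho> (x - y))"
      by (rule Bochner_Integration.integral_cong) (auto simp: power2_eq_square algebra_simps)
    also have "\<dots> = (LINT y|lebesgue. \<rho> (x - y) * (g' y)\<^sup>2) - (2 * ?c) * ?c + ?c\<^sup>2"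
      using int_sq[of x] integrable_test_mult[OF \<rho>(1) int', of x] i one[of x] by (simp add: conv_def[symmetric])
    finally show ?thesis unfolding conv_eq by (simp add: power2_eq_square)
  qed
  have "(\<integral>\<^sup>+x. ennreal ((conv \<rho> g x)\<^sup>2) \<partial>lebesgue) = (\<integral>\<^sup>+x. ennreal ((conv \<rho> g x)\<^sup>2) \<partial>lborel)" by (rule nn_integral_completion)
  also have "\<dots> \<le> (\<integral>\<^sup>+x. (\<integral>\<^sup>+y. ennreal (\<rho> (x - y) * (g' y)\<^sup>2) \<partial>lborel) \<partial>lborel)"
  proof (rule nn_integral_mono)
    fix x
    have "ennreal ((conv \<rho> g x)\<^sup>2) \<le> ennreal (LINT y|lebesgue. \<rho> (x - y) * (g' y)\<^sup>2)" by (intro ennreal_leI jensen)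
    also have "\<dots> = (\<integral>\<^sup>+y. ennreal (\<rho> (x - y) * (g' y)\<^sup>2) \<partial>lebesgue)"
      using int_sq \<rho>(2) by (intro nn_integral_eq_integral[symmetric]) auto
    finally show "ennreal ((conv \<rho> g x)\<^sup>2) \<le> (\<integral>\<^sup>+y. ennreal (\<rho> (x - y) * (g' y)\<^sup>2) \<partial>lborel)" by (simp add: nn_integral_completion)
  qed
  also have "\<dots> = (\<integral>\<^sup>+y. (\<integral>\<^sup>+x. ennreal (\<rho> (x - y) * (g' y)\<^sup>2) \<partial>lborel) \<partial>lborel)"
    by (rule lborel_pair.Fubini'[symmetric]) measurable
  also have "\<dots> = (\<integral>\<^sup>+y. ennreal ((g' y)\<^sup>2) \<partial>lborel)"
  proof (rule nn_integral_cong)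
    fix y
    have "integrable lebesgue (\<lambda>x. \<rho> (x - y))"
      using test_integrable[OF test_reflect[OF \<rho>(1), of y]] \<rho>(3) by (metis (no_types, lifting) Bochner_Integration.integrable_cong minus_diff_eq)
    then have "(\<integral>\<^sup>+x. ennreal (\<rho> (x - y)) \<partial>lebesgue) = ennreal 1"
      using nn_integral_eq_integral[of lebesgue "\<lambda>x. \<rho> (x - y)"] \<rho>(2) one'[of y] by simp
    moreover have "(\<integral>\<^sup>+x. ennreal (\<rho> (x - y) * (g' y)\<^sup>2) \<partial>lborel) = (\<integral>\<^sup>+x. ennreal (\<rho> (x - y)) \<partial>lborel) * ennreal ((g' y)\<^sup>2)"
      using \<rho>(2) by (simp add: ennreal_mult nn_integral_multc)
    ultimately show "(\<integral>\<^sup>+x. ennreal (\<rho> (x - y) * (g' y)\<^sup>2) \<partial>lborel) = ennreal ((g' y)\<^sup>2)" by (simp add: nn_integral_completion)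
  qed
  also have "\<dots> = (\<integral>\<^sup>+y. ennreal ((g y)\<^sup>2) \<partial>lebesgue)"
  proof -
    have "(\<integral>\<^sup>+y. ennreal ((g y)\<^sup>2) \<partial>lebesgue) = (\<integral>\<^sup>+y. ennreal ((g' y)\<^sup>2) \<partial>lebesgue)"
      by (rule nn_integral_cong_AE) (use ae in eventually_elim, simp)
    then show ?thesis by (simp add: nn_integral_completion)
  qed
  also have "\<dots> = ennreal ((norm (l2_of g))\<^sup>2)" by (rule sq_int_nn_integral[OF g(1)])
  finally have le: "(\<integral>\<^sup>+x. ennreal ((conv \<rho> g x)\<^sup>2) \<partial>lebesgue) \<le> ennreal ((norm (l2_of g))\<^sup>2)" .
  show sq: "conv \<rho> g \<in> sq_int"
    using le smooth_lebesgue[OF smooth_conv[OF \<rho>(1) g(2)]] by (intro sq_intI_nn_integral) (auto intro: le_less_trans)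
  show "norm (l2_of (conv \<rho> g)) \<le> norm (l2_of g)" using le by (simp add: sq_int_nn_integral[OF sq] power2_le_iff_abs_le)
qed

text \<open>The standard bump exp(-1/(\<epsilon>^2 - |x|^2)), normalised separately for each
  \<epsilon>. The squared norm is written in coordinates so that the closure rules for smoothness
  apply.\<close>

definition mollifier :: "real \<Rightarrow> real^'n \<Rightarrow> real" where
  "mollifier \<epsilon> x = flat 0 (\<epsilon>\<^sup>2 - (\<Sum>i\<in>UNIV. (x $ i)\<^sup>2)) / (LINT x|lebesgue. flat 0 (\<epsilon>\<^sup>2 - (\<Sum>i\<in>UNIV. ((x::real^'n) $ i)\<^sup>2)))"

lemma mollifier_properties:
  fixes x :: "real^'n"
  assumes \<epsilon>: "\<epsilon> > 0"
  shows "(mollifier \<epsilon> :: real^'n \<Rightarrow> real) \<in> test_functions UNIV" "0 \<le> mollifier \<epsilon> x" "mollifier \<epsilon> (- x) = mollifier \<epsilon> x"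
    "(LINT x|lebesgue. mollifier \<epsilon> (x::real^'n)) = 1" "norm x > \<epsilon> \<Longrightarrow> mollifier \<epsilon> x = 0"
proof -
  have norm_sq: "(\<Sum>i\<in>UNIV. (x $ i)\<^sup>2) = (norm x)\<^sup>2" for x :: "real^'n"
    unfolding power2_norm_eq_inner by (simp add: inner_vec_def power2_eq_square)
  define b where "b x = flat 0 (\<epsilon>\<^sup>2 - (\<Sum>i\<in>UNIV. (x $ i)\<^sup>2))" for x :: "real^'n"
  have b0: "b x = 0" if "norm x > \<epsilon>" for x
    using that \<epsilon> power_mono[of \<epsilon> "norm x" 2] unfolding b_def norm_sq by (intro flat_le_0) auto
  have "smooth b" unfolding b_def by (intro smooth_intros)
  then have bt: "b \<in> test_functions UNIV" unfolding test_functions_iff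
    by (intro conjI exI[of _ "cball 0 \<epsilon>"]) (auto simp: b0)
  have bn: "b x \<ge> 0" for x by (simp add: b_def flat_nonneg)
  have "(LINT x|lebesgue. b x) \<noteq> 0"
  proof
    assume "(LINT x|lebesgue. b x) = 0"
    then have "AE x in lebesgue. b x = 0" using integral_nonneg_eq_0_iff_AE[OF test_integrable[OF bt]] bn by auto
    then have "AE x in lebesgue. x \<notin> ball (0::real^'n) \<epsilon>"
    proof eventually_elim
      case (elim x)
      then show ?case using flat_pos[of "\<epsilon>\<^sup>2 - (norm x)\<^sup>2" 0] \<epsilon> unfolding b_def norm_sq by (auto simp: abs_square_less_1 power_strict_mono)
    qed
    then have "negligible (ball (0::real^'n) \<epsilon>)" unfolding negligible_iff_null_sets by (simp add: AE_iff_null_sets Compl_eq[symmetric])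
    then show False using open_not_negligible[of "ball (0::real^'n) \<epsilon>"] \<epsilon> by simp
  qed
  moreover have "(LINT x|lebesgue. b x) \<ge> 0" using bn by simp
  ultimately have I: "(LINT x|lebesgue. b x) > 0" by simp
  have m: "mollifier \<epsilon> = (\<lambda>x. inverse (LINT x|lebesgue. b x) * b x)"
    by (simp add: fun_eq_iff mollifier_def b_def divide_inverse)
  show "(mollifier \<epsilon> :: real^'n \<Rightarrow> real) \<in> test_functions UNIV" unfolding m by (rule test_cmult[OF bt])
  show "0 \<le> mollifier \<epsilon> x" unfolding m using I bn by simp
  show "mollifier \<epsilon> (- x) = mollifier \<epsilon> x" unfolding m by (simp add: b_def)
  show "(LINT x|lebesgue. mollifier \<epsilon> (x::real^'n)) = 1" unfolding m using I by simp
  show "norm x > \<epsilon> \<Longrightarrow> mollifier \<epsilon> x = 0" unfolding m by (simp add: b0)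
qed

text \<open>The Lipschitz bound makes the error at most \<open>L * \<epsilon> n\<close> everywhere,
  and the error vanishes outside a ball independent of \<open>n\<close>, so uniform convergence
  gives convergence in L^2.\<close>

lemma conv_mollifier_test_tendsto:
  fixes \<phi> :: "real^'n \<Rightarrow> real"
  assumes \<phi>: "\<phi> \<in> test_functions \<Omega>" and \<epsilon>: "\<And>n. \<epsilon> n > 0" "\<epsilon> \<longlonglongrightarrow> 0"
  shows "(\<lambda>n. l2_of (conv (mollifier (\<epsilon> n)) \<phi>)) \<longlonglongrightarrow> l2_of \<phi>"
proof -
  note mol = mollifier_properties[where 'n = 'n, OF \<epsilon>(1)]
  have sm: "smooth \<phi>" using \<phi> by (rule test_smooth)
  have int: "integrable lebesgue \<phi>" and sq: "\<phi> \<in> sq_int" using \<phi> by (auto intro: test_integrable test_sq_int)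
  obtain L where L: "L > 0" "\<And>x y. \<bar>\<phi> x - \<phi> y\<bar> \<le> L * norm (x - y)" using test_lipschitz[OF \<phi>] by metis
  obtain K where K: "compact K" "\<And>x. x \<notin> K \<Longrightarrow> \<phi> x = 0" using \<phi> by (auto simp: test_functions_iff)
  obtain R where R: "\<And>x. x \<in> K \<Longrightarrow> norm x \<le> R" using K(1) compact_imp_bounded bounded_iff by metis
  obtain E where E: "\<And>n. \<epsilon> n \<le> E" using convergent_imp_Bseq[OF convergentI[OF \<epsilon>(2)]] unfolding Bseq_def
    by (metis abs_ge_self order_trans real_norm_def)
  define I :: "real^'n \<Rightarrow> real" where "I x = indicator (cball 0 (R + E)) x" for x
  have Isq: "I \<in> sq_int"
  proof -
    have "integrable lebesgue (indicator (cball (0::real^'n) (R + E)) :: _ \<Rightarrow> real)"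
      using lmeasurable_compact[OF compact_cball] by (intro integrable_real_indicator) (auto simp: fmeasurable_def)
    moreover have "(I x)\<^sup>2 = I x" for x :: "real^'n" by (auto simp: I_def indicator_def)
    ultimately show ?thesis unfolding sq_int_def by (simp add: I_def[abs_def])
  qed
  have est: "\<bar>conv (mollifier (\<epsilon> n)) \<phi> x - \<phi> x\<bar> \<le> L * \<epsilon> n" for n x
  proof -
    have mi: "integrable lebesgue (\<lambda>y. mollifier (\<epsilon> n) (x - y))" by (rule test_integrable[OF test_reflect[OF mol(1)]])
    have sym: "mollifier (\<epsilon> n) (x - y) = mollifier (\<epsilon> n) (- x + y)" for y using mol(3)[of n "x - y"] by simp
    have one: "(LINT y|lebesgue. mollifier (\<epsilon> n) (x - y)) = 1"
      unfolding sym using integral_lebesgue_translation[of "mollifier (\<epsilon> n)" "- x"] mol(4)[of n]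
        smooth_borel[OF test_smooth[OF mol(1)], of n] by simp
    have i1: "integrable lebesgue (\<lambda>y. mollifier (\<epsilon> n) (x - y) * \<phi> y)" by (rule integrable_test_mult[OF mol(1) int])
    have "conv (mollifier (\<epsilon> n)) \<phi> x - \<phi> x = (LINT y|lebesgue. mollifier (\<epsilon> n) (x - y) * (\<phi> y - \<phi> x))"
      unfolding conv_def right_diff_distrib using one i1 mi by simp
    also have "\<bar>\<dots>\<bar> \<le> (LINT y|lebesgue. \<bar>mollifier (\<epsilon> n) (x - y) * (\<phi> y - \<phi> x)\<bar>)" by (rule integral_abs_bound)
    also have "\<dots> \<le> (LINT y|lebesgue. mollifier (\<epsilon> n) (x - y) * (L * \<epsilon> n))"
    proof (rule integral_mono')
      show "integrable lebesgue (\<lambda>y. mollifier (\<epsilon> n) (x - y) * (L * \<epsilon> n))" using mi by simp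
      fix y
      show "\<bar>mollifier (\<epsilon> n) (x - y) * (\<phi> y - \<phi> x)\<bar> \<le> mollifier (\<epsilon> n) (x - y) * (L * \<epsilon> n)"
      proof (cases "norm (x - y) > \<epsilon> n")
        case True then show ?thesis using mol(5) by simp
      next
        case False
        then have "\<bar>\<phi> y - \<phi> x\<bar> \<le> L * \<epsilon> n" using L(2)[of y x] L(1) by (simp add: norm_minus_commute) (meson mult_left_mono less_imp_le linorder_not_le order_trans)
        then show ?thesis using mol(2) by (simp add: abs_mult mult_left_mono)
      qed
    qed (use mol(2) L \<epsilon>(1)[of n] in auto)
    also have "\<dots> = L * \<epsilon> n" using one by simp
    finally show ?thesis .
  qed
  have zero: "conv (mollifier (\<epsilon> n)) \<phi> x - \<phi> x = 0" if x: "x \<notin> cball 0 (R + E)" for n x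
  proof -
    have Z: "mollifier (\<epsilon> n) (x - y) * \<phi> y = 0" for y
    proof (cases "y \<in> K")
      case True
      have "norm x \<le> norm (x - y) + norm y" using norm_triangle_ineq[of "x - y" y] by simp
      then have "norm (x - y) > \<epsilon> n" using R[OF True] E[of n] x by simp
      then show ?thesis using mol(5) by simp
    qed (simp add: K(2))
    have "x \<notin> K" using R[of x] E[of 0] \<epsilon>(1)[of 0] x by auto
    then show ?thesis unfolding conv_def Z by (simp add: K(2))
  qed
  have csq: "conv (mollifier (\<epsilon> n)) \<phi> \<in> sq_int" for n by (rule conv_contraction(1)[OF mol(1-4) sq int])
  have A: "norm (l2_of (conv (mollifier (\<epsilon> n)) \<phi>) - l2_of \<phi>) \<le> (L * \<epsilon> n) * norm (l2_of I)" for n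
  proof -
    have "norm (l2_of (\<lambda>x. conv (mollifier (\<epsilon> n)) \<phi> x - \<phi> x)) \<le> norm (l2_of (\<lambda>x. (L * \<epsilon> n) * I x))"
      using est[of n] zero[of _ n] L \<epsilon>(1)[of n]
      by (intro l2_norm_mono sq_int_diff csq sq sq_int_scale Isq AE_I2) (auto simp: I_def indicator_def)
    then show ?thesis using csq sq Isq L \<epsilon>(1)[of n] by (simp add: l2_of_diff l2_of_scale)
  qed
  have "(\<lambda>n. (L * \<epsilon> n) * norm (l2_of I)) \<longlonglongrightarrow> (L * 0) * norm (l2_of I)" by (intro tendsto_intros \<epsilon>)
  then have "(\<lambda>n. (L * \<epsilon> n) * norm (l2_of I)) \<longlonglongrightarrow> 0" by simp
  then have "(\<lambda>n. l2_of (conv (mollifier (\<epsilon> n)) \<phi>) - l2_of \<phi>) \<longlonglongrightarrow> 0" by (rule LIMSEQ_norm_0[OF A])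
  then show ?thesis by (rule LIM_zero_cancel)
qed

lemma conv_diff:
  assumes "\<rho> \<in> test_functions UNIV" "f \<in> sq_int" "g \<in> sq_int"
  shows "conv \<rho> (\<lambda>x. f x - g x) x = conv \<rho> f x - conv \<rho> g x"
  using assms by (simp add: conv_l2 sq_int_diff l2_of_diff inner_diff_right)

text \<open>Mollification is a contraction, so convergence carries over from test functions to their
  L^2 closure by splitting the error into three parts.\<close>

lemma conv_mollifier_tendsto:
  fixes z :: "real^'n \<Rightarrow> real"
  assumes z: "z \<in> sq_int" "integrable lebesgue z" "l2_of z \<in> closure (l2_of ` test_functions \<Omega>)"
    and \<epsilon>: "\<And>n. \<epsilon> n > 0" "\<epsilon> \<longlonglongrightarrow> 0"
  shows "(\<lambda>n. l2_of (conv (mollifier (\<epsilon> n)) z)) \<longlonglongrightarrow> l2_of z"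
proof (rule metric_LIMSEQ_I)
  note mol = mollifier_properties[where 'n = 'n, OF \<epsilon>(1)]
  fix r :: real assume r: "r > 0"
  then have "r / 3 > 0" by simp
  with z(3) obtain \<phi> where \<phi>: "\<phi> \<in> test_functions \<Omega>" "dist (l2_of \<phi>) (l2_of z) < r / 3"
    unfolding closure_approachable by blast
  have int: "integrable lebesgue \<phi>" and sq: "\<phi> \<in> sq_int" using \<phi> by (auto intro: test_integrable test_sq_int)
  obtain N where N: "\<And>n. n \<ge> N \<Longrightarrow> dist (l2_of (conv (mollifier (\<epsilon> n)) \<phi>)) (l2_of \<phi>) < r / 3"
    using metric_LIMSEQ_D[OF conv_mollifier_test_tendsto[OF \<phi>(1) \<epsilon>] \<open>r / 3 > 0\<close>] by blast
  have "dist (l2_of (conv (mollifier (\<epsilon> n)) z)) (l2_of z) < r" if "n \<ge> N" for n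
  proof -
    have c: "conv (mollifier (\<epsilon> n)) z \<in> sq_int" "conv (mollifier (\<epsilon> n)) \<phi> \<in> sq_int"
      by (intro conv_contraction(1)[OF mol(1-4)] z sq int)+
    have "conv (mollifier (\<epsilon> n)) (\<lambda>x. z x - \<phi> x) = (\<lambda>x. conv (mollifier (\<epsilon> n)) z x - conv (mollifier (\<epsilon> n)) \<phi> x)"
      using conv_diff[OF mol(1) z(1) sq] by blast
    then have "norm (l2_of (conv (mollifier (\<epsilon> n)) z) - l2_of (conv (mollifier (\<epsilon> n)) \<phi>)) \<le> norm (l2_of z - l2_of \<phi>)"
      using conv_contraction(2)[OF mol(1-4)[of n] sq_int_diff[OF z(1) sq]] z(2) int c
      by (simp add: l2_of_diff z sq)
    then have "dist (l2_of (conv (mollifier (\<epsilon> n)) z)) (l2_of (conv (mollifier (\<epsilon> n)) \<phi>)) \<le> dist (l2_of \<phi>) (l2_of z)"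
      by (simp add: dist_norm norm_minus_commute)
    then show ?thesis using N[OF that] \<phi>(2)
      dist_triangle_third[of "l2_of (conv (mollifier (\<epsilon> n)) z)" "l2_of (conv (mollifier (\<epsilon> n)) \<phi>)" r "l2_of \<phi>" "l2_of z"] by simp
  qed
  then show "\<exists>no. \<forall>n\<ge>no. dist (l2_of (conv (mollifier (\<epsilon> n)) z)) (l2_of z) < r" by blast
qed

section \<open>The weak Poisson equation\<close>

definition grad_l2 :: "(real^'n \<Rightarrow> real) \<Rightarrow> (real^'n) l2 ^ 'n" where
  "grad_l2 \<phi> = (\<chi> i. l2_of (partial_deriv i \<phi>))"

text \<open>The space H^1_0 as a closed set of pairs (function, gradient). The gradient is part of
  the data, so limits can be taken in the product Hilbert space before any weak derivative is
  mentioned.\<close>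

definition H10 :: "(real^'n) set \<Rightarrow> ((real^'n) l2 \<times> ((real^'n) l2 ^ 'n)) set" where
  "H10 \<Omega> = closure ((\<lambda>\<phi>. (l2_of \<phi>, grad_l2 \<phi>)) ` test_functions \<Omega>)"

lemma l2_of_test_add:
  "\<phi> \<in> test_functions \<Omega> \<Longrightarrow> \<psi> \<in> test_functions \<Omega>' \<Longrightarrow> l2_of (\<lambda>x. \<phi> x + \<psi> x) = l2_of \<phi> + l2_of \<psi>"
  by (intro l2_of_add test_sq_int)

lemma l2_of_test_scale: "\<phi> \<in> test_functions \<Omega> \<Longrightarrow> l2_of (\<lambda>x. c * \<phi> x) = c *\<^sub>R l2_of \<phi>"
  by (intro l2_of_scale test_sq_int)

lemma grad_l2_add:
  assumes "\<phi> \<in> test_functions \<Omega>" "\<psi> \<in> test_functions \<Omega>'"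
  shows "grad_l2 (\<lambda>x. \<phi> x + \<psi> x) = grad_l2 \<phi> + grad_l2 \<psi>"
proof -
  have "partial_deriv i (\<lambda>x. \<phi> x + \<psi> x) = (\<lambda>x. partial_deriv i \<phi> x + partial_deriv i \<psi> x)" for i
    using assms by (intro ext partial_deriv_add smooth_differentiable test_smooth)
  then show ?thesis
    by (simp add: grad_l2_def vec_eq_iff l2_of_test_add[OF test_partial[OF assms(1)] test_partial[OF assms(2)]])
qed

lemma grad_l2_scale:
  assumes "\<phi> \<in> test_functions \<Omega>"
  shows "grad_l2 (\<lambda>x. c * \<phi> x) = c *\<^sub>R grad_l2 \<phi>"
proof -
  have "partial_deriv i (\<lambda>x. c * \<phi> x) = (\<lambda>x. c * partial_deriv i \<phi> x)" for i
    using assms by (intro ext partial_deriv_cmult test_smooth)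
  then show ?thesis
    by (simp add: grad_l2_def vec_eq_iff l2_of_test_scale[OF test_partial[OF assms]])
qed

lemma subspace_image_test:
  fixes T :: "(real^'n \<Rightarrow> real) \<Rightarrow> 'v::real_vector"
  assumes "\<And>\<phi> \<psi>. \<phi> \<in> test_functions \<Omega> \<Longrightarrow> \<psi> \<in> test_functions \<Omega> \<Longrightarrow> T (\<lambda>x. \<phi> x + \<psi> x) = T \<phi> + T \<psi>"
    and "\<And>c \<phi>. \<phi> \<in> test_functions \<Omega> \<Longrightarrow> T (\<lambda>x. c * \<phi> x) = c *\<^sub>R T \<phi>"
  shows "subspace (T ` test_functions \<Omega>)"
proof (rule subspaceI)
  have "T (\<lambda>x. 0) = 0" using assms(2)[OF test_zero, of 0] by simp
  then show "0 \<in> T ` test_functions \<Omega>" using test_zero by (metis image_eqI)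
next
  fix a b assume "a \<in> T ` test_functions \<Omega>" "b \<in> T ` test_functions \<Omega>"
  then obtain \<phi> \<psi> where "a = T \<phi>" "\<phi> \<in> test_functions \<Omega>" "b = T \<psi>" "\<psi> \<in> test_functions \<Omega>" by blast
  then show "a + b \<in> T ` test_functions \<Omega>"
    by (intro image_eqI[of _ _ "\<lambda>x. \<phi> x + \<psi> x"]) (simp_all add: assms(1) test_add)
next
  fix a c assume "a \<in> T ` test_functions \<Omega>"
  then obtain \<phi> where "a = T \<phi>" "\<phi> \<in> test_functions \<Omega>" by blast
  then show "c *\<^sub>R a \<in> T ` test_functions \<Omega>"
    by (intro image_eqI[of _ _ "\<lambda>x. c * \<phi> x"]) (simp_all add: assms(2) test_cmult)
qed

lemma H10_seq:
  "(w, z) \<in> H10 \<Omega> \<longleftrightarrow> (\<exists>\<phi>. (\<forall>k. \<phi> k \<in> test_functions \<Omega>) \<and> (\<lambda>k. l2_of (\<phi> k)) \<longlonglongrightarrow> w \<and> (\<lambda>k. grad_l2 (\<phi> k)) \<longlonglongrightarrow> z)"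
proof
  assume "(w, z) \<in> H10 \<Omega>"
  then obtain p where p: "\<And>k. p k \<in> (\<lambda>\<phi>. (l2_of \<phi>, grad_l2 \<phi>)) ` test_functions \<Omega>" "p \<longlonglongrightarrow> (w, z)"
    unfolding H10_def closure_sequential by blast
  have "\<forall>k. \<exists>\<phi>. \<phi> \<in> test_functions \<Omega> \<and> p k = (l2_of \<phi>, grad_l2 \<phi>)" using p(1) by blast
  then obtain \<phi> where \<phi>: "\<And>k. \<phi> k \<in> test_functions \<Omega>" "\<And>k. p k = (l2_of (\<phi> k), grad_l2 (\<phi> k))" by metis
  have "p = (\<lambda>k. (l2_of (\<phi> k), grad_l2 (\<phi> k)))" using \<phi>(2) by blast
  then have "(\<lambda>k. (l2_of (\<phi> k), grad_l2 (\<phi> k))) \<longlonglongrightarrow> (w, z)" using p(2) by simp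
  then have "(\<lambda>k. l2_of (\<phi> k)) \<longlonglongrightarrow> w" "(\<lambda>k. grad_l2 (\<phi> k)) \<longlonglongrightarrow> z" by (auto dest: tendsto_fst tendsto_snd)
  then show "\<exists>\<phi>. (\<forall>k. \<phi> k \<in> test_functions \<Omega>) \<and> (\<lambda>k. l2_of (\<phi> k)) \<longlonglongrightarrow> w \<and> (\<lambda>k. grad_l2 (\<phi> k)) \<longlonglongrightarrow> z"
    using \<phi>(1) by blast
next
  assume "\<exists>\<phi>. (\<forall>k. \<phi> k \<in> test_functions \<Omega>) \<and> (\<lambda>k. l2_of (\<phi> k)) \<longlonglongrightarrow> w \<and> (\<lambda>k. grad_l2 (\<phi> k)) \<longlonglongrightarrow> z"
  then obtain \<phi> where \<phi>: "\<And>k. \<phi> k \<in> test_functions \<Omega>" "(\<lambda>k. l2_of (\<phi> k)) \<longlonglongrightarrow> w" "(\<lambda>k. grad_l2 (\<phi> k)) \<longlonglongrightarrow> z" by blast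
  then have "(\<lambda>k. (l2_of (\<phi> k), grad_l2 (\<phi> k))) \<longlonglongrightarrow> (w, z)" by (intro tendsto_Pair)
  then show "(w, z) \<in> H10 \<Omega>" unfolding H10_def closure_sequential
    using \<phi>(1) by (intro exI[of _ "\<lambda>k. (l2_of (\<phi> k), grad_l2 (\<phi> k))"]) simp
qed

lemma subspace_closure:
  fixes S :: "'v::real_normed_vector set"
  assumes S: "subspace S" shows "subspace (closure S)"
proof (rule subspaceI)
  show "0 \<in> closure S" using subspace_0[OF S] closure_subset[of S] by blast
next
  fix a b assume "a \<in> closure S" "b \<in> closure S"
  then obtain x y where "\<And>k. x k \<in> S" "x \<longlonglongrightarrow> a" "\<And>k. y k \<in> S" "y \<longlonglongrightarrow> b" unfolding closure_sequential by blast
  then have "\<And>k. x k + y k \<in> S" "(\<lambda>k. x k + y k) \<longlonglongrightarrow> a + b" using S by (auto intro: subspace_add tendsto_add)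
  then show "a + b \<in> closure S" unfolding closure_sequential by (intro exI[of _ "\<lambda>k. x k + y k"]) simp
next
  fix c a assume "a \<in> closure S"
  then obtain x where "\<And>k. x k \<in> S" "x \<longlonglongrightarrow> a" unfolding closure_sequential by blast
  then have "\<And>k. c *\<^sub>R x k \<in> S" "(\<lambda>k. c *\<^sub>R x k) \<longlonglongrightarrow> c *\<^sub>R a" using S by (auto intro: subspace_scale tendsto_scaleR)
  then show "c *\<^sub>R a \<in> closure S" unfolding closure_sequential by (intro exI[of _ "\<lambda>k. c *\<^sub>R x k"]) simp
qed

lemma subspace_H10: "subspace (H10 \<Omega>)"
  unfolding H10_def
  by (intro subspace_closure subspace_image_test) (auto simp: l2_of_test_add grad_l2_add l2_of_test_scale grad_l2_scale)

lemma H10_diff: "(w, z) \<in> H10 \<Omega> \<Longrightarrow> (w', z') \<in> H10 \<Omega> \<Longrightarrow> (w - w', z - z') \<in> H10 \<Omega>"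
  using subspace_diff[OF subspace_H10] by fastforce

lemma H10_test: "\<phi> \<in> test_functions \<Omega> \<Longrightarrow> (l2_of \<phi>, grad_l2 \<phi>) \<in> H10 \<Omega>"
  unfolding H10_def by (rule subsetD[OF closure_subset], rule image_eqI) auto

lemma H10_mono: "\<Omega> \<subseteq> \<Omega>' \<Longrightarrow> H10 \<Omega> \<subseteq> H10 \<Omega>'"
  unfolding H10_def using test_mono by (intro closure_mono image_mono) blast

lemma H10_closure: "(w, z) \<in> H10 \<Omega> \<Longrightarrow> w \<in> closure (l2_of ` test_functions \<Omega>)"
  "(w, z) \<in> H10 \<Omega> \<Longrightarrow> z \<in> closure (grad_l2 ` test_functions \<Omega>)"
  "(w, z) \<in> H10 \<Omega> \<Longrightarrow> z $ i \<in> closure (l2_of ` test_functions \<Omega>)"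
proof -
  assume "(w, z) \<in> H10 \<Omega>"
  then obtain \<phi> where \<phi>: "\<And>k. \<phi> k \<in> test_functions \<Omega>" "(\<lambda>k. l2_of (\<phi> k)) \<longlonglongrightarrow> w" "(\<lambda>k. grad_l2 (\<phi> k)) \<longlonglongrightarrow> z" unfolding H10_seq by blast
  show "w \<in> closure (l2_of ` test_functions \<Omega>)"
    unfolding closure_sequential using \<phi> by (intro exI[of _ "\<lambda>k. l2_of (\<phi> k)"]) simp
  show "z \<in> closure (grad_l2 ` test_functions \<Omega>)"
    unfolding closure_sequential using \<phi> by (intro exI[of _ "\<lambda>k. grad_l2 (\<phi> k)"]) simp
  have "(\<lambda>k. grad_l2 (\<phi> k) $ i) \<longlonglongrightarrow> z $ i" using \<phi>(3) by (rule tendsto_vec_nth)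
  moreover have "grad_l2 (\<phi> k) $ i \<in> l2_of ` test_functions \<Omega>" for k using test_partial[OF \<phi>(1)] by (simp add: grad_l2_def)
  ultimately show "z $ i \<in> closure (l2_of ` test_functions \<Omega>)"
    unfolding closure_sequential by (intro exI[of _ "\<lambda>k. grad_l2 (\<phi> k) $ i"]) simp
qed

lemma H10_poincare:
  assumes "(w, z) \<in> H10 \<Omega>" "\<Omega> \<subseteq> cball 0 R" "0 \<le> R"
  shows "norm w \<le> 2 * R * norm z"
proof -
  obtain \<phi> where \<phi>: "\<And>k. \<phi> k \<in> test_functions \<Omega>" "(\<lambda>k. l2_of (\<phi> k)) \<longlonglongrightarrow> w" "(\<lambda>k. grad_l2 (\<phi> k)) \<longlonglongrightarrow> z"
    using assms(1) unfolding H10_seq by blast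
  have "norm (l2_of (\<phi> k)) \<le> 2 * R * norm (grad_l2 (\<phi> k))" for k
  proof -
    have "norm (l2_of (\<phi> k)) \<le> 2 * R * norm (l2_of (partial_deriv undefined (\<phi> k)))" by (rule poincare_inequality[OF \<phi>(1) assms(2)])
    also have "\<dots> \<le> 2 * R * norm (grad_l2 (\<phi> k))"
      using Finite_Cartesian_Product.norm_nth_le[of "grad_l2 (\<phi> k)" undefined] assms(3) by (intro mult_left_mono) (auto simp: grad_l2_def)
    finally show ?thesis .
  qed
  moreover have "(\<lambda>k. norm (l2_of (\<phi> k))) \<longlonglongrightarrow> norm w" "(\<lambda>k. 2 * R * norm (grad_l2 (\<phi> k))) \<longlonglongrightarrow> 2 * R * norm z"
    by (intro tendsto_intros \<phi>)+
  ultimately show ?thesis using LIMSEQ_le by blast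
qed

text \<open>The test function lives on the whole space and may be nonzero at the boundary: an
  element of H^1_0 extended by zero has the extended gradient as its weak gradient everywhere. The
  identity passes to the limit from test functions.\<close>

lemma H10_by_parts:
  assumes "(w, z) \<in> H10 \<Omega>" "\<phi> \<in> test_functions UNIV"
  shows "inner w (l2_of (partial_deriv i \<phi>)) = - inner (z $ i) (l2_of \<phi>)"
proof -
  obtain u where u: "\<And>k. u k \<in> test_functions \<Omega>" "(\<lambda>k. l2_of (u k)) \<longlonglongrightarrow> w" "(\<lambda>k. grad_l2 (u k)) \<longlonglongrightarrow> z"
    using assms(1) unfolding H10_seq by blast
  have "inner (l2_of (u k)) (l2_of (partial_deriv i \<phi>)) = - inner (grad_l2 (u k) $ i) (l2_of \<phi>)" for k
    using integral_by_parts[OF u(1)[of k] test_smooth[OF assms(2)], of i] test_sq_int[OF assms(2)] test_sq_int[OF u(1)]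
      test_sq_int[OF test_partial[OF assms(2)]] test_sq_int[OF test_partial[OF u(1)]]
    by (simp add: inner_l2_of grad_l2_def)
  moreover have "(\<lambda>k. inner (l2_of (u k)) (l2_of (partial_deriv i \<phi>))) \<longlonglongrightarrow> inner w (l2_of (partial_deriv i \<phi>))"
    by (intro tendsto_intros u)
  moreover have "(\<lambda>k. - inner (grad_l2 (u k) $ i) (l2_of \<phi>)) \<longlonglongrightarrow> - inner (z $ i) (l2_of \<phi>)"
    by (intro tendsto_intros u)
  ultimately show ?thesis using LIMSEQ_unique by simp
qed

text \<open>Multiplication by the indicator of the complement is continuous on L^2 and annihilates
  the test functions, hence also their closure.\<close>

lemma closure_test_vanishes:
  assumes w: "w \<in> closure (l2_of ` test_functions \<Omega>)" and \<Omega>: "\<Omega> \<in> sets lebesgue"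
  shows "AE x in lebesgue. x \<notin> \<Omega> \<longrightarrow> fun_of w x = 0"
proof -
  obtain v where v: "\<And>k. v k \<in> l2_of ` test_functions \<Omega>" "v \<longlonglongrightarrow> w" using w unfolding closure_sequential by blast
  have m: "(\<lambda>x. indicator (- \<Omega>) x) \<in> borel_measurable lebesgue" using \<Omega> by (auto intro!: borel_measurable_indicator)
  have b: "AE x in lebesgue. \<bar>indicator (- \<Omega>) x :: real\<bar> \<le> 1" by (simp add: indicator_def)
  define T where "T u = l2_of (\<lambda>x. indicator (- \<Omega>) x * fun_of u x)" for u
  have lim: "(\<lambda>k. T (v k)) \<longlonglongrightarrow> T w"
    unfolding T_def by (rule l2_tendsto_bounded_mult[OF fun_of_sq_int fun_of_sq_int _ m b]) (simp add: v)
  have "T (v k) = 0" for k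
  proof -
    obtain \<phi> where \<phi>: "\<phi> \<in> test_functions \<Omega>" "v k = l2_of \<phi>" using v(1) by blast
    have "AE x in lebesgue. indicator (- \<Omega>) x * fun_of (v k) x = 0"
      using fun_of_l2_of[OF test_sq_int[OF \<phi>(1)]] unfolding \<phi>(2)[symmetric]
      by eventually_elim (use test_outside[OF \<phi>(1)] in \<open>force simp: indicator_def\<close>)
    then show ?thesis unfolding T_def zero_l2_def
      by (subst l2_of_eq_iff) (auto intro: sq_int_bounded_mult[OF fun_of_sq_int m b] sq_int_0)
  qed
  then have "T w = 0" using lim by (simp add: LIMSEQ_const_iff)
  then have "AE x in lebesgue. indicator (- \<Omega>) x * fun_of w x = 0" unfolding T_def zero_l2_def
    by (subst (asm) l2_of_eq_iff) (auto intro: sq_int_bounded_mult[OF fun_of_sq_int m b] sq_int_0)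
  then show ?thesis by eventually_elim (auto simp: indicator_def)
qed

lemma sq_int_vanishing_integrable:
  assumes f: "f \<in> sq_int" and ae: "AE x in lebesgue. x \<notin> \<Omega> \<longrightarrow> f x = 0" and bd: "bounded \<Omega>"
  shows "integrable lebesgue f"
proof -
  obtain R where R: "\<Omega> \<subseteq> cball 0 R" using bounded_subset_ballD[OF bd, of 0] ball_subset_cball by (metis subset_trans)
  have "integrable lebesgue (indicator (cball (0::'a) R) :: _ \<Rightarrow> real)"
    using lmeasurable_compact[OF compact_cball] by (intro integrable_real_indicator) (auto simp: fmeasurable_def)
  then have I: "(indicator (cball (0::'a) R) :: _ \<Rightarrow> real) \<in> sq_int"
    unfolding sq_int_def by (simp add: power2_eq_square indicator_inter_arith[symmetric] borel_measurable_integrable)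
  have "integrable lebesgue (\<lambda>x. indicator (cball 0 R) x * f x)" by (rule sq_int_integrable_mult[OF I f])
  moreover have "AE x in lebesgue. indicator (cball 0 R) x * f x = f x" using ae by eventually_elim (use R in \<open>auto simp: indicator_def\<close>)
  ultimately show ?thesis
    using f I by (subst integrable_cong_AE[of f lebesgue "\<lambda>x. indicator (cball 0 R) x * f x"])
      (auto simp: sq_int_meas elim: eventually_mono)
qed

lemma inner_grad_l2: "inner z (grad_l2 \<phi>) = (\<Sum>i\<in>UNIV. inner (z $ i) (l2_of (partial_deriv i \<phi>)))"
  by (simp add: inner_vec_def grad_l2_def)

text \<open>The equation is - \<Delta>w = F with zero boundary values. Riesz is applied in the space
  of gradients to the relation pairing \<open>grad_l2 \<phi>\<close> with
  \<open>inner F (l2_of \<phi>)\<close>. The Poincare inequality makes this relation bounded, and it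
  also supplies \<open>w\<close>, since test functions with convergent gradients form a Cauchy
  sequence.\<close>

lemma weak_poisson_solution_exists:
  fixes F :: "(real^'n) l2"
  assumes bd: "bounded \<Omega>"
  obtains w z where "(w, z) \<in> H10 \<Omega>" "\<And>\<phi>. \<phi> \<in> test_functions \<Omega> \<Longrightarrow> inner z (grad_l2 \<phi>) = inner F (l2_of \<phi>)"
proof -
  obtain R where R: "\<Omega> \<subseteq> cball 0 R" "0 \<le> R"
    using bounded_subset_ballD[OF bd, of 0] ball_subset_cball by (metis less_imp_le subset_trans)
  define T where "T \<phi> = (grad_l2 \<phi>, inner F (l2_of \<phi>))" for \<phi>
  have poincare: "norm (l2_of \<phi>) \<le> 2 * R * norm (grad_l2 \<phi>)" if "\<phi> \<in> test_functions \<Omega>" for \<phi>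
    by (rule H10_poincare[OF H10_test[OF that] R])
  obtain z where z: "z \<in> closure (fst ` T ` test_functions \<Omega>)" "\<And>g r. (g, r) \<in> T ` test_functions \<Omega> \<Longrightarrow> inner z g = r"
  proof (rule riesz_relation[of "T ` test_functions \<Omega>" "norm F * (2 * R)"])
    show "subspace (T ` test_functions \<Omega>)"
      unfolding T_def by (intro subspace_image_test) (auto simp: grad_l2_add grad_l2_scale l2_of_test_add l2_of_test_scale inner_add_right)
    show "\<bar>r\<bar> \<le> norm F * (2 * R) * norm g" if gr: "(g, r) \<in> T ` test_functions \<Omega>" for g r
    proof -
      obtain \<phi> where \<phi>: "\<phi> \<in> test_functions \<Omega>" "g = grad_l2 \<phi>" "r = inner F (l2_of \<phi>)" using gr by (auto simp: T_def)
      have "\<bar>r\<bar> \<le> norm F * norm (l2_of \<phi>)" unfolding \<phi> by (rule Cauchy_Schwarz_ineq2)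
      also have "\<dots> \<le> norm F * (2 * R * norm g)" using poincare[OF \<phi>(1)] \<phi>(2) by (intro mult_left_mono) auto
      finally show ?thesis by (simp add: mult_ac)
    qed
  qed (use R in auto)
  have "z \<in> closure (grad_l2 ` test_functions \<Omega>)" using z(1) by (simp add: image_image T_def)
  then obtain g where g: "\<And>k. g k \<in> grad_l2 ` test_functions \<Omega>" "g \<longlonglongrightarrow> z" unfolding closure_sequential by blast
  have "\<forall>k. \<exists>\<phi>. \<phi> \<in> test_functions \<Omega> \<and> g k = grad_l2 \<phi>" using g(1) by blast
  then obtain \<phi> where \<phi>: "\<And>k. \<phi> k \<in> test_functions \<Omega>" "\<And>k. g k = grad_l2 (\<phi> k)" by metis
  have est: "dist (l2_of (\<phi> m)) (l2_of (\<phi> k)) \<le> 2 * R * dist (g m) (g k)" for m k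
  proof -
    have "(l2_of (\<phi> m) - l2_of (\<phi> k), grad_l2 (\<phi> m) - grad_l2 (\<phi> k)) \<in> H10 \<Omega>" by (intro H10_diff H10_test \<phi>)
    from H10_poincare[OF this R] show ?thesis by (simp add: dist_norm \<phi>(2))
  qed
  have "Cauchy (\<lambda>k. l2_of (\<phi> k))"
  proof (rule metric_CauchyI)
    fix e :: real assume e: "e > 0"
    have "Cauchy g" using g(2) by (rule LIMSEQ_imp_Cauchy)
    moreover have "e / (2 * R + 1) > 0" using e R by simp
    ultimately obtain M where M: "\<And>m k. m \<ge> M \<Longrightarrow> k \<ge> M \<Longrightarrow> dist (g m) (g k) < e / (2 * R + 1)"
      using metric_CauchyD by blast
    have "dist (l2_of (\<phi> m)) (l2_of (\<phi> k)) < e" if "m \<ge> M" "k \<ge> M" for m k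
    proof -
      have "2 * R * dist (g m) (g k) \<le> (2 * R + 1) * dist (g m) (g k)" by (intro mult_right_mono) auto
      also have "\<dots> < e" using M[OF that] R by (simp add: field_simps)
      finally show ?thesis using est[of m k] by linarith
    qed
    then show "\<exists>M. \<forall>m\<ge>M. \<forall>n\<ge>M. dist (l2_of (\<phi> m)) (l2_of (\<phi> n)) < e" by blast
  qed
  then obtain w where w: "(\<lambda>k. l2_of (\<phi> k)) \<longlonglongrightarrow> w" using Cauchy_convergent convergent_def by blast
  have "(\<lambda>k. grad_l2 (\<phi> k)) \<longlonglongrightarrow> z" using g(2) unfolding \<phi>(2)[symmetric] .
  then have "(w, z) \<in> H10 \<Omega>" unfolding H10_seq using \<phi>(1) w by blast
  then show ?thesis using z(2) by (intro that) (auto simp: T_def)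
qed

section \<open>The Hessian of smooth functions\<close>

definition gradv :: "(real^'n \<Rightarrow> real) \<Rightarrow> real^'n \<Rightarrow> real^'n" where
  "gradv \<phi> x = (\<chi> i. partial_deriv i \<phi> x)"

definition lap :: "(real^'n \<Rightarrow> real) \<Rightarrow> real^'n \<Rightarrow> real" where
  "lap \<phi> x = (\<Sum>i\<in>UNIV. partial_deriv i (partial_deriv i \<phi>) x)"

definition hess :: "(real^'n \<Rightarrow> real) \<Rightarrow> real^'n \<Rightarrow> real^'n \<Rightarrow> real" where
  "hess \<phi> x \<xi> = (\<Sum>i\<in>UNIV. \<Sum>j\<in>UNIV. partial_deriv i (partial_deriv j \<phi>) x * (\<xi> $ i * \<xi> $ j))"

definition hess_sq :: "(real^'n \<Rightarrow> real) \<Rightarrow> real^'n \<Rightarrow> real" where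
  "hess_sq \<phi> x = (\<Sum>i\<in>UNIV. \<Sum>j\<in>UNIV. (partial_deriv i (partial_deriv j \<phi>) x)\<^sup>2)"

lemma norm_sq_vec: "(norm (x :: real^'n))\<^sup>2 = (\<Sum>i\<in>UNIV. (x $ i)\<^sup>2)"
  unfolding power2_norm_eq_inner by (simp add: inner_vec_def power2_eq_square)

lemma smooth_lap: "smooth \<phi> \<Longrightarrow> smooth (lap \<phi>)"
  unfolding lap_def[abs_def] by (intro smooth_intros smooth_partial)

text \<open>The summed divergence of the fields \<open>F i j\<close> contains third derivatives of
  \<open>v\<close> only through \<open>G i j - G j i\<close>, which cancels in the double sum. What
  remains is the integrand \<open>E\<close>, and its integral vanishes because the fields are test
  functions.\<close>

lemma hessian_integral_identity:
  fixes v \<eta> :: "real^'n \<Rightarrow> real"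
  assumes \<eta>: "\<eta> \<in> test_functions \<Omega>" and v: "smooth v"
  shows "(LINT x|lebesgue. \<eta> x * hess_sq v x) =
    (LINT x|lebesgue. \<eta> x * (lap v x)\<^sup>2) - (LINT x|lebesgue. hess \<eta> x (gradv v x) - lap \<eta> x * (norm (gradv v x))\<^sup>2)"
proof -
  let ?D = partial_deriv
  have sm [simp]: "smooth v" "smooth \<eta>" "\<And>\<phi> i. smooth \<phi> \<Longrightarrow> smooth (?D i \<phi>)" "\<And>\<phi> x. smooth \<phi> \<Longrightarrow> \<phi> differentiable (at x)"
    using v \<eta> by (auto intro: smooth_partial smooth_differentiable test_smooth)
  \<comment> \<open>For \<eta> = 1 the summed divergence of the first part is (\<Delta>v)^2 -
    |D^2v|^2. The other two parts trade the terms with first derivatives of \<eta> for terms with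
    second derivatives of \<eta>.\<close>
  define F where "F i j x = \<eta> x * (?D i v x * ?D j (?D j v) x - ?D j v x * ?D i (?D j v) x)
    - ?D j \<eta> x * (?D j v x * ?D i v x) + ?D i \<eta> x * (?D j v x * ?D j v x)" for i j x
  define E where "E i j x = \<eta> x * (?D i (?D i v) x * ?D j (?D j v) x - (?D i (?D j v) x)\<^sup>2)
    - ?D i (?D j \<eta>) x * (?D i v x * ?D j v x) + ?D i (?D i \<eta>) x * (?D j v x)\<^sup>2" for i j x
  define G where "G i j x = ?D i \<eta> x * ?D i v x * ?D j (?D j v) x + ?D i \<eta> x * ?D j v x * ?D i (?D j v) x
    + \<eta> x * ?D i v x * ?D j (?D j (?D i v)) x" for i j x
  have Ft: "F i j \<in> test_functions \<Omega>" for i j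
    unfolding F_def[abs_def] by (intro test_add test_diff test_mult[OF \<eta>] test_mult[OF test_partial[OF \<eta>]] smooth_intros) simp_all
  have c3: "?D i (?D j (?D j v)) = ?D j (?D j (?D i v))" for i j
    using partial_deriv_commute[of "?D j v" i j] partial_deriv_commute[of v i j] by simp
  have DF: "?D i (F i j) x = E i j x + (G i j x - G j i x)" for i j x
  proof -
    have "?D i (F i j) x = \<eta> x * (?D i v x * ?D i (?D j (?D j v)) x + ?D i (?D i v) x * ?D j (?D j v) x
        - (?D j v x * ?D i (?D i (?D j v)) x + ?D i (?D j v) x * ?D i (?D j v) x))
      + ?D i \<eta> x * (?D i v x * ?D j (?D j v) x - ?D j v x * ?D i (?D j v) x)
      - (?D j \<eta> x * (?D j v x * ?D i (?D i v) x + ?D i (?D j v) x * ?D i v x) + ?D i (?D j \<eta>) x * (?D j v x * ?D i v x))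
      + (?D i \<eta> x * (?D j v x * ?D i (?D j v) x + ?D i (?D j v) x * ?D j v x) + ?D i (?D i \<eta>) x * (?D j v x * ?D j v x))"
      unfolding F_def[abs_def]
      by (simp add: partial_deriv_add partial_deriv_diff partial_deriv_mult smooth_add smooth_diff smooth_mult)
    moreover have "?D j (?D i v) x = ?D i (?D j v) x" using partial_deriv_commute[of v j i] by simp
    ultimately show ?thesis unfolding E_def G_def c3[of i j] by (simp add: power2_eq_square algebra_simps)
  qed
  have "(\<Sum>i\<in>UNIV. \<Sum>j\<in>UNIV. ?D i (F i j) x) = (\<Sum>i\<in>UNIV. \<Sum>j\<in>UNIV. E i j x)" for x
  proof -
    have "(\<Sum>i\<in>UNIV. \<Sum>j\<in>UNIV. G j i x) = (\<Sum>i\<in>UNIV. \<Sum>j\<in>UNIV. G i j x)" by (rule sum.swap)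
    then show ?thesis unfolding DF by (simp add: sum.distrib sum_subtractf)
  qed
  moreover have "(\<Sum>i\<in>UNIV. \<Sum>j\<in>UNIV. E i j x) = \<eta> x * (lap v x)\<^sup>2 - \<eta> x * hess_sq v x - (hess \<eta> x (gradv v x) - lap \<eta> x * (norm (gradv v x))\<^sup>2)" for x
  proof -
    have "(lap v x)\<^sup>2 = (\<Sum>i\<in>UNIV. \<Sum>j\<in>UNIV. ?D i (?D i v) x * ?D j (?D j v) x)"
      by (simp add: lap_def power2_eq_square sum_product)
    moreover have "lap \<eta> x * (norm (gradv v x))\<^sup>2 = (\<Sum>i\<in>UNIV. \<Sum>j\<in>UNIV. ?D i (?D i \<eta>) x * (?D j v x)\<^sup>2)"
      by (simp add: lap_def norm_sq_vec gradv_def sum_product)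
    ultimately show ?thesis
      by (simp add: E_def hess_sq_def hess_def gradv_def sum.distrib sum_subtractf sum_distrib_left right_diff_distrib)
  qed
  moreover have "(LINT x|lebesgue. (\<Sum>i\<in>UNIV. \<Sum>j\<in>UNIV. ?D i (F i j) x)) = 0"
    using integral_partial_deriv[OF Ft] test_integrable[OF test_partial[OF Ft]] by simp
  ultimately have zero: "(LINT x|lebesgue. \<eta> x * (lap v x)\<^sup>2 - \<eta> x * hess_sq v x - (hess \<eta> x (gradv v x) - lap \<eta> x * (norm (gradv v x))\<^sup>2)) = 0"
    by simp
  have i1: "integrable lebesgue (\<lambda>x. \<eta> x * (lap v x)\<^sup>2)"
    by (intro test_integrable[OF test_mult[OF \<eta>]] smooth_intros smooth_lap v)
  have i2: "integrable lebesgue (\<lambda>x. \<eta> x * hess_sq v x)"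
    unfolding hess_sq_def by (intro test_integrable[OF test_mult[OF \<eta>]] smooth_intros) simp
  have i3: "integrable lebesgue (\<lambda>x. hess \<eta> x (gradv v x) - lap \<eta> x * (norm (gradv v x))\<^sup>2)"
    unfolding hess_def lap_def norm_sq_vec gradv_def vec_lambda_beta
    by (intro test_integrable[of _ \<Omega>] test_diff test_sum test_mult test_partial \<eta> smooth_intros) simp_all
  show ?thesis using zero i1 i2 i3 by simp
qed

text \<open>This is \<open>|p|\<^sup>2\<close> times the squared length of the component of \<open>\<xi>\<close> orthogonal to \<open>p\<close>.\<close>

definition tang :: "'a::real_inner \<Rightarrow> 'a \<Rightarrow> real" where
  "tang p \<xi> = (norm p)\<^sup>2 * (norm \<xi>)\<^sup>2 - (inner p \<xi>)\<^sup>2"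

lemma tang_nonneg: "0 \<le> tang p \<xi>"
  using Cauchy_Schwarz_ineq[of p \<xi>] by (simp add: tang_def power2_norm_eq_inner)

lemma tang_le: "tang p \<xi> \<le> (norm p)\<^sup>2 * (norm \<xi>)\<^sup>2"
  by (simp add: tang_def)

text \<open>Meant for \<nabla>(\<kappa>\<omega>) = \<kappa>\<nabla>\<omega> + \<omega>\<nabla>\<psi>
  with p = \<nabla>\<psi>: the summand parallel to p drops out and only \<kappa>^2 times the form of
  \<nabla>\<omega> remains.\<close>

lemma tang_combination: "tang p (a *\<^sub>R \<xi> + b *\<^sub>R p) = a\<^sup>2 * tang p \<xi>"
  unfolding tang_def power2_norm_eq_inner
  by (simp add: inner_add_left inner_add_right inner_commute power2_eq_square algebra_simps)

lemma tang_sum: "tang p \<xi> = (\<Sum>i\<in>UNIV. \<Sum>j\<in>UNIV. (if i = j then (norm p)\<^sup>2 else 0) * (\<xi> $ i * \<xi> $ j) - (p $ i * p $ j) * (\<xi> $ i * \<xi> $ j))"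
  for p \<xi> :: "real^'n"
proof -
  have "(inner p \<xi>)\<^sup>2 = (\<Sum>i\<in>UNIV. \<Sum>j\<in>UNIV. (p $ i * p $ j) * (\<xi> $ i * \<xi> $ j))"
    by (simp add: inner_vec_def power2_eq_square sum_product mult_ac)
  moreover have "(\<Sum>i\<in>UNIV. \<Sum>j\<in>UNIV. (if i = j then (norm p)\<^sup>2 else 0) * (\<xi> $ i * \<xi> $ j)) = (norm p)\<^sup>2 * (norm \<xi>)\<^sup>2"
    by (simp add: norm_sq_vec[of \<xi>] if_distrib[of "\<lambda>a. a * _"] sum_distrib_left power2_eq_square[of "\<xi> $ _"] cong: if_cong)
  ultimately show ?thesis by (simp add: tang_def sum_subtractf)
qed

lemma partial_deriv_cong_open:
  assumes "open S" "x \<in> S" "\<And>y. y \<in> S \<Longrightarrow> f y = g y" "smooth f"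
  shows "partial_deriv i f x = partial_deriv i g x"
proof -
  have "(f has_derivative frechet_derivative f (at x)) (at x)"
    using smooth_differentiable[OF assms(4)] unfolding frechet_derivative_works .
  then have "(g has_derivative frechet_derivative f (at x)) (at x)"
    by (rule has_derivative_transform_within_open[OF _ assms(1,2)]) (use assms(3) in auto)
  then show ?thesis using partial_deriv_eq[of g _ x i] by (simp add: partial_deriv_def)
qed

lemma integrable_Fatou:
  fixes f :: "nat \<Rightarrow> 'a::euclidean_space \<Rightarrow> real"
  assumes f: "\<And>n. integrable lebesgue (f n)" "\<And>n x. 0 \<le> f n x" "\<And>n. (LINT x|lebesgue. f n x) \<le> C"
    and lim: "AE x in lebesgue. (\<lambda>n. f n x) \<longlonglongrightarrow> g x" and g: "g \<in> borel_measurable lebesgue" "\<And>x. 0 \<le> g x"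
  shows "integrable lebesgue g"
proof -
  have [measurable]: "f n \<in> borel_measurable lebesgue" for n using f(1) by simp
  have "(\<integral>\<^sup>+x. ennreal (g x) \<partial>lebesgue) = (\<integral>\<^sup>+x. liminf (\<lambda>n. ennreal (f n x)) \<partial>lebesgue)"
  proof (rule nn_integral_cong_AE)
    show "AE x in lebesgue. ennreal (g x) = liminf (\<lambda>n. ennreal (f n x))"
      using lim
    proof eventually_elim
      case (elim x)
      then have L: "(\<lambda>n. ennreal (f n x)) \<longlonglongrightarrow> ennreal (g x)" by (rule tendsto_ennrealI)
      show ?case by (rule lim_imp_Liminf[OF sequentially_bot L, symmetric])
    qed
  qed
  also have "\<dots> \<le> liminf (\<lambda>n. \<integral>\<^sup>+x. ennreal (f n x) \<partial>lebesgue)" by (rule nn_integral_liminf) measurable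
  also have "\<dots> \<le> liminf (\<lambda>n::nat. ennreal C)"
    by (rule Liminf_mono) (use f in \<open>auto simp: nn_integral_eq_integral intro!: always_eventually ennreal_leI\<close>)
  also have "\<dots> < \<infinity>" by (simp add: Liminf_const)
  finally show ?thesis using g by (intro integrableI_bounded) auto
qed

lemma smooth_bounded_on:
  assumes "smooth g" "bounded S"
  obtains C where "0 \<le> C" "\<And>x. x \<in> S \<Longrightarrow> \<bar>g x\<bar> \<le> C"
proof -
  have "bounded (g ` closure S)"
    using assms by (intro compact_imp_bounded compact_continuous_image smooth_continuous) (auto simp: compact_closure)
  then obtain C where "\<And>y. y \<in> g ` closure S \<Longrightarrow> norm y \<le> C" unfolding bounded_iff by blast
  then show ?thesis using closure_subset[of S] by (intro that[of "max C 0"]) (force simp: le_max_iff_disj)+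
qed

lemma hess_lap_compose:
  assumes \<psi>: "smooth \<psi>" and A: "\<And>t. (A has_real_derivative A1 t) (at t)" "\<And>t. (A1 has_real_derivative A2 t) (at t)"
  shows "hess (\<lambda>x. A (\<psi> x)) x \<xi> = A1 (\<psi> x) * hess \<psi> x \<xi> + A2 (\<psi> x) * (inner (gradv \<psi> x) \<xi>)\<^sup>2"
    "lap (\<lambda>x. A (\<psi> x)) x = A1 (\<psi> x) * lap \<psi> x + A2 (\<psi> x) * (norm (gradv \<psi> x))\<^sup>2"
proof -
  have d: "\<psi> differentiable (at x)" "partial_deriv j \<psi> differentiable (at x)" for x j
    using \<psi> by (auto intro: smooth_differentiable smooth_partial)
  have p1: "partial_deriv j (\<lambda>x. A (\<psi> x)) = (\<lambda>x. A1 (\<psi> x) * partial_deriv j \<psi> x)" for j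
    by (intro ext partial_deriv_compose(1) d A)
  have p2: "partial_deriv i (partial_deriv j (\<lambda>x. A (\<psi> x))) x
     = A1 (\<psi> x) * partial_deriv i (partial_deriv j \<psi>) x + A2 (\<psi> x) * (partial_deriv i \<psi> x * partial_deriv j \<psi> x)" for i j
    unfolding p1 by (subst partial_deriv_mult[OF partial_deriv_compose(2)[OF d(1) A(2)] d(2)])
      (simp add: partial_deriv_compose(1)[OF d(1) A(2)])
  have "(inner (gradv \<psi> x) \<xi>)\<^sup>2 = (\<Sum>i\<in>UNIV. \<Sum>j\<in>UNIV. (partial_deriv i \<psi> x * partial_deriv j \<psi> x) * (\<xi> $ i * \<xi> $ j))"
    by (simp add: inner_vec_def gradv_def power2_eq_square sum_product mult_ac)
  then show "hess (\<lambda>x. A (\<psi> x)) x \<xi> = A1 (\<psi> x) * hess \<psi> x \<xi> + A2 (\<psi> x) * (inner (gradv \<psi> x) \<xi>)\<^sup>2"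
    unfolding hess_def p2 by (simp add: sum.distrib sum_distrib_left distrib_right mult.assoc)
  show "lap (\<lambda>x. A (\<psi> x)) x = A1 (\<psi> x) * lap \<psi> x + A2 (\<psi> x) * (norm (gradv \<psi> x))\<^sup>2"
    unfolding lap_def p2 norm_sq_vec by (simp add: gradv_def sum.distrib sum_distrib_left power2_eq_square)
qed

section \<open>Cut-off functions\<close>

text \<open>On \<open>{t. 0 < t}\<close>, \<open>cutoff K s\<close> tends to \<open>1\<close> as first \<open>s \<rightarrow> 0\<close> and then \<open>K \<rightarrow> \<infinity>\<close>. The point of
  this choice is that \<open>cut2\<close>, the second derivative, is at most of order \<open>K / t\<close>, uniformly in \<open>s\<close>.\<close>

definition cutb :: "real \<Rightarrow> real \<Rightarrow> real" where
  "cutb s t = (t - s) * flat 0 (inverse s * (t - s))"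

definition cutoff :: "real \<Rightarrow> real \<Rightarrow> real \<Rightarrow> real" where
  "cutoff K s t = 1 - exp (- K * cutb s t)"

definition cut1 :: "real \<Rightarrow> real \<Rightarrow> real \<Rightarrow> real" where
  "cut1 K s t = K * ((flat 0 (inverse s * (t - s)) + flat 1 (inverse s * (t - s))) * exp (- K * cutb s t))"

definition cut2 :: "real \<Rightarrow> real \<Rightarrow> real \<Rightarrow> real" where
  "cut2 K s t = K * (exp (- K * cutb s t) *
     (inverse s * flat 3 (inverse s * (t - s)) - K * (flat 0 (inverse s * (t - s)) + flat 1 (inverse s * (t - s)))\<^sup>2))"

lemma flat_Suc_mult: "y * flat (Suc n) y = flat n y"
  by (simp add: flat_def)

lemma DERIV_flat_scaled:
  "((\<lambda>t. flat n (inverse s * (t - s))) has_real_derivative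
    inverse s * (flat (n + 2) (inverse s * (t - s)) - real n * flat (n + 1) (inverse s * (t - s)))) (at t)"
proof -
  have "((\<lambda>t. inverse s * (t - s)) has_real_derivative inverse s) (at t)" by (auto intro!: derivative_eq_intros)
  from DERIV_chain2[OF DERIV_flat this] show ?thesis by (simp add: mult.commute)
qed

lemma DERIV_cutb:
  assumes "s > 0"
  shows "(cutb s has_real_derivative flat 0 (inverse s * (t - s)) + flat 1 (inverse s * (t - s))) (at t)"
proof -
  let ?y = "inverse s * (t - s)"
  have "(cutb s has_real_derivative (t - s) * (inverse s * flat 2 ?y) + flat 0 ?y) (at t)"
    unfolding cutb_def[abs_def] using DERIV_flat_scaled[of 0 s t]
    by (auto intro!: derivative_eq_intros simp: numeral_2_eq_2)
  moreover have "(t - s) * (inverse s * flat 2 ?y) = flat 1 ?y"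
    using flat_Suc_mult[of ?y 1] by (simp add: numeral_2_eq_2 mult_ac)
  ultimately show ?thesis by (simp add: add.commute)
qed

lemma DERIV_cut: "s > 0 \<Longrightarrow> (cutoff K s has_real_derivative cut1 K s t) (at t)"
  unfolding cutoff_def[abs_def] cut1_def using DERIV_cutb[of s t] by (auto intro!: derivative_eq_intros)

text \<open>The \<open>flat 2\<close> terms cancel, so \<open>cutb s\<close> has second derivative
  \<open>inverse s * flat 3 (inverse s * (t - s))\<close>, which is nonnegative:
  \<open>cutb s\<close> is a smooth convex substitute for the positive part of t - s.\<close>

lemma DERIV_cut1:
  assumes "s > 0" shows "(cut1 K s has_real_derivative cut2 K s t) (at t)"
proof -
  let ?y = "inverse s * (t - s)"
  have "((\<lambda>t. flat 0 (inverse s * (t - s)) + flat 1 (inverse s * (t - s))) has_real_derivative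
      inverse s * flat 2 ?y + inverse s * (flat 3 ?y - flat 2 ?y)) (at t)"
    using DERIV_add[OF DERIV_flat_scaled[of 0 s t] DERIV_flat_scaled[of 1 s t]] by (simp add: numeral_eq_Suc)
  then have a: "((\<lambda>t. flat 0 (inverse s * (t - s)) + flat 1 (inverse s * (t - s))) has_real_derivative inverse s * flat 3 ?y) (at t)"
    by (simp add: algebra_simps)
  have b: "((\<lambda>t. exp (- K * cutb s t)) has_real_derivative exp (- K * cutb s t) * (- K * (flat 0 ?y + flat 1 ?y))) (at t)"
    using DERIV_cutb[OF assms, of t] by (auto intro!: derivative_eq_intros)
  show ?thesis unfolding cut1_def[abs_def] cut2_def
    by (rule DERIV_cong[OF DERIV_cmult[OF DERIV_mult[OF a b]]]) (simp add: algebra_simps power2_eq_square)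
qed

lemma cutb_nonneg: "s > 0 \<Longrightarrow> 0 \<le> cutb s t"
  by (cases "t \<ge> s") (auto simp: cutb_def flat_nonneg flat_le_0 mult_nonneg_nonpos mult.commute)

lemma cut_bounds: "s > 0 \<Longrightarrow> K \<ge> 0 \<Longrightarrow> 0 \<le> cutoff K s t" "cutoff K s t \<le> 1"
  by (auto simp: cutoff_def cutb_nonneg)

lemma cut_zero: "s > 0 \<Longrightarrow> t \<le> s \<Longrightarrow> cutoff K s t = 0"
  by (simp add: cutoff_def cutb_def flat_le_0 mult_nonneg_nonpos)

lemma cut1_nonneg: "K \<ge> 0 \<Longrightarrow> 0 \<le> cut1 K s t"
  by (simp add: cut1_def flat_nonneg)

text \<open>An upper bound is what matters, because \<open>cut2\<close> enters with a minus sign in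
  front of a nonnegative form. The discarded summand, minus \<open>K\<close> times a square, has the
  favourable sign.\<close>

lemma cut2_le:
  assumes "s > 0" "K \<ge> 0" shows "cut2 K s t \<le> K * (inverse s * flat 3 (inverse s * (t - s)))"
proof -
  let ?y = "inverse s * (t - s)"
  have "exp (- K * cutb s t) * (inverse s * flat 3 ?y - K * (flat 0 ?y + flat 1 ?y)\<^sup>2) \<le> exp (- K * cutb s t) * (inverse s * flat 3 ?y)"
    using assms by (intro mult_left_mono) auto
  also have "\<dots> \<le> 1 * (inverse s * flat 3 ?y)"
    using assms cutb_nonneg[of s t] by (intro mult_right_mono) (auto simp: flat_nonneg)
  finally show ?thesis unfolding cut2_def using assms(2) by (simp add: mult_left_mono)
qed

lemma cut2_zero: "s > 0 \<Longrightarrow> t \<le> s \<Longrightarrow> cut2 K s t = 0" and cut1_zero: "s > 0 \<Longrightarrow> t \<le> s \<Longrightarrow> cut1 K s t = 0"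
  by (simp_all add: cut2_def cut1_def flat_le_0 mult_nonneg_nonpos)

text \<open>With t \<ge> \<delta> and s \<le> \<delta>/2 one has t - s \<ge> \<delta>/2 and (t -
  s)/s \<ge> 1, so \<open>flat 0\<close> is at least exp(-1) there. The product of the two bounds is
  a lower bound for \<open>cutb\<close> independent of s.\<close>

lemma cut_lower:
  assumes "0 < s" "s \<le> \<delta> / 2" "\<delta> \<le> t" "K \<ge> 0"
  shows "1 - exp (- K * (\<delta> / 2 * exp (- 1))) \<le> cutoff K s t"
proof -
  have ts: "t - s \<ge> \<delta> / 2" "t - s > 0" "s \<le> t - s" using assms by auto
  have "exp (- 1) \<le> flat 0 (inverse s * (t - s))" using ts assms by (simp add: flat_def field_simps)
  then have "\<delta> / 2 * exp (- 1) \<le> cutb s t" unfolding cutb_def using ts by (intro mult_mono) auto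
  then show ?thesis unfolding cutoff_def using mult_left_mono[OF _ assms(4)] by force
qed

text \<open>A single term of the exponential series is a lower bound for exp(1/t).\<close>

lemma flat_le_fact: "flat n t \<le> fact n"
proof (cases "t > 0")
  case True
  have "inverse t ^ n / fact n \<le> exp (inverse t)"
    using sum_le_suminf[OF sums_summable[OF exp_converges[of "inverse t"]], of "{n}"] True
      sums_unique[OF exp_converges[of "inverse t"]] by (simp add: field_simps)
  then show ?thesis using True by (simp add: flat_def exp_minus field_simps)
qed (simp add: flat_def)

lemma flat_le_power: "t > 0 \<Longrightarrow> flat n t \<le> inverse t ^ n"
  by (simp add: flat_def mult_left_le)

section \<open>Superlevel sets of concave functions\<close>

lemma young_real:
  fixes a b t :: real
  assumes t: "t > 0" shows "2 * a * b \<le> a\<^sup>2 / t + t * b\<^sup>2"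
proof -
  have "0 \<le> (a - t * b)\<^sup>2 / t" using t by simp
  also have "\<dots> = a\<^sup>2 / t + t * b\<^sup>2 - 2 * a * b" using t by (simp add: power2_eq_square field_simps)
  finally show ?thesis by simp
qed

text \<open>For a bounded weight supported in a bounded set the integral is a quadratic form in the
  components with bounded coefficients, hence continuous on L^2. The unbounded weight 1/\<psi> is
  reached later through such weights.\<close>

lemma tang_weight_tendsto:
  fixes g :: "nat \<Rightarrow> 'n \<Rightarrow> real^'n \<Rightarrow> real" and \<psi> :: "real^'n \<Rightarrow> real"
  assumes \<psi>: "smooth \<psi>" and \<Omega>: "bounded \<Omega>"
    and r: "r \<in> borel_measurable lebesgue" "\<And>x. \<bar>r x\<bar> \<le> C" "\<And>x. x \<notin> \<Omega> \<Longrightarrow> r x = 0"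
    and g: "\<And>k i. g k i \<in> sq_int" "\<And>i. g0 i \<in> sq_int" "\<And>i. (\<lambda>k. l2_of (g k i)) \<longlonglongrightarrow> l2_of (g0 i)"
  shows "(\<lambda>k. LINT x|lebesgue. r x * tang (gradv \<psi> x) (\<chi> i. g k i x)) \<longlonglongrightarrow> (LINT x|lebesgue. r x * tang (gradv \<psi> x) (\<chi> i. g0 i x))"
    and "integrable lebesgue (\<lambda>x. r x * tang (gradv \<psi> x) (\<chi> i. g0 i x))"
proof -
  define c where "c i j x = r x * ((if i = j then (norm (gradv \<psi> x))\<^sup>2 else 0) - partial_deriv i \<psi> x * partial_deriv j \<psi> x)" for i j x
  have cm: "c i j \<in> borel_measurable lebesgue" for i j
  proof -
    have "smooth (\<lambda>x. (if i = j then (norm (gradv \<psi> x))\<^sup>2 else 0) - partial_deriv i \<psi> x * partial_deriv j \<psi> x)"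
      unfolding norm_sq_vec gradv_def vec_lambda_beta using \<psi>
      by (cases "i = j") (auto intro!: smooth_intros smooth_partial)
    then show ?thesis unfolding c_def[abs_def] by (intro borel_measurable_times r(1) smooth_lebesgue)
  qed
  have cb: "\<exists>B. \<forall>x. \<bar>c i j x\<bar> \<le> B" for i j
  proof -
    have "smooth (\<lambda>x. (if i = j then (norm (gradv \<psi> x))\<^sup>2 else 0) - partial_deriv i \<psi> x * partial_deriv j \<psi> x)"
      unfolding norm_sq_vec gradv_def vec_lambda_beta using \<psi>
      by (cases "i = j") (auto intro!: smooth_intros smooth_partial)
    from smooth_bounded_on[OF this \<Omega>] obtain D where D: "0 \<le> D"
      "\<And>x. x \<in> \<Omega> \<Longrightarrow> \<bar>(if i = j then (norm (gradv \<psi> x))\<^sup>2 else 0) - partial_deriv i \<psi> x * partial_deriv j \<psi> x\<bar> \<le> D" by blast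
    have C: "0 \<le> C" using r(2) abs_ge_zero order_trans by blast
    have "\<bar>c i j x\<bar> \<le> C * D" for x
    proof (cases "x \<in> \<Omega>")
      case True
      then show ?thesis unfolding c_def abs_mult using D r(2) C by (intro mult_mono) auto
    next
      case False
      then show ?thesis using C D by (simp add: c_def r(3))
    qed
    then show ?thesis by blast
  qed
  then obtain B where B: "\<And>i j x. \<bar>c i j x\<bar> \<le> B i j" by metis
  have cb': "AE x in lebesgue. \<bar>c i j x\<bar> \<le> B i j" for i j by (simp add: B)
  have rew: "r x * tang (gradv \<psi> x) (\<chi> i. h i x) = (\<Sum>i\<in>UNIV. \<Sum>j\<in>UNIV. c i j x * (h i x * h j x))" for x and h :: "'n \<Rightarrow> real^'n \<Rightarrow> real"
    unfolding tang_sum c_def by (simp add: sum_distrib_left gradv_def algebra_simps)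
  have int: "integrable lebesgue (\<lambda>x. c i j x * (h i x * h j x))" if "\<And>i. h i \<in> sq_int" for h i j
    by (rule integrable_weighted[OF that that cm cb'])
  have eq: "(LINT x|lebesgue. r x * tang (gradv \<psi> x) (\<chi> i. h i x)) = (\<Sum>i\<in>UNIV. \<Sum>j\<in>UNIV. LINT x|lebesgue. c i j x * (h i x * h j x))"
    if "\<And>i. h i \<in> sq_int" for h
    unfolding rew using int[of h, OF that] by simp
  have "(\<lambda>k. \<Sum>i\<in>UNIV. \<Sum>j\<in>UNIV. LINT x|lebesgue. c i j x * (g k i x * g k j x)) \<longlonglongrightarrow> (\<Sum>i\<in>UNIV. \<Sum>j\<in>UNIV. LINT x|lebesgue. c i j x * (g0 i x * g0 j x))"
    by (intro tendsto_sum integral_tendsto_weighted[OF g(1,2,3) g(1,2,3) cm cb'])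
  then show "(\<lambda>k. LINT x|lebesgue. r x * tang (gradv \<psi> x) (\<chi> i. g k i x)) \<longlonglongrightarrow> (LINT x|lebesgue. r x * tang (gradv \<psi> x) (\<chi> i. g0 i x))"
    using eq g by simp
  show "integrable lebesgue (\<lambda>x. r x * tang (gradv \<psi> x) (\<chi> i. g0 i x))" unfolding rew using int[of g0, OF g(2)] by simp
qed

text \<open>The assumption \<open>hess_ge\<close> is what concavity of \<open>\<psi>\<close> gives: each eigenvalue of a negative
  semidefinite matrix is at least its trace.\<close>

locale concave_level =
  fixes \<psi> :: "real^'n \<Rightarrow> real" and c :: real and \<Omega> :: "(real^'n) set"
  assumes smooth_psi: "smooth \<psi>" and Omega: "\<Omega> = {x. 0 < \<psi> x}" and bounded: "bounded \<Omega>"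
    and c_pos: "0 < c" and lap_le: "\<And>x. x \<in> \<Omega> \<Longrightarrow> lap \<psi> x \<le> - c"
    and hess_ge: "\<And>x \<xi>. x \<in> \<Omega> \<Longrightarrow> lap \<psi> x * (norm \<xi>)\<^sup>2 \<le> hess \<psi> x \<xi>"
begin

lemma open_Omega: "open \<Omega>"
  unfolding Omega by (intro open_Collect_less continuous_intros smooth_continuous[OF smooth_psi])

lemma Omega_sets [measurable]: "\<Omega> \<in> sets lebesgue" "\<Omega> \<in> sets borel"
  using open_Omega by auto

text \<open>Division by \<open>\<psi> + \<tau>\<close> must preserve smoothness on the whole space.\<close>

lemma positive_extension:
  assumes \<tau>: "\<tau> > 0"
  obtains \<kappa> where "smooth \<kappa>" "\<And>x. \<kappa> x > 0" "\<And>x. x \<in> \<Omega> \<Longrightarrow> \<kappa> x = \<psi> x + \<tau>"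
proof -
  \<comment> \<open>\<open>y\<close> exceeds 0 exactly where \<psi> > - \<tau>/2 and exceeds 1
    exactly where \<psi> > 0; \<theta> is a smooth step from 0 to 1 between these two levels. So
    \<kappa> interpolates between 1 and \<psi> + \<tau>, the latter being positive wherever it
    contributes.\<close>
  define y where "y x = 1 + (2 / \<tau>) * \<psi> x" for x
  have ys: "smooth y" unfolding y_def[abs_def] by (intro smooth_intros smooth_psi)
  have den: "flat 0 t + flat 0 (1 - t) > 0" for t
    using flat_pos[of t 0] flat_pos[of "1 - t" 0] flat_nonneg[of 0 t] flat_nonneg[of 0 "1 - t"] by (cases "t > 0") auto
  define \<theta> where "\<theta> x = flat 0 (y x) * inverse (flat 0 (y x) + flat 0 (1 - y x))" for x
  have \<theta>s: "smooth \<theta>" unfolding \<theta>_def[abs_def]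
    using den by (intro smooth_mult smooth_inverse smooth_intros ys) (metis less_irrefl)
  define \<kappa> where "\<kappa> x = \<theta> x * (\<psi> x + \<tau>) + (1 - \<theta> x)" for x
  show ?thesis
  proof (rule that)
    show "smooth \<kappa>" unfolding \<kappa>_def[abs_def] by (intro smooth_intros \<theta>s smooth_psi)
    show "\<kappa> x > 0" for x
    proof (cases "y x > 0")
      case True
      then have "\<psi> x > - \<tau> / 2" using \<tau> by (simp add: y_def field_simps)
      then have p: "\<psi> x + \<tau> > 0" using \<tau> by simp
      have t: "0 < \<theta> x" "\<theta> x \<le> 1" using flat_pos[OF True, of 0] den[of "y x"] flat_nonneg[of 0 "1 - y x"]
        by (auto simp: \<theta>_def field_simps)
      then show ?thesis unfolding \<kappa>_def using mult_pos_pos[OF t(1) p] by linarith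
    qed (simp add: \<kappa>_def \<theta>_def flat_le_0)
    show "\<kappa> x = \<psi> x + \<tau>" if "x \<in> \<Omega>" for x
    proof -
      have "y x > 1" using that \<tau> by (simp add: y_def Omega)
      then have "\<theta> x = 1" using flat_pos[of "y x" 0] by (simp add: \<theta>_def flat_le_0)
      then show ?thesis by (simp add: \<kappa>_def)
    qed
  qed
qed

text \<open>With \<open>\<phi> = \<kappa> \<omega>\<close>, the cross term \<open>2 \<omega> \<nabla>\<omega> \<bullet> \<nabla>\<kappa>\<close> integrates to \<open>- \<omega>\<^sup>2 \<Delta>\<kappa> \<ge> c \<omega>\<^sup>2\<close>.\<close>

lemma weighted_energy:
  assumes \<phi>: "\<phi> \<in> test_functions \<Omega>" and \<kappa>: "smooth \<kappa>" "\<And>x. \<kappa> x > 0" "\<And>x. x \<in> \<Omega> \<Longrightarrow> \<kappa> x = \<psi> x + \<tau>"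
    and \<omega>: "\<omega> = (\<lambda>x. \<phi> x * inverse (\<kappa> x))"
  shows "(LINT x|lebesgue. \<kappa> x * (norm (gradv \<omega> x))\<^sup>2) + (c / 2) * (norm (l2_of \<omega>))\<^sup>2 \<le> inner (grad_l2 \<phi>) (grad_l2 \<omega>)"
proof -
  have ne: "\<kappa> x \<noteq> 0" for x using \<kappa>(2)[of x] by simp
  have inv: "smooth (\<lambda>x. inverse (\<kappa> x))" by (intro smooth_inverse \<kappa>(1) ne)
  have \<omega>t: "\<omega> \<in> test_functions \<Omega>" unfolding \<omega> by (rule test_mult[OF \<phi> inv])
  have sm: "smooth \<omega>" "smooth \<phi>" using \<omega>t \<phi> by (auto intro: test_smooth)
  have \<phi>eq: "\<phi> = (\<lambda>x. \<kappa> x * \<omega> x)" by (simp add: \<omega> fun_eq_iff ne)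
  have d\<phi>: "partial_deriv i \<phi> x = \<kappa> x * partial_deriv i \<omega> x + partial_deriv i \<kappa> x * \<omega> x" for i x
    unfolding \<phi>eq by (intro partial_deriv_mult smooth_differentiable \<kappa> sm)
  have lap_eq: "lap \<kappa> x = lap \<psi> x" if "x \<in> \<Omega>" for x
  proof -
    have p1: "partial_deriv i \<kappa> y = partial_deriv i \<psi> y" if "y \<in> \<Omega>" for i y
    proof -
      have "partial_deriv i \<kappa> y = partial_deriv i (\<lambda>x. \<psi> x + \<tau>) y"
        by (rule partial_deriv_cong_open[OF open_Omega that]) (use \<kappa> in auto)
      also have "\<dots> = partial_deriv i \<psi> y"
        by (subst partial_deriv_add) (auto intro: smooth_differentiable smooth_psi smooth_const simp: partial_deriv_const)
      finally show ?thesis .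
    qed
    have "partial_deriv i (partial_deriv i \<kappa>) x = partial_deriv i (partial_deriv i \<psi>) x" for i
      by (rule partial_deriv_cong_open[OF open_Omega that p1]) (auto intro: smooth_partial \<kappa>)
    then show ?thesis by (simp add: lap_def)
  qed
  have "inner (grad_l2 \<phi>) (grad_l2 \<omega>) = (\<Sum>i\<in>UNIV. LINT x|lebesgue. partial_deriv i \<phi> x * partial_deriv i \<omega> x)"
    using test_sq_int[OF test_partial[OF \<phi>]] test_sq_int[OF test_partial[OF \<omega>t]] by (simp add: inner_vec_def grad_l2_def inner_l2_of)
  also have "\<dots> = (\<Sum>i\<in>UNIV. (LINT x|lebesgue. (partial_deriv i \<omega> x)\<^sup>2 * \<kappa> x) - (1/2) * (LINT x|lebesgue. (\<omega> x * \<omega> x) * partial_deriv i (partial_deriv i \<kappa>) x))"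
  proof (rule sum.cong[OF refl])
    fix i
    have ip: "(LINT x|lebesgue. partial_deriv i (\<lambda>x. \<omega> x * \<omega> x) x * partial_deriv i \<kappa> x) = - (LINT x|lebesgue. (\<omega> x * \<omega> x) * partial_deriv i (partial_deriv i \<kappa>) x)"
      by (rule integral_by_parts[OF test_mult[OF \<omega>t sm(1)] smooth_partial[OF \<kappa>(1)]])
    \<comment> \<open>The cross term is written as half the derivative of \<omega>^2 times that of
      \<kappa>, which is the origin of the factor 1/2.\<close>
    have p: "partial_deriv i \<phi> x * partial_deriv i \<omega> x = (partial_deriv i \<omega> x)\<^sup>2 * \<kappa> x + (1/2) * (partial_deriv i (\<lambda>x. \<omega> x * \<omega> x) x * partial_deriv i \<kappa> x)" for x
      unfolding d\<phi> using sm by (simp add: partial_deriv_mult smooth_differentiable power2_eq_square algebra_simps)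
    have i1: "integrable lebesgue (\<lambda>x. (partial_deriv i \<omega> x)\<^sup>2 * \<kappa> x)"
      unfolding power2_eq_square mult.assoc by (intro test_integrable[where \<Omega> = \<Omega>, OF test_mult] test_partial[OF \<omega>t] smooth_intros smooth_partial sm \<kappa>)
    have i2: "integrable lebesgue (\<lambda>x. partial_deriv i (\<lambda>x. \<omega> x * \<omega> x) x * partial_deriv i \<kappa> x)"
      by (intro test_integrable[where \<Omega> = \<Omega>, OF test_mult] test_partial[OF test_mult[OF \<omega>t sm(1)]] smooth_partial \<kappa>)
    show "(LINT x|lebesgue. partial_deriv i \<phi> x * partial_deriv i \<omega> x) =
      (LINT x|lebesgue. (partial_deriv i \<omega> x)\<^sup>2 * \<kappa> x) - (1/2) * (LINT x|lebesgue. (\<omega> x * \<omega> x) * partial_deriv i (partial_deriv i \<kappa>) x)"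
      unfolding p using i1 i2 ip by simp
  qed
  also have "\<dots> = (LINT x|lebesgue. \<kappa> x * (norm (gradv \<omega> x))\<^sup>2) - (1/2) * (LINT x|lebesgue. (\<omega> x)\<^sup>2 * lap \<kappa> x)"
  proof -
    have i1: "integrable lebesgue (\<lambda>x. (partial_deriv i \<omega> x)\<^sup>2 * \<kappa> x)" for i
      unfolding power2_eq_square mult.assoc by (intro test_integrable[where \<Omega> = \<Omega>, OF test_mult] test_partial[OF \<omega>t] smooth_intros smooth_partial sm \<kappa>)
    have i2: "integrable lebesgue (\<lambda>x. (\<omega> x * \<omega> x) * partial_deriv i (partial_deriv i \<kappa>) x)" for i
      by (intro test_integrable[where \<Omega> = \<Omega>, OF test_mult] test_mult[OF \<omega>t sm(1)] smooth_partial \<kappa>)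
    have "(LINT x|lebesgue. \<kappa> x * (norm (gradv \<omega> x))\<^sup>2) = (\<Sum>i\<in>UNIV. LINT x|lebesgue. (partial_deriv i \<omega> x)\<^sup>2 * \<kappa> x)"
      unfolding norm_sq_vec gradv_def vec_lambda_beta sum_distrib_left mult.commute[of "\<kappa> _"] by (rule Bochner_Integration.integral_sum) (rule i1)
    moreover have "(LINT x|lebesgue. (\<omega> x)\<^sup>2 * lap \<kappa> x) = (\<Sum>i\<in>UNIV. LINT x|lebesgue. (\<omega> x * \<omega> x) * partial_deriv i (partial_deriv i \<kappa>) x)"
      unfolding lap_def sum_distrib_left power2_eq_square by (rule Bochner_Integration.integral_sum) (rule i2)
    ultimately show ?thesis by (simp add: sum_subtractf sum_distrib_left)
  qed
  finally have eq: "inner (grad_l2 \<phi>) (grad_l2 \<omega>) = (LINT x|lebesgue. \<kappa> x * (norm (gradv \<omega> x))\<^sup>2) - (1/2) * (LINT x|lebesgue. (\<omega> x)\<^sup>2 * lap \<kappa> x)" .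
  have "(LINT x|lebesgue. (\<omega> x)\<^sup>2 * lap \<kappa> x) \<le> (LINT x|lebesgue. (- c) * (\<omega> x)\<^sup>2)"
  proof (rule integral_mono)
    show "integrable lebesgue (\<lambda>x. (\<omega> x)\<^sup>2 * lap \<kappa> x)"
      unfolding power2_eq_square mult.assoc by (intro test_integrable[where \<Omega> = \<Omega>, OF test_mult] \<omega>t smooth_intros sm smooth_lap \<kappa>)
    show "integrable lebesgue (\<lambda>x. (- c) * (\<omega> x)\<^sup>2)" using test_sq_int[OF \<omega>t] by (simp add: sq_int_def)
    show "(\<omega> x)\<^sup>2 * lap \<kappa> x \<le> (- c) * (\<omega> x)\<^sup>2" for x
    proof (cases "x \<in> \<Omega>")
      case True
      then have "(\<omega> x)\<^sup>2 * lap \<kappa> x \<le> (\<omega> x)\<^sup>2 * (- c)" using lap_le lap_eq by (intro mult_left_mono) auto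
      then show ?thesis by (simp add: mult.commute)
    qed (simp add: test_outside[OF \<omega>t])
  qed
  also have "\<dots> = - c * (norm (l2_of \<omega>))\<^sup>2" using test_sq_int[OF \<omega>t] by (simp add: norm_l2_of_sq)
  finally show ?thesis unfolding eq by simp
qed

text \<open>The weak equation is tested with \<omega> = \<phi>/(\<psi> + \<tau>), where \<phi>
  approximates \<open>w\<close>, and \<open>weighted_energy\<close> bounds \<integral> (\<psi> +
  \<tau>) |\<nabla>\<omega>|^2 independently of \<tau>, up to the approximation error. By
  \<open>tang_combination\<close> this energy controls the tangential form of \<nabla>\<phi> divided
  by \<psi> + \<tau>. The approximation is removed at fixed \<tau>; then \<tau> \<rightarrow> 0 by
  Fatou.\<close>

lemma tangential_hardy:
  assumes wz: "(w, z) \<in> H10 \<Omega>" and weak: "\<And>\<phi>. \<phi> \<in> test_functions \<Omega> \<Longrightarrow> inner z (grad_l2 \<phi>) = inner F (l2_of \<phi>)"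
  shows "integrable lebesgue (\<lambda>x. (indicator \<Omega> x * inverse (\<psi> x)) * tang (gradv \<psi> x) (\<chi> i. fun_of (z $ i) x))"
proof -
  obtain \<phi> where \<phi>: "\<And>k. \<phi> k \<in> test_functions \<Omega>" "(\<lambda>k. grad_l2 (\<phi> k)) \<longlonglongrightarrow> z"
    using wz unfolding H10_seq by blast
  obtain L where L: "0 \<le> L" "\<And>x. x \<in> \<Omega> \<Longrightarrow> (norm (gradv \<psi> x))\<^sup>2 \<le> L"
  proof -
    have "smooth (\<lambda>x. (norm (gradv \<psi> x))\<^sup>2)"
      unfolding norm_sq_vec gradv_def vec_lambda_beta by (intro smooth_intros smooth_partial smooth_psi)
    from smooth_bounded_on[OF this bounded] show ?thesis using that by (metis abs_le_D1)
  qed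
  define C where "C = L * ((norm F)\<^sup>2 / c)"
  define r where "r \<tau> x = indicator \<Omega> x * inverse (\<psi> x + \<tau>)" for \<tau> x
  have rm: "r \<tau> \<in> borel_measurable lebesgue" for \<tau>
    unfolding r_def[abs_def] using smooth_lebesgue[OF smooth_psi] by (intro borel_measurable_times borel_measurable_inverse borel_measurable_add) auto
  have rn: "0 \<le> r \<tau> x" if "\<tau> \<ge> 0" for \<tau> x using that by (auto simp: r_def indicator_def Omega)
  have est: "(LINT x|lebesgue. r \<tau> x * tang (gradv \<psi> x) (\<chi> i. fun_of (z $ i) x)) \<le> C
      \<and> integrable lebesgue (\<lambda>x. r \<tau> x * tang (gradv \<psi> x) (\<chi> i. fun_of (z $ i) x))" if \<tau>: "\<tau> > 0" for \<tau>
  proof -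
    obtain \<kappa> where \<kappa>: "smooth \<kappa>" "\<And>x. \<kappa> x > 0" "\<And>x. x \<in> \<Omega> \<Longrightarrow> \<kappa> x = \<psi> x + \<tau>" using positive_extension[OF \<tau>] by blast
    have ne: "\<kappa> x \<noteq> 0" for x using \<kappa>(2)[of x] by simp
    have inv: "smooth (\<lambda>x. inverse (\<kappa> x))" by (intro smooth_inverse \<kappa>(1) ne)
    define \<omega> where "\<omega> k x = \<phi> k x * inverse (\<kappa> x)" for k x
    have \<omega>t: "\<omega> k \<in> test_functions \<Omega>" for k unfolding \<omega>_def[abs_def] by (rule test_mult[OF \<phi>(1) inv])
    define d where "d k = norm (grad_l2 (\<phi> k) - z)" for k
    define I where "I k = (LINT x|lebesgue. \<kappa> x * (norm (gradv (\<omega> k) x))\<^sup>2)" for k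
    have i1: "integrable lebesgue (\<lambda>x. \<kappa> x * (norm (gradv (\<omega> k) x))\<^sup>2)" for k
      unfolding norm_sq_vec gradv_def vec_lambda_beta sum_distrib_left
      by (intro Bochner_Integration.integrable_sum) (simp add: power2_eq_square mult.left_commute[of "\<kappa> _"],
        intro test_integrable[where \<Omega> = \<Omega>, OF test_mult] test_partial[OF \<omega>t] smooth_intros smooth_partial test_smooth[OF \<omega>t] \<kappa>)
    have X: "\<tau> * (norm (grad_l2 (\<omega> k)))\<^sup>2 \<le> I k" for k
    proof -
      have sq: "partial_deriv i (\<omega> k) \<in> sq_int" for i by (rule test_sq_int[OF test_partial[OF \<omega>t]])
      have "(norm (grad_l2 (\<omega> k)))\<^sup>2 = (LINT x|lebesgue. (norm (gradv (\<omega> k) x))\<^sup>2)"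
        using sq by (simp add: power2_norm_eq_inner inner_vec_def grad_l2_def gradv_def inner_l2_of sq_int_integrable_mult)
      then have "\<tau> * (norm (grad_l2 (\<omega> k)))\<^sup>2 = (LINT x|lebesgue. \<tau> * (norm (gradv (\<omega> k) x))\<^sup>2)" by simp
      also have "\<dots> \<le> I k" unfolding I_def
      proof (rule integral_mono'[OF i1])
        fix x
        show "\<tau> * (norm (gradv (\<omega> k) x))\<^sup>2 \<le> \<kappa> x * (norm (gradv (\<omega> k) x))\<^sup>2"
        proof (cases "x \<in> \<Omega>")
          case True
          then have "\<tau> \<le> \<kappa> x" using \<kappa>(3) by (simp add: Omega)
          then show ?thesis by (intro mult_right_mono) auto
        next
          case False
          then have "gradv (\<omega> k) x = 0" using test_outside[OF test_partial[OF \<omega>t]] by (simp add: gradv_def vec_eq_iff)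
          then show ?thesis by simp
        qed
        show "0 \<le> \<kappa> x * (norm (gradv (\<omega> k) x))\<^sup>2" using \<kappa>(2)[of x] by simp
      qed
      finally show ?thesis .
    qed
    \<comment> \<open>The defect \<open>d k\<close> costs (d k)^2/\<tau>, harmless because k
      \<rightarrow> \<infinity> at fixed \<tau>. The summand with \<open>c\<close> in
      \<open>weighted_energy\<close> absorbs the one with \<open>?W\<close> and leaves the bound
      |F|^2/c, which is free of \<tau>.\<close>
    have Ik: "I k \<le> (norm F)\<^sup>2 / c + (d k)\<^sup>2 / \<tau>" for k
    proof -
      let ?X = "norm (grad_l2 (\<omega> k))" and ?W = "norm (l2_of (\<omega> k))"
      have "I k + (c / 2) * ?W\<^sup>2 \<le> inner (grad_l2 (\<phi> k)) (grad_l2 (\<omega> k))"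
        unfolding I_def by (rule weighted_energy[OF \<phi>(1) \<kappa>]) (auto simp: \<omega>_def fun_eq_iff)
      also have "\<dots> = inner (grad_l2 (\<phi> k) - z) (grad_l2 (\<omega> k)) + inner F (l2_of (\<omega> k))"
        using weak[OF \<omega>t[of k]] by (simp add: inner_diff_left)
      also have "\<dots> \<le> d k * ?X + norm F * ?W" unfolding d_def by (intro add_mono norm_cauchy_schwarz)
      finally have main: "I k + (c / 2) * ?W\<^sup>2 \<le> d k * ?X + norm F * ?W" .
      have "2 * d k * ?X \<le> (d k)\<^sup>2 / \<tau> + \<tau> * ?X\<^sup>2"
        by (rule young_real[OF \<tau>])
      moreover have "norm F * ?W \<le> (norm F)\<^sup>2 / (2 * c) + (c / 2) * ?W\<^sup>2"
        using young_real[OF c_pos, of "norm F" ?W] by (simp add: field_simps)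
      ultimately show ?thesis using main X[of k] by (simp add: field_simps)
    qed
    have rb: "\<bar>r \<tau> x\<bar> \<le> inverse \<tau>" for x
      using \<tau> by (auto simp: r_def indicator_def Omega intro: le_imp_inverse_le)
    have gs: "partial_deriv i (\<phi> k) \<in> sq_int" for k i by (rule test_sq_int[OF test_partial[OF \<phi>(1)]])
    have gl: "(\<lambda>k. l2_of (partial_deriv i (\<phi> k))) \<longlonglongrightarrow> l2_of (fun_of (z $ i))" for i
      using tendsto_vec_nth[OF \<phi>(2), of i] by (simp add: grad_l2_def)
    have r0: "x \<notin> \<Omega> \<Longrightarrow> r \<tau> x = 0" for x by (simp add: r_def)
    note lim = tang_weight_tendsto[OF smooth_psi bounded rm rb r0 gs fun_of_sq_int gl]
    have le: "(LINT x|lebesgue. r \<tau> x * tang (gradv \<psi> x) (\<chi> i. partial_deriv i (\<phi> k) x)) \<le> L * ((norm F)\<^sup>2 / c + (d k)\<^sup>2 / \<tau>)" for k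
    proof -
      have "(LINT x|lebesgue. r \<tau> x * tang (gradv \<psi> x) (\<chi> i. partial_deriv i (\<phi> k) x)) \<le> (LINT x|lebesgue. L * (\<kappa> x * (norm (gradv (\<omega> k) x))\<^sup>2))"
      proof (rule integral_mono')
        show "integrable lebesgue (\<lambda>x. L * (\<kappa> x * (norm (gradv (\<omega> k) x))\<^sup>2))" using i1 by simp
        fix x
        show "0 \<le> L * (\<kappa> x * (norm (gradv (\<omega> k) x))\<^sup>2)" using L(1) \<kappa>(2)[of x] by simp
        show "r \<tau> x * tang (gradv \<psi> x) (\<chi> i. partial_deriv i (\<phi> k) x) \<le> L * (\<kappa> x * (norm (gradv (\<omega> k) x))\<^sup>2)"
        proof (cases "x \<in> \<Omega>")
          case True
          have "partial_deriv i (\<phi> k) x = \<kappa> x * partial_deriv i (\<omega> k) x + \<omega> k x * partial_deriv i \<psi> x" for i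
          proof -
            have e: "\<phi> k = (\<lambda>x. \<kappa> x * \<omega> k x)" by (simp add: \<omega>_def fun_eq_iff ne)
            have "partial_deriv i (\<phi> k) x = \<kappa> x * partial_deriv i (\<omega> k) x + partial_deriv i \<kappa> x * \<omega> k x"
              by (subst e) (intro partial_deriv_mult smooth_differentiable \<kappa> test_smooth[OF \<omega>t])
            moreover have "partial_deriv i \<kappa> x = partial_deriv i (\<lambda>x. \<psi> x + \<tau>) x"
              by (rule partial_deriv_cong_open[OF open_Omega True]) (use \<kappa> in auto)
            moreover have "partial_deriv i (\<lambda>x. \<psi> x + \<tau>) x = partial_deriv i \<psi> x"
              by (subst partial_deriv_add) (auto intro: smooth_differentiable smooth_psi smooth_const simp: partial_deriv_const)
            ultimately show ?thesis by simp
          qed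
          then have "(\<chi> i. partial_deriv i (\<phi> k) x) = \<kappa> x *\<^sub>R gradv (\<omega> k) x + \<omega> k x *\<^sub>R gradv \<psi> x"
            by (simp add: gradv_def vec_eq_iff)
          then have "r \<tau> x * tang (gradv \<psi> x) (\<chi> i. partial_deriv i (\<phi> k) x) = inverse (\<kappa> x) * ((\<kappa> x)\<^sup>2 * tang (gradv \<psi> x) (gradv (\<omega> k) x))"
            using True by (simp add: tang_combination r_def \<kappa>(3))
          also have "\<dots> = \<kappa> x * tang (gradv \<psi> x) (gradv (\<omega> k) x)" using \<kappa>(2)[of x] by (simp add: power2_eq_square)
          also have "\<dots> \<le> \<kappa> x * (L * (norm (gradv (\<omega> k) x))\<^sup>2)"
            using \<kappa>(2)[of x] L(2)[OF True] by (intro mult_left_mono order_trans[OF tang_le] mult_right_mono) auto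
          finally show ?thesis by (simp add: mult_ac)
        qed (use L(1) \<kappa>(2)[of x] in \<open>simp add: r_def\<close>)
      qed
      also have "\<dots> = L * I k" by (simp add: I_def)
      also have "\<dots> \<le> L * ((norm F)\<^sup>2 / c + (d k)\<^sup>2 / \<tau>)" by (intro mult_left_mono Ik L)
      finally show ?thesis .
    qed
    have "(\<lambda>k. L * ((norm F)\<^sup>2 / c + (d k)\<^sup>2 / \<tau>)) \<longlonglongrightarrow> L * ((norm F)\<^sup>2 / c + (norm (z - z))\<^sup>2 / \<tau>)"
      unfolding d_def using \<tau> by (intro tendsto_intros \<phi>) auto
    from LIMSEQ_le[OF lim(1) this] le
    have "(LINT x|lebesgue. r \<tau> x * tang (gradv \<psi> x) (\<chi> i. fun_of (z $ i) x)) \<le> L * ((norm F)\<^sup>2 / c + (norm (z - z))\<^sup>2 / \<tau>)"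
      by simp
    then show ?thesis using lim(2) by (simp add: C_def)
  qed
  define \<tau> where "\<tau> n = inverse (real (Suc n))" for n
  have \<tau>: "\<tau> n > 0" for n by (simp add: \<tau>_def)
  show ?thesis
  proof (rule integrable_Fatou[where f = "\<lambda>n x. r (\<tau> n) x * tang (gradv \<psi> x) (\<chi> i. fun_of (z $ i) x)" and C = C])
    show "integrable lebesgue (\<lambda>x. r (\<tau> n) x * tang (gradv \<psi> x) (\<chi> i. fun_of (z $ i) x))" for n using est[OF \<tau>] by blast
    show "(LINT x|lebesgue. r (\<tau> n) x * tang (gradv \<psi> x) (\<chi> i. fun_of (z $ i) x)) \<le> C" for n using est[OF \<tau>] by blast
    show "0 \<le> r (\<tau> n) x * tang (gradv \<psi> x) (\<chi> i. fun_of (z $ i) x)" for n x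
      using rn[OF less_imp_le[OF \<tau>]] tang_nonneg by (intro mult_nonneg_nonneg)
    show "0 \<le> (indicator \<Omega> x * inverse (\<psi> x)) * tang (gradv \<psi> x) (\<chi> i. fun_of (z $ i) x)" for x
      by (rule mult_nonneg_nonneg[OF _ tang_nonneg]) (auto simp: indicator_def Omega)
    have lim: "(\<lambda>n. r (\<tau> n) x) \<longlonglongrightarrow> indicator \<Omega> x * inverse (\<psi> x)" for x
    proof (cases "x \<in> \<Omega>")
      case True
      have "(\<lambda>n. inverse (\<psi> x + \<tau> n)) \<longlonglongrightarrow> inverse (\<psi> x + 0)"
        using True LIMSEQ_inverse_real_of_nat unfolding \<tau>_def by (intro tendsto_intros) (auto simp: Omega)
      then show ?thesis using True by (simp add: r_def)
    qed (simp add: r_def)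
    then have lim: "(\<lambda>n. r (\<tau> n) x * tang (gradv \<psi> x) (\<chi> i. fun_of (z $ i) x)) \<longlonglongrightarrow> (indicator \<Omega> x * inverse (\<psi> x)) * tang (gradv \<psi> x) (\<chi> i. fun_of (z $ i) x)" for x
      by (rule tendsto_mult_right)
    then show "AE x in lebesgue. (\<lambda>n. r (\<tau> n) x * tang (gradv \<psi> x) (\<chi> i. fun_of (z $ i) x)) \<longlonglongrightarrow> (indicator \<Omega> x * inverse (\<psi> x)) * tang (gradv \<psi> x) (\<chi> i. fun_of (z $ i) x)"
      by (rule AE_I2)
    show "(\<lambda>x. (indicator \<Omega> x * inverse (\<psi> x)) * tang (gradv \<psi> x) (\<chi> i. fun_of (z $ i) x)) \<in> borel_measurable lebesgue"
      by (rule borel_measurable_LIMSEQ_metric[OF borel_measurable_integrable[OF est[OF \<tau>, THEN conjunct2]] lim])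
  qed
qed

end

context concave_level
begin

lemma smooth_cut: "smooth (\<lambda>x. cutoff K s (\<psi> x))"
  unfolding cutoff_def cutb_def by (intro smooth_intros smooth_psi)

lemma cut_test:
  assumes "s > 0" shows "(\<lambda>x. cutoff K s (\<psi> x)) \<in> test_functions \<Omega>"
  unfolding test_functions_iff
proof (intro conjI exI)
  have "closed {x. s \<le> \<psi> x}" by (intro closed_Collect_le continuous_intros smooth_continuous[OF smooth_psi])
  moreover have "{x. s \<le> \<psi> x} \<subseteq> \<Omega>" using assms by (auto simp: Omega)
  ultimately show "compact {x. s \<le> \<psi> x}" "{x. s \<le> \<psi> x} \<subseteq> \<Omega>"
    using bounded bounded_subset by (auto simp: compact_eq_bounded_closed)
  show "\<forall>x. x \<notin> {x. s \<le> \<psi> x} \<longrightarrow> cutoff K s (\<psi> x) = 0" using assms by (auto simp: cut_zero)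
qed (rule smooth_cut)

text \<open>The bound of \<open>cut2_le\<close>, restricted to the domain: the weight of the only
  term of unfavourable sign.\<close>

definition layer :: "real \<Rightarrow> real \<Rightarrow> real^'n \<Rightarrow> real" where
  "layer K s x = indicator \<Omega> x * (K * (inverse s * flat 3 (inverse s * (\<psi> x - s))))"

lemma layer_measurable: "layer K s \<in> borel_measurable lebesgue"
  unfolding layer_def[abs_def]
  by (intro borel_measurable_times borel_measurable_indicator smooth_lebesgue smooth_intros smooth_psi) auto

lemma layer_nonneg: "s > 0 \<Longrightarrow> K \<ge> 0 \<Longrightarrow> 0 \<le> layer K s x"
  by (simp add: layer_def flat_nonneg)

lemma layer_bounded: "s > 0 \<Longrightarrow> K \<ge> 0 \<Longrightarrow> \<bar>layer K s x\<bar> \<le> K * (inverse s * 6)"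
  using flat_le_fact[of 3 "inverse s * (\<psi> x - s)"] flat_nonneg[of 3 "inverse s * (\<psi> x - s)"]
  by (auto simp: layer_def indicator_def fact_numeral intro!: mult_left_mono divide_right_mono)

text \<open>With \<psi> = s (1 + y) the claim reduces to
  \<open>flat 3 y + y * flat 3 y \<le> 8\<close>, and \<open>y * flat 3 y\<close> is
  \<open>flat 2 y\<close>; the constant is 3! + 2!. The bound is uniform in \<open>s\<close> and has
  exactly the weight of the Hardy estimate.\<close>

lemma layer_le:
  assumes "s > 0" "K \<ge> 0"
  shows "layer K s x \<le> (8 * K) * (indicator \<Omega> x * inverse (\<psi> x))"
proof (cases "x \<in> \<Omega>")
  case True
  define y where "y = inverse s * (\<psi> x - s)"
  have p: "\<psi> x > 0" using True by (simp add: Omega)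
  have e: "\<psi> x = s * (1 + y)" using assms by (simp add: y_def field_simps)
  have "inverse s * flat 3 y * \<psi> x = flat 3 y + y * flat (Suc 2) y"
    unfolding e using assms by (simp add: numeral_3_eq_3 numeral_2_eq_2 field_simps)
  also have "\<dots> \<le> 6 + 2"
    unfolding flat_Suc_mult using flat_le_fact[of 3 y] flat_le_fact[of 2 y] by (simp add: fact_numeral)
  finally have "inverse s * flat 3 y \<le> 8 * inverse (\<psi> x)" using p by (simp add: field_simps)
  then have "K * (inverse s * flat 3 y) \<le> K * (8 * inverse (\<psi> x))" by (intro mult_left_mono assms)
  then show ?thesis using True by (simp add: layer_def y_def)
qed (simp add: layer_def)

text \<open>By the chain rule the form is \<open>cut1\<close> times a quantity that
  \<open>hess_ge\<close> makes nonnegative, minus \<open>cut2\<close> times \<open>tang\<close>: the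
  second derivative of the cut-off sees only the part of \<xi> tangential to the level sets.\<close>

lemma cut_quadratic_form:
  assumes "s > 0" "K \<ge> 0"
  shows "hess (\<lambda>x. cutoff K s (\<psi> x)) x \<xi> - lap (\<lambda>x. cutoff K s (\<psi> x)) x * (norm \<xi>)\<^sup>2 \<ge> - layer K s x * tang (gradv \<psi> x) \<xi>"
proof -
  have eq: "hess (\<lambda>x. cutoff K s (\<psi> x)) x \<xi> - lap (\<lambda>x. cutoff K s (\<psi> x)) x * (norm \<xi>)\<^sup>2
      = cut1 K s (\<psi> x) * (hess \<psi> x \<xi> - lap \<psi> x * (norm \<xi>)\<^sup>2) - cut2 K s (\<psi> x) * tang (gradv \<psi> x) \<xi>"
    unfolding hess_lap_compose[OF smooth_psi DERIV_cut[OF assms(1)] DERIV_cut1[OF assms(1)]]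
    by (simp add: tang_def algebra_simps)
  show ?thesis
  proof (cases "x \<in> \<Omega>")
    case True
    have "0 \<le> cut1 K s (\<psi> x) * (hess \<psi> x \<xi> - lap \<psi> x * (norm \<xi>)\<^sup>2)"
      using cut1_nonneg[OF assms(2)] hess_ge[OF True, of \<xi>] by (intro mult_nonneg_nonneg) auto
    moreover have "cut2 K s (\<psi> x) * tang (gradv \<psi> x) \<xi> \<le> layer K s x * tang (gradv \<psi> x) \<xi>"
      using cut2_le[OF assms] True by (intro mult_right_mono tang_nonneg) (simp add: layer_def)
    ultimately show ?thesis unfolding eq by simp
  next
    case False
    then have "\<psi> x \<le> s" using assms by (simp add: Omega)
    then show ?thesis unfolding eq using False assms by (simp add: layer_def cut1_zero cut2_zero)
  qed
qed

lemma hess_sq_le: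
  assumes v: "smooth v" and s: "s > 0" "K \<ge> 0" and int: "integrable lebesgue (\<lambda>x. layer K s x * tang (gradv \<psi> x) (gradv v x))"
  shows "(LINT x|lebesgue. cutoff K s (\<psi> x) * hess_sq v x) \<le>
    (LINT x|lebesgue. cutoff K s (\<psi> x) * (lap v x)\<^sup>2) + (LINT x|lebesgue. layer K s x * tang (gradv \<psi> x) (gradv v x))"
proof -
  let ?\<eta> = "\<lambda>x. cutoff K s (\<psi> x)"
  have t: "?\<eta> \<in> test_functions \<Omega>" by (rule cut_test[OF s(1)])
  have i: "integrable lebesgue (\<lambda>x. hess ?\<eta> x (gradv v x) - lap ?\<eta> x * (norm (gradv v x))\<^sup>2)"
    unfolding hess_def lap_def norm_sq_vec gradv_def vec_lambda_beta
    by (intro test_integrable[of _ \<Omega>] test_diff test_sum test_mult test_partial t smooth_intros smooth_partial v)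
  have "(LINT x|lebesgue. - (layer K s x * tang (gradv \<psi> x) (gradv v x))) \<le> (LINT x|lebesgue. hess ?\<eta> x (gradv v x) - lap ?\<eta> x * (norm (gradv v x))\<^sup>2)"
    using cut_quadratic_form[OF s] int i by (intro integral_mono) auto
  then show ?thesis unfolding hessian_integral_identity[OF t v] by simp
qed

text \<open>Dominated convergence with the majorant 8 K/\<psi> from \<open>layer_le\<close>.
  Pointwise, the bound y^(-3) for \<open>flat 3 y\<close> outweighs the factor 1/s and leaves s^2.
  The parameter \<open>K\<close> stays fixed.\<close>

lemma layer_integral_tendsto_0:
  fixes \<zeta> :: "real^'n \<Rightarrow> real^'n"
  assumes int: "integrable lebesgue (\<lambda>x. (indicator \<Omega> x * inverse (\<psi> x)) * tang (gradv \<psi> x) (\<zeta> x))"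
    and m: "\<And>s. s > 0 \<Longrightarrow> (\<lambda>x. layer K s x * tang (gradv \<psi> x) (\<zeta> x)) \<in> borel_measurable lebesgue"
    and K: "K \<ge> 0" and s: "\<And>n. s n > 0" "s \<longlonglongrightarrow> 0"
  shows "(\<lambda>n. LINT x|lebesgue. layer K (s n) x * tang (gradv \<psi> x) (\<zeta> x)) \<longlonglongrightarrow> 0"
proof -
  have "(\<lambda>n. LINT x|lebesgue. layer K (s n) x * tang (gradv \<psi> x) (\<zeta> x)) \<longlonglongrightarrow> (LINT x|(lebesgue :: (real^'n) measure). 0)"
  proof (rule integral_dominated_convergence[where w = "\<lambda>x. (8 * K) * ((indicator \<Omega> x * inverse (\<psi> x)) * tang (gradv \<psi> x) (\<zeta> x))"])
    show "integrable lebesgue (\<lambda>x. (8 * K) * ((indicator \<Omega> x * inverse (\<psi> x)) * tang (gradv \<psi> x) (\<zeta> x)))" using int by (rule integrable_mult_right)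
    show "AE x in lebesgue. norm (layer K (s n) x * tang (gradv \<psi> x) (\<zeta> x)) \<le> (8 * K) * ((indicator \<Omega> x * inverse (\<psi> x)) * tang (gradv \<psi> x) (\<zeta> x))" for n
    proof (rule AE_I2)
      fix x
      have "layer K (s n) x * tang (gradv \<psi> x) (\<zeta> x) \<le> ((8 * K) * (indicator \<Omega> x * inverse (\<psi> x))) * tang (gradv \<psi> x) (\<zeta> x)"
        by (intro mult_right_mono layer_le s K tang_nonneg)
      moreover have "0 \<le> layer K (s n) x * tang (gradv \<psi> x) (\<zeta> x)" by (intro mult_nonneg_nonneg layer_nonneg s K tang_nonneg)
      ultimately show "norm (layer K (s n) x * tang (gradv \<psi> x) (\<zeta> x)) \<le> (8 * K) * ((indicator \<Omega> x * inverse (\<psi> x)) * tang (gradv \<psi> x) (\<zeta> x))"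
        by (simp add: mult.assoc)
    qed
    show "AE x in lebesgue. (\<lambda>n. layer K (s n) x * tang (gradv \<psi> x) (\<zeta> x)) \<longlonglongrightarrow> 0"
    proof (rule AE_I2)
      fix x
      have "(\<lambda>n. layer K (s n) x) \<longlonglongrightarrow> 0"
      proof (cases "x \<in> \<Omega>")
        case True
        then have p: "\<psi> x > 0" by (simp add: Omega)
        have ev: "eventually (\<lambda>n. s n < \<psi> x / 2) sequentially" using order_tendstoD(2)[OF s(2), of "\<psi> x / 2"] p by simp
        have lim: "(\<lambda>n. K * ((s n)\<^sup>2 * (8 / (\<psi> x)^3))) \<longlonglongrightarrow> K * (0\<^sup>2 * (8 / (\<psi> x)^3))" by (intro tendsto_intros s)
        show ?thesis
        proof (rule tendsto_sandwich[OF _ _ tendsto_const])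
          show "eventually (\<lambda>n. 0 \<le> layer K (s n) x) sequentially" by (intro always_eventually allI layer_nonneg s K)
          show "eventually (\<lambda>n. layer K (s n) x \<le> K * ((s n)\<^sup>2 * (8 / (\<psi> x)^3))) sequentially"
            using ev
          proof eventually_elim
            case (elim n)
            then have t: "\<psi> x - s n \<ge> \<psi> x / 2" "\<psi> x - s n > 0" using p by auto
            have "flat 3 (inverse (s n) * (\<psi> x - s n)) \<le> inverse (inverse (s n) * (\<psi> x - s n)) ^ 3"
              using t s(1)[of n] by (intro flat_le_power) auto
            also have "\<dots> = (s n)^3 * inverse (\<psi> x - s n) ^ 3" using s(1)[of n] by (simp add: power_mult_distrib)
            also have "\<dots> \<le> (s n)^3 * (inverse (\<psi> x / 2)) ^ 3"
              using t p s(1)[of n] by (intro mult_left_mono power_mono le_imp_inverse_le) auto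
            finally have "inverse (s n) * flat 3 (inverse (s n) * (\<psi> x - s n)) \<le> inverse (s n) * ((s n)^3 * (inverse (\<psi> x / 2)) ^ 3)"
              using s(1)[of n] by (intro mult_left_mono) auto
            also have "\<dots> = (s n)\<^sup>2 * (8 / (\<psi> x)^3)" using s(1)[of n] p by (simp add: power2_eq_square power3_eq_cube field_simps)
            finally show ?case unfolding layer_def using True by (simp only: indicator_simps mult_1 mult_left_mono[OF _ K])
          qed
          show "(\<lambda>n. K * ((s n)\<^sup>2 * (8 / (\<psi> x)^3))) \<longlonglongrightarrow> 0" using lim by simp
        qed
      qed (simp add: layer_def)
      then show "(\<lambda>n. layer K (s n) x * tang (gradv \<psi> x) (\<zeta> x)) \<longlonglongrightarrow> 0" by (rule tendsto_mult_left_zero)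
    qed
  qed (use m s in auto)
  then show ?thesis by simp
qed

text \<open>First derivatives commute with mollification on the whole space, because the extension
  of \<open>w\<close> by zero has weak gradient \<open>z\<close> there. Second derivatives stay on
  the kernel, since nothing is known yet about a weak Hessian.\<close>

lemma mollified_derivatives:
  fixes \<rho> :: "real^'n \<Rightarrow> real"
  assumes wz: "(w, z) \<in> H10 \<Omega>" and \<rho>: "\<rho> \<in> test_functions UNIV"
  shows "integrable lebesgue (fun_of w)" "integrable lebesgue (fun_of (z $ i))"
    "smooth (conv \<rho> (fun_of w))" "partial_deriv i (conv \<rho> (fun_of w)) = conv \<rho> (fun_of (z $ i))"
    "partial_deriv j (conv \<rho> (fun_of (z $ i))) = conv (partial_deriv j \<rho>) (fun_of (z $ i))"
proof -
  show iw: "integrable lebesgue (fun_of w)"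
    by (rule sq_int_vanishing_integrable[OF fun_of_sq_int closure_test_vanishes[OF H10_closure(1)[OF wz] Omega_sets(1)] bounded])
  show iz: "integrable lebesgue (fun_of (z $ i))"
    by (rule sq_int_vanishing_integrable[OF fun_of_sq_int closure_test_vanishes[OF H10_closure(3)[OF wz] Omega_sets(1)] bounded])
  show "smooth (conv \<rho> (fun_of w))" by (rule smooth_conv[OF \<rho> iw])
  show "partial_deriv j (conv \<rho> (fun_of (z $ i))) = conv (partial_deriv j \<rho>) (fun_of (z $ i))" by (rule partial_deriv_conv[OF \<rho> iz])
  show "partial_deriv i (conv \<rho> (fun_of w)) = conv \<rho> (fun_of (z $ i))"
  proof
    fix x
    have d: "partial_deriv i (\<lambda>y. \<rho> (x - y)) = (\<lambda>y. (- 1) * partial_deriv i \<rho> (x - y))"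
      by (simp add: fun_eq_iff partial_deriv_reflect smooth_differentiable test_smooth[OF \<rho>])
    have "inner w (l2_of (partial_deriv i (\<lambda>y. \<rho> (x - y)))) = - inner (z $ i) (l2_of (\<lambda>y. \<rho> (x - y)))"
      by (rule H10_by_parts[OF wz test_reflect[OF \<rho>]])
    then have "inner w (l2_of (\<lambda>y. partial_deriv i \<rho> (x - y))) = inner (z $ i) (l2_of (\<lambda>y. \<rho> (x - y)))"
      unfolding d using l2_of_test_scale[OF test_reflect[OF test_partial[OF \<rho>]], of "-1" i x] by simp
    then show "partial_deriv i (conv \<rho> (fun_of w)) x = conv \<rho> (fun_of (z $ i)) x"
      unfolding partial_deriv_conv[OF \<rho> iw] by (simp add: conv_l2 \<rho> test_partial fun_of_sq_int inner_commute)
  qed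
qed

text \<open>At a point whose closed \<epsilon>-ball lies in the domain the reflected kernel is an
  admissible test function for the weak equation. The sign is that of - \<Delta>w = F.\<close>

lemma lap_mollified:
  fixes \<rho> :: "real^'n \<Rightarrow> real"
  assumes wz: "(w, z) \<in> H10 \<Omega>" and weak: "\<And>\<phi>. \<phi> \<in> test_functions \<Omega> \<Longrightarrow> inner z (grad_l2 \<phi>) = inner F (l2_of \<phi>)"
    and \<rho>: "\<rho> \<in> test_functions UNIV" "\<And>x. norm x > \<epsilon> \<Longrightarrow> \<rho> x = 0" and x: "cball x \<epsilon> \<subseteq> \<Omega>"
  shows "lap (conv \<rho> (fun_of w)) x = - conv \<rho> (fun_of F) x"
proof -
  have t: "(\<lambda>y. \<rho> (x - y)) \<in> test_functions \<Omega>" unfolding test_functions_iff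
    using \<rho>(2) x by (intro conjI exI[of _ "cball x \<epsilon>"] smooth_reflect test_smooth[OF \<rho>(1)]) (auto simp: dist_norm not_le)
  have d: "partial_deriv i (\<lambda>y. \<rho> (x - y)) = (\<lambda>y. (- 1) * partial_deriv i \<rho> (x - y))" for i
    by (simp add: fun_eq_iff partial_deriv_reflect smooth_differentiable test_smooth[OF \<rho>(1)])
  have "lap (conv \<rho> (fun_of w)) x = (\<Sum>i\<in>UNIV. conv (partial_deriv i \<rho>) (fun_of (z $ i)) x)"
    unfolding lap_def by (simp add: mollified_derivatives[OF wz \<rho>(1)])
  also have "\<dots> = - inner z (grad_l2 (\<lambda>y. \<rho> (x - y)))"
    using l2_of_test_scale[OF test_reflect[OF test_partial[OF \<rho>(1)]], of "-1" _ x]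
    by (simp add: conv_l2 \<rho> test_partial fun_of_sq_int inner_grad_l2 d inner_commute sum_negf)
  also have "\<dots> = - conv \<rho> (fun_of F) x"
    unfolding weak[OF t] by (simp add: conv_l2 \<rho> fun_of_sq_int inner_commute)
  finally show ?thesis .
qed

end

text \<open>The right-hand side is minimal at t = B/N. Replacing N and B by N + e and B + e covers
  the case that one of them vanishes.\<close>

lemma young_limit:
  fixes l N B :: real
  assumes N: "0 \<le> N" and B: "0 \<le> B" and le: "\<And>t. t > 0 \<Longrightarrow> l \<le> t / 2 * N\<^sup>2 + B\<^sup>2 / (2 * t)"
  shows "l \<le> N * B"
proof (rule tendsto_lowerbound)
  show "((\<lambda>e. (N + e) * (B + e)) \<longlongrightarrow> N * B) (at_right 0)"
    by (rule tendsto_eq_intros | simp)+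
  show "eventually (\<lambda>e. l \<le> (N + e) * (B + e)) (at_right 0)"
    unfolding eventually_at_right_field
  proof (intro exI[of _ 1] conjI allI impI)
    fix e :: real assume e: "0 < e"
    have t: "(B + e) / (N + e) > 0" using N B e by simp
    have "l \<le> (B + e) / (N + e) / 2 * N\<^sup>2 + B\<^sup>2 / (2 * ((B + e) / (N + e)))" by (rule le[OF t])
    also have "\<dots> \<le> (B + e) / (N + e) / 2 * (N + e)\<^sup>2 + (B + e)\<^sup>2 / (2 * ((B + e) / (N + e)))"
      using N B e by (intro add_mono mult_left_mono divide_right_mono power_mono) auto
    also have "\<dots> = (N + e) * (B + e)"
    proof -
      have gen: "b / a / 2 * a\<^sup>2 + b\<^sup>2 / (2 * (b / a)) = a * b" if "a > 0" "b > 0" for a b :: real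
        using that by (simp add: power2_eq_square field_simps)
      show ?thesis by (rule gen) (use N B e in auto)
    qed
    finally show "l \<le> (N + e) * (B + e)" .
  qed simp
qed simp

context concave_level
begin

text \<open>For the mollified \<open>w\<close> two integrations by parts produce the true Hessian,
  which Young's inequality with parameter \<open>t\<close> pairs with \<Phi>. On \<open>S\<close>,
  outside of which \<Phi> vanishes, the cut-off is at least \<open>e\<close>, so the Hessian there
  is bounded by its cut-off integral, to which \<open>hess_sq_le\<close> applies. The mollification
  is removed with \<open>s\<close> and \<open>K\<close> fixed.\<close>

lemma hessian_duality_cut:
  fixes \<Phi> :: "'n \<Rightarrow> 'n \<Rightarrow> real^'n \<Rightarrow> real"
  assumes wz: "(w, z) \<in> H10 \<Omega>" and weak: "\<And>\<phi>. \<phi> \<in> test_functions \<Omega> \<Longrightarrow> inner z (grad_l2 \<phi>) = inner F (l2_of \<phi>)"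
    and F: "integrable lebesgue (fun_of F)" and \<Phi>: "\<And>i j. \<Phi> i j \<in> test_functions \<Omega>"
    and S: "\<And>i j x. x \<notin> S \<Longrightarrow> \<Phi> i j x = 0" "\<And>x. x \<in> S \<Longrightarrow> \<delta> \<le> \<psi> x"
    and sK: "0 < s" "s \<le> \<delta> / 2" "0 < K" and t: "0 < t" and e: "e = 1 - exp (- K * (\<delta> / 2 * exp (- 1)))"
  shows "(\<Sum>i\<in>UNIV. \<Sum>j\<in>UNIV. inner w (l2_of (partial_deriv i (partial_deriv j (\<Phi> i j)))))
    \<le> t / (2 * e) * ((norm F)\<^sup>2 + (LINT x|lebesgue. layer K s x * tang (gradv \<psi> x) (\<chi> i. fun_of (z $ i) x)))
      + (\<Sum>i\<in>UNIV. \<Sum>j\<in>UNIV. (norm (l2_of (\<Phi> i j)))\<^sup>2) / (2 * t)"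
proof -
  define B where "B = (\<Sum>i\<in>UNIV. \<Sum>j\<in>UNIV. (norm (l2_of (\<Phi> i j)))\<^sup>2)"
  have e0: "e > 0" using sK unfolding e by simp
  define \<epsilon> where "\<epsilon> n = inverse (real (Suc n))" for n
  have \<epsilon>: "\<epsilon> n > 0" "\<epsilon> \<longlonglongrightarrow> 0" for n unfolding \<epsilon>_def using LIMSEQ_inverse_real_of_nat by auto
  note mol = mollifier_properties[where 'n = 'n, OF \<epsilon>(1)]
  define v where "v n = conv (mollifier (\<epsilon> n)) (fun_of w)" for n
  note der = mollified_derivatives[OF wz mol(1)]
  have sv: "smooth (v n)" for n unfolding v_def by (rule der(3))
  have gv: "gradv (v n) = (\<lambda>x. \<chi> i. conv (mollifier (\<epsilon> n)) (fun_of (z $ i)) x)" for n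
    by (simp add: fun_eq_iff gradv_def v_def der(4))
  have sqv: "v n \<in> sq_int" for n unfolding v_def by (rule conv_contraction(1)[OF mol(1-4) fun_of_sq_int der(1)])
  have limv: "(\<lambda>n. l2_of (v n)) \<longlonglongrightarrow> w"
    using conv_mollifier_tendsto[OF fun_of_sq_int der(1) _ \<epsilon>, of \<Omega>] H10_closure(1)[OF wz] by (simp add: v_def)
  have sqz: "conv (mollifier (\<epsilon> n)) (fun_of (z $ i)) \<in> sq_int" for n i
    by (rule conv_contraction(1)[OF mol(1-4) fun_of_sq_int der(2)])
  have limz: "(\<lambda>n. l2_of (conv (mollifier (\<epsilon> n)) (fun_of (z $ i)))) \<longlonglongrightarrow> l2_of (fun_of (z $ i))" for i
    by (rule conv_mollifier_tendsto[OF fun_of_sq_int der(2) _ \<epsilon>, of _ \<Omega>]) (simp add: H10_closure(3)[OF wz])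
  have K0: "K \<ge> 0" using sK by simp
  have lay0: "x \<notin> \<Omega> \<Longrightarrow> layer K s x = 0" for x by (simp add: layer_def)
  note tl = tang_weight_tendsto[OF smooth_psi bounded layer_measurable layer_bounded[OF sK(1) K0] lay0]
  have limt: "(\<lambda>n. LINT x|lebesgue. layer K s x * tang (gradv \<psi> x) (gradv (v n) x)) \<longlonglongrightarrow> (LINT x|lebesgue. layer K s x * tang (gradv \<psi> x) (\<chi> i. fun_of (z $ i) x))"
    unfolding gv by (rule tl(1)[OF _ sqz fun_of_sq_int limz])
  have intt: "integrable lebesgue (\<lambda>x. layer K s x * tang (gradv \<psi> x) (gradv (v n) x))" for n
    unfolding gv by (rule tl(2)[of "\<lambda>k i. conv (mollifier (\<epsilon> n)) (fun_of (z $ i))"]) (simp_all add: sqz)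
  have "closed {x. s \<le> \<psi> x}" by (intro closed_Collect_le continuous_intros smooth_continuous[OF smooth_psi])
  moreover have sub: "{x. s \<le> \<psi> x} \<subseteq> \<Omega>" using sK by (auto simp: Omega)
  ultimately have "compact {x. s \<le> \<psi> x}" using bounded bounded_subset by (auto simp: compact_eq_bounded_closed)
  \<comment> \<open>Once the mollification radius is below \<open>r\<close>, the mollified equation
    holds wherever the cut-off is nonzero.\<close>
  from compact_subset_open_imp_cball_epsilon_subset[OF this open_Omega sub]
  obtain r where r: "r > 0" "(\<Union>x\<in>{x. s \<le> \<psi> x}. cball x r) \<subseteq> \<Omega>" by blast
  have ct: "(\<lambda>x. cutoff K s (\<psi> x)) \<in> test_functions \<Omega>" by (rule cut_test[OF sK(1)])
  have bound: "(\<Sum>i\<in>UNIV. \<Sum>j\<in>UNIV. inner (l2_of (v n)) (l2_of (partial_deriv i (partial_deriv j (\<Phi> i j)))))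
    \<le> t / (2 * e) * ((norm F)\<^sup>2 + (LINT x|lebesgue. layer K s x * tang (gradv \<psi> x) (gradv (v n) x))) + B / (2 * t)"
    if n: "\<epsilon> n < r" for n
  proof -
    have lap: "(LINT x|lebesgue. cutoff K s (\<psi> x) * (lap (v n) x)\<^sup>2) \<le> (norm F)\<^sup>2"
    proof -
      have cF: "conv (mollifier (\<epsilon> n)) (fun_of F) \<in> sq_int" "norm (l2_of (conv (mollifier (\<epsilon> n)) (fun_of F))) \<le> norm F"
        using conv_contraction[OF mol(1-4) fun_of_sq_int F] by auto
      have "(LINT x|lebesgue. cutoff K s (\<psi> x) * (lap (v n) x)\<^sup>2) \<le> (LINT x|lebesgue. (conv (mollifier (\<epsilon> n)) (fun_of F) x)\<^sup>2)"
      proof (rule integral_mono')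
        show "integrable lebesgue (\<lambda>x. (conv (mollifier (\<epsilon> n)) (fun_of F) x)\<^sup>2)" using cF by (simp add: sq_int_def)
        fix x
        show "cutoff K s (\<psi> x) * (lap (v n) x)\<^sup>2 \<le> (conv (mollifier (\<epsilon> n)) (fun_of F) x)\<^sup>2"
        proof (cases "s \<le> \<psi> x")
          case True
          then have "cball x r \<subseteq> \<Omega>" using r(2) by blast
          then have "cball x (\<epsilon> n) \<subseteq> \<Omega>" using n by (meson less_imp_le order_trans subset_cball)
          then have "lap (v n) x = - conv (mollifier (\<epsilon> n)) (fun_of F) x"
            unfolding v_def by (intro lap_mollified[OF wz weak mol(1,5)]) auto
          then show ?thesis using cut_bounds(1)[OF sK(1) K0, of "\<psi> x"] by (simp add: mult_left_le_one_le cut_bounds(2))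
        next
          case False
          then show ?thesis using sK by (simp add: cut_zero)
        qed
      qed simp
      also have "\<dots> = (norm (l2_of (conv (mollifier (\<epsilon> n)) (fun_of F))))\<^sup>2" using cF by (simp add: norm_l2_of_sq)
      also have "\<dots> \<le> (norm F)\<^sup>2" using cF by (intro power_mono) auto
      finally show ?thesis .
    qed
    have DDsq: "partial_deriv i (partial_deriv j (\<Phi> i j)) \<in> sq_int" for i j
      by (intro test_sq_int[of _ \<Omega>] test_partial \<Phi>)
    have parts: "inner (l2_of (v n)) (l2_of (partial_deriv i (partial_deriv j (\<Phi> i j))))
       = (LINT x|lebesgue. \<Phi> i j x * partial_deriv i (partial_deriv j (v n)) x)" for i j
    proof -
      have "inner (l2_of (v n)) (l2_of (partial_deriv i (partial_deriv j (\<Phi> i j)))) = (LINT x|lebesgue. partial_deriv i (partial_deriv j (\<Phi> i j)) x * v n x)"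
        using sqv DDsq by (simp add: inner_l2_of mult.commute)
      also have "\<dots> = - (LINT x|lebesgue. partial_deriv j (\<Phi> i j) x * partial_deriv i (v n) x)"
        by (rule integral_by_parts[OF test_partial[OF \<Phi>] sv])
      also have "\<dots> = (LINT x|lebesgue. \<Phi> i j x * partial_deriv j (partial_deriv i (v n)) x)"
        using integral_by_parts[OF \<Phi> smooth_partial[OF sv]] by simp
      finally show ?thesis unfolding partial_deriv_commute[OF sv, of i j] .
    qed
    have i1: "integrable lebesgue (\<lambda>x. \<Phi> i j x * partial_deriv i (partial_deriv j (v n)) x)" for i j
      by (intro test_integrable[OF test_mult[OF \<Phi>]] smooth_partial sv)
    have i2: "integrable lebesgue (\<lambda>x. cutoff K s (\<psi> x) * hess_sq (v n) x)"
      unfolding hess_sq_def by (intro test_integrable[OF test_mult[OF ct]] smooth_intros smooth_partial sv)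
    have i3: "integrable lebesgue (\<lambda>x. (\<Phi> i j x)\<^sup>2)" for i j using test_sq_int[OF \<Phi>] by (simp add: sq_int_def)
    have "(\<Sum>i\<in>UNIV. \<Sum>j\<in>UNIV. inner (l2_of (v n)) (l2_of (partial_deriv i (partial_deriv j (\<Phi> i j)))))
      = (LINT x|lebesgue. (\<Sum>i\<in>UNIV. \<Sum>j\<in>UNIV. \<Phi> i j x * partial_deriv i (partial_deriv j (v n)) x))"
      unfolding parts using i1 by simp
    also have "\<dots> \<le> (LINT x|lebesgue. t / (2 * e) * (cutoff K s (\<psi> x) * hess_sq (v n) x) + (\<Sum>i\<in>UNIV. \<Sum>j\<in>UNIV. (\<Phi> i j x)\<^sup>2) / (2 * t))"
    proof (rule integral_mono)
      show "integrable lebesgue (\<lambda>x. \<Sum>i\<in>UNIV. \<Sum>j\<in>UNIV. \<Phi> i j x * partial_deriv i (partial_deriv j (v n)) x)" using i1 by simp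
      show "integrable lebesgue (\<lambda>x. t / (2 * e) * (cutoff K s (\<psi> x) * hess_sq (v n) x) + (\<Sum>i\<in>UNIV. \<Sum>j\<in>UNIV. (\<Phi> i j x)\<^sup>2) / (2 * t))"
        using i2 i3 by simp
      fix x
      show "(\<Sum>i\<in>UNIV. \<Sum>j\<in>UNIV. \<Phi> i j x * partial_deriv i (partial_deriv j (v n)) x)
        \<le> t / (2 * e) * (cutoff K s (\<psi> x) * hess_sq (v n) x) + (\<Sum>i\<in>UNIV. \<Sum>j\<in>UNIV. (\<Phi> i j x)\<^sup>2) / (2 * t)"
      proof (cases "x \<in> S")
        case True
        have hs0: "0 \<le> hess_sq (v n) x" unfolding hess_sq_def by (intro sum_nonneg) auto
        have "e \<le> cutoff K s (\<psi> x)" unfolding e using cut_lower[OF sK(1,2) S(2)[OF True] K0] by simp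
        then have "hess_sq (v n) x \<le> (cutoff K s (\<psi> x) * hess_sq (v n) x) / e"
          using e0 mult_right_mono[OF _ hs0] by (subst pos_le_divide_eq) (simp_all add: mult.commute[of "hess_sq _ _" e])
        then have "t / 2 * hess_sq (v n) x \<le> t / 2 * ((cutoff K s (\<psi> x) * hess_sq (v n) x) / e)" using t by (intro mult_left_mono) auto
        moreover have "(\<Sum>i\<in>UNIV. \<Sum>j\<in>UNIV. \<Phi> i j x * partial_deriv i (partial_deriv j (v n)) x)
          \<le> (\<Sum>i\<in>UNIV. \<Sum>j\<in>UNIV. t / 2 * (partial_deriv i (partial_deriv j (v n)) x)\<^sup>2 + (\<Phi> i j x)\<^sup>2 / (2 * t))"
        proof (intro sum_mono)
          fix i j
          show "\<Phi> i j x * partial_deriv i (partial_deriv j (v n)) x \<le> t / 2 * (partial_deriv i (partial_deriv j (v n)) x)\<^sup>2 + (\<Phi> i j x)\<^sup>2 / (2 * t)"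
            using young_real[OF t, of "\<Phi> i j x" "partial_deriv i (partial_deriv j (v n)) x"] t by (simp add: field_simps)
        qed
        ultimately show ?thesis
          by (simp add: hess_sq_def sum.distrib sum_distrib_left sum_divide_distrib)
      next
        case False
        have "0 \<le> hess_sq (v n) x" unfolding hess_sq_def by (intro sum_nonneg) auto
        then show ?thesis using False S(1) t e0 cut_bounds(1)[OF sK(1) K0, of "\<psi> x"] by simp
      qed
    qed
    also have "\<dots> = t / (2 * e) * (LINT x|lebesgue. cutoff K s (\<psi> x) * hess_sq (v n) x) + B / (2 * t)"
      using i2 i3 test_sq_int[OF \<Phi>] by (simp add: B_def norm_l2_of_sq)
    also have "\<dots> \<le> t / (2 * e) * ((norm F)\<^sup>2 + (LINT x|lebesgue. layer K s x * tang (gradv \<psi> x) (gradv (v n) x))) + B / (2 * t)"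
      using order_trans[OF hess_sq_le[OF sv sK(1) K0 intt] add_right_mono[OF lap]] t e0 by (intro add_right_mono mult_left_mono) auto
    finally show ?thesis .
  qed
  have L1: "(\<lambda>n. \<Sum>i\<in>UNIV. \<Sum>j\<in>UNIV. inner (l2_of (v n)) (l2_of (partial_deriv i (partial_deriv j (\<Phi> i j)))))
    \<longlonglongrightarrow> (\<Sum>i\<in>UNIV. \<Sum>j\<in>UNIV. inner w (l2_of (partial_deriv i (partial_deriv j (\<Phi> i j)))))"
    by (intro tendsto_intros limv)
  have L2: "(\<lambda>n. t / (2 * e) * ((norm F)\<^sup>2 + (LINT x|lebesgue. layer K s x * tang (gradv \<psi> x) (gradv (v n) x))) + B / (2 * t))
    \<longlonglongrightarrow> t / (2 * e) * ((norm F)\<^sup>2 + (LINT x|lebesgue. layer K s x * tang (gradv \<psi> x) (\<chi> i. fun_of (z $ i) x))) + B / (2 * t)"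
    by (intro tendsto_intros limt)
  have "eventually (\<lambda>n. \<epsilon> n < r) sequentially" using order_tendstoD(2)[OF \<epsilon>(2) r(1)] .
  then have "eventually (\<lambda>n. (\<Sum>i\<in>UNIV. \<Sum>j\<in>UNIV. inner (l2_of (v n)) (l2_of (partial_deriv i (partial_deriv j (\<Phi> i j)))))
    \<le> t / (2 * e) * ((norm F)\<^sup>2 + (LINT x|lebesgue. layer K s x * tang (gradv \<psi> x) (gradv (v n) x))) + B / (2 * t)) sequentially"
    by eventually_elim (rule bound)
  from tendsto_le[OF sequentially_bot L2 L1 this] show ?thesis unfolding B_def .
qed

text \<open>The weak form of \<open>|D\<^sup>2 w| \<le> |\<Delta> w|\<close>, to which the Riesz theorem applies.\<close>

lemma hessian_duality_level:
  fixes \<Phi> :: "'n \<Rightarrow> 'n \<Rightarrow> real^'n \<Rightarrow> real"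
  assumes wz: "(w, z) \<in> H10 \<Omega>" and weak: "\<And>\<phi>. \<phi> \<in> test_functions \<Omega> \<Longrightarrow> inner z (grad_l2 \<phi>) = inner F (l2_of \<phi>)"
    and F: "integrable lebesgue (fun_of F)" and \<Phi>: "\<And>i j. \<Phi> i j \<in> test_functions \<Omega>"
  shows "(\<Sum>i\<in>UNIV. \<Sum>j\<in>UNIV. inner w (l2_of (partial_deriv i (partial_deriv j (\<Phi> i j)))))
    \<le> norm F * sqrt (\<Sum>i\<in>UNIV. \<Sum>j\<in>UNIV. (norm (l2_of (\<Phi> i j)))\<^sup>2)"
proof -
  let ?l = "\<Sum>i\<in>UNIV. \<Sum>j\<in>UNIV. inner w (l2_of (partial_deriv i (partial_deriv j (\<Phi> i j))))"
  define B where "B = (\<Sum>i\<in>UNIV. \<Sum>j\<in>UNIV. (norm (l2_of (\<Phi> i j)))\<^sup>2)"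
  have B0: "B \<ge> 0" unfolding B_def by (intro sum_nonneg) auto
  have "\<forall>i j. \<exists>K. compact K \<and> K \<subseteq> \<Omega> \<and> (\<forall>x. x \<notin> K \<longrightarrow> \<Phi> i j x = 0)" using \<Phi> by (auto simp: test_functions_iff)
  then obtain C where C: "\<And>i j. compact (C i j)" "\<And>i j. C i j \<subseteq> \<Omega>" "\<And>i j x. x \<notin> C i j \<Longrightarrow> \<Phi> i j x = 0" by metis
  define S where "S = (\<Union>i. \<Union>j. C i j)"
  have "compact S" unfolding S_def using C(1) by (auto intro!: compact_UN)
  moreover have "S \<subseteq> \<Omega>" unfolding S_def using C(2) by blast
  moreover have "\<Phi> i j x = 0" if "x \<notin> S" for i j x using C(3)[of x i j] that unfolding S_def by blast
  ultimately have S: "compact S" "S \<subseteq> \<Omega>" "\<And>i j x. x \<notin> S \<Longrightarrow> \<Phi> i j x = 0" by auto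
  obtain \<delta> where \<delta>: "\<delta> > 0" "\<And>x. x \<in> S \<Longrightarrow> \<delta> \<le> \<psi> x"
  proof (cases "S = {}")
    case False
    then obtain y where y: "y \<in> S" "\<And>x. x \<in> S \<Longrightarrow> \<psi> y \<le> \<psi> x"
      using continuous_attains_inf[OF S(1) False smooth_continuous[OF smooth_psi]] by blast
    show ?thesis by (rule that[of "\<psi> y"]) (use y S(2) in \<open>auto simp: Omega\<close>)
  qed (use that[of 1] in auto)
  define s where "s n = \<delta> / 2 * inverse (real (Suc n))" for n
  have s: "s n > 0" "s n \<le> \<delta> / 2" for n using \<delta>(1) by (auto simp: s_def field_simps)
  have s0: "s \<longlonglongrightarrow> 0" unfolding s_def using tendsto_mult_left[OF LIMSEQ_inverse_real_of_nat, of "\<delta>/2"] by simp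
  \<comment> \<open>The lower bound of the cut-off on \<open>S\<close>. It tends to 1 as K
    \<rightarrow> \<infinity>, a limit taken only after s \<rightarrow> 0 has removed the layer
    term, which is proportional to \<open>K\<close>.\<close>
  define E where "E K = 1 - exp (- K * (\<delta> / 2 * exp (- 1)))" for K
  have step: "?l \<le> t / (2 * E K) * (norm F)\<^sup>2 + B / (2 * t)" if K: "K > 0" and t: "t > 0" for K t
  proof -
    have lay0: "x \<notin> \<Omega> \<Longrightarrow> layer K s x = 0" for x s by (simp add: layer_def)
    have m: "(\<lambda>x. layer K s x * tang (gradv \<psi> x) (\<chi> i. fun_of (z $ i) x)) \<in> borel_measurable lebesgue" if "s > 0" for s
      by (rule borel_measurable_integrable[OF tang_weight_tendsto(2)[OF smooth_psi bounded layer_measurable layer_bounded[OF that less_imp_le[OF K]] lay0,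
          of "\<lambda>k i. fun_of (z $ i)"]]) (auto simp: fun_of_sq_int)
    have L: "(\<lambda>n. LINT x|lebesgue. layer K (s n) x * tang (gradv \<psi> x) (\<chi> i. fun_of (z $ i) x)) \<longlonglongrightarrow> 0"
      by (rule layer_integral_tendsto_0[OF tangential_hardy[OF wz weak] m less_imp_le[OF K] s(1) s0])
    have "(\<lambda>n. t / (2 * E K) * ((norm F)\<^sup>2 + (LINT x|lebesgue. layer K (s n) x * tang (gradv \<psi> x) (\<chi> i. fun_of (z $ i) x))) + B / (2 * t))
      \<longlonglongrightarrow> t / (2 * E K) * ((norm F)\<^sup>2 + 0) + B / (2 * t)"
      by (intro tendsto_intros L)
    then have "?l \<le> t / (2 * E K) * ((norm F)\<^sup>2 + 0) + B / (2 * t)"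
      by (rule LIMSEQ_le_const)
        (use hessian_duality_cut[OF wz weak F \<Phi> S(3) \<delta>(2) s K t E_def] in \<open>auto simp: B_def\<close>)
    then show ?thesis by simp
  qed
  have "?l \<le> t / 2 * (norm F)\<^sup>2 + (sqrt B)\<^sup>2 / (2 * t)" if t: "t > 0" for t
  proof -
    have "filterlim (\<lambda>n. (\<delta> / 2 * exp (- 1)) * real (Suc n)) at_top sequentially"
      using \<delta>(1) by (intro filterlim_tendsto_pos_mult_at_top[OF tendsto_const] filterlim_compose[OF filterlim_real_sequentially filterlim_Suc]) auto
    then have "filterlim (\<lambda>n. - ((\<delta> / 2 * exp (- 1)) * real (Suc n))) at_bot sequentially" by (simp add: filterlim_uminus_at_top)
    then have "(\<lambda>n. exp (- ((\<delta> / 2 * exp (- 1)) * real (Suc n)))) \<longlonglongrightarrow> 0" by (rule filterlim_compose[OF exp_at_bot])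
    then have "(\<lambda>n. 1 - exp (- ((\<delta> / 2 * exp (- 1)) * real (Suc n)))) \<longlonglongrightarrow> 1 - 0" by (intro tendsto_intros)
    moreover have "E (real (Suc n)) = 1 - exp (- ((\<delta> / 2 * exp (- 1)) * real (Suc n)))" for n
      unfolding E_def by (simp only: mult_minus_left mult.commute)
    ultimately have "(\<lambda>n. E (real (Suc n))) \<longlonglongrightarrow> 1" by simp
    then have "(\<lambda>n. t / (2 * E (real (Suc n))) * (norm F)\<^sup>2 + B / (2 * t)) \<longlonglongrightarrow> t / (2 * 1) * (norm F)\<^sup>2 + B / (2 * t)"
      by (intro tendsto_intros) auto
    then have "?l \<le> t / (2 * 1) * (norm F)\<^sup>2 + B / (2 * t)"
      by (rule LIMSEQ_le_const) (use step[OF _ t] in auto)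
    then show ?thesis using B0 by simp
  qed
  then show ?thesis unfolding B_def[symmetric] using B0 by (intro young_limit) auto
qed

end

section \<open>The Hessian estimate on convex domains\<close>

lemma exp_affine:
  fixes a :: "real^'n"
  shows "smooth (\<lambda>x. exp (b - inner a x))" "partial_deriv j (\<lambda>x. exp (b - inner a x)) = (\<lambda>x. - (a $ j) * exp (b - inner a x))"
proof -
  show "smooth (\<lambda>x. exp (b - inner a x))" unfolding inner_vec_def inner_real_def by (intro smooth_intros)
  have D: "((\<lambda>x. b - inner a x) has_derivative (\<lambda>h. - inner a h)) (at x)" for x by (auto intro!: derivative_eq_intros)
  have p: "partial_deriv j (\<lambda>x. b - inner a x) x = - (a $ j)" for x
    using partial_deriv_eq[OF D] by (simp add: inner_axis)
  have "partial_deriv j (\<lambda>x. exp (b - inner a x)) x = exp (b - inner a x) * (- (a $ j))" for x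
    using partial_deriv_compose(1)[where s = exp and g = "\<lambda>x. b - inner a x" and x = x and i = j, OF differentiableI[OF D] DERIV_exp] by (simp add: p)
  then show "partial_deriv j (\<lambda>x. exp (b - inner a x)) = (\<lambda>x. - (a $ j) * exp (b - inner a x))" by auto
qed

lemma partial_deriv_cmult_fun: "smooth f \<Longrightarrow> partial_deriv i (\<lambda>x. c * f x) = (\<lambda>x. c * partial_deriv i f x)"
  by (rule ext) (rule partial_deriv_cmult)

text \<open>The Hessian of \<psi> is minus a sum of positive multiples of a_i \<otimes> a_i, so
  \<open>hess_ge\<close> is the Cauchy-Schwarz inequality for each summand. The summand with nonzero
  \<open>a k\<close> bounds the Laplacian away from zero, uniformly because the set is
  bounded.\<close>

lemma concave_level_exp_affine:
  fixes a :: "'i \<Rightarrow> real^'n" and b :: "'i \<Rightarrow> real"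
  assumes I: "finite I" and k: "k \<in> I" "a k \<noteq> 0"
    and \<psi>: "\<psi> = (\<lambda>x. 1 - (\<Sum>i\<in>I. exp (b i - inner (a i) x)))"
    and bd: "bounded {x. 0 < \<psi> x}"
  obtains c where "concave_level \<psi> c {x. 0 < \<psi> x}"
proof -
  obtain R where R: "\<And>x. 0 < \<psi> x \<Longrightarrow> norm x \<le> R" using bd unfolding bounded_iff by blast
  \<comment> \<open>A lower bound, on the ball of radius \<open>R\<close>, for the summand of -
    \<Delta>\<psi> with index \<open>k\<close>.\<close>
  define c where "c = (norm (a k))\<^sup>2 * exp (b k - norm (a k) * R)"
  have sm: "smooth (\<lambda>x. exp (b i - inner (a i) x))" for i by (rule exp_affine)
  have p1: "partial_deriv j \<psi> = (\<lambda>x. \<Sum>i\<in>I. (a i $ j) * exp (b i - inner (a i) x))" for j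
  proof
    fix x
    have "partial_deriv j \<psi> x = partial_deriv j (\<lambda>x. 1) x - partial_deriv j (\<lambda>x. \<Sum>i\<in>I. exp (b i - inner (a i) x)) x"
      unfolding \<psi> by (intro partial_deriv_diff smooth_intros sm)
    then show "partial_deriv j \<psi> x = (\<Sum>i\<in>I. (a i $ j) * exp (b i - inner (a i) x))"
      by (simp add: partial_deriv_const partial_deriv_sum[OF sm] exp_affine sum_negf)
  qed
  have p2: "partial_deriv l (partial_deriv j \<psi>) x = (\<Sum>i\<in>I. - (a i $ l * a i $ j) * exp (b i - inner (a i) x))" for l j x
    unfolding p1 by (subst partial_deriv_sum) (auto intro!: smooth_intros sm sum.cong simp: partial_deriv_cmult[OF sm] exp_affine)
  have lap: "lap \<psi> x = - (\<Sum>i\<in>I. (norm (a i))\<^sup>2 * exp (b i - inner (a i) x))" for x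
    unfolding lap_def p2 norm_sq_vec by (subst sum.swap) (simp add: sum_distrib_right power2_eq_square sum_negf)
  have hess: "hess \<psi> x \<xi> = - (\<Sum>i\<in>I. (inner (a i) \<xi>)\<^sup>2 * exp (b i - inner (a i) x))" for x \<xi>
  proof -
    have "hess \<psi> x \<xi> = (\<Sum>l\<in>UNIV. \<Sum>j\<in>UNIV. \<Sum>i\<in>I. - (exp (b i - inner (a i) x) * ((a i $ l * \<xi> $ l) * (a i $ j * \<xi> $ j))))"
      unfolding hess_def p2 sum_distrib_right by (intro sum.cong refl) (simp add: mult_ac)
    also have "\<dots> = (\<Sum>l\<in>UNIV. \<Sum>i\<in>I. \<Sum>j\<in>UNIV. - (exp (b i - inner (a i) x) * ((a i $ l * \<xi> $ l) * (a i $ j * \<xi> $ j))))"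
      by (intro sum.cong refl sum.swap)
    also have "\<dots> = (\<Sum>i\<in>I. \<Sum>l\<in>UNIV. \<Sum>j\<in>UNIV. - (exp (b i - inner (a i) x) * ((a i $ l * \<xi> $ l) * (a i $ j * \<xi> $ j))))"
      by (rule sum.swap)
    also have "\<dots> = (\<Sum>i\<in>I. - (exp (b i - inner (a i) x) * ((\<Sum>l\<in>UNIV. a i $ l * \<xi> $ l) * (\<Sum>j\<in>UNIV. a i $ j * \<xi> $ j))))"
      unfolding sum_product by (intro sum.cong refl) (simp only: sum_distrib_left sum_negf)
    finally show ?thesis by (simp add: inner_vec_def power2_eq_square sum_negf mult.commute)
  qed
  have "concave_level \<psi> c {x. 0 < \<psi> x}"
  proof
    show "smooth \<psi>" unfolding \<psi> by (intro smooth_intros sm)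
    show "0 < c" using k(2) by (simp add: c_def)
    show "lap \<psi> x \<le> - c" if "x \<in> {x. 0 < \<psi> x}" for x
    proof -
      have "inner (a k) x \<le> norm (a k) * R"
        using order_trans[OF norm_cauchy_schwarz[of "a k" x] mult_left_mono[OF R norm_ge_zero]] that by simp
      then have "c \<le> (norm (a k))\<^sup>2 * exp (b k - inner (a k) x)" unfolding c_def by (intro mult_left_mono) auto
      also have "\<dots> \<le> (\<Sum>i\<in>I. (norm (a i))\<^sup>2 * exp (b i - inner (a i) x))" using I k by (intro member_le_sum) auto
      finally show ?thesis unfolding lap by simp
    qed
    show "lap \<psi> x * (norm \<xi>)\<^sup>2 \<le> hess \<psi> x \<xi>" for x \<xi>
    proof -
      have "(\<Sum>i\<in>I. (inner (a i) \<xi>)\<^sup>2 * exp (b i - inner (a i) x)) \<le> (\<Sum>i\<in>I. ((norm (a i))\<^sup>2 * (norm \<xi>)\<^sup>2) * exp (b i - inner (a i) x))"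
        using tang_nonneg[of _ \<xi>] unfolding tang_def by (intro sum_mono mult_right_mono) auto
      then show ?thesis unfolding lap hess by (simp add: sum_distrib_left mult_ac)
    qed
  qed (use bd in auto)
  then show ?thesis by (rule that)
qed

text \<open>A hyperplane strictly separates each point of \<open>T\<close> from \<open>K\<close>; by
  compactness finitely many of the resulting open half-spaces cover \<open>T\<close>.\<close>

lemma separating_half_spaces:
  fixes K :: "'a::euclidean_space set"
  assumes K: "compact K" "convex K" "K \<noteq> {}" and T: "compact T" "T \<inter> K = {}"
  obtains I :: "('a \<times> real) set" where "finite I" "\<And>p x. p \<in> I \<Longrightarrow> x \<in> K \<Longrightarrow> snd p < inner (fst p) x"
    "\<And>y. y \<in> T \<Longrightarrow> \<exists>p\<in>I. inner (fst p) y < snd p" "\<And>p. p \<in> I \<Longrightarrow> fst p \<noteq> 0"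
proof -
  have "\<exists>p. inner (fst p) y < snd p \<and> (\<forall>x\<in>K. snd p < inner (fst p) x)" if "y \<in> T" for y
    using separating_hyperplane_closed_point[OF K(2) compact_imp_closed[OF K(1)], of y] that T(2) by force
  then obtain p where p: "\<And>y. y \<in> T \<Longrightarrow> inner (fst (p y)) y < snd (p y)" "\<And>x y. y \<in> T \<Longrightarrow> x \<in> K \<Longrightarrow> snd (p y) < inner (fst (p y)) x"
    by metis
  have "open {x. inner (fst (p y)) x < snd (p y)}" for y by (intro open_Collect_less continuous_intros)
  moreover have "T \<subseteq> (\<Union>y\<in>T. {x. inner (fst (p y)) x < snd (p y)})" using p(1) by auto
  ultimately obtain D where D: "D \<subseteq> T" "finite D" "T \<subseteq> (\<Union>y\<in>D. {x. inner (fst (p y)) x < snd (p y)})"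
    by (rule compactE_image[OF T(1)])
  show ?thesis
  proof (rule that[of "p ` D"])
    show "fst q \<noteq> 0" if q: "q \<in> p ` D" for q
    proof -
      obtain y where y: "y \<in> D" "q = p y" using q by blast
      obtain x where "x \<in> K" using K(3) by blast
      then show ?thesis using p(1)[of y] p(2)[of y x] y D(1) by auto
    qed
  qed (use D p in auto)
qed

text \<open>The superlevel set is a smoothed polytope: 1 - \<psi> is the sum of exp(-\<beta> l_p)
  over finitely many affine functions l_p that are positive on \<open>K\<close>. Where \<psi> > 0
  every exponential is below 1, so every l_p is positive, which excludes the points outside the
  domain; a large \<beta> makes \<psi> positive on \<open>K\<close>.\<close>

lemma concave_level_exhaustion:
  fixes \<Omega> K :: "(real^'n) set"
  assumes \<Omega>: "open \<Omega>" "bounded \<Omega>" "convex \<Omega>" and K: "compact K" "K \<subseteq> \<Omega>" "K \<noteq> {}"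
  obtains \<psi> c \<Omega>' where "concave_level \<psi> c \<Omega>'" "K \<subseteq> \<Omega>'" "\<Omega>' \<subseteq> \<Omega>"
proof -
  define K' where "K' = convex hull K"
  have K': "compact K'" "convex K'" "K' \<noteq> {}" "K \<subseteq> K'" "K' \<subseteq> \<Omega>"
    using K \<Omega>(3) unfolding K'_def by (auto simp: compact_convex_hull hull_subset hull_minimal)
  obtain R where R: "R > 0" "\<Omega> \<subseteq> ball 0 R" using bounded_subset_ballD[OF \<Omega>(2), of 0] by blast
  \<comment> \<open>Only the part of the complement inside a ball is compact. A point beyond that
    ball is excluded later through the segment joining it to K', which meets
    \<open>T\<close>.\<close>
  define T where "T = cball 0 R - \<Omega>"
  have T: "compact T" "T \<inter> K' = {}" unfolding T_def using \<Omega>(1) K'(5) by (auto intro: compact_diff)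
  obtain I where I: "finite I" "\<And>p x. p \<in> I \<Longrightarrow> x \<in> K' \<Longrightarrow> snd p < inner (fst p) x"
    "\<And>y. y \<in> T \<Longrightarrow> \<exists>p\<in>I. inner (fst p) y < snd p" "\<And>p. p \<in> I \<Longrightarrow> fst p \<noteq> 0"
    using separating_half_spaces[OF K'(1-3) T] by metis
  obtain y :: "real^'n" where y: "norm y = R" using vector_choose_size[of R] R(1) by auto
  then have "y \<in> T" using R(2) by (auto simp: T_def)
  then have I0: "I \<noteq> {}" using I(3) by blast
  have "\<exists>d>0. \<forall>p\<in>I. \<forall>x\<in>K'. d \<le> inner (fst p) x - snd p"
  proof -
    have "\<exists>d>0. \<forall>x\<in>K'. d \<le> inner (fst p) x - snd p" if p: "p \<in> I" for p
    proof -
      have "continuous_on K' (\<lambda>x. inner (fst p) x - snd p)" by (intro continuous_intros)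
      then obtain m where "m \<in> K'" "\<And>x. x \<in> K' \<Longrightarrow> inner (fst p) m - snd p \<le> inner (fst p) x - snd p"
        using continuous_attains_inf[OF K'(1,3)] by blast
      then show ?thesis using I(2)[OF p] by (intro exI[of _ "inner (fst p) m - snd p"]) auto
    qed
    then obtain d where d: "\<And>p. p \<in> I \<Longrightarrow> d p > 0" "\<And>p x. p \<in> I \<Longrightarrow> x \<in> K' \<Longrightarrow> d p \<le> inner (fst p) x - snd p" by metis
    have "Min (d ` I) \<le> d p" if "p \<in> I" for p using I(1) that by simp
    moreover have "Min (d ` I) > 0" using d(1) I(1) I0 by simp
    ultimately show ?thesis using d(2) order_trans by blast
  qed
  then obtain d where d: "d > 0" "\<And>p x. p \<in> I \<Longrightarrow> x \<in> K' \<Longrightarrow> d \<le> inner (fst p) x - snd p" by blast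
  define N where "N = real (card I)"
  have N: "N \<ge> 1" unfolding N_def using I(1) I0 by (simp add: card_gt_0_iff Suc_leI)
  \<comment> \<open>Chosen so that \<beta> d = ln N + 1, which makes the sum of the \<open>N\<close>
    exponentials on K' at most exp(-1).\<close>
  define \<beta> where "\<beta> = (ln N + 1) / d"
  have \<beta>: "\<beta> > 0" unfolding \<beta>_def using N d(1) by (simp add: add_nonneg_pos)
  define a where "a p = \<beta> *\<^sub>R fst p" for p :: "(real^'n) \<times> real"
  define b where "b p = \<beta> * snd p" for p :: "(real^'n) \<times> real"
  define \<psi> where "\<psi> = (\<lambda>x. 1 - (\<Sum>p\<in>I. exp (b p - inner (a p) x)))"
  have arg: "b p - inner (a p) x = - \<beta> * (inner (fst p) x - snd p)" for p x by (simp add: a_def b_def algebra_simps)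
  have pos: "inner (fst p) x > snd p" if "0 < \<psi> x" "p \<in> I" for x p
  proof (rule ccontr)
    assume "\<not> inner (fst p) x > snd p"
    then have "1 \<le> exp (b p - inner (a p) x)" unfolding arg using \<beta> by (simp add: mult_nonneg_nonpos)
    also have "\<dots> \<le> (\<Sum>p\<in>I. exp (b p - inner (a p) x))" using I(1) that(2) by (intro member_le_sum) auto
    finally show False using that(1) by (simp add: \<psi>_def)
  qed
  have sub: "{x. 0 < \<psi> x} \<subseteq> \<Omega>"
  proof
    fix x assume "x \<in> {x. 0 < \<psi> x}"
    then have x: "0 < \<psi> x" by simp
    show "x \<in> \<Omega>"
    proof (rule ccontr)
      assume nx: "x \<notin> \<Omega>"
      obtain k where k: "k \<in> K'" using K'(3) by blast
      define g where "g t = (1 - t) *\<^sub>R k + t *\<^sub>R x" for t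
      have "\<exists>t\<ge>0. t \<le> 1 \<and> g t \<in> T"
      proof (cases "norm x \<le> R")
        case True
        then show ?thesis using nx by (intro exI[of _ 1]) (simp add: g_def T_def)
      next
        case False
        have c: "continuous_on {0..1} (\<lambda>t. norm (g t))" unfolding g_def by (intro continuous_intros)
        have "norm (g 0) \<le> R" using k K'(5) R(2) by (auto simp: g_def)
        moreover have "R \<le> norm (g 1)" using False by (simp add: g_def)
        ultimately obtain t where t: "0 \<le> t" "t \<le> 1" "norm (g t) = R" using IVT'[of "\<lambda>t. norm (g t)" 0 R 1] c by auto
        then have "g t \<in> T" using R(2) by (auto simp: T_def)
        then show ?thesis using t by blast
      qed
      then obtain t where t: "0 \<le> t" "t \<le> 1" "g t \<in> T" by blast
      obtain p where p: "p \<in> I" "inner (fst p) (g t) < snd p" using I(3)[OF t(3)] by blast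
      have "inner (fst p) (g t) = (1 - t) * inner (fst p) k + t * inner (fst p) x" by (simp add: g_def inner_add_right)
      moreover have "(1 - t) * snd p \<le> (1 - t) * inner (fst p) k" using t I(2)[OF p(1) k] by (intro mult_left_mono) auto
      moreover have "t * snd p \<le> t * inner (fst p) x" using t pos[OF x p(1)] by (intro mult_left_mono) auto
      ultimately show False using p(2) by (simp add: algebra_simps)
    qed
  qed
  have KK: "K \<subseteq> {x. 0 < \<psi> x}"
  proof
    fix x assume "x \<in> K"
    then have x: "x \<in> K'" using K'(4) by blast
    have "(\<Sum>p\<in>I. exp (b p - inner (a p) x)) \<le> (\<Sum>p\<in>I. exp (- (ln N + 1)))"
    proof (intro sum_mono)
      fix p assume "p \<in> I"
      then have "\<beta> * d \<le> \<beta> * (inner (fst p) x - snd p)" using d(2) x \<beta> by (intro mult_left_mono) auto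
      then show "exp (b p - inner (a p) x) \<le> exp (- (ln N + 1))" unfolding arg using d(1) by (simp add: \<beta>_def)
    qed
    also have "\<dots> = N * exp (- ln N) * exp (- 1)" unfolding minus_add_distrib exp_add by (simp add: N_def)
    also have "\<dots> = exp (- 1)" using N by (simp add: exp_minus)
    also have "\<dots> < 1" by simp
    finally show "x \<in> {x. 0 < \<psi> x}" by (simp add: \<psi>_def)
  qed
  obtain q where q: "q \<in> I" using I0 by blast
  have "a q \<noteq> 0" using I(4)[OF q] \<beta> by (simp add: a_def)
  then obtain c where "concave_level \<psi> c {x. 0 < \<psi> x}"
    using concave_level_exp_affine[OF I(1) q _ \<psi>_def bounded_subset[OF \<Omega>(2) sub]] by blast
  then show ?thesis using that KK sub by blast
qed

text \<open>The Poisson problem with the same right-hand side is solved on an inner set \<Omega>'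
  containing the supports of \<Phi> and of a test function whose gradient is close to
  \<open>z\<close>. Its gradient z' is the projection of \<open>z\<close> onto the closed span of
  gradients from \<Omega>', so z - z' is no longer than that distance. The bound on \<Omega>'
  carries over up to an error that Poincare controls through w - w'.\<close>

lemma hessian_duality:
  fixes \<Phi> :: "'n \<Rightarrow> 'n \<Rightarrow> real^'n \<Rightarrow> real"
  assumes \<Omega>: "open \<Omega>" "bounded \<Omega>" "convex \<Omega>" "\<Omega> \<noteq> {}"
    and wz: "(w, z) \<in> H10 \<Omega>" and weak: "\<And>\<phi>. \<phi> \<in> test_functions \<Omega> \<Longrightarrow> inner z (grad_l2 \<phi>) = inner F (l2_of \<phi>)"
    and F: "integrable lebesgue (fun_of F)" and \<Phi>: "\<And>i j. \<Phi> i j \<in> test_functions \<Omega>"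
  shows "(\<Sum>i\<in>UNIV. \<Sum>j\<in>UNIV. inner w (l2_of (partial_deriv i (partial_deriv j (\<Phi> i j)))))
    \<le> norm F * sqrt (\<Sum>i\<in>UNIV. \<Sum>j\<in>UNIV. (norm (l2_of (\<Phi> i j)))\<^sup>2)"
proof -
  let ?D = "\<lambda>i j. l2_of (partial_deriv i (partial_deriv j (\<Phi> i j)))"
  define M where "M = (\<Sum>i\<in>UNIV. \<Sum>j\<in>UNIV. norm (?D i j))"
  have M0: "M \<ge> 0" unfolding M_def by (intro sum_nonneg) auto
  obtain R where R: "\<Omega> \<subseteq> cball 0 R" "0 \<le> R"
    using bounded_subset_ballD[OF \<Omega>(2), of 0] ball_subset_cball by (metis less_imp_le subset_trans)
  have main: "(\<Sum>i\<in>UNIV. \<Sum>j\<in>UNIV. inner w (?D i j))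
    \<le> norm F * sqrt (\<Sum>i\<in>UNIV. \<Sum>j\<in>UNIV. (norm (l2_of (\<Phi> i j)))\<^sup>2) + (2 * R * e) * M" if e: "e > 0" for e
  proof -
    obtain \<phi> where \<phi>: "\<phi> \<in> test_functions \<Omega>" "norm (grad_l2 \<phi> - z) < e"
      using H10_closure(2)[OF wz] e unfolding closure_approachable dist_norm by blast
    have "\<forall>i j. \<exists>K. compact K \<and> K \<subseteq> \<Omega> \<and> (\<forall>x. x \<notin> K \<longrightarrow> \<Phi> i j x = 0)" using \<Phi> by (auto simp: test_functions_iff)
    then obtain C where C: "\<And>i j. compact (C i j)" "\<And>i j. C i j \<subseteq> \<Omega>" "\<And>i j x. x \<notin> C i j \<Longrightarrow> \<Phi> i j x = 0" by metis
    obtain C' where C': "compact C'" "C' \<subseteq> \<Omega>" "\<And>x. x \<notin> C' \<Longrightarrow> \<phi> x = 0" using \<phi>(1) by (auto simp: test_functions_iff)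
    obtain p where p: "p \<in> \<Omega>" using \<Omega>(4) by blast
    define K where "K = (\<Union>i. \<Union>j. C i j) \<union> C' \<union> {p}"
    have "compact K" unfolding K_def using C(1) C'(1) by (intro compact_Un compact_UN) (auto intro!: compact_UN)
    moreover have "K \<subseteq> \<Omega>" unfolding K_def using C(2) C'(2) p by blast
    moreover have "K \<noteq> {}" unfolding K_def by blast
    ultimately obtain \<psi> c \<Omega>' where cl: "concave_level \<psi> c \<Omega>'" and sub: "K \<subseteq> \<Omega>'" "\<Omega>' \<subseteq> \<Omega>"
      using concave_level_exhaustion[OF \<Omega>(1-3)] by metis
    have \<phi>': "\<phi> \<in> test_functions \<Omega>'"
      unfolding test_functions_iff using C' sub(1) test_smooth[OF \<phi>(1)] by (intro conjI exI[of _ C']) (auto simp: K_def)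
    have \<Phi>': "\<Phi> i j \<in> test_functions \<Omega>'" for i j
    proof -
      have "C i j \<subseteq> K" unfolding K_def by blast
      then show ?thesis unfolding test_functions_iff using C sub(1) test_smooth[OF \<Phi>] by (intro conjI exI[of _ "C i j"]) auto
    qed
    obtain w' z' where wz': "(w', z') \<in> H10 \<Omega>'" and weak': "\<And>\<phi>. \<phi> \<in> test_functions \<Omega>' \<Longrightarrow> inner z' (grad_l2 \<phi>) = inner F (l2_of \<phi>)"
      using weak_poisson_solution_exists[OF bounded_subset[OF \<Omega>(2) sub(2)]] by metis
    \<comment> \<open>Both gradients satisfy the weak equation for test functions of \<Omega>', so
      their difference is orthogonal to the gradients of these and, in the limit, to z'.\<close>
    have orth: "inner (z - z') g = 0" if "g \<in> grad_l2 ` test_functions \<Omega>'" for g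
      using that weak weak' test_mono[OF _ sub(2)] by (auto simp: inner_diff_left)
    have orth': "inner (z - z') z' = 0"
    proof -
      obtain g where g: "\<And>k. g k \<in> grad_l2 ` test_functions \<Omega>'" "g \<longlonglongrightarrow> z'"
        using H10_closure(2)[OF wz'] unfolding closure_sequential by blast
      have "(\<lambda>k. inner (z - z') (g k)) \<longlonglongrightarrow> inner (z - z') z'" by (intro tendsto_intros g)
      then show ?thesis by (simp add: orth[OF g(1)] LIMSEQ_const_iff)
    qed
    have "norm (z - z') * norm (z - z') = inner (z - z') (z - grad_l2 \<phi>)"
    proof -
      have "norm (z - z') * norm (z - z') = inner (z - z') (z - z')" by (simp add: power2_norm_eq_inner[symmetric] power2_eq_square)
      then show ?thesis using orth[OF imageI[OF \<phi>']] orth' by (simp add: inner_diff_right[of "z - z'"])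
    qed
    also have "\<dots> \<le> norm (z - z') * e"
      using \<phi>(2) by (intro order_trans[OF norm_cauchy_schwarz] mult_left_mono) (simp_all add: norm_minus_commute)
    finally have zz: "norm (z - z') \<le> e" using e by (cases "norm (z - z') = 0") (auto simp: mult_le_cancel_left)
    have "(w - w', z - z') \<in> H10 \<Omega>" using H10_diff[OF wz] wz' H10_mono[OF sub(2)] by blast
    from H10_poincare[OF this R] have "norm (w - w') \<le> 2 * R * norm (z - z')" .
    also have "\<dots> \<le> 2 * R * e" using zz R by (intro mult_left_mono) auto
    finally have ww: "norm (w - w') \<le> 2 * R * e" .
    have "(\<Sum>i\<in>UNIV. \<Sum>j\<in>UNIV. inner w (?D i j)) = (\<Sum>i\<in>UNIV. \<Sum>j\<in>UNIV. inner w' (?D i j)) + (\<Sum>i\<in>UNIV. \<Sum>j\<in>UNIV. inner (w - w') (?D i j))"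
      by (simp add: inner_diff_left sum_subtractf)
    moreover have "(\<Sum>i\<in>UNIV. \<Sum>j\<in>UNIV. inner w' (?D i j)) \<le> norm F * sqrt (\<Sum>i\<in>UNIV. \<Sum>j\<in>UNIV. (norm (l2_of (\<Phi> i j)))\<^sup>2)"
      by (rule concave_level.hessian_duality_level[OF cl wz' weak' F \<Phi>'])
    moreover have "(\<Sum>i\<in>UNIV. \<Sum>j\<in>UNIV. inner (w - w') (?D i j)) \<le> (\<Sum>i\<in>UNIV. \<Sum>j\<in>UNIV. (2 * R * e) * norm (?D i j))"
    proof (intro sum_mono)
      fix i j
      have "inner (w - w') (?D i j) \<le> norm (w - w') * norm (?D i j)" by (rule norm_cauchy_schwarz)
      also have "\<dots> \<le> (2 * R * e) * norm (?D i j)" by (intro mult_right_mono ww) auto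
      finally show "inner (w - w') (?D i j) \<le> (2 * R * e) * norm (?D i j)" .
    qed
    ultimately show ?thesis by (simp add: M_def sum_distrib_left)
  qed
  show ?thesis
  proof (rule field_le_epsilon)
    fix r :: real assume r: "r > 0"
    define e where "e = r / (2 * R * M + 1)"
    have pos: "2 * R * M + 1 > 0" using R M0 by (simp add: add_nonneg_pos)
    have "e > 0" using r pos by (simp add: e_def)
    then have "(2 * R * e) * M \<le> e * (2 * R * M + 1)" by (simp add: algebra_simps)
    also have "\<dots> = r" using pos by (simp add: e_def)
    finally show "(\<Sum>i\<in>UNIV. \<Sum>j\<in>UNIV. inner w (?D i j)) \<le> norm F * sqrt (\<Sum>i\<in>UNIV. \<Sum>j\<in>UNIV. (norm (l2_of (\<Phi> i j)))\<^sup>2) + r"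
      using main[of e] r pos by (simp add: e_def)
  qed
qed

lemma sum_single2:
  fixes c :: real and i :: "'a::finite" and j :: "'b::finite"
  shows "(\<Sum>i'\<in>UNIV. \<Sum>j'\<in>UNIV. if i' = i \<and> j' = j then c else 0) = c"
proof -
  have "(\<Sum>j'\<in>UNIV. if i' = i \<and> j' = j then c else 0) = (if i' = i then c else 0)" for i' by (cases "i' = i") simp_all
  then show ?thesis by simp
qed

text \<open>Riesz in the Hilbert space of matrices of L^2 functions, for the relation sending \<Phi>
  to the sum of \<integral> w D_i D_j \<Phi>_ij. By \<open>hessian_duality\<close> its bound is
  \<open>norm F\<close>, so existence and estimate come from the same step.\<close>

lemma weak_hessian_exists:
  assumes \<Omega>: "open \<Omega>" "bounded \<Omega>" "convex \<Omega>" "\<Omega> \<noteq> {}"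
    and wz: "(w, z) \<in> H10 \<Omega>" and weak: "\<And>\<phi>. \<phi> \<in> test_functions \<Omega> \<Longrightarrow> inner z (grad_l2 \<phi>) = inner F (l2_of \<phi>)"
    and F: "integrable lebesgue (fun_of F)"
  obtains D :: "((real^'n) l2 ^ 'n) ^ 'n" where "norm D \<le> norm F"
    "\<And>i j \<phi>. \<phi> \<in> test_functions \<Omega> \<Longrightarrow> inner (z $ i) (l2_of (partial_deriv j \<phi>)) = - inner (D $ i $ j) (l2_of \<phi>)"
proof -
  define X where "X = {\<Phi> :: 'n \<Rightarrow> 'n \<Rightarrow> real^'n \<Rightarrow> real. \<forall>i j. \<Phi> i j \<in> test_functions \<Omega>}"
  define T where "T \<Phi> = ((\<chi> i j. l2_of (\<Phi> i j)) :: ((real^'n) l2 ^ 'n) ^ 'n, \<Sum>i\<in>UNIV. \<Sum>j\<in>UNIV. inner w (l2_of (partial_deriv i (partial_deriv j (\<Phi> i j)))))"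
    for \<Phi> :: "'n \<Rightarrow> 'n \<Rightarrow> real^'n \<Rightarrow> real"
  have nrm: "norm (fst (T \<Phi>)) = sqrt (\<Sum>i\<in>UNIV. \<Sum>j\<in>UNIV. (norm (l2_of (\<Phi> i j)))\<^sup>2)" for \<Phi>
    by (simp add: T_def norm_eq_sqrt_inner inner_vec_def)
  have Tadd: "T (\<lambda>i j x. \<Phi> i j x + \<Psi> i j x) = T \<Phi> + T \<Psi>" if "\<Phi> \<in> X" "\<Psi> \<in> X" for \<Phi> \<Psi>
  proof -
    have t: "\<Phi> i j \<in> test_functions \<Omega>" "\<Psi> i j \<in> test_functions \<Omega>" for i j using that by (auto simp: X_def)
    have p1: "partial_deriv j (\<lambda>x. \<Phi> i j x + \<Psi> i j x) = (\<lambda>x. partial_deriv j (\<Phi> i j) x + partial_deriv j (\<Psi> i j) x)" for i j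
      by (intro ext partial_deriv_add smooth_differentiable test_smooth[OF t(1)] test_smooth[OF t(2)])
    have "partial_deriv i (partial_deriv j (\<lambda>x. \<Phi> i j x + \<Psi> i j x)) = (\<lambda>x. partial_deriv i (partial_deriv j (\<Phi> i j)) x + partial_deriv i (partial_deriv j (\<Psi> i j)) x)" for i j
      unfolding p1 by (intro ext partial_deriv_add smooth_differentiable smooth_partial test_smooth[OF t(1)] test_smooth[OF t(2)])
    then show ?thesis
      by (simp add: T_def vec_eq_iff l2_of_test_add[OF t(1) t(2)] l2_of_test_add[OF test_partial[OF test_partial[OF t(1)]] test_partial[OF test_partial[OF t(2)]]]
        inner_add_right sum.distrib)
  qed
  have Tscale: "T (\<lambda>i j x. c * \<Phi> i j x) = c *\<^sub>R T \<Phi>" if "\<Phi> \<in> X" for c \<Phi>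
  proof -
    have t: "\<Phi> i j \<in> test_functions \<Omega>" for i j using that by (auto simp: X_def)
    have "partial_deriv i (partial_deriv j (\<lambda>x. c * \<Phi> i j x)) = (\<lambda>x. c * partial_deriv i (partial_deriv j (\<Phi> i j)) x)" for i j
      by (simp add: partial_deriv_cmult_fun smooth_partial test_smooth[OF t])
    then show ?thesis
      by (simp add: T_def vec_eq_iff l2_of_test_scale[OF t] l2_of_test_scale[OF test_partial[OF test_partial[OF t]]] sum_distrib_left)
  qed
  have sub: "subspace (T ` X)"
  proof (rule subspaceI)
    have z: "(\<lambda>i j x. 0) \<in> X" by (simp add: X_def test_zero)
    then have "T (\<lambda>i j x. 0) = 0" using Tscale[OF z, of 0] by simp
    then show "0 \<in> T ` X" using z by (metis image_eqI)
  next
    fix a b assume "a \<in> T ` X" "b \<in> T ` X"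
    then obtain \<Phi> \<Psi> where "a = T \<Phi>" "\<Phi> \<in> X" "b = T \<Psi>" "\<Psi> \<in> X" by blast
    then show "a + b \<in> T ` X" by (intro image_eqI[of _ _ "\<lambda>i j x. \<Phi> i j x + \<Psi> i j x"]) (simp_all add: Tadd X_def test_add)
  next
    fix c a assume "a \<in> T ` X"
    then obtain \<Phi> where "a = T \<Phi>" "\<Phi> \<in> X" by blast
    then show "c *\<^sub>R a \<in> T ` X" by (intro image_eqI[of _ _ "\<lambda>i j x. c * \<Phi> i j x"]) (simp_all add: Tscale X_def test_cmult)
  qed
  have le: "snd (T \<Phi>) \<le> norm F * norm (fst (T \<Phi>))" if "\<Phi> \<in> X" for \<Phi>
    unfolding nrm using that hessian_duality[OF \<Omega> wz weak F] by (simp add: T_def X_def)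
  obtain D where D: "\<And>g r. (g, r) \<in> T ` X \<Longrightarrow> inner D g = r" "norm D \<le> norm F"
  proof (rule riesz_relation[OF sub, of "norm F"])
    fix g r assume gr: "(g, r) \<in> T ` X"
    then obtain \<Phi> where \<Phi>: "(g, r) = T \<Phi>" "\<Phi> \<in> X" by blast
    \<comment> \<open>\<open>hessian_duality\<close> is one-sided; applied to the negative of \<Phi>
      as well it bounds the absolute value.\<close>
    have m: "(\<lambda>i j x. (- 1) * \<Phi> i j x) \<in> X" using \<Phi>(2) test_cmult[of _ \<Omega> "- 1"] by (simp add: X_def)
    have "T (\<lambda>i j x. (- 1) * \<Phi> i j x) = (- g, - r)" unfolding Tscale[OF \<Phi>(2)] \<Phi>(1)[symmetric] by simp
    then show "\<bar>r\<bar> \<le> norm F * norm g" using le[OF \<Phi>(2)] le[OF m] unfolding \<Phi>(1)[symmetric] by (simp add: abs_le_iff)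
  qed auto
  have "inner (z $ i) (l2_of (partial_deriv j \<phi>)) = - inner (D $ i $ j) (l2_of \<phi>)" if \<phi>: "\<phi> \<in> test_functions \<Omega>" for i j \<phi>
  proof -
    \<comment> \<open>The single entry \<phi> at position (i, j) isolates the corresponding entry of
      \<open>D\<close>.\<close>
    define \<Phi> where "\<Phi> = (\<lambda>i' j' x. if i' = i \<and> j' = j then \<phi> x else 0)"
    have ij: "\<Phi> i' j' = (if i' = i \<and> j' = j then \<phi> else (\<lambda>x. 0))" for i' j' by (auto simp: \<Phi>_def)
    have X: "\<Phi> \<in> X" using \<phi> by (simp add: X_def ij test_zero)
    have z: "l2_of (\<lambda>x. 0) = (0 :: (real^'n) l2)" by (simp add: zero_l2_def)
    have "fst (T \<Phi>) $ i' $ j' = (if i' = i \<and> j' = j then l2_of \<phi> else 0)" for i' j' by (simp add: T_def ij z)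
    then have "inner D (fst (T \<Phi>)) = (\<Sum>i'\<in>UNIV. \<Sum>j'\<in>UNIV. if i' = i \<and> j' = j then inner (D $ i $ j) (l2_of \<phi>) else 0)"
      unfolding inner_vec_def by (intro sum.cong refl) auto
    also have "\<dots> = inner (D $ i $ j) (l2_of \<phi>)"
      by (rule sum_single2)
    finally have 1: "inner D (fst (T \<Phi>)) = inner (D $ i $ j) (l2_of \<phi>)" .
    have "snd (T \<Phi>) = (\<Sum>i'\<in>UNIV. \<Sum>j'\<in>UNIV. if i' = i \<and> j' = j then inner w (l2_of (partial_deriv i (partial_deriv j \<phi>))) else 0)"
      unfolding T_def snd_conv by (intro sum.cong refl) (auto simp: ij partial_deriv_const z)
    also have "\<dots> = inner w (l2_of (partial_deriv i (partial_deriv j \<phi>)))"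
      by (rule sum_single2)
    also have "\<dots> = - inner (z $ i) (l2_of (partial_deriv j \<phi>))"
      by (rule H10_by_parts[OF wz test_mono[OF test_partial[OF \<phi>]]]) simp
    finally have 2: "snd (T \<Phi>) = - inner (z $ i) (l2_of (partial_deriv j \<phi>))" .
    have "(fst (T \<Phi>), snd (T \<Phi>)) \<in> T ` X" using X by simp
    from D(1)[OF this] show ?thesis unfolding 1 2 by simp
  qed
  then show ?thesis using D(2) by (intro that)
qed

section \<open>Sobolev spaces and the Miranda-Talenti estimate\<close>

text \<open>Extension by zero identifies L^2 of the domain with a subspace of \<open>l2\<close>.
  Equality of extensions is equality almost everywhere in the domain, so chosen representatives
  disappear.\<close>

definition ext :: "(real^'n) set \<Rightarrow> (real^'n \<Rightarrow> real) \<Rightarrow> (real^'n) l2" where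
  "ext \<Omega> g = l2_of (\<lambda>x. indicator \<Omega> x * g x)"

definition grad_ext :: "(real^'n) set \<Rightarrow> (real^'n \<Rightarrow> real) \<Rightarrow> (real^'n) l2 ^ 'n" where
  "grad_ext \<Omega> u = (\<chi> i. ext \<Omega> (weak_partial \<Omega> i u))"

definition hess_ext :: "(real^'n) set \<Rightarrow> (real^'n \<Rightarrow> real) \<Rightarrow> ((real^'n) l2 ^ 'n) ^ 'n" where
  "hess_ext \<Omega> u = (\<chi> i j. ext \<Omega> (weak_partial \<Omega> j (weak_partial \<Omega> i u)))"

lemma norm_vec_sq: "(norm (z :: 'h::real_inner ^ 'n))\<^sup>2 = (\<Sum>i\<in>UNIV. (norm (z $ i))\<^sup>2)"
  unfolding power2_norm_eq_inner by (simp add: inner_vec_def)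

lemma norm_vec_mono: "(\<And>i. norm (z $ i) \<le> norm (y $ i)) \<Longrightarrow> norm z \<le> norm y"
  for z y :: "'h::real_inner ^ 'n"
  by (rule power2_le_imp_le) (auto simp: norm_vec_sq intro!: sum_mono power_mono)

section \<open>Translation of the function spaces on a domain into Hilbert space terms\<close>

locale bounded_domain =
  fixes \<Omega> :: "(real^'n) set"
  assumes open_domain: "open \<Omega>" and bounded_domain: "bounded \<Omega>"
begin

lemma domain_sets [measurable]: "\<Omega> \<in> sets lebesgue"
  using open_domain by auto

lemma L2_iff: "g \<in> L2 \<Omega> \<longleftrightarrow> (\<lambda>x. indicator \<Omega> x * g x) \<in> sq_int"
proof -
  have "(indicator \<Omega> x * g x)\<^sup>2 = indicator \<Omega> x * (g x)\<^sup>2" for x by (auto simp: indicator_def)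
  moreover have "\<Omega> \<inter> space lebesgue \<in> sets lebesgue" by simp
  ultimately show ?thesis
    by (simp add: L2_def sq_int_def borel_measurable_restrict_space_iff integrable_restrict_space mult.commute)
qed

lemma AE_domain: "(AE x in lebesgue_on \<Omega>. P x) \<longleftrightarrow> (AE x in lebesgue. x \<in> \<Omega> \<longrightarrow> P x)"
  by (rule AE_restrict_space_iff) simp

lemma L2_inner_ext: "g \<in> L2 \<Omega> \<Longrightarrow> h \<in> L2 \<Omega> \<Longrightarrow> L2_inner \<Omega> g h = inner (ext \<Omega> g) (ext \<Omega> h)"
proof -
  assume g: "g \<in> L2 \<Omega>" "h \<in> L2 \<Omega>"
  have "L2_inner \<Omega> g h = (LINT x|lebesgue. indicator \<Omega> x * (g x * h x))"
    unfolding L2_inner_def by (subst integral_restrict_space) auto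
  also have "\<dots> = (LINT x|lebesgue. (indicator \<Omega> x * g x) * (indicator \<Omega> x * h x))"
    by (rule Bochner_Integration.integral_cong) (auto simp: indicator_def)
  finally show ?thesis using g unfolding ext_def L2_iff by (simp add: inner_l2_of)
qed

lemma L2_norm_ext: "g \<in> L2 \<Omega> \<Longrightarrow> L2_norm \<Omega> g = norm (ext \<Omega> g)"
  by (simp add: L2_norm_def L2_inner_ext norm_eq_sqrt_inner)

lemma ext_eq_iff: "g \<in> L2 \<Omega> \<Longrightarrow> h \<in> L2 \<Omega> \<Longrightarrow> ext \<Omega> g = ext \<Omega> h \<longleftrightarrow> (AE x in lebesgue_on \<Omega>. g x = h x)"
  unfolding ext_def L2_iff AE_domain
  by (subst l2_of_eq_iff) (auto intro!: eventually_cong simp: indicator_def)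

lemma L2_lin: "g \<in> L2 \<Omega> \<Longrightarrow> h \<in> L2 \<Omega> \<Longrightarrow> (\<lambda>x. g x + c * h x) \<in> L2 \<Omega>"
  and ext_lin: "g \<in> L2 \<Omega> \<Longrightarrow> h \<in> L2 \<Omega> \<Longrightarrow> ext \<Omega> (\<lambda>x. g x + c * h x) = ext \<Omega> g + c *\<^sub>R ext \<Omega> h"
proof -
  assume g: "g \<in> L2 \<Omega>" "h \<in> L2 \<Omega>"
  have eq: "indicator \<Omega> x * (g x + c * h x) = indicator \<Omega> x * g x + c * (indicator \<Omega> x * h x)" for x by (simp add: algebra_simps)
  show "(\<lambda>x. g x + c * h x) \<in> L2 \<Omega>" using g unfolding L2_iff eq by (intro sq_int_add sq_int_scale)
  show "ext \<Omega> (\<lambda>x. g x + c * h x) = ext \<Omega> g + c *\<^sub>R ext \<Omega> h"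
    using g unfolding L2_iff ext_def eq by (simp add: l2_of_add l2_of_scale sq_int_scale)
qed

lemma L2_diff: "g \<in> L2 \<Omega> \<Longrightarrow> h \<in> L2 \<Omega> \<Longrightarrow> (\<lambda>x. g x - h x) \<in> L2 \<Omega>"
  and ext_diff: "g \<in> L2 \<Omega> \<Longrightarrow> h \<in> L2 \<Omega> \<Longrightarrow> ext \<Omega> (\<lambda>x. g x - h x) = ext \<Omega> g - ext \<Omega> h"
  using L2_lin[of g h "-1"] ext_lin[of g h "-1"] by simp_all

lemma L2_zero: "(\<lambda>x. 0) \<in> L2 \<Omega>"
  by (simp add: L2_iff sq_int_0)

lemma L2_sum: "(\<And>i. i \<in> I \<Longrightarrow> g i \<in> L2 \<Omega>) \<Longrightarrow> (\<lambda>x. \<Sum>i\<in>I. g i x) \<in> L2 \<Omega>"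
  and ext_sum: "(\<And>i. i \<in> I \<Longrightarrow> g i \<in> L2 \<Omega>) \<Longrightarrow> ext \<Omega> (\<lambda>x. \<Sum>i\<in>I. g i x) = (\<Sum>i\<in>I. ext \<Omega> (g i))"
  unfolding L2_iff ext_def sum_distrib_left by (auto intro: sq_int_sum simp: l2_of_sum)

lemma fun_of_L2: "fun_of z \<in> L2 \<Omega>"
  unfolding L2_iff by (rule sq_int_bounded_mult[OF fun_of_sq_int, of _ 1]) (auto simp: indicator_def)

lemma norm_ext_fun_of: "norm (ext \<Omega> (fun_of z)) \<le> norm z"
  using l2_norm_bounded_mult[OF fun_of_sq_int, of "indicator \<Omega>" 1 z] unfolding ext_def by (simp add: indicator_def)

lemma ext_fun_of_ext: "g \<in> L2 \<Omega> \<Longrightarrow> ext \<Omega> (fun_of (ext \<Omega> g)) = ext \<Omega> g"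
proof -
  assume g: "g \<in> L2 \<Omega>"
  then have "AE x in lebesgue. fun_of (ext \<Omega> g) x = indicator \<Omega> x * g x" unfolding ext_def L2_iff by (rule fun_of_l2_of)
  then have "AE x in lebesgue_on \<Omega>. fun_of (ext \<Omega> g) x = g x" unfolding AE_domain by eventually_elim auto
  then show ?thesis using ext_eq_iff[OF fun_of_L2 g] by simp
qed

lemma ext_fun_of_diff: "ext \<Omega> (fun_of (z - y)) = ext \<Omega> (fun_of z) - ext \<Omega> (fun_of y)"
proof -
  have "AE x in lebesgue. fun_of (z - y) x = fun_of z x - fun_of y x"
    using fun_of_l2_of[OF sq_int_diff[OF fun_of_sq_int fun_of_sq_int], of z y] by (simp add: l2_of_diff fun_of_sq_int)
  then have "AE x in lebesgue_on \<Omega>. fun_of (z - y) x = fun_of z x - fun_of y x" unfolding AE_domain by eventually_elim simp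
  then show ?thesis using ext_eq_iff[OF fun_of_L2 L2_diff[OF fun_of_L2 fun_of_L2]] by (simp add: ext_diff fun_of_L2)
qed

lemma test_L2: "\<phi> \<in> test_functions \<Omega> \<Longrightarrow> \<phi> \<in> L2 \<Omega>"
  and ext_test: "\<phi> \<in> test_functions \<Omega> \<Longrightarrow> ext \<Omega> \<phi> = l2_of \<phi>"
proof -
  assume \<phi>: "\<phi> \<in> test_functions \<Omega>"
  have eq: "indicator \<Omega> x * \<phi> x = \<phi> x" for x using test_outside[OF \<phi>, of x] by (auto simp: indicator_def)
  show "\<phi> \<in> L2 \<Omega>" "ext \<Omega> \<phi> = l2_of \<phi>" unfolding L2_iff ext_def eq by (auto intro: test_sq_int[OF \<phi>])
qed

lemma inner_ext_fun_of_test: "\<phi> \<in> test_functions \<Omega> \<Longrightarrow> inner (ext \<Omega> (fun_of z)) (l2_of \<phi>) = inner z (l2_of \<phi>)"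
proof -
  assume \<phi>: "\<phi> \<in> test_functions \<Omega>"
  have eq: "indicator \<Omega> x * fun_of z x * \<phi> x = fun_of z x * \<phi> x" for x using test_outside[OF \<phi>, of x] by (auto simp: indicator_def)
  have "inner (ext \<Omega> (fun_of z)) (l2_of \<phi>) = (LINT x|lebesgue. indicator \<Omega> x * fun_of z x * \<phi> x)"
    using fun_of_L2[of z] test_sq_int[OF \<phi>] unfolding ext_def L2_iff by (rule inner_l2_of)
  also have "\<dots> = inner (l2_of (fun_of z)) (l2_of \<phi>)" unfolding eq by (rule inner_l2_of[OF fun_of_sq_int test_sq_int[OF \<phi>], symmetric])
  finally show ?thesis by simp
qed

lemma ext_integrable: "g \<in> L2 \<Omega> \<Longrightarrow> integrable lebesgue (\<lambda>x. indicator \<Omega> x * g x)"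
  by (rule sq_int_vanishing_integrable[OF _ _ bounded_domain]) (auto simp: L2_iff)

lemma fun_of_ext_integrable: "g \<in> L2 \<Omega> \<Longrightarrow> integrable lebesgue (fun_of (ext \<Omega> g))"
proof (rule sq_int_vanishing_integrable[OF fun_of_sq_int _ bounded_domain])
  assume "g \<in> L2 \<Omega>"
  then have "AE x in lebesgue. fun_of (ext \<Omega> g) x = indicator \<Omega> x * g x" unfolding ext_def L2_iff by (rule fun_of_l2_of)
  then show "AE x in lebesgue. x \<notin> \<Omega> \<longrightarrow> fun_of (ext \<Omega> g) x = 0" by eventually_elim auto
qed

lemma ext_eq_0I:
  assumes g: "g \<in> L2 \<Omega>" and orth: "\<And>\<phi>. \<phi> \<in> test_functions \<Omega> \<Longrightarrow> inner (ext \<Omega> g) (l2_of \<phi>) = 0"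
  shows "ext \<Omega> g = 0"
proof -
  have "(LINT x|lebesgue. (indicator \<Omega> x * g x) * \<phi> x) = 0" if "\<phi> \<in> test_functions \<Omega>" for \<phi>
    using orth[OF that] g test_sq_int[OF that] unfolding ext_def L2_iff by (simp add: inner_l2_of)
  then have "AE x in lebesgue. x \<in> \<Omega> \<longrightarrow> indicator \<Omega> x * g x = 0"
    by (rule fundamental_lemma[OF ext_integrable[OF g] open_domain])
  then have "AE x in lebesgue_on \<Omega>. g x = 0" unfolding AE_domain by eventually_elim auto
  then have "ext \<Omega> g = ext \<Omega> (\<lambda>x. 0)" using ext_eq_iff[OF g L2_zero] by simp
  then show ?thesis by (simp add: ext_def zero_l2_def)
qed

lemma ext_eqI:
  assumes "g \<in> L2 \<Omega>" "h \<in> L2 \<Omega>" "\<And>\<phi>. \<phi> \<in> test_functions \<Omega> \<Longrightarrow> inner (ext \<Omega> g) (l2_of \<phi>) = inner (ext \<Omega> h) (l2_of \<phi>)"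
  shows "ext \<Omega> g = ext \<Omega> h"
  using ext_eq_0I[OF L2_diff[OF assms(1,2)]] assms by (simp add: ext_diff inner_diff_left)

lemma has_weak_partial_iff:
  "has_weak_partial \<Omega> i u g \<longleftrightarrow> u \<in> L2 \<Omega> \<and> g \<in> L2 \<Omega> \<and>
    (\<forall>\<phi>\<in>test_functions \<Omega>. inner (ext \<Omega> u) (l2_of (partial_deriv i \<phi>)) = - inner (ext \<Omega> g) (l2_of \<phi>))"
  unfolding has_weak_partial_def
  by (auto simp: L2_inner_ext test_L2 ext_test test_partial)

lemma weak_partial_works: "\<exists>g. has_weak_partial \<Omega> i u g \<Longrightarrow> has_weak_partial \<Omega> i u (weak_partial \<Omega> i u)"
  unfolding weak_partial_def using someI_ex[of "has_weak_partial \<Omega> i u"] .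

lemma weak_partial_eq: "has_weak_partial \<Omega> i u g \<Longrightarrow> ext \<Omega> (weak_partial \<Omega> i u) = ext \<Omega> g"
proof -
  assume g: "has_weak_partial \<Omega> i u g"
  then have "has_weak_partial \<Omega> i u (weak_partial \<Omega> i u)" by (intro weak_partial_works) blast
  then show ?thesis using g unfolding has_weak_partial_iff by (intro ext_eqI) auto
qed

lemma has_weak_partial_cong: "has_weak_partial \<Omega> i u g \<Longrightarrow> v \<in> L2 \<Omega> \<Longrightarrow> ext \<Omega> v = ext \<Omega> u \<Longrightarrow> has_weak_partial \<Omega> i v g"
  unfolding has_weak_partial_iff by auto

lemma has_weak_partial_lin:
  "has_weak_partial \<Omega> i u g \<Longrightarrow> has_weak_partial \<Omega> i v h \<Longrightarrow> has_weak_partial \<Omega> i (\<lambda>x. u x + c * v x) (\<lambda>x. g x + c * h x)"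
  unfolding has_weak_partial_iff by (auto simp: L2_lin ext_lin inner_add_left)

lemma H1_L2: "u \<in> H1 \<Omega> \<Longrightarrow> u \<in> L2 \<Omega>"
  by (simp add: H1_def)

lemma H1_weak_partial: "u \<in> H1 \<Omega> \<Longrightarrow> has_weak_partial \<Omega> i u (weak_partial \<Omega> i u)"
  by (rule weak_partial_works) (auto simp: H1_def)

lemma H1_weak_partial_L2: "u \<in> H1 \<Omega> \<Longrightarrow> weak_partial \<Omega> i u \<in> L2 \<Omega>"
  using H1_weak_partial unfolding has_weak_partial_def by blast

text \<open>\<open>weak_partial\<close> is chosen per representative, and a second weak derivative
  is a derivative of such a chosen function. Independence of the representative is therefore needed
  to compute with second derivatives at all.\<close>

lemma H1_cong: "u \<in> H1 \<Omega> \<Longrightarrow> v \<in> L2 \<Omega> \<Longrightarrow> ext \<Omega> v = ext \<Omega> u \<Longrightarrow> v \<in> H1 \<Omega>"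
  and weak_partial_cong: "u \<in> H1 \<Omega> \<Longrightarrow> v \<in> L2 \<Omega> \<Longrightarrow> ext \<Omega> v = ext \<Omega> u \<Longrightarrow> ext \<Omega> (weak_partial \<Omega> i v) = ext \<Omega> (weak_partial \<Omega> i u)"
proof -
  assume a: "u \<in> H1 \<Omega>" "v \<in> L2 \<Omega>" "ext \<Omega> v = ext \<Omega> u"
  have h: "has_weak_partial \<Omega> i v (weak_partial \<Omega> i u)" for i by (rule has_weak_partial_cong[OF H1_weak_partial[OF a(1)] a(2,3)])
  then show "v \<in> H1 \<Omega>" using a by (auto simp: H1_def)
  show "ext \<Omega> (weak_partial \<Omega> i v) = ext \<Omega> (weak_partial \<Omega> i u)" by (rule weak_partial_eq[OF h])
qed

lemma H1_lin: "u \<in> H1 \<Omega> \<Longrightarrow> v \<in> H1 \<Omega> \<Longrightarrow> (\<lambda>x. u x + c * v x) \<in> H1 \<Omega>"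
  and weak_partial_lin: "u \<in> H1 \<Omega> \<Longrightarrow> v \<in> H1 \<Omega> \<Longrightarrow>
    ext \<Omega> (weak_partial \<Omega> i (\<lambda>x. u x + c * v x)) = ext \<Omega> (\<lambda>x. weak_partial \<Omega> i u x + c * weak_partial \<Omega> i v x)"
proof -
  assume a: "u \<in> H1 \<Omega>" "v \<in> H1 \<Omega>"
  have h: "has_weak_partial \<Omega> i (\<lambda>x. u x + c * v x) (\<lambda>x. weak_partial \<Omega> i u x + c * weak_partial \<Omega> i v x)" for i
    by (intro has_weak_partial_lin H1_weak_partial a)
  then show "(\<lambda>x. u x + c * v x) \<in> H1 \<Omega>" using a by (auto simp: H1_def L2_lin)
  show "ext \<Omega> (weak_partial \<Omega> i (\<lambda>x. u x + c * v x)) = ext \<Omega> (\<lambda>x. weak_partial \<Omega> i u x + c * weak_partial \<Omega> i v x)"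
    by (rule weak_partial_eq[OF h])
qed

lemma grad_ext_lin: "u \<in> H1 \<Omega> \<Longrightarrow> v \<in> H1 \<Omega> \<Longrightarrow> grad_ext \<Omega> (\<lambda>x. u x + c * v x) = grad_ext \<Omega> u + c *\<^sub>R grad_ext \<Omega> v"
  by (simp add: grad_ext_def vec_eq_iff weak_partial_lin ext_lin H1_weak_partial_L2)

lemma H2_H1: "u \<in> H2 \<Omega> \<Longrightarrow> u \<in> H1 \<Omega>" "u \<in> H2 \<Omega> \<Longrightarrow> weak_partial \<Omega> i u \<in> H1 \<Omega>"
  by (auto simp: H2_def)

lemma H2_hessian_L2: "u \<in> H2 \<Omega> \<Longrightarrow> weak_partial \<Omega> j (weak_partial \<Omega> i u) \<in> L2 \<Omega>"
  by (intro H1_weak_partial_L2 H2_H1)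

lemma H2_lin: "u \<in> H2 \<Omega> \<Longrightarrow> v \<in> H2 \<Omega> \<Longrightarrow> (\<lambda>x. u x + c * v x) \<in> H2 \<Omega>"
  and weak_partial2_lin: "u \<in> H2 \<Omega> \<Longrightarrow> v \<in> H2 \<Omega> \<Longrightarrow>
    ext \<Omega> (weak_partial \<Omega> j (weak_partial \<Omega> i (\<lambda>x. u x + c * v x)))
      = ext \<Omega> (\<lambda>x. weak_partial \<Omega> j (weak_partial \<Omega> i u) x + c * weak_partial \<Omega> j (weak_partial \<Omega> i v) x)"
proof -
  assume a: "u \<in> H2 \<Omega>" "v \<in> H2 \<Omega>"
  have l: "(\<lambda>x. weak_partial \<Omega> i u x + c * weak_partial \<Omega> i v x) \<in> H1 \<Omega>" for i by (intro H1_lin H2_H1 a)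
  have w: "weak_partial \<Omega> i (\<lambda>x. u x + c * v x) \<in> L2 \<Omega>" for i by (intro H1_weak_partial_L2 H1_lin H2_H1 a)
  have e: "ext \<Omega> (weak_partial \<Omega> i (\<lambda>x. u x + c * v x)) = ext \<Omega> (\<lambda>x. weak_partial \<Omega> i u x + c * weak_partial \<Omega> i v x)" for i
    by (intro weak_partial_lin H2_H1 a)
  show "(\<lambda>x. u x + c * v x) \<in> H2 \<Omega>" unfolding H2_def using H1_lin[OF H2_H1(1)[OF a(1)] H2_H1(1)[OF a(2)]] H1_cong[OF l w e] by simp
  show "ext \<Omega> (weak_partial \<Omega> j (weak_partial \<Omega> i (\<lambda>x. u x + c * v x)))
      = ext \<Omega> (\<lambda>x. weak_partial \<Omega> j (weak_partial \<Omega> i u) x + c * weak_partial \<Omega> j (weak_partial \<Omega> i v) x)"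
    unfolding weak_partial_cong[OF l w e] by (intro weak_partial_lin H2_H1 a)
qed

lemma hess_ext_lin: "u \<in> H2 \<Omega> \<Longrightarrow> v \<in> H2 \<Omega> \<Longrightarrow> hess_ext \<Omega> (\<lambda>x. u x + c * v x) = hess_ext \<Omega> u + c *\<^sub>R hess_ext \<Omega> v"
  by (simp add: hess_ext_def vec_eq_iff weak_partial2_lin ext_lin H2_hessian_L2)

lemma test_has_weak_partial: "\<phi> \<in> test_functions \<Omega> \<Longrightarrow> has_weak_partial \<Omega> i \<phi> (partial_deriv i \<phi>)"
proof -
  assume \<phi>: "\<phi> \<in> test_functions \<Omega>"
  have "inner (l2_of \<phi>) (l2_of (partial_deriv i \<psi>)) = - inner (l2_of (partial_deriv i \<phi>)) (l2_of \<psi>)" if \<psi>: "\<psi> \<in> test_functions \<Omega>" for \<psi>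
    using H10_by_parts[OF H10_test[OF \<phi>] test_mono[OF \<psi>], of i] by (simp add: grad_l2_def)
  then show ?thesis unfolding has_weak_partial_iff using \<phi> by (simp add: test_L2 test_partial ext_test)
qed

lemma test_H1: "\<phi> \<in> test_functions \<Omega> \<Longrightarrow> \<phi> \<in> H1 \<Omega>"
  using test_has_weak_partial test_L2 unfolding H1_def by blast

lemma grad_ext_test: "\<phi> \<in> test_functions \<Omega> \<Longrightarrow> grad_ext \<Omega> \<phi> = grad_l2 \<phi>"
  by (simp add: grad_ext_def grad_l2_def vec_eq_iff weak_partial_eq[OF test_has_weak_partial] ext_test test_partial)

lemma H1_norm_ext: "u \<in> H1 \<Omega> \<Longrightarrow> H1_norm \<Omega> u = sqrt ((norm (ext \<Omega> u))\<^sup>2 + (norm (grad_ext \<Omega> u))\<^sup>2)"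
  unfolding H1_norm_def norm_vec_sq by (simp add: L2_norm_ext H1_L2 H1_weak_partial_L2 grad_ext_def)

lemma H2_norm_ext: "u \<in> H2 \<Omega> \<Longrightarrow> H2_norm \<Omega> u = sqrt ((norm (ext \<Omega> u))\<^sup>2 + (norm (grad_ext \<Omega> u))\<^sup>2 + (norm (hess_ext \<Omega> u))\<^sup>2)"
  unfolding H2_norm_def norm_vec_sq
  by (simp add: L2_norm_ext H1_L2 H2_H1 H1_weak_partial_L2 grad_ext_def hess_ext_def)

text \<open>The H^1 norm of u - \<phi> is exactly the distance of the two pairs in the product
  space, so approximation by test functions is membership in the closure \<open>H10\<close>.\<close>

lemma H1_zero_iff: "u \<in> H1_zero \<Omega> \<longleftrightarrow> u \<in> H1 \<Omega> \<and> (ext \<Omega> u, grad_ext \<Omega> u) \<in> H10 \<Omega>"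
proof -
  have eq: "H1_norm \<Omega> (\<lambda>x. u x - \<phi> x) = dist (l2_of \<phi>, grad_l2 \<phi>) (ext \<Omega> u, grad_ext \<Omega> u)"
    if "u \<in> H1 \<Omega>" "\<phi> \<in> test_functions \<Omega>" for \<phi>
    using H1_lin[OF that(1) test_H1[OF that(2)], of "-1"] grad_ext_lin[OF that(1) test_H1[OF that(2)], of "-1"] that
    by (simp add: H1_norm_ext ext_diff H1_L2 test_L2 ext_test grad_ext_test dist_norm norm_Pair norm_minus_commute)
  show ?thesis
  proof (intro iffI conjI)
    assume u: "u \<in> H1_zero \<Omega>"
    then show u1: "u \<in> H1 \<Omega>" by (simp add: H1_zero_def)
    from u obtain \<phi> where \<phi>: "\<And>k. \<phi> k \<in> test_functions \<Omega>" "(\<lambda>k. H1_norm \<Omega> (\<lambda>x. u x - \<phi> k x)) \<longlonglongrightarrow> 0"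
      unfolding H1_zero_def by blast
    have "(\<lambda>k. dist (l2_of (\<phi> k), grad_l2 (\<phi> k)) (ext \<Omega> u, grad_ext \<Omega> u)) \<longlonglongrightarrow> 0" using \<phi>(2) by (simp add: eq[OF u1 \<phi>(1)])
    then have "(\<lambda>k. (l2_of (\<phi> k), grad_l2 (\<phi> k))) \<longlonglongrightarrow> (ext \<Omega> u, grad_ext \<Omega> u)" by (rule iffD2[OF tendsto_dist_iff])
    then show "(ext \<Omega> u, grad_ext \<Omega> u) \<in> H10 \<Omega>"
      unfolding H10_def closure_sequential using \<phi>(1) by (intro exI[of _ "\<lambda>k. (l2_of (\<phi> k), grad_l2 (\<phi> k))"]) simp
  next
    assume "u \<in> H1 \<Omega> \<and> (ext \<Omega> u, grad_ext \<Omega> u) \<in> H10 \<Omega>"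
    then obtain \<phi> where u: "u \<in> H1 \<Omega>" and \<phi>: "\<And>k. \<phi> k \<in> test_functions \<Omega>" "(\<lambda>k. l2_of (\<phi> k)) \<longlonglongrightarrow> ext \<Omega> u" "(\<lambda>k. grad_l2 (\<phi> k)) \<longlonglongrightarrow> grad_ext \<Omega> u"
      unfolding H10_seq by blast
    have "(\<lambda>k. dist (l2_of (\<phi> k), grad_l2 (\<phi> k)) (ext \<Omega> u, grad_ext \<Omega> u)) \<longlonglongrightarrow> 0"
      by (rule iffD1[OF tendsto_dist_iff tendsto_Pair[OF \<phi>(2,3)]])
    then have "(\<lambda>k. H1_norm \<Omega> (\<lambda>x. u x - \<phi> k x)) \<longlonglongrightarrow> 0" by (simp add: eq[OF u \<phi>(1)])
    then show "u \<in> H1_zero \<Omega>" unfolding H1_zero_def using u \<phi>(1) by blast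
  qed
qed

lemma V_iff: "u \<in> V_space \<Omega> \<longleftrightarrow> u \<in> H2 \<Omega> \<and> (ext \<Omega> u, grad_ext \<Omega> u) \<in> H10 \<Omega>"
  unfolding V_space_def by (auto simp: H1_zero_iff H2_H1)

lemma V_H2: "u \<in> V_space \<Omega> \<Longrightarrow> u \<in> H2 \<Omega>"
  by (simp add: V_iff)

lemma V_lin: "u \<in> V_space \<Omega> \<Longrightarrow> v \<in> V_space \<Omega> \<Longrightarrow> (\<lambda>x. u x + c * v x) \<in> V_space \<Omega>"
proof -
  assume a: "u \<in> V_space \<Omega>" "v \<in> V_space \<Omega>"
  then have h: "u \<in> H2 \<Omega>" "v \<in> H2 \<Omega>" by (auto simp: V_iff)
  have "(ext \<Omega> u, grad_ext \<Omega> u) + c *\<^sub>R (ext \<Omega> v, grad_ext \<Omega> v) \<in> H10 \<Omega>"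
    using a by (intro subspace_add subspace_scale subspace_H10) (auto simp: V_iff)
  then show ?thesis unfolding V_iff using H2_lin[OF h] by (simp add: ext_lin grad_ext_lin H2_H1 H1_L2 h)
qed

lemma V_diff: "u \<in> V_space \<Omega> \<Longrightarrow> v \<in> V_space \<Omega> \<Longrightarrow> (\<lambda>x. u x - v x) \<in> V_space \<Omega>"
  using V_lin[of u v "-1"] by simp

lemma hess_ext_diff: "u \<in> V_space \<Omega> \<Longrightarrow> v \<in> V_space \<Omega> \<Longrightarrow> hess_ext \<Omega> (\<lambda>x. u x - v x) = hess_ext \<Omega> u - hess_ext \<Omega> v"
  using hess_ext_lin[of u v "-1"] by (simp add: V_H2)

lemma weak_hessian_nth: "weak_hessian \<Omega> u x $ i $ j = weak_partial \<Omega> j (weak_partial \<Omega> i u) x"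
  by (simp add: weak_hessian_def)

lemma weak_hessian_L2: "u \<in> V_space \<Omega> \<Longrightarrow> (\<lambda>x. weak_hessian \<Omega> u x $ i $ j) \<in> L2 \<Omega>"
  by (simp add: weak_hessian_nth H2_hessian_L2 V_H2)

lemma hess_ext_nth: "hess_ext \<Omega> u $ i $ j = ext \<Omega> (\<lambda>x. weak_hessian \<Omega> u x $ i $ j)"
  by (simp add: hess_ext_def weak_hessian_nth)

lemma weak_hessian_lin:
  assumes "u \<in> V_space \<Omega>" "v \<in> V_space \<Omega>"
  shows "AE x in lebesgue_on \<Omega>. weak_hessian \<Omega> (\<lambda>x. u x + c * v x) x = weak_hessian \<Omega> u x + c *\<^sub>R weak_hessian \<Omega> v x"
proof -
  have h: "u \<in> H2 \<Omega>" "v \<in> H2 \<Omega>" using assms by (auto simp: V_iff)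
  have "AE x in lebesgue_on \<Omega>. weak_partial \<Omega> j (weak_partial \<Omega> i (\<lambda>x. u x + c * v x)) x
      = weak_partial \<Omega> j (weak_partial \<Omega> i u) x + c * weak_partial \<Omega> j (weak_partial \<Omega> i v) x" for i j
    using weak_partial2_lin[OF h, of j i c]
    by (subst (asm) ext_eq_iff) (auto intro!: L2_lin H2_hessian_L2 h H2_lin)
  then have "AE x in lebesgue_on \<Omega>. \<forall>i j. weak_partial \<Omega> j (weak_partial \<Omega> i (\<lambda>x. u x + c * v x)) x
      = weak_partial \<Omega> j (weak_partial \<Omega> i u) x + c * weak_partial \<Omega> j (weak_partial \<Omega> i v) x"
    by (simp add: AE_all_countable)
  then show ?thesis by eventually_elim (simp add: vec_eq_iff weak_hessian_nth)
qed

lemma weak_hessian_diff: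
  "u \<in> V_space \<Omega> \<Longrightarrow> v \<in> V_space \<Omega> \<Longrightarrow> AE x in lebesgue_on \<Omega>. weak_hessian \<Omega> (\<lambda>x. u x - v x) x = weak_hessian \<Omega> u x - weak_hessian \<Omega> v x"
  using weak_hessian_lin[of u v "-1"] by simp

lemma hess_ext_by_parts:
  assumes u: "u \<in> V_space \<Omega>" and \<phi>: "\<phi> \<in> test_functions \<Omega>"
  shows "inner (grad_ext \<Omega> u $ i) (l2_of (partial_deriv j \<phi>)) = - inner (hess_ext \<Omega> u $ i $ j) (l2_of \<phi>)"
  using H1_weak_partial[OF H2_H1(2)[OF V_H2[OF u]], of j i] \<phi> unfolding has_weak_partial_iff by (simp add: grad_ext_def hess_ext_def)

text \<open>Both mixed derivatives have the same pairing with every test function, because second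
  derivatives of the test function commute.\<close>

lemma weak_hessian_symmetric:
  assumes u: "u \<in> V_space \<Omega>"
  shows "AE x in lebesgue_on \<Omega>. weak_hessian \<Omega> u x \<in> sym_matrices"
proof -
  have "ext \<Omega> (\<lambda>x. weak_hessian \<Omega> u x $ i $ j) = ext \<Omega> (\<lambda>x. weak_hessian \<Omega> u x $ j $ i)" for i j
  proof (rule ext_eqI)
    fix \<phi> assume \<phi>: "\<phi> \<in> test_functions \<Omega>"
    have e: "inner (hess_ext \<Omega> u $ i $ j) (l2_of \<phi>) = inner (ext \<Omega> u) (l2_of (partial_deriv i (partial_deriv j \<phi>)))" for i j
    proof -
      have "inner (ext \<Omega> u) (l2_of (partial_deriv i (partial_deriv j \<phi>))) = - inner (grad_ext \<Omega> u $ i) (l2_of (partial_deriv j \<phi>))"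
        using u unfolding V_iff by (intro H10_by_parts[of _ _ \<Omega>] test_mono[OF test_partial[OF \<phi>]]) auto
      then show ?thesis using hess_ext_by_parts[OF u \<phi>, of i j] by simp
    qed
    show "inner (ext \<Omega> (\<lambda>x. weak_hessian \<Omega> u x $ i $ j)) (l2_of \<phi>) = inner (ext \<Omega> (\<lambda>x. weak_hessian \<Omega> u x $ j $ i)) (l2_of \<phi>)"
      unfolding hess_ext_nth[symmetric] e partial_deriv_commute[OF test_smooth[OF \<phi>], of i j] ..
  qed (auto intro: weak_hessian_L2 u)
  then have "AE x in lebesgue_on \<Omega>. weak_hessian \<Omega> u x $ i $ j = weak_hessian \<Omega> u x $ j $ i" for i j
    using ext_eq_iff[OF weak_hessian_L2[OF u] weak_hessian_L2[OF u]] by blast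
  then have "AE x in lebesgue_on \<Omega>. \<forall>i j. weak_hessian \<Omega> u x $ i $ j = weak_hessian \<Omega> u x $ j $ i" by (simp add: AE_all_countable)
  then show ?thesis by eventually_elim (simp add: sym_matrices_def transpose_def vec_eq_iff)
qed

lemma trace_L2: "u \<in> V_space \<Omega> \<Longrightarrow> (\<lambda>x. trace (weak_hessian \<Omega> u x)) \<in> L2 \<Omega>"
  and ext_trace: "u \<in> V_space \<Omega> \<Longrightarrow> ext \<Omega> (\<lambda>x. trace (weak_hessian \<Omega> u x)) = (\<Sum>i\<in>UNIV. hess_ext \<Omega> u $ i $ i)"
  unfolding trace_def by (auto intro!: L2_sum weak_hessian_L2 simp: ext_sum weak_hessian_L2 hess_ext_nth)

lemma V_weak_poisson:
  assumes u: "u \<in> V_space \<Omega>" and \<phi>: "\<phi> \<in> test_functions \<Omega>"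
  shows "inner (grad_ext \<Omega> u) (grad_l2 \<phi>) = inner (- ext \<Omega> (\<lambda>x. trace (weak_hessian \<Omega> u x))) (l2_of \<phi>)"
  unfolding inner_grad_l2 hess_ext_by_parts[OF u \<phi>] ext_trace[OF u] by (simp add: sum_negf inner_sum_left)

text \<open>\<open>D\<close> is known only through its pairings with test functions of the domain
  and may be nonzero outside, hence the restriction in the conclusion. The components of
  \<open>w\<close> and \<open>z\<close> vanish outside, being limits of test functions.\<close>

lemma V_from_l2:
  assumes wz: "(w, z) \<in> H10 \<Omega>"
    and D: "\<And>i j \<phi>. \<phi> \<in> test_functions \<Omega> \<Longrightarrow> inner (z $ i) (l2_of (partial_deriv j \<phi>)) = - inner (D $ i $ j) (l2_of \<phi>)"
  obtains u where "u \<in> V_space \<Omega>" "ext \<Omega> u = w" "grad_ext \<Omega> u = z" "\<And>i j. hess_ext \<Omega> u $ i $ j = ext \<Omega> (fun_of (D $ i $ j))"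
proof -
  have ext_id: "ext \<Omega> (fun_of y) = y" if y: "y \<in> closure (l2_of ` test_functions \<Omega>)" for y
  proof -
    have "AE x in lebesgue. indicator \<Omega> x * fun_of y x = fun_of y x"
      using closure_test_vanishes[OF y domain_sets] by eventually_elim (auto simp: indicator_def)
    then have "l2_of (\<lambda>x. indicator \<Omega> x * fun_of y x) = l2_of (fun_of y)"
      using fun_of_L2[of y] unfolding L2_iff by (subst l2_of_eq_iff) (auto simp: fun_of_sq_int)
    then show ?thesis by (simp add: ext_def)
  qed
  have ew: "ext \<Omega> (fun_of w) = w" by (rule ext_id[OF H10_closure(1)[OF wz]])
  have ez: "ext \<Omega> (fun_of (z $ i)) = z $ i" for i by (rule ext_id[OF H10_closure(3)[OF wz]])
  define u where "u = fun_of w"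
  have p1: "has_weak_partial \<Omega> i u (fun_of (z $ i))" for i
    unfolding has_weak_partial_iff u_def ew ez using H10_by_parts[OF wz test_mono] fun_of_L2 by blast
  have p2: "has_weak_partial \<Omega> j (fun_of (z $ i)) (fun_of (D $ i $ j))" for i j
    unfolding has_weak_partial_iff ez using D by (simp add: fun_of_L2 inner_ext_fun_of_test)
  have u1: "u \<in> H1 \<Omega>" unfolding H1_def using p1 fun_of_L2 by (auto simp: u_def)
  have z1: "fun_of (z $ i) \<in> H1 \<Omega>" for i unfolding H1_def using p2 fun_of_L2 by auto
  have ewp: "ext \<Omega> (weak_partial \<Omega> i u) = ext \<Omega> (fun_of (z $ i))" for i by (rule weak_partial_eq[OF p1])
  have wpL: "weak_partial \<Omega> i u \<in> L2 \<Omega>" for i by (rule H1_weak_partial_L2[OF u1])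
  have u2: "u \<in> H2 \<Omega>" unfolding H2_def using u1 H1_cong[OF z1 wpL ewp] by simp
  have g: "grad_ext \<Omega> u = z" by (simp add: grad_ext_def vec_eq_iff ewp ez)
  have h: "hess_ext \<Omega> u $ i $ j = ext \<Omega> (fun_of (D $ i $ j))" for i j
    using weak_partial_cong[OF z1 wpL ewp, of j] weak_partial_eq[OF p2] by (simp add: hess_ext_def)
  have "u \<in> V_space \<Omega>" unfolding V_iff using u2 wz g ew by (simp add: u_def)
  then show ?thesis using that ew g h by (simp add: u_def)
qed

text \<open>Values, gradients and Hessians converge in a product Hilbert space. Closedness of
  \<open>H10\<close> and passage to the limit in the integration by parts show that the limits
  belong to one function.\<close>

lemma V_complete:
  assumes u: "\<And>k. u k \<in> V_space \<Omega>" and Cauchy: "\<And>e. e > 0 \<Longrightarrow> \<exists>N. \<forall>m\<ge>N. \<forall>n\<ge>N. H2_norm \<Omega> (\<lambda>x. u m x - u n x) < e"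
  obtains v where "v \<in> V_space \<Omega>" "(\<lambda>k. H2_norm \<Omega> (\<lambda>x. u k x - v x)) \<longlonglongrightarrow> 0" "(\<lambda>k. hess_ext \<Omega> (u k)) \<longlonglongrightarrow> hess_ext \<Omega> v"
proof -
  define p where "p k = ((ext \<Omega> (u k), grad_ext \<Omega> (u k)), hess_ext \<Omega> (u k))" for k
  have h: "u k \<in> H2 \<Omega>" for k using u V_H2 by blast
  have nrm: "H2_norm \<Omega> (\<lambda>x. f x - g x) = sqrt ((norm (ext \<Omega> f - ext \<Omega> g))\<^sup>2 + (norm (grad_ext \<Omega> f - grad_ext \<Omega> g))\<^sup>2 + (norm (hess_ext \<Omega> f - hess_ext \<Omega> g))\<^sup>2)"
    if "f \<in> V_space \<Omega>" "g \<in> V_space \<Omega>" for f g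
    using H2_norm_ext[OF V_H2[OF V_diff[OF that]]] grad_ext_lin[of f g "-1"] that
    by (simp add: ext_diff hess_ext_diff H1_L2 H2_H1 V_H2)
  have dp: "dist (p m) (p n) = H2_norm \<Omega> (\<lambda>x. u m x - u n x)" for m n
    unfolding p_def nrm[OF u u] by (simp add: dist_norm norm_Pair)
  have "Cauchy p" using Cauchy unfolding Cauchy_def dp by blast
  then obtain q where q: "p \<longlonglongrightarrow> q" using Cauchy_convergent convergent_def by blast
  obtain w z D where wzD: "q = ((w, z), D)" by (metis surj_pair)
  have lim: "(\<lambda>k. (ext \<Omega> (u k), grad_ext \<Omega> (u k))) \<longlonglongrightarrow> (w, z)" "(\<lambda>k. hess_ext \<Omega> (u k)) \<longlonglongrightarrow> D"
    using tendsto_fst[OF q] tendsto_snd[OF q] by (simp_all add: p_def wzD)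
  then have lim': "(\<lambda>k. ext \<Omega> (u k)) \<longlonglongrightarrow> w" "(\<lambda>k. grad_ext \<Omega> (u k)) \<longlonglongrightarrow> z"
    using tendsto_fst[OF lim(1)] tendsto_snd[OF lim(1)] by simp_all
  have "closed (H10 \<Omega>)" by (simp add: H10_def)
  then have wz: "(w, z) \<in> H10 \<Omega>"
    by (rule closed_sequentially[OF _ _ lim(1)]) (use u in \<open>simp add: V_iff\<close>)
  have parts: "inner (z $ i) (l2_of (partial_deriv j \<phi>)) = - inner (D $ i $ j) (l2_of \<phi>)" if \<phi>: "\<phi> \<in> test_functions \<Omega>" for i j \<phi>
  proof (rule LIMSEQ_unique)
    show "(\<lambda>k. inner (grad_ext \<Omega> (u k) $ i) (l2_of (partial_deriv j \<phi>))) \<longlonglongrightarrow> inner (z $ i) (l2_of (partial_deriv j \<phi>))"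
      by (intro tendsto_intros lim')
    show "(\<lambda>k. inner (grad_ext \<Omega> (u k) $ i) (l2_of (partial_deriv j \<phi>))) \<longlonglongrightarrow> - inner (D $ i $ j) (l2_of \<phi>)"
      unfolding hess_ext_by_parts[OF u \<phi>] by (intro tendsto_intros lim)
  qed
  obtain v where v: "v \<in> V_space \<Omega>" "ext \<Omega> v = w" "grad_ext \<Omega> v = z" "\<And>i j. hess_ext \<Omega> v $ i $ j = ext \<Omega> (fun_of (D $ i $ j))"
    using V_from_l2[OF wz parts] by blast
  have hl: "(\<lambda>k. hess_ext \<Omega> (u k)) \<longlonglongrightarrow> hess_ext \<Omega> v"
  proof (intro vec_tendstoI)
    fix i j
    have "norm (hess_ext \<Omega> (u k) $ i $ j - hess_ext \<Omega> v $ i $ j) \<le> norm (hess_ext \<Omega> (u k) $ i $ j - D $ i $ j)" for k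
    proof -
      have "hess_ext \<Omega> (u k) $ i $ j = ext \<Omega> (fun_of (hess_ext \<Omega> (u k) $ i $ j))"
        unfolding hess_ext_nth by (rule ext_fun_of_ext[symmetric, OF weak_hessian_L2[OF u]])
      then have "hess_ext \<Omega> (u k) $ i $ j - hess_ext \<Omega> v $ i $ j = ext \<Omega> (fun_of (hess_ext \<Omega> (u k) $ i $ j - D $ i $ j))"
        by (simp add: v(4) ext_fun_of_diff)
      then show ?thesis using norm_ext_fun_of by metis
    qed
    moreover have "(\<lambda>k. norm (hess_ext \<Omega> (u k) $ i $ j - D $ i $ j)) \<longlonglongrightarrow> norm (D $ i $ j - D $ i $ j)" by (intro tendsto_intros lim)
    then have "(\<lambda>k. norm (hess_ext \<Omega> (u k) $ i $ j - D $ i $ j)) \<longlonglongrightarrow> 0" by simp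
    ultimately have "(\<lambda>k. hess_ext \<Omega> (u k) $ i $ j - hess_ext \<Omega> v $ i $ j) \<longlonglongrightarrow> 0" by (rule LIMSEQ_norm_0)
    then show "(\<lambda>k. hess_ext \<Omega> (u k) $ i $ j) \<longlonglongrightarrow> hess_ext \<Omega> v $ i $ j" by (rule LIM_zero_cancel)
  qed
  have "(\<lambda>k. sqrt ((norm (ext \<Omega> (u k) - ext \<Omega> v))\<^sup>2 + (norm (grad_ext \<Omega> (u k) - grad_ext \<Omega> v))\<^sup>2 + (norm (hess_ext \<Omega> (u k) - hess_ext \<Omega> v))\<^sup>2))
    \<longlonglongrightarrow> sqrt ((norm (ext \<Omega> v - ext \<Omega> v))\<^sup>2 + (norm (grad_ext \<Omega> v - grad_ext \<Omega> v))\<^sup>2 + (norm (hess_ext \<Omega> v - hess_ext \<Omega> v))\<^sup>2)"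
    using lim' hl unfolding v(2,3)[symmetric] by (intro tendsto_intros)
  then have "(\<lambda>k. H2_norm \<Omega> (\<lambda>x. u k x - v x)) \<longlonglongrightarrow> 0" by (simp add: nrm[OF u v(1)])
  then show ?thesis using that v(1) hl by blast
qed

end

locale convex_domain = bounded_domain +
  assumes convex_domain: "convex \<Omega>" and nonempty_domain: "\<Omega> \<noteq> {}"
begin

text \<open>\<open>u\<close> solves the weak Poisson equation with the negative of its own trace as
  data, so \<open>weak_hessian_exists\<close> provides a matrix with the required bound. Uniqueness
  of weak derivatives identifies it on the domain with the Hessian of \<open>u\<close>.\<close>

theorem miranda_talenti:
  assumes u: "u \<in> V_space \<Omega>"
  shows "norm (hess_ext \<Omega> u) \<le> norm (ext \<Omega> (\<lambda>x. trace (weak_hessian \<Omega> u x)))"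
proof -
  let ?t = "\<lambda>x. trace (weak_hessian \<Omega> u x)"
  have t: "(\<lambda>x. - ?t x) \<in> L2 \<Omega>" using L2_lin[OF L2_zero trace_L2[OF u], of "-1"] by simp
  have F: "- ext \<Omega> ?t = ext \<Omega> (\<lambda>x. - ?t x)" using ext_diff[OF L2_zero trace_L2[OF u]] by (simp add: ext_def zero_l2_def[symmetric])
  have wz: "(ext \<Omega> u, grad_ext \<Omega> u) \<in> H10 \<Omega>" using u by (simp add: V_iff)
  obtain D :: "((real^'a) l2 ^ 'a) ^ 'a" where D: "norm D \<le> norm (- ext \<Omega> ?t)"
    "\<And>i j \<phi>. \<phi> \<in> test_functions \<Omega> \<Longrightarrow> inner (grad_ext \<Omega> u $ i) (l2_of (partial_deriv j \<phi>)) = - inner (D $ i $ j) (l2_of \<phi>)"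
    using weak_hessian_exists[OF open_domain bounded_domain convex_domain nonempty_domain wz V_weak_poisson[OF u]]
      fun_of_ext_integrable[OF t] unfolding F by metis
  have "hess_ext \<Omega> u $ i $ j = ext \<Omega> (fun_of (D $ i $ j))" for i j
    unfolding hess_ext_nth
  proof (rule ext_eqI[OF weak_hessian_L2[OF u] fun_of_L2])
    fix \<phi> assume \<phi>: "\<phi> \<in> test_functions \<Omega>"
    show "inner (ext \<Omega> (\<lambda>x. weak_hessian \<Omega> u x $ i $ j)) (l2_of \<phi>) = inner (ext \<Omega> (fun_of (D $ i $ j))) (l2_of \<phi>)"
      using D(2)[OF \<phi>, of i j] hess_ext_by_parts[OF u \<phi>, of i j] by (simp add: inner_ext_fun_of_test[OF \<phi>] hess_ext_nth)
  qed
  then have "norm (hess_ext \<Omega> u) \<le> norm D" by (intro norm_vec_mono) (simp add: norm_ext_fun_of)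
  then show ?thesis using D(1) by simp
qed

text \<open>The Poisson equation tested with \<open>u\<close> itself and the Poincare inequality
  bound gradient and function; the Miranda-Talenti estimate bounds the Hessian.\<close>

lemma H2_norm_le_trace:
  obtains C where "0 \<le> C" "\<And>u. u \<in> V_space \<Omega> \<Longrightarrow> H2_norm \<Omega> u \<le> C * norm (ext \<Omega> (\<lambda>x. trace (weak_hessian \<Omega> u x)))"
proof -
  obtain R where R: "\<Omega> \<subseteq> cball 0 R" "0 \<le> R"
    using bounded_subset_ballD[OF bounded_domain, of 0] ball_subset_cball by (metis less_imp_le subset_trans)
  show ?thesis
  proof (rule that[of "2 * R * (2 * R) + 2 * R + 1"])
    show "0 \<le> 2 * R * (2 * R) + 2 * R + 1" using R by simp
    fix u assume u: "u \<in> V_space \<Omega>"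
    let ?N = "norm (ext \<Omega> (\<lambda>x. trace (weak_hessian \<Omega> u x)))" and ?g = "norm (grad_ext \<Omega> u)"
    have wz: "(ext \<Omega> u, grad_ext \<Omega> u) \<in> H10 \<Omega>" using u by (simp add: V_iff)
    have p: "norm (ext \<Omega> u) \<le> 2 * R * ?g" by (rule H10_poincare[OF wz R])
    obtain \<phi> where \<phi>: "\<And>k. \<phi> k \<in> test_functions \<Omega>" "(\<lambda>k. l2_of (\<phi> k)) \<longlonglongrightarrow> ext \<Omega> u" "(\<lambda>k. grad_l2 (\<phi> k)) \<longlonglongrightarrow> grad_ext \<Omega> u"
      using wz unfolding H10_seq by blast
    have "inner (grad_ext \<Omega> u) (grad_ext \<Omega> u) = inner (- ext \<Omega> (\<lambda>x. trace (weak_hessian \<Omega> u x))) (ext \<Omega> u)"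
    proof (rule LIMSEQ_unique)
      show "(\<lambda>k. inner (grad_ext \<Omega> u) (grad_l2 (\<phi> k))) \<longlonglongrightarrow> inner (grad_ext \<Omega> u) (grad_ext \<Omega> u)" by (intro tendsto_intros \<phi>)
      show "(\<lambda>k. inner (grad_ext \<Omega> u) (grad_l2 (\<phi> k))) \<longlonglongrightarrow> inner (- ext \<Omega> (\<lambda>x. trace (weak_hessian \<Omega> u x))) (ext \<Omega> u)"
        unfolding V_weak_poisson[OF u \<phi>(1)] by (intro tendsto_intros \<phi>)
    qed
    also have "\<dots> \<le> ?N * norm (ext \<Omega> u)" using norm_cauchy_schwarz[of "- ext \<Omega> (\<lambda>x. trace (weak_hessian \<Omega> u x))" "ext \<Omega> u"] by simp
    also have "\<dots> \<le> ?N * (2 * R * ?g)" by (intro mult_left_mono p) auto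
    finally have "?g * ?g \<le> (2 * R * ?N) * ?g" by (simp add: power2_norm_eq_inner[symmetric] power2_eq_square mult_ac)
    then have g: "?g \<le> 2 * R * ?N" using R by (cases "?g = 0") (auto simp: mult_le_cancel_right)
    then have "norm (ext \<Omega> u) \<le> 2 * R * (2 * R * ?N)" using p R by (meson mult_left_mono mult_nonneg_nonneg order_trans zero_le_numeral)
    moreover have "norm (hess_ext \<Omega> u) \<le> ?N" by (rule miranda_talenti[OF u])
    moreover have "H2_norm \<Omega> u \<le> norm (ext \<Omega> u) + ?g + norm (hess_ext \<Omega> u)"
    proof -
      have "sqrt (a\<^sup>2 + b\<^sup>2 + c\<^sup>2) \<le> a + b + c" if "0 \<le> a" "0 \<le> b" "0 \<le> c" for a b c :: real
        using that by (intro real_le_lsqrt) (auto simp: power2_eq_square algebra_simps)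
      then show ?thesis by (simp add: H2_norm_ext[OF V_H2[OF u]])
    qed
    ultimately show "H2_norm \<Omega> u \<le> (2 * R * (2 * R) + 2 * R + 1) * ?N" using g by (simp add: algebra_simps)
  qed
qed

text \<open>The weak Poisson equation is solved with data - f, according to its sign convention -
  \<Delta>w = F. The second derivatives that place the solution in V come from
  \<open>weak_hessian_exists\<close>.\<close>

theorem laplacian_surjective:
  assumes f: "f \<in> L2 \<Omega>"
  obtains u where "u \<in> V_space \<Omega>" "ext \<Omega> (\<lambda>x. trace (weak_hessian \<Omega> u x)) = ext \<Omega> f"
proof -
  have nf: "(\<lambda>x. - f x) \<in> L2 \<Omega>" using L2_lin[OF L2_zero f, of "-1"] by simp
  have F: "ext \<Omega> (\<lambda>x. - f x) = - ext \<Omega> f" using ext_diff[OF L2_zero f] by (simp add: ext_def zero_l2_def[symmetric])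
  obtain w z where wz: "(w, z) \<in> H10 \<Omega>" and weak: "\<And>\<phi>. \<phi> \<in> test_functions \<Omega> \<Longrightarrow> inner z (grad_l2 \<phi>) = inner (ext \<Omega> (\<lambda>x. - f x)) (l2_of \<phi>)"
    using weak_poisson_solution_exists[OF bounded_domain] by metis
  obtain D :: "((real^'a) l2 ^ 'a) ^ 'a" where D: "\<And>i j \<phi>. \<phi> \<in> test_functions \<Omega> \<Longrightarrow> inner (z $ i) (l2_of (partial_deriv j \<phi>)) = - inner (D $ i $ j) (l2_of \<phi>)"
    using weak_hessian_exists[OF open_domain bounded_domain convex_domain nonempty_domain wz weak fun_of_ext_integrable[OF nf]] by metis
  obtain u where u: "u \<in> V_space \<Omega>" "ext \<Omega> u = w" "grad_ext \<Omega> u = z" using V_from_l2[OF wz D] by metis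
  have "ext \<Omega> (\<lambda>x. trace (weak_hessian \<Omega> u x)) = ext \<Omega> f"
  proof (rule ext_eqI[OF trace_L2[OF u(1)] f])
    fix \<phi> assume \<phi>: "\<phi> \<in> test_functions \<Omega>"
    show "inner (ext \<Omega> (\<lambda>x. trace (weak_hessian \<Omega> u x))) (l2_of \<phi>) = inner (ext \<Omega> f) (l2_of \<phi>)"
      using V_weak_poisson[OF u(1) \<phi>] weak[OF \<phi>] by (simp add: u(3) F)
  qed
  then show ?thesis using that u(1) by blast
qed

end

section \<open>The Cordes class and derivatives along symmetric matrices\<close>

lemma transpose_lin: "transpose (A + c *\<^sub>R B) = transpose A + c *\<^sub>R transpose (B :: real^'n^'m)"
  by (simp add: vec_eq_iff transpose_def)

lemma sym_matrices_lin: "A \<in> sym_matrices \<Longrightarrow> B \<in> sym_matrices \<Longrightarrow> A + c *\<^sub>R B \<in> sym_matrices"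
  by (simp add: sym_matrices_def transpose_lin)

lemma sym_matrices_0: "0 \<in> sym_matrices"
  by (simp add: sym_matrices_def transpose_def vec_eq_iff)

lemma sym_matrices_diff: "A \<in> sym_matrices \<Longrightarrow> B \<in> sym_matrices \<Longrightarrow> A - B \<in> sym_matrices"
  using sym_matrices_lin[of A B "-1"] by simp

lemma sym_matrices_add: "A \<in> sym_matrices \<Longrightarrow> B \<in> sym_matrices \<Longrightarrow> A + B \<in> sym_matrices"
  using sym_matrices_lin[of A B 1] by simp

lemma sym_matrices_nth: "A \<in> sym_matrices \<longleftrightarrow> (\<forall>i j. A $ i $ j = A $ j $ i)"
  by (auto simp: sym_matrices_def transpose_def vec_eq_iff)

definition sym_part :: "real^'n^'n \<Rightarrow> real^'n^'n" where
  "sym_part M = (1/2) *\<^sub>R (M + transpose M)"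

lemma sym_part_nth: "sym_part M $ i $ j = (M $ i $ j + M $ j $ i) / 2"
  by (simp add: sym_part_def transpose_def)

lemma sym_part_sym: "sym_part M \<in> sym_matrices"
  by (simp add: sym_matrices_nth sym_part_nth)

lemma sym_part_id: "M \<in> sym_matrices \<Longrightarrow> sym_part M = M"
  by (simp add: sym_matrices_nth sym_part_nth vec_eq_iff)

lemma inner_sym_part: "N \<in> sym_matrices \<Longrightarrow> sym_part M \<bullet> N = M \<bullet> N"
proof -
  assume N: "N \<in> sym_matrices"
  have "(\<Sum>i\<in>UNIV. \<Sum>j\<in>UNIV. M $ j $ i * N $ i $ j) = (\<Sum>i\<in>UNIV. \<Sum>j\<in>UNIV. M $ i $ j * N $ i $ j)"
    by (subst sum.swap) (use N in \<open>auto simp: sym_matrices_nth intro!: sum.cong\<close>)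
  then show ?thesis
    by (simp add: inner_matrix_eq_sum sym_part_nth add_divide_distrib distrib_right sum.distrib
        flip: sum_divide_distrib)
qed

lemma trace_inner: "trace A = mat 1 \<bullet> (A :: real^'n^'n)"
  by (simp add: inner_matrix_eq_sum trace_def mat_def if_distrib if_distribR sum.delta cong: if_cong)

lemma norm_mat_1: "(norm (mat 1 :: real^'n^'n))\<^sup>2 = real CARD('n)"
  unfolding power2_norm_eq_inner trace_inner[symmetric] by (rule trace_I)

lemma axis_quadratic: "axis i 1 \<bullet> (A *v axis i 1) = (A $ i $ i :: real)"
  by (simp add: matrix_vector_mul_component inner_axis inner_axis' matrix_vector_mult_basis column_def)

context
  fixes \<nu>l \<nu>u \<epsilon> :: real
  assumes cordes_pos: "0 < \<nu>l" "0 < \<epsilon>" "\<epsilon> \<le> 1"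
begin

lemma cordes_diag: "A \<in> cordes_class \<nu>l \<nu>u \<epsilon> \<Longrightarrow> \<nu>l \<le> A $ i $ i" "A \<in> cordes_class \<nu>l \<nu>u \<epsilon> \<Longrightarrow> A $ i $ i \<le> \<nu>u"
  unfolding cordes_class_def using axis_quadratic[of i A] by (auto dest!: spec[of _ "axis i 1"])

lemma cordes_norm_ge: "A \<in> cordes_class \<nu>l \<nu>u \<epsilon> \<Longrightarrow> \<nu>l \<le> norm (A :: real^'n^'n)"
proof -
  assume A: "A \<in> cordes_class \<nu>l \<nu>u \<epsilon>"
  fix i :: 'n
  have "\<nu>l \<le> A $ i $ i" by (rule cordes_diag[OF A])
  also have "\<dots> \<le> norm (A $ i)" using component_le_norm_cart[of "A $ i" i] by linarith
  also have "\<dots> \<le> norm A" by (rule Finite_Cartesian_Product.norm_nth_le)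
  finally show ?thesis .
qed

lemma cordes_trace: 
  assumes A: "(A :: real^'n^'n) \<in> cordes_class \<nu>l \<nu>u \<epsilon>"
  shows "0 < trace A" "trace A \<le> real CARD('n) * \<nu>u"
proof -
  show "0 < trace A" unfolding trace_def
    using cordes_diag(1)[OF A] cordes_pos(1) by (intro sum_pos) (auto intro: less_le_trans)
  show "trace A \<le> real CARD('n) * \<nu>u" unfolding trace_def
    using sum_bounded_above[of UNIV "\<lambda>i. A $ i $ i" \<nu>u] cordes_diag(2)[OF A] by simp
qed

lemma cordes_norm_trace:
  assumes A: "(A :: real^'n^'n) \<in> cordes_class \<nu>l \<nu>u \<epsilon>"
  shows "norm A * sqrt (real CARD('n) - 1 + \<epsilon>) \<le> trace A"
proof -
  have "0 < real CARD('n) - 1 + \<epsilon>" using cordes_pos by (simp add: Suc_leI add_nonneg_pos)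
  moreover have "norm A / trace A \<le> 1 / sqrt (real CARD('n) - 1 + \<epsilon>)"
    using A by (simp add: cordes_class_def)
  ultimately show ?thesis using cordes_trace(1)[OF A] by (simp add: field_simps)
qed

lemma cordes_norm_le:
  assumes A: "(A :: real^'n^'n) \<in> cordes_class \<nu>l \<nu>u \<epsilon>"
  shows "norm A \<le> real CARD('n) * \<nu>u / sqrt (real CARD('n) - 1 + \<epsilon>)"
proof -
  have "0 < real CARD('n) - 1 + \<epsilon>" using cordes_pos by (simp add: Suc_leI add_nonneg_pos)
  then show ?thesis using cordes_norm_trace[OF A] cordes_trace(2)[OF A] by (simp add: field_simps)
qed

text \<open>This \<gamma> minimises |\<gamma> A - I|, with minimum given by |\<gamma> A - I|^2 = n -
  (Tr A)^2/|A|^2, n the dimension; the Cordes condition bounds it by 1 - \<epsilon>. The upper bound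
  on \<gamma> uses Tr A \<le> n \<open>\<nu>u\<close> and |A| \<ge> \<open>\<nu>l\<close>.\<close>

lemma cordes_scaled:
  assumes A: "(A :: real^'n^'n) \<in> cordes_class \<nu>l \<nu>u \<epsilon>"
  defines "\<gamma> \<equiv> trace A / (norm A)\<^sup>2"
  shows "0 < \<gamma>" "\<gamma> \<le> real CARD('n) * \<nu>u / \<nu>l\<^sup>2" "norm (\<gamma> *\<^sub>R A - mat 1) \<le> sqrt (1 - \<epsilon>)"
proof -
  have nA: "0 < norm A" using cordes_norm_ge[OF A] cordes_pos by linarith
  show "0 < \<gamma>" using nA cordes_trace(1)[OF A] by (simp add: \<gamma>_def)
  have "\<nu>l\<^sup>2 \<le> (norm A)\<^sup>2" using cordes_norm_ge[OF A] cordes_pos by (intro power_mono) auto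
  then show "\<gamma> \<le> real CARD('n) * \<nu>u / \<nu>l\<^sup>2" unfolding \<gamma>_def
    using cordes_trace[OF A] cordes_pos by (intro frac_le) auto
  have c: "0 \<le> real CARD('n) - 1 + \<epsilon>" using cordes_pos by (simp add: Suc_leI)
  have "(norm A * sqrt (real CARD('n) - 1 + \<epsilon>))\<^sup>2 \<le> (trace A)\<^sup>2"
    using cordes_norm_trace[OF A] c by (intro power_mono) auto
  then have tr: "(real CARD('n) - 1 + \<epsilon>) * (norm A)\<^sup>2 \<le> (trace A)\<^sup>2"
    using c by (simp add: power_mult_distrib mult.commute)
  have "(norm (\<gamma> *\<^sub>R A - mat 1))\<^sup>2 = \<gamma>\<^sup>2 * (norm A)\<^sup>2 - 2 * \<gamma> * trace A + real CARD('n)"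
    unfolding power2_norm_eq_inner norm_mat_1[where 'n='n, symmetric] trace_inner
    by (simp add: inner_diff inner_commute power2_eq_square algebra_simps)
  also have "\<dots> = real CARD('n) - (trace A)\<^sup>2 / (norm A)\<^sup>2"
    using nA by (simp add: \<gamma>_def power2_eq_square field_simps)
  also have "\<dots> \<le> 1 - \<epsilon>" using tr nA by (simp add: field_simps)
  finally show "norm (\<gamma> *\<^sub>R A - mat 1) \<le> sqrt (1 - \<epsilon>)" by (rule real_le_rsqrt)
qed

lemma cordes_trace_diff:
  assumes A: "(A :: real^'n^'n) \<in> cordes_class \<nu>l \<nu>u \<epsilon>"
  shows "\<bar>trace M - trace A / (norm A)\<^sup>2 * (A \<bullet> M)\<bar> \<le> sqrt (1 - \<epsilon>) * norm M"
proof -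
  have "trace M - trace A / (norm A)\<^sup>2 * (A \<bullet> M) = - (((trace A / (norm A)\<^sup>2) *\<^sub>R A - mat 1) \<bullet> M)"
    by (simp add: trace_inner inner_diff)
  then have "\<bar>trace M - trace A / (norm A)\<^sup>2 * (A \<bullet> M)\<bar> \<le> norm ((trace A / (norm A)\<^sup>2) *\<^sub>R A - mat 1) * norm M"
    using Cauchy_Schwarz_ineq2 by simp
  also have "\<dots> \<le> sqrt (1 - \<epsilon>) * norm M"
    using cordes_scaled(3)[OF A] by (intro mult_right_mono) auto
  finally show ?thesis .
qed

lemma cordes_trace_le:
  assumes A: "(A :: real^'n^'n) \<in> cordes_class \<nu>l \<nu>u \<epsilon>"
  shows "\<bar>trace M\<bar> \<le> real CARD('n) * \<nu>u / \<nu>l\<^sup>2 * \<bar>A \<bullet> M\<bar> + sqrt (1 - \<epsilon>) * norm M"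
proof -
  have "\<bar>trace A / (norm A)\<^sup>2 * (A \<bullet> M)\<bar> \<le> real CARD('n) * \<nu>u / \<nu>l\<^sup>2 * \<bar>A \<bullet> M\<bar>"
    unfolding abs_mult using cordes_scaled(1,2)[OF A] by (intro mult_right_mono) auto
  then show ?thesis using cordes_trace_diff[OF A, of M] by linarith
qed

end

section \<open>Derivatives within the subspace of symmetric matrices\<close>

lemma has_derivative_sym_line:
  fixes g :: "real^'n^'n \<Rightarrow> real"
  assumes g: "(g has_derivative (\<lambda>N. A \<bullet> N)) (at (M + t *\<^sub>R N) within sym_matrices)"
    and M: "M \<in> sym_matrices" and N: "N \<in> sym_matrices"
  shows "((\<lambda>t. g (M + t *\<^sub>R N)) has_real_derivative A \<bullet> N) (at t)"
proof -
  have l: "((\<lambda>t. M + t *\<^sub>R N) has_derivative (\<lambda>t. t *\<^sub>R N)) (at t)"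
    by (auto intro!: derivative_eq_intros)
  have g': "(g has_derivative (\<lambda>N. A \<bullet> N)) (at (M + t *\<^sub>R N) within range (\<lambda>t. M + t *\<^sub>R N))"
    by (rule has_derivative_subset[OF g]) (use sym_matrices_lin[OF M N] in auto)
  show ?thesis using has_derivative_in_compose[OF l g']
    by (simp add: has_field_derivative_def mult_commute_abs)
qed

text \<open>A derivative within the subspace is a linear map on all matrices of which only the
  values on symmetric ones are determined. The symmetric part of the representing matrix keeps these
  values. Uniqueness follows by testing the difference of two candidates with itself, a symmetric
  matrix.\<close>

lemma partial_M_works:
  fixes h :: "real^'n \<Rightarrow> real^'n^'n \<Rightarrow> real"
  assumes d: "h x differentiable_on sym_matrices" and M: "M \<in> sym_matrices"
  shows "partial_M h x M \<in> sym_matrices"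
    "((h x) has_derivative (\<lambda>N. partial_M h x M \<bullet> N)) (at M within sym_matrices)"
proof -
  obtain D where D: "((h x) has_derivative D) (at M within sym_matrices)"
    using d M by (auto simp: differentiable_on_def differentiable_def)
  define A where "A = sym_part (adjoint D 1)"
  have A: "A \<in> sym_matrices" by (simp add: A_def sym_part_sym)
  have AD: "A \<bullet> N = D N" if "N \<in> sym_matrices" for N
    using adjoint_works[OF has_derivative_linear[OF D], of N 1] inner_sym_part[OF that, of "adjoint D 1"]
    by (simp add: A_def inner_commute)
  have dA: "((h x) has_derivative (\<lambda>N. A \<bullet> N)) (at M within sym_matrices)"
    unfolding has_derivative_within
  proof (intro conjI bounded_linear_inner_right)
    have "((\<lambda>y. (1 / norm (y - M)) *\<^sub>R (h x y - (h x M + D (y - M)))) \<longlongrightarrow> 0) (at M within sym_matrices)"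
      using D by (simp add: has_derivative_within)
    then show "((\<lambda>y. (1 / norm (y - M)) *\<^sub>R (h x y - (h x M + A \<bullet> (y - M)))) \<longlongrightarrow> 0) (at M within sym_matrices)"
      by (rule tendsto_cong[THEN iffD1, rotated])
        (auto simp: eventually_at_filter AD sym_matrices_diff[OF _ M])
  qed
  have "\<exists>!A. A \<in> sym_matrices \<and> ((h x) has_derivative (\<lambda>N. A \<bullet> N)) (at M within sym_matrices)"
  proof (intro ex1I[of _ A] conjI A dA)
    fix B assume B: "B \<in> sym_matrices \<and> ((h x) has_derivative (\<lambda>N. B \<bullet> N)) (at M within sym_matrices)"
    have N: "B - A \<in> sym_matrices" using B A by (simp add: sym_matrices_diff)
    have "B \<bullet> (B - A) = A \<bullet> (B - A)"
      using has_derivative_sym_line[of "h x" _ M 0 "B - A", OF _ M N] B dA by (auto intro: DERIV_unique)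
    then have "(B - A) \<bullet> (B - A) = 0" by (simp add: inner_diff_left)
    then show "B = A" by simp
  qed
  from theI'[OF this] show "partial_M h x M \<in> sym_matrices"
    "((h x) has_derivative (\<lambda>N. partial_M h x M \<bullet> N)) (at M within sym_matrices)"
    unfolding partial_M_def by auto
qed

lemma partial_M_line:
  fixes h :: "real^'n \<Rightarrow> real^'n^'n \<Rightarrow> real"
  assumes d: "h x differentiable_on sym_matrices" and M: "M \<in> sym_matrices" and N: "N \<in> sym_matrices"
  shows "((\<lambda>t. h x (M + t *\<^sub>R N)) has_real_derivative partial_M h x (M + t *\<^sub>R N) \<bullet> N) (at t)"
  by (rule has_derivative_sym_line[OF partial_M_works(2)[where h = h, OF d sym_matrices_lin[OF M N]] M N])

text \<open>Linearises a difference of values with a single coefficient matrix that is itself a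
  value of the derivative, so that the Cordes bounds apply to it.\<close>

lemma partial_M_mvt:
  fixes h :: "real^'n \<Rightarrow> real^'n^'n \<Rightarrow> real"
  assumes d: "h x differentiable_on sym_matrices" and M: "M \<in> sym_matrices" and N: "N \<in> sym_matrices"
  obtains P where "P \<in> sym_matrices" "h x M - h x N = partial_M h x P \<bullet> (M - N)"
proof -
  have "\<exists>t>0. t < 1 \<and> h x (N + 1 *\<^sub>R (M - N)) - h x (N + 0 *\<^sub>R (M - N))
      = (1 - 0) * (partial_M h x (N + t *\<^sub>R (M - N)) \<bullet> (M - N))"
    by (rule MVT2) (auto intro!: partial_M_line d N M sym_matrices_diff)
  then show ?thesis using that sym_matrices_lin[OF N sym_matrices_diff[OF M N]] by auto
qed

lemma partial_M_subgradient:
  fixes h :: "real^'n \<Rightarrow> real^'n^'n \<Rightarrow> real"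
  assumes d: "h x differentiable_on sym_matrices" and c: "convex_on sym_matrices (h x)"
    and M: "M \<in> sym_matrices" and N: "N \<in> sym_matrices"
  shows "h x M + partial_M h x M \<bullet> (N - M) \<le> h x N"
proof -
  have NM: "N - M \<in> sym_matrices" by (rule sym_matrices_diff[OF N M])
  have "convex_on UNIV (\<lambda>t. h x (M + t *\<^sub>R (N - M)))"
  proof (rule convex_onI)
    fix t r s :: real assume t: "0 < t" "t < 1"
    have "M + ((1 - t) *\<^sub>R r + t *\<^sub>R s) *\<^sub>R (N - M)
        = (1 - t) *\<^sub>R (M + r *\<^sub>R (N - M)) + t *\<^sub>R (M + s *\<^sub>R (N - M))"
      by (simp add: algebra_simps)
    then show "h x (M + ((1 - t) *\<^sub>R r + t *\<^sub>R s) *\<^sub>R (N - M))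
        \<le> (1 - t) * h x (M + r *\<^sub>R (N - M)) + t * h x (M + s *\<^sub>R (N - M))"
      using convex_onD[OF c, of t "M + r *\<^sub>R (N - M)" "M + s *\<^sub>R (N - M)"] t
        sym_matrices_lin[OF M NM] by simp
  qed simp
  from convex_on_imp_above_tangent[OF this _ _ _ DERIV_subset[OF partial_M_line[where h = h and t = 0, OF d M NM]], of 1]
  show ?thesis by simp
qed

lemma weak_strong_inner_tendsto:
  fixes x y :: "nat \<Rightarrow> 'h::real_inner"
  assumes w: "(\<lambda>n. inner (x n) y0) \<longlonglongrightarrow> inner x0 y0" and b: "\<And>n. norm (x n) \<le> C"
    and s: "y \<longlonglongrightarrow> y0"
  shows "(\<lambda>n. inner (x n) (y n)) \<longlonglongrightarrow> inner x0 y0"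
proof -
  have "(\<lambda>n. norm (y n - y0)) \<longlonglongrightarrow> 0" using s by (simp add: LIM_zero_iff tendsto_norm_zero_iff)
  then have "(\<lambda>n. C * norm (y n - y0)) \<longlonglongrightarrow> 0" by (rule tendsto_mult_right_zero)
  moreover have "norm (inner (x n) (y n - y0)) \<le> C * norm (y n - y0)" for n
    using order_trans[OF Cauchy_Schwarz_ineq2[of "x n" "y n - y0"] mult_right_mono[OF b[of n] norm_ge_zero]] by simp
  ultimately have "(\<lambda>n. inner (x n) (y n - y0)) \<longlonglongrightarrow> 0" by (rule LIMSEQ_norm_0[rotated])
  from tendsto_add[OF this w] show ?thesis by (simp add: inner_diff_right)
qed

lemma AE_nonneg_if_integrals_nonneg:
  fixes g :: "'b \<Rightarrow> real"
  assumes g: "integrable M g" and p: "\<And>E. E \<in> sets M \<Longrightarrow> 0 \<le> (LINT x|M. indicator E x * g x)"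
  shows "AE x in M. 0 \<le> g x"
proof -
  let ?E = "{x \<in> space M. g x < 0}"
  have [measurable]: "g \<in> borel_measurable M" using g by simp
  have E: "?E \<in> sets M" by measurable
  have i: "integrable M (\<lambda>x. - (indicator ?E x * g x))"
    using integrable_mult_indicator[OF E g] by simp
  have "(LINT x|M. - (indicator ?E x * g x)) = 0"
  proof (rule antisym)
    show "(LINT x|M. - (indicator ?E x * g x)) \<le> 0" using p[OF E] by simp
    show "0 \<le> (LINT x|M. - (indicator ?E x * g x))" by (rule integral_nonneg_AE) (auto simp: indicator_def)
  qed
  then have "AE x in M. - (indicator ?E x * g x) = 0"
    by (subst (asm) integral_nonneg_eq_0_iff_AE[OF i]) (auto simp: indicator_def)
  with AE_space show ?thesis by eventually_elim (auto simp: indicator_def split: if_splits)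
qed

text \<open>Continuity is given only on symmetric matrices, so the inserted map has to be symmetric
  at every point and not merely almost everywhere. \<open>sym_hessian\<close> is introduced for this
  reason.\<close>

lemma measurable_symmetric_compose:
  fixes h :: "real^'n \<Rightarrow> real^'n^'n \<Rightarrow> real"
  assumes h: "continuous_on (closure \<Omega> \<times> sym_matrices) (\<lambda>(x, M). h x M)"
    and g: "g \<in> borel_measurable (lebesgue_on \<Omega>)" "\<And>x. g x \<in> sym_matrices"
  shows "(\<lambda>x. h x (g x)) \<in> borel_measurable (lebesgue_on \<Omega>)"
proof -
  have "(\<lambda>x::real^'n. x) \<in> borel_measurable (lebesgue_on \<Omega>)"
    by (rule measurable_restrict_space1) (simp add: measurable_completion)
  then have "(\<lambda>x. (x, g x)) \<in> borel_measurable (lebesgue_on \<Omega>)" using g(1) by (rule borel_measurable_Pair)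
  then have "(\<lambda>x. (x, g x)) \<in> measurable (lebesgue_on \<Omega>) (restrict_space borel (closure \<Omega> \<times> sym_matrices))"
    using closure_subset[of \<Omega>] g(2) by (intro measurable_restrict_space2) auto
  from measurable_compose[OF this borel_measurable_continuous_on_restrict[OF h]] show ?thesis by simp
qed

text \<open>Measurability comes from joint continuity of \<open>h\<close>: the derivative along a
  fixed symmetric direction is a pointwise limit of difference quotients.\<close>

lemma partial_M_measurable:
  fixes h :: "real^'n \<Rightarrow> real^'n^'n \<Rightarrow> real"
  assumes h: "continuous_on (closure \<Omega> \<times> sym_matrices) (\<lambda>(x, M). h x M)"
    and d: "\<And>x. x \<in> closure \<Omega> \<Longrightarrow> h x differentiable_on sym_matrices"
    and g: "g \<in> borel_measurable (lebesgue_on \<Omega>)" "\<And>x. g x \<in> sym_matrices"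
  shows "(\<lambda>x. partial_M h x (g x) $ i $ k) \<in> borel_measurable (lebesgue_on \<Omega>)"
proof -
  \<comment> \<open>Pairing a symmetric matrix with this direction returns its entry (i, k), and
    moving along it stays within the symmetric matrices.\<close>
  let ?E = "sym_part (axis i (axis k 1)) :: real^'n^'n"
  let ?q = "\<lambda>n x. (h x (g x + inverse (real (Suc n)) *\<^sub>R ?E) - h x (g x)) / inverse (real (Suc n))"
  show ?thesis
  proof (rule borel_measurable_LIMSEQ_real[of _ ?q])
    fix n
    have "(\<lambda>x. g x + inverse (real (Suc n)) *\<^sub>R ?E) \<in> borel_measurable (lebesgue_on \<Omega>)"
      using g(1) by measurable
    then show "?q n \<in> borel_measurable (lebesgue_on \<Omega>)"
      by (intro borel_measurable_divide borel_measurable_diff measurable_symmetric_compose[OF h] g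
          borel_measurable_const sym_matrices_lin sym_part_sym)
  next
    fix x assume "x \<in> space (lebesgue_on \<Omega>)"
    then have x: "x \<in> closure \<Omega>" using closure_subset by auto
    have S: "partial_M h x (g x) \<in> sym_matrices" by (rule partial_M_works(1)[where h = h, OF d[OF x] g(2)])
    have "?E \<bullet> partial_M h x (g x) = partial_M h x (g x) $ i $ k"
      by (subst inner_sym_part[OF S]) (simp add: inner_axis')
    then have *: "partial_M h x (g x) \<bullet> ?E = partial_M h x (g x) $ i $ k" by (simp add: inner_commute)
    have D: "((\<lambda>t. h x (g x + t *\<^sub>R ?E)) has_real_derivative partial_M h x (g x) $ i $ k) (at 0)"
      using partial_M_line[where h = h and t = 0, OF d[OF x] g(2)[of x] sym_part_sym[of "axis i (axis k 1)"]] by (simp add: *)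
    have lim: "filterlim (\<lambda>n. inverse (real (Suc n))) (at 0) sequentially"
      unfolding filterlim_at using LIMSEQ_inverse_real_of_nat by auto
    from filterlim_compose[OF D[unfolded DERIV_def] lim] show "(\<lambda>n. ?q n x) \<longlonglongrightarrow> partial_M h x (g x) $ i $ k"
      by simp
  qed
qed

section \<open>Square-integrable matrix fields\<close>

definition mat_L2 :: "(real^'n) set \<Rightarrow> (real^'n \<Rightarrow> real^'n^'n) set" where
  "mat_L2 \<Omega> = {A. \<forall>i k. (\<lambda>x. A x $ i $ k) \<in> L2 \<Omega>}"

definition mat_ext :: "(real^'n) set \<Rightarrow> (real^'n \<Rightarrow> real^'n^'n) \<Rightarrow> ((real^'n) l2 ^ 'n) ^ 'n" where
  "mat_ext \<Omega> A = (\<chi> i k. ext \<Omega> (\<lambda>x. A x $ i $ k))"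

lemma measurable_matrix_nth:
  fixes A :: "'b \<Rightarrow> real^'n^'m"
  assumes "\<And>i k. (\<lambda>x. A x $ i $ k) \<in> borel_measurable M"
  shows "A \<in> borel_measurable M"
  by (rule borel_measurable_euclidean_space[THEN iffD2])
    (use assms in \<open>auto simp: Basis_vec_def inner_axis\<close>)

context bounded_domain
begin

lemma L2_dominated:
  assumes g: "g \<in> borel_measurable (lebesgue_on \<Omega>)" and f: "f \<in> L2 \<Omega>"
    and le: "AE x in lebesgue_on \<Omega>. \<bar>g x\<bar> \<le> f x"
  shows "g \<in> L2 \<Omega>" "norm (ext \<Omega> g) \<le> norm (ext \<Omega> f)"
proof -
  have gm: "(\<lambda>x. indicator \<Omega> x * g x) \<in> borel_measurable lebesgue"
    using g by (subst (asm) borel_measurable_restrict_space_iff) (auto simp: mult.commute)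
  have le': "AE x in lebesgue. \<bar>indicator \<Omega> x * g x\<bar> \<le> \<bar>indicator \<Omega> x * f x\<bar>"
    using le unfolding AE_domain by eventually_elim (auto simp: indicator_def)
  show "g \<in> L2 \<Omega>" using sq_int_dominated[OF gm _ le'] f by (simp add: L2_iff)
  then show "norm (ext \<Omega> g) \<le> norm (ext \<Omega> f)"
    using f le' unfolding L2_iff ext_def by (rule l2_norm_mono)
qed

lemma L2_scale: "f \<in> L2 \<Omega> \<Longrightarrow> (\<lambda>x. c * f x) \<in> L2 \<Omega>"
  and ext_scale: "f \<in> L2 \<Omega> \<Longrightarrow> ext \<Omega> (\<lambda>x. c * f x) = c *\<^sub>R ext \<Omega> f"
  using L2_lin[OF L2_zero, of f c] ext_lin[OF L2_zero, of f c] by (simp_all add: ext_def zero_l2_def[symmetric])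

lemma L2_add: "f \<in> L2 \<Omega> \<Longrightarrow> g \<in> L2 \<Omega> \<Longrightarrow> (\<lambda>x. f x + g x) \<in> L2 \<Omega>"
  and ext_add: "f \<in> L2 \<Omega> \<Longrightarrow> g \<in> L2 \<Omega> \<Longrightarrow> ext \<Omega> (\<lambda>x. f x + g x) = ext \<Omega> f + ext \<Omega> g"
  using L2_lin[of f g 1] ext_lin[of f g 1] by simp_all

lemma L2_const: "(\<lambda>x. c) \<in> L2 \<Omega>"
proof -
  have "emeasure lebesgue \<Omega> < \<infinity>"
    using emeasure_bounded_finite[OF bounded_domain] open_domain by (simp add: emeasure_completion)
  then show ?thesis unfolding L2_def
    by (auto intro!: finite_measure.integrable_const finite_measureI simp: emeasure_restrict_space)
qed

lemma L2_abs: "f \<in> L2 \<Omega> \<Longrightarrow> (\<lambda>x. \<bar>f x\<bar>) \<in> L2 \<Omega>"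
  by (auto simp: L2_def)

lemma norm_ext_abs: "f \<in> L2 \<Omega> \<Longrightarrow> norm (ext \<Omega> (\<lambda>x. \<bar>f x\<bar>)) = norm (ext \<Omega> f)"
  by (simp add: L2_norm_ext[symmetric] L2_abs L2_norm_def L2_inner_def)

lemma L2_meas: "f \<in> L2 \<Omega> \<Longrightarrow> f \<in> borel_measurable (lebesgue_on \<Omega>)"
  by (simp add: L2_def)

lemma L2_integrable_mult: "f \<in> L2 \<Omega> \<Longrightarrow> g \<in> L2 \<Omega> \<Longrightarrow> integrable (lebesgue_on \<Omega>) (\<lambda>x. f x * g x)"
proof -
  assume f: "f \<in> L2 \<Omega>" and g: "g \<in> L2 \<Omega>"
  show ?thesis
  proof (rule Bochner_Integration.integrable_bound[where f = "\<lambda>x. (f x)\<^sup>2 + (g x)\<^sup>2"])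
    show "AE x in lebesgue_on \<Omega>. norm (f x * g x) \<le> norm ((f x)\<^sup>2 + (g x)\<^sup>2)"
    proof (rule AE_I2)
      fix x
      have "2 * (\<bar>f x\<bar> * \<bar>g x\<bar>) \<le> \<bar>f x\<bar>\<^sup>2 + \<bar>g x\<bar>\<^sup>2" using sum_squares_bound[of "\<bar>f x\<bar>" "\<bar>g x\<bar>"] by simp
      then have "\<bar>f x\<bar> * \<bar>g x\<bar> \<le> \<bar>f x\<bar>\<^sup>2 + \<bar>g x\<bar>\<^sup>2" using mult_nonneg_nonneg[OF abs_ge_zero[of "f x"] abs_ge_zero[of "g x"]] by linarith
      then show "norm (f x * g x) \<le> norm ((f x)\<^sup>2 + (g x)\<^sup>2)" by (simp add: abs_mult)
    qed
  qed (use f g in \<open>auto simp: L2_def\<close>)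
qed

lemma L2_inner_self: "f \<in> L2 \<Omega> \<Longrightarrow> L2_inner \<Omega> f f = (norm (ext \<Omega> f))\<^sup>2"
  by (simp add: L2_inner_ext power2_norm_eq_inner)

lemma inner_ext_fun_of:
  assumes g: "g \<in> L2 \<Omega>"
  shows "inner z (ext \<Omega> g) = inner (ext \<Omega> (fun_of z)) (ext \<Omega> g)"
proof -
  have gs: "(\<lambda>x. indicator \<Omega> x * g x) \<in> sq_int" and z: "(\<lambda>x. indicator \<Omega> x * fun_of z x) \<in> sq_int"
    using g fun_of_L2[of z] by (auto simp: L2_iff)
  have "inner (l2_of (fun_of z)) (ext \<Omega> g) = (LINT x|lebesgue. fun_of z x * (indicator \<Omega> x * g x))"
    unfolding ext_def by (rule inner_l2_of[OF fun_of_sq_int gs])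
  also have "\<dots> = (LINT x|lebesgue. (indicator \<Omega> x * fun_of z x) * (indicator \<Omega> x * g x))"
    by (rule Bochner_Integration.integral_cong) (auto simp: indicator_def)
  also have "\<dots> = inner (ext \<Omega> (fun_of z)) (ext \<Omega> g)"
    unfolding ext_def by (rule inner_l2_of[OF z gs, symmetric])
  finally show ?thesis by (simp add: l2_of_fun_of)
qed

lemma mat_L2_nth: "A \<in> mat_L2 \<Omega> \<Longrightarrow> (\<lambda>x. A x $ i $ k) \<in> L2 \<Omega>"
  by (simp add: mat_L2_def)

lemma mat_L2_meas: "A \<in> mat_L2 \<Omega> \<Longrightarrow> A \<in> borel_measurable (lebesgue_on \<Omega>)"
  by (rule measurable_matrix_nth) (auto simp: mat_L2_def L2_def)

lemma mat_L2_dominated: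
  assumes A: "A \<in> borel_measurable (lebesgue_on \<Omega>)" and f: "f \<in> L2 \<Omega>"
    and le: "AE x in lebesgue_on \<Omega>. norm (A x) \<le> f x"
  shows "A \<in> mat_L2 \<Omega>"
  unfolding mat_L2_def
proof safe
  fix i k
  have "(\<lambda>x. A x \<bullet> axis i (axis k 1)) \<in> borel_measurable (lebesgue_on \<Omega>)" using A by measurable
  then have m: "(\<lambda>x. A x $ i $ k) \<in> borel_measurable (lebesgue_on \<Omega>)" by (simp add: inner_axis)
  have "\<bar>A x $ i $ k\<bar> \<le> norm (A x)" for x
    using order_trans[OF component_le_norm_cart Finite_Cartesian_Product.norm_nth_le] by blast
  note * = order_trans[OF this]
  have "AE x in lebesgue_on \<Omega>. \<bar>A x $ i $ k\<bar> \<le> f x" using le by eventually_elim (rule *)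
  then show "(\<lambda>x. A x $ i $ k) \<in> L2 \<Omega>" using L2_dominated(1)[OF m f] by blast
qed

lemma inner_mat_ext:
  assumes A: "A \<in> mat_L2 \<Omega>" and B: "B \<in> mat_L2 \<Omega>"
  shows "inner (mat_ext \<Omega> A) (mat_ext \<Omega> B) = (LINT x|lebesgue_on \<Omega>. A x \<bullet> B x)"
    "integrable (lebesgue_on \<Omega>) (\<lambda>x. A x \<bullet> B x)"
proof -
  have i: "integrable (lebesgue_on \<Omega>) (\<lambda>x. A x $ i $ k * B x $ i $ k)" for i k
    by (intro L2_integrable_mult mat_L2_nth A B)
  show "integrable (lebesgue_on \<Omega>) (\<lambda>x. A x \<bullet> B x)" unfolding inner_matrix_eq_sum using i by simp
  show "inner (mat_ext \<Omega> A) (mat_ext \<Omega> B) = (LINT x|lebesgue_on \<Omega>. A x \<bullet> B x)"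
    unfolding inner_matrix_eq_sum using i
    by (simp add: inner_vec_def mat_ext_def L2_inner_ext[symmetric] L2_inner_def mat_L2_nth A B)
qed

lemma mat_L2_norm:
  assumes A: "A \<in> mat_L2 \<Omega>"
  shows "(\<lambda>x. norm (A x)) \<in> L2 \<Omega>" "norm (mat_ext \<Omega> A) = norm (ext \<Omega> (\<lambda>x. norm (A x)))"
proof -
  show *: "(\<lambda>x. norm (A x)) \<in> L2 \<Omega>"
    using mat_L2_meas[OF A] inner_mat_ext(2)[OF A A] by (simp add: L2_def power2_norm_eq_inner)
  have "(norm (mat_ext \<Omega> A))\<^sup>2 = (norm (ext \<Omega> (\<lambda>x. norm (A x))))\<^sup>2"
    unfolding L2_inner_self[OF *, symmetric] unfolding power2_norm_eq_inner inner_mat_ext(1)[OF A A] L2_inner_def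
    by (simp add: power2_norm_eq_inner[symmetric] power2_eq_square)
  then show "norm (mat_ext \<Omega> A) = norm (ext \<Omega> (\<lambda>x. norm (A x)))" by (simp add: power2_eq_iff_nonneg)
qed

lemma mat_ext_diff: "A \<in> mat_L2 \<Omega> \<Longrightarrow> B \<in> mat_L2 \<Omega> \<Longrightarrow> mat_ext \<Omega> (\<lambda>x. A x - B x) = mat_ext \<Omega> A - mat_ext \<Omega> B"
  and mat_L2_diff: "A \<in> mat_L2 \<Omega> \<Longrightarrow> B \<in> mat_L2 \<Omega> \<Longrightarrow> (\<lambda>x. A x - B x) \<in> mat_L2 \<Omega>"
  by (simp_all add: mat_ext_def vec_eq_iff ext_diff mat_L2_def L2_diff)

lemma mat_L2_const: "(\<lambda>x. A) \<in> mat_L2 \<Omega>"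
  by (simp add: mat_L2_def L2_const)

lemma mat_L2_hessian: "v \<in> V_space \<Omega> \<Longrightarrow> weak_hessian \<Omega> v \<in> mat_L2 \<Omega>"
  by (simp add: mat_L2_def weak_hessian_L2)

lemma mat_ext_hessian: "mat_ext \<Omega> (weak_hessian \<Omega> v) = hess_ext \<Omega> v"
  by (simp add: mat_ext_def vec_eq_iff hess_ext_nth)

end

section \<open>The vanishing regularization limit\<close>

text \<open>Equal almost everywhere in the domain to the weak Hessian of a function in V, but
  symmetric at every point, as pointwise evaluation of a Hamiltonian requires.\<close>

definition sym_hessian :: "(real^'n) set \<Rightarrow> (real^'n \<Rightarrow> real) \<Rightarrow> real^'n \<Rightarrow> real^'n^'n" where
  "sym_hessian \<Omega> v x = sym_part (weak_hessian \<Omega> v x)"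

lemma sym_hessian_sym: "sym_hessian \<Omega> v x \<in> sym_matrices"
  by (simp add: sym_hessian_def sym_part_sym)

context bounded_domain
begin

lemma sym_hessian_AE: "v \<in> V_space \<Omega> \<Longrightarrow> AE x in lebesgue_on \<Omega>. weak_hessian \<Omega> v x = sym_hessian \<Omega> v x"
proof -
  assume "v \<in> V_space \<Omega>"
  from weak_hessian_symmetric[OF this] show ?thesis by eventually_elim (simp add: sym_hessian_def sym_part_id)
qed

lemma sym_hessian_meas: "v \<in> V_space \<Omega> \<Longrightarrow> sym_hessian \<Omega> v \<in> borel_measurable (lebesgue_on \<Omega>)"
  using L2_meas[OF mat_L2_nth[OF mat_L2_hessian]]
  by (intro measurable_matrix_nth) (simp add: sym_hessian_def sym_part_nth)

lemma measurable_AE_cong: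
  fixes f g :: "real^'n \<Rightarrow> real"
  assumes f: "f \<in> borel_measurable (lebesgue_on \<Omega>)" and eq: "AE x in lebesgue_on \<Omega>. f x = g x"
  shows "g \<in> borel_measurable (lebesgue_on \<Omega>)"
proof -
  have "(\<lambda>x. f x * indicator \<Omega> x) \<in> borel_measurable lebesgue"
    using f by (subst (asm) borel_measurable_restrict_space_iff) (auto simp: mult.commute)
  moreover have "AE x in lebesgue. f x * indicator \<Omega> x = g x * indicator \<Omega> x"
    using eq unfolding AE_domain by eventually_elim (auto simp: indicator_def)
  ultimately have "(\<lambda>x. g x * indicator \<Omega> x) \<in> borel_measurable lebesgue" by (rule borel_measurable_AE)
  then show ?thesis by (subst borel_measurable_restrict_space_iff) (auto simp: mult.commute)
qed

end

text \<open>Keeps m/\<gamma> square-integrable, so that it is admissible data for the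
  Laplacian.\<close>

lemma cordes_scaled_inverse:
  assumes pos: "0 < \<nu>l" "0 < \<epsilon>" "\<epsilon> \<le> 1" and A: "(A :: real^'n^'n) \<in> cordes_class \<nu>l \<nu>u \<epsilon>"
  shows "inverse (trace A / (norm A)\<^sup>2) \<le> real CARD('n) * \<nu>u / (real CARD('n) - 1 + \<epsilon>)"
proof -
  have c: "0 < real CARD('n) - 1 + \<epsilon>" using pos by (simp add: Suc_leI add_nonneg_pos)
  have "(norm A * sqrt (real CARD('n) - 1 + \<epsilon>))\<^sup>2 \<le> (trace A)\<^sup>2"
    using cordes_norm_trace[OF pos A] c by (intro power_mono) auto
  then have "(real CARD('n) - 1 + \<epsilon>) * (norm A)\<^sup>2 \<le> (trace A)\<^sup>2"
    using c by (simp add: power_mult_distrib mult.commute)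
  then have "(norm A)\<^sup>2 / trace A \<le> trace A / (real CARD('n) - 1 + \<epsilon>)"
    using c cordes_trace(1)[OF pos A] by (simp add: field_simps power2_eq_square)
  also have "\<dots> \<le> real CARD('n) * \<nu>u / (real CARD('n) - 1 + \<epsilon>)"
    using c cordes_trace(2)[OF pos A] by (intro divide_right_mono) auto
  finally show ?thesis by simp
qed

text \<open>Minus this matrix is the coefficient field of the linearised equation. The symmetric
  representative of the Hessian makes the Cordes bounds hold at every point of the domain.\<close>

definition policy :: "(real^'n) set \<Rightarrow> (nat \<Rightarrow> real^'n \<Rightarrow> real^'n^'n \<Rightarrow> real) \<Rightarrow> (nat \<Rightarrow> real^'n \<Rightarrow> real) \<Rightarrow> nat \<Rightarrow> real^'n \<Rightarrow> real^'n^'n" where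
  "policy \<Omega> h u j x = (if x \<in> \<Omega> then partial_M (h j) x (sym_hessian \<Omega> (u j) x) else 0)"

text \<open>All data along a sequence of regularisation parameters. The constants do not depend on
  the index, so the assumptions pass to subsequences; the locale is used again in this way after the
  weak limits have been extracted.\<close>

locale regularized_sequence = convex_domain \<Omega> for \<Omega> :: "(real^'n) set" +
  fixes H :: "real^'n \<Rightarrow> real^'n^'n \<Rightarrow> real"
    and h :: "nat \<Rightarrow> real^'n \<Rightarrow> real^'n^'n \<Rightarrow> real"
    and \<omega> :: "nat \<Rightarrow> real" and C \<nu>l \<nu>u \<epsilon> :: real
    and F :: "(real^'n \<Rightarrow> real) \<Rightarrow> real^'n \<Rightarrow> real"
    and G :: "(real^'n \<Rightarrow> real) \<Rightarrow> real"
    and u m :: "nat \<Rightarrow> real^'n \<Rightarrow> real"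
  assumes h_continuous: "\<And>j. continuous_on (closure \<Omega> \<times> sym_matrices) (\<lambda>(x, M). h j x M)"
    and h_lipschitz: "\<And>j x M N. x \<in> closure \<Omega> \<Longrightarrow> M \<in> sym_matrices \<Longrightarrow> N \<in> sym_matrices \<Longrightarrow>
        \<bar>h j x M - h j x N\<bar> \<le> C * norm (M - N)"
    and h_convex: "\<And>j x. x \<in> closure \<Omega> \<Longrightarrow> convex_on sym_matrices (h j x)"
    and h_differentiable: "\<And>j x. x \<in> closure \<Omega> \<Longrightarrow> h j x differentiable_on sym_matrices"
    and h_approx: "\<And>j x M. x \<in> closure \<Omega> \<Longrightarrow> M \<in> sym_matrices \<Longrightarrow> \<bar>h j x M - H x M\<bar> \<le> \<omega> j"
    and \<omega>_tendsto: "\<omega> \<longlonglongrightarrow> 0"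
    and h_cordes: "\<And>j x M. x \<in> closure \<Omega> \<Longrightarrow> M \<in> sym_matrices \<Longrightarrow> - partial_M (h j) x M \<in> cordes_class \<nu>l \<nu>u \<epsilon>"
    and cordes_params: "0 < \<nu>l" "0 < \<epsilon>" "\<epsilon> \<le> 1"
    and F_operator: "L2_operator \<Omega> F" and F_completely_continuous: "completely_continuous \<Omega> F"
    and G_dual: "G \<in> V_dual \<Omega>"
    and solution: "\<And>j. regularized_solution \<Omega> (h j) F G (u j) (m j)"
begin

abbreviation "A \<equiv> policy \<Omega> h u"
abbreviation "S j \<equiv> sym_hessian \<Omega> (u j)"

lemma in_closure: "x \<in> \<Omega> \<Longrightarrow> x \<in> closure \<Omega>"
  using closure_subset by blast

lemma u_V: "u j \<in> V_space \<Omega>" and m_L2: "m j \<in> L2 \<Omega>"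
  and m_nonneg: "AE x in lebesgue_on \<Omega>. 0 \<le> m j x"
  using solution[of j] by (auto simp: regularized_solution_def L2_nonneg_def)

lemma F_L2: "g \<in> L2 \<Omega> \<Longrightarrow> F g \<in> L2 \<Omega>"
  using F_operator by (simp add: L2_operator_def)

lemma AE_in_domain: "AE x in lebesgue_on \<Omega>. x \<in> \<Omega>"
  by (simp add: AE_domain)

lemma u_equation: "AE x in lebesgue_on \<Omega>. h j x (S j x) = F (m j) x"
proof -
  have "AE x in lebesgue_on \<Omega>. h j x (weak_hessian \<Omega> (u j) x) = F (m j) x"
    using solution[of j] by (simp add: regularized_solution_def)
  with sym_hessian_AE[OF u_V[of j]] show ?thesis by eventually_elim simp
qed

lemma A_cordes: "x \<in> \<Omega> \<Longrightarrow> - A j x \<in> cordes_class \<nu>l \<nu>u \<epsilon>"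
  using h_cordes[OF _ sym_hessian_sym] in_closure by (simp add: policy_def)

lemma A_norm: "norm (A j x) \<le> real CARD('n) * \<nu>u / sqrt (real CARD('n) - 1 + \<epsilon>)" if "x \<in> \<Omega>"
  using cordes_norm_le[OF cordes_params A_cordes[OF that]] by simp

lemma A_meas: "A j \<in> borel_measurable (lebesgue_on \<Omega>)"
proof (rule measurable_cong[THEN iffD1])
  show "(\<lambda>x. partial_M (h j) x (S j x)) \<in> borel_measurable (lebesgue_on \<Omega>)"
    by (intro measurable_matrix_nth partial_M_measurable h_continuous h_differentiable sym_hessian_meas u_V sym_hessian_sym)
qed (simp add: policy_def)

lemma A_L2: "A j \<in> mat_L2 \<Omega>"
  using A_norm by (intro mat_L2_dominated[OF A_meas L2_const]) (auto simp: AE_domain)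

lemma mA_L2: "(\<lambda>x. m j x *\<^sub>R A j x) \<in> mat_L2 \<Omega>"
proof (rule mat_L2_dominated)
  show "(\<lambda>x. m j x *\<^sub>R A j x) \<in> borel_measurable (lebesgue_on \<Omega>)"
    using A_meas L2_meas[OF m_L2] by measurable
  show "(\<lambda>x. (real CARD('n) * \<nu>u / sqrt (real CARD('n) - 1 + \<epsilon>)) * \<bar>m j x\<bar>) \<in> L2 \<Omega>"
    by (intro L2_scale L2_abs m_L2)
  show "AE x in lebesgue_on \<Omega>. norm (m j x *\<^sub>R A j x) \<le> (real CARD('n) * \<nu>u / sqrt (real CARD('n) - 1 + \<epsilon>)) * \<bar>m j x\<bar>"
    unfolding AE_domain norm_scaleR by (intro AE_I2 impI) (subst mult.commute, intro mult_right_mono A_norm, auto)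
qed

lemma m_equation:
  assumes v: "v \<in> V_space \<Omega>"
  shows "(LINT x|lebesgue_on \<Omega>. (m j x *\<^sub>R A j x) \<bullet> weak_hessian \<Omega> v x) = G v"
proof -
  have "G v = (LINT x|lebesgue_on \<Omega>. m j x * (partial_M (h j) x (weak_hessian \<Omega> (u j) x) \<bullet> weak_hessian \<Omega> v x))"
    using solution[of j] v by (simp add: regularized_solution_def L2_inner_def)
  also have "\<dots> = (LINT x|lebesgue_on \<Omega>. (m j x *\<^sub>R A j x) \<bullet> weak_hessian \<Omega> v x)"
  proof (rule integral_cong_AE)
    have [measurable]: "weak_hessian \<Omega> v \<in> borel_measurable (lebesgue_on \<Omega>)" "(\<lambda>x. m j x *\<^sub>R A j x) \<in> borel_measurable (lebesgue_on \<Omega>)"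
      using v by (auto intro: mat_L2_meas mat_L2_hessian mA_L2)
    show *: "(\<lambda>x. (m j x *\<^sub>R A j x) \<bullet> weak_hessian \<Omega> v x) \<in> borel_measurable (lebesgue_on \<Omega>)" by measurable
    show eq: "AE x in lebesgue_on \<Omega>. m j x * (partial_M (h j) x (weak_hessian \<Omega> (u j) x) \<bullet> weak_hessian \<Omega> v x)
        = (m j x *\<^sub>R A j x) \<bullet> weak_hessian \<Omega> v x"
      using sym_hessian_AE[OF u_V[of j]] AE_in_domain by eventually_elim (simp add: policy_def)
    show "(\<lambda>x. m j x * (partial_M (h j) x (weak_hessian \<Omega> (u j) x) \<bullet> weak_hessian \<Omega> v x)) \<in> borel_measurable (lebesgue_on \<Omega>)"
      by (rule measurable_AE_cong[OF * eventually_mono[OF eq]]) (rule sym)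
  qed
  finally show ?thesis by simp
qed

lemma m_bounded:
  obtains K where "\<And>j. norm (ext \<Omega> (m j)) \<le> K"
proof -
  obtain CG where CG: "\<And>v. v \<in> V_space \<Omega> \<Longrightarrow> \<bar>G v\<bar> \<le> CG * H2_norm \<Omega> v"
    using G_dual unfolding V_dual_def by blast
  obtain CV where CV: "0 \<le> CV" "\<And>v. v \<in> V_space \<Omega> \<Longrightarrow> H2_norm \<Omega> v \<le> CV * norm (ext \<Omega> (\<lambda>x. trace (weak_hessian \<Omega> v x)))"
    using H2_norm_le_trace by metis
  define s where "s = sqrt (1 - \<epsilon>)"
  have s: "0 \<le> s" "s < 1" using cordes_params by (auto simp: s_def)
  define g0 where "g0 = real CARD('n) * \<nu>u / \<nu>l\<^sup>2"
  define k0 where "k0 = real CARD('n) * \<nu>u / (real CARD('n) - 1 + \<epsilon>)"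
  have "norm (ext \<Omega> (m j)) \<le> g0 * (\<bar>CG\<bar> * CV / (1 - s))" for j
  proof -
    define \<gamma> where "\<gamma> x = trace (- A j x) / (norm (- A j x))\<^sup>2" for x
    have \<gamma>: "0 < \<gamma> x" "\<gamma> x \<le> g0" "inverse (\<gamma> x) \<le> k0" if "x \<in> \<Omega>" for x
      using cordes_scaled(1,2)[OF cordes_params A_cordes[OF that, of j]] cordes_scaled_inverse[OF cordes_params A_cordes[OF that, of j]]
      unfolding \<gamma>_def g0_def k0_def by auto
    define m' where "m' x = m j x / \<gamma> x" for x
    have Am [measurable]: "A j \<in> borel_measurable (lebesgue_on \<Omega>)" by (rule A_meas)
    have mm [measurable]: "m j \<in> borel_measurable (lebesgue_on \<Omega>)" by (rule L2_meas[OF m_L2])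
    have \<gamma>m [measurable]: "\<gamma> \<in> borel_measurable (lebesgue_on \<Omega>)"
      unfolding \<gamma>_def trace_inner by measurable
    have m'm: "m' \<in> borel_measurable (lebesgue_on \<Omega>)" unfolding m'_def by measurable
    have m': "m' \<in> L2 \<Omega>"
    proof (rule L2_dominated(1)[OF m'm L2_scale[OF L2_abs[OF m_L2[of j]], of k0]])
      show "AE x in lebesgue_on \<Omega>. \<bar>m' x\<bar> \<le> k0 * \<bar>m j x\<bar>"
        using AE_in_domain
      proof eventually_elim
        case (elim x)
        then have "\<bar>m j x\<bar> * inverse (\<gamma> x) \<le> \<bar>m j x\<bar> * k0" using \<gamma>[OF elim] by (intro mult_left_mono) auto
        then show ?case using \<gamma>(1)[OF elim] by (simp add: m'_def divide_inverse abs_mult mult.commute)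
      qed
    qed
    obtain v where v: "v \<in> V_space \<Omega>" "ext \<Omega> (\<lambda>x. trace (weak_hessian \<Omega> v x)) = ext \<Omega> m'"
      using laplacian_surjective[OF m'] by metis
    have tr: "AE x in lebesgue_on \<Omega>. trace (weak_hessian \<Omega> v x) = m' x"
      using v ext_eq_iff[OF trace_L2[OF v(1)] m'] by simp
    have nW: "(\<lambda>x. norm (weak_hessian \<Omega> v x)) \<in> L2 \<Omega>" by (rule mat_L2_norm(1)[OF mat_L2_hessian[OF v(1)]])
    have Wle: "norm (ext \<Omega> (\<lambda>x. norm (weak_hessian \<Omega> v x))) \<le> norm (ext \<Omega> m')"
      using miranda_talenti[OF v(1)] mat_L2_norm(2)[OF mat_L2_hessian[OF v(1)]] by (simp add: mat_ext_hessian v(2))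
    \<comment> \<open>Pointwise this is the Cordes inequality with trace \<open>m'\<close>,
      multiplied by \<open>m'\<close>; nonnegativity of \<open>m\<close> enters here. By
      Miranda-Talenti the left-hand side is at least (1 - s) times the squared norm of
      \<open>m'\<close>.\<close>
    have "(LINT x|lebesgue_on \<Omega>. m' x * (m' x - s * norm (weak_hessian \<Omega> v x)))
        \<le> (LINT x|lebesgue_on \<Omega>. - ((m j x *\<^sub>R A j x) \<bullet> weak_hessian \<Omega> v x))"
    proof (rule integral_mono_AE)
      show "integrable (lebesgue_on \<Omega>) (\<lambda>x. m' x * (m' x - s * norm (weak_hessian \<Omega> v x)))"
        by (intro L2_integrable_mult L2_diff L2_scale m' nW)
      show "integrable (lebesgue_on \<Omega>) (\<lambda>x. - ((m j x *\<^sub>R A j x) \<bullet> weak_hessian \<Omega> v x))"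
        by (intro Bochner_Integration.integrable_minus inner_mat_ext(2) mA_L2 mat_L2_hessian v)
      show "AE x in lebesgue_on \<Omega>. m' x * (m' x - s * norm (weak_hessian \<Omega> v x)) \<le> - ((m j x *\<^sub>R A j x) \<bullet> weak_hessian \<Omega> v x)"
        using AE_in_domain tr m_nonneg[of j]
      proof eventually_elim
        case (elim x)
        let ?W = "weak_hessian \<Omega> v x"
        have "trace ?W - \<gamma> x * (- A j x \<bullet> ?W) \<le> s * norm ?W"
          using cordes_trace_diff[OF cordes_params A_cordes[OF elim(1), of j], of ?W] unfolding \<gamma>_def s_def by linarith
        then have "m' x - s * norm ?W \<le> \<gamma> x * (- A j x \<bullet> ?W)" using elim by simp
        moreover have "0 \<le> m' x" using elim \<gamma>[OF elim(1)] by (simp add: m'_def)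
        ultimately have "m' x * (m' x - s * norm ?W) \<le> m' x * (\<gamma> x * (- A j x \<bullet> ?W))" by (rule mult_left_mono)
        also have "\<dots> = - ((m j x *\<^sub>R A j x) \<bullet> ?W)" using \<gamma>(1)[OF elim(1)] by (simp add: m'_def)
        finally show ?case .
      qed
    qed
    also have "\<dots> = - G v" using m_equation[OF v(1)] by simp
    also have "\<dots> \<le> \<bar>CG\<bar> * (CV * norm (ext \<Omega> m'))"
    proof -
      have n0: "0 \<le> H2_norm \<Omega> v" by (simp add: H2_norm_ext[OF V_H2[OF v(1)]])
      have "- G v \<le> CG * H2_norm \<Omega> v" using CG[OF v(1)] by linarith
      also have "\<dots> \<le> \<bar>CG\<bar> * H2_norm \<Omega> v" by (intro mult_right_mono n0) simp
      also have "\<dots> \<le> \<bar>CG\<bar> * (CV * norm (ext \<Omega> m'))" using CV(2)[OF v(1)] by (intro mult_left_mono) (auto simp: v(2))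
      finally show ?thesis .
    qed
    finally have "(LINT x|lebesgue_on \<Omega>. m' x * (m' x - s * norm (weak_hessian \<Omega> v x))) \<le> \<bar>CG\<bar> * (CV * norm (ext \<Omega> m'))" .
    moreover have "(LINT x|lebesgue_on \<Omega>. m' x * (m' x - s * norm (weak_hessian \<Omega> v x)))
        = inner (ext \<Omega> m') (ext \<Omega> m' - s *\<^sub>R ext \<Omega> (\<lambda>x. norm (weak_hessian \<Omega> v x)))"
      using L2_inner_ext[OF m' L2_diff[OF m' L2_scale[OF nW, of s]]] unfolding L2_inner_def
      by (simp add: ext_diff ext_scale L2_scale m' nW)
    moreover have "inner (ext \<Omega> m') (ext \<Omega> (\<lambda>x. norm (weak_hessian \<Omega> v x))) \<le> norm (ext \<Omega> m') * norm (ext \<Omega> m')"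
      by (rule order_trans[OF norm_cauchy_schwarz mult_left_mono[OF Wle norm_ge_zero]])
    then have "s * inner (ext \<Omega> m') (ext \<Omega> (\<lambda>x. norm (weak_hessian \<Omega> v x))) \<le> s * (norm (ext \<Omega> m') * norm (ext \<Omega> m'))"
      using s by (intro mult_left_mono)
    ultimately have "(1 - s) * norm (ext \<Omega> m') * norm (ext \<Omega> m') \<le> \<bar>CG\<bar> * CV * norm (ext \<Omega> m')"
      by (simp add: inner_diff_right power2_norm_eq_inner[symmetric] power2_eq_square algebra_simps)
    then have "(1 - s) * norm (ext \<Omega> m') \<le> \<bar>CG\<bar> * CV"
      using CV by (cases "norm (ext \<Omega> m') = 0") (auto simp: mult_le_cancel_right)
    then have n': "norm (ext \<Omega> m') \<le> \<bar>CG\<bar> * CV / (1 - s)" using s by (simp add: field_simps)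
    obtain x0 where x0: "x0 \<in> \<Omega>" using nonempty_domain by blast
    have g0: "0 \<le> g0" using \<gamma>(1,2)[OF x0] by linarith
    have "norm (ext \<Omega> (m j)) \<le> norm (ext \<Omega> (\<lambda>x. g0 * \<bar>m' x\<bar>))"
    proof (rule L2_dominated(2)[OF mm L2_scale[OF L2_abs[OF m']]])
      show "AE x in lebesgue_on \<Omega>. \<bar>m j x\<bar> \<le> g0 * \<bar>m' x\<bar>"
        using AE_in_domain
      proof eventually_elim
        case (elim x)
        have "\<gamma> x * \<bar>m' x\<bar> \<le> g0 * \<bar>m' x\<bar>" using \<gamma>(2)[OF elim] by (intro mult_right_mono) auto
        then show ?case using \<gamma>(1)[OF elim] by (simp add: m'_def)
      qed
    qed
    also have "\<dots> = g0 * norm (ext \<Omega> m')" using g0 by (simp add: ext_scale L2_abs m' norm_ext_abs)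
    also have "\<dots> \<le> g0 * (\<bar>CG\<bar> * CV / (1 - s))" by (rule mult_left_mono[OF n' g0])
    finally show ?thesis .
  qed
  then show ?thesis by (rule that)
qed

lemma hessian_difference_bound:
  defines "s \<equiv> sqrt (1 - \<epsilon>)" and "g0 \<equiv> real CARD('n) * \<nu>u / \<nu>l\<^sup>2"
  shows "(1 - s) * norm (ext \<Omega> (\<lambda>x. trace (weak_hessian \<Omega> (\<lambda>x. u j x - u k x) x)))
    \<le> g0 * (norm (ext \<Omega> (F (m j)) - ext \<Omega> (F (m k))) + (\<omega> j + \<omega> k) * norm (ext \<Omega> (\<lambda>x. 1)))"
proof -
  let ?v = "\<lambda>x. u j x - u k x"
  let ?n = "\<lambda>x. norm (weak_hessian \<Omega> ?v x)"
  have v: "?v \<in> V_space \<Omega>" by (intro V_diff u_V)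
  have nW: "?n \<in> L2 \<Omega>" by (rule mat_L2_norm(1)[OF mat_L2_hessian[OF v]])
  have Wle: "norm (ext \<Omega> ?n) \<le> norm (ext \<Omega> (\<lambda>x. trace (weak_hessian \<Omega> ?v x)))"
    using miranda_talenti[OF v] mat_L2_norm(2)[OF mat_L2_hessian[OF v]] by (simp add: mat_ext_hessian)
  have FF: "(\<lambda>x. F (m j) x - F (m k) x) \<in> L2 \<Omega>" by (intro L2_diff F_L2 m_L2)
  have s: "0 \<le> s" using cordes_params by (simp add: s_def)
  obtain x0 where x0: "x0 \<in> \<Omega>" using nonempty_domain by blast
  have g0: "0 \<le> g0" using cordes_scaled(1,2)[OF cordes_params A_cordes[OF x0, of 0]] unfolding g0_def by linarith
  have \<omega>0: "0 \<le> \<omega> j" for j using h_approx[OF in_closure[OF x0] sym_matrices_0, of j] by linarith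
  have L: "(\<lambda>x. g0 * (\<bar>F (m j) x - F (m k) x\<bar> + (\<omega> j + \<omega> k)) + s * ?n x) \<in> L2 \<Omega>"
    by (intro L2_add L2_scale L2_abs L2_const FF nW)
  have "norm (ext \<Omega> (\<lambda>x. trace (weak_hessian \<Omega> ?v x))) \<le> norm (ext \<Omega> (\<lambda>x. g0 * (\<bar>F (m j) x - F (m k) x\<bar> + (\<omega> j + \<omega> k)) + s * ?n x))"
  proof (rule L2_dominated(2)[OF L2_meas[OF trace_L2[OF v]] L])
    show "AE x in lebesgue_on \<Omega>. \<bar>trace (weak_hessian \<Omega> ?v x)\<bar> \<le> g0 * (\<bar>F (m j) x - F (m k) x\<bar> + (\<omega> j + \<omega> k)) + s * ?n x"
      using AE_in_domain weak_hessian_diff[OF u_V[of j] u_V[of k]] sym_hessian_AE[OF u_V[of j]] sym_hessian_AE[OF u_V[of k]]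
        u_equation[of j] u_equation[of k]
    proof eventually_elim
      case (elim x)
      note x = in_closure[OF elim(1)]
      obtain P where P: "P \<in> sym_matrices" "h j x (S j x) - h j x (S k x) = partial_M (h j) x P \<bullet> (S j x - S k x)"
        using partial_M_mvt[where h = "h j", OF h_differentiable[OF x] sym_hessian_sym sym_hessian_sym] by metis
      have "\<bar>trace (S j x - S k x)\<bar> \<le> g0 * \<bar>- partial_M (h j) x P \<bullet> (S j x - S k x)\<bar> + s * norm (S j x - S k x)"
        unfolding g0_def s_def by (rule cordes_trace_le[OF cordes_params h_cordes[OF x P(1)]])
      also have "\<bar>- partial_M (h j) x P \<bullet> (S j x - S k x)\<bar> = \<bar>h j x (S j x) - h j x (S k x)\<bar>" using P(2) by simp
      \<comment> \<open>The equations give \<open>h j\<close> at \<open>S j\<close> and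
        \<open>h k\<close> at \<open>S k\<close>; exchanging \<open>h j\<close> for
        \<open>h k\<close> at \<open>S k\<close> passes through \<open>H\<close> and costs
        \<open>\<omega> j + \<omega> k\<close>.\<close>
      also have "g0 * \<dots> \<le> g0 * (\<bar>F (m j) x - F (m k) x\<bar> + (\<omega> j + \<omega> k))"
        using h_approx[OF x sym_hessian_sym, of j \<Omega> "u k" x] h_approx[OF x sym_hessian_sym, of k \<Omega> "u k" x] elim(5,6)
        by (intro mult_left_mono g0) linarith
      finally show ?case using elim by simp
    qed
  qed
  also have "\<dots> \<le> g0 * (norm (ext \<Omega> (F (m j)) - ext \<Omega> (F (m k))) + (\<omega> j + \<omega> k) * norm (ext \<Omega> (\<lambda>x. 1))) + s * norm (ext \<Omega> ?n)"
  proof -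
    have c: "ext \<Omega> (\<lambda>x. \<omega> j + \<omega> k) = (\<omega> j + \<omega> k) *\<^sub>R ext \<Omega> (\<lambda>x. 1)" using ext_scale[OF L2_const, of "\<omega> j + \<omega> k" 1] by simp
    have "ext \<Omega> (\<lambda>x. g0 * (\<bar>F (m j) x - F (m k) x\<bar> + (\<omega> j + \<omega> k)) + s * ?n x)
        = g0 *\<^sub>R (ext \<Omega> (\<lambda>x. \<bar>F (m j) x - F (m k) x\<bar>) + (\<omega> j + \<omega> k) *\<^sub>R ext \<Omega> (\<lambda>x. 1)) + s *\<^sub>R ext \<Omega> ?n"
      by (simp add: ext_add ext_scale L2_add L2_scale L2_abs L2_const FF nW c)
    also have "norm \<dots> \<le> g0 * (norm (ext \<Omega> (\<lambda>x. \<bar>F (m j) x - F (m k) x\<bar>)) + (\<omega> j + \<omega> k) * norm (ext \<Omega> (\<lambda>x. 1))) + s * norm (ext \<Omega> ?n)"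
    proof (intro norm_triangle_le add_mono)
      show "norm (s *\<^sub>R ext \<Omega> ?n) \<le> s * norm (ext \<Omega> ?n)" using s by simp
      show "norm (g0 *\<^sub>R (ext \<Omega> (\<lambda>x. \<bar>F (m j) x - F (m k) x\<bar>) + (\<omega> j + \<omega> k) *\<^sub>R ext \<Omega> (\<lambda>x. 1)))
          \<le> g0 * (norm (ext \<Omega> (\<lambda>x. \<bar>F (m j) x - F (m k) x\<bar>)) + (\<omega> j + \<omega> k) * norm (ext \<Omega> (\<lambda>x. 1)))"
        unfolding norm_scaleR abs_of_nonneg[OF g0] using \<omega>0[of j] \<omega>0[of k]
        by (intro mult_left_mono g0 norm_triangle_le) simp
    qed
    finally show ?thesis by (simp add: norm_ext_abs[OF FF] ext_diff F_L2 m_L2)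
  qed
  \<comment> \<open>Miranda-Talenti turns this term into a multiple of the left-hand side, where it
    is absorbed and leaves the factor 1 - s.\<close>
  also have "s * norm (ext \<Omega> ?n) \<le> s * norm (ext \<Omega> (\<lambda>x. trace (weak_hessian \<Omega> ?v x)))" by (rule mult_left_mono[OF Wle s])
  finally show ?thesis by (simp add: algebra_simps)
qed

lemma A_bounded:
  obtains K where "\<And>j. norm (mat_ext \<Omega> (A j)) \<le> K"
proof
  fix j
  let ?k = "real CARD('n) * \<nu>u / sqrt (real CARD('n) - 1 + \<epsilon>)"
  show "norm (mat_ext \<Omega> (A j)) \<le> norm (ext \<Omega> (\<lambda>x. ?k))"
    unfolding mat_L2_norm(2)[OF A_L2]
    by (rule L2_dominated(2)[OF L2_meas[OF mat_L2_norm(1)[OF A_L2]] L2_const]) (use A_norm in \<open>simp add: AE_domain\<close>)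
qed

lemma mA_bounded:
  obtains K where "\<And>j. norm (mat_ext \<Omega> (\<lambda>x. m j x *\<^sub>R A j x)) \<le> K"
proof -
  obtain K where K: "\<And>j. norm (ext \<Omega> (m j)) \<le> K" using m_bounded by blast
  let ?k = "\<bar>real CARD('n) * \<nu>u / sqrt (real CARD('n) - 1 + \<epsilon>)\<bar>"
  have "norm (mat_ext \<Omega> (\<lambda>x. m j x *\<^sub>R A j x)) \<le> ?k * K" for j
  proof -
    have "norm (mat_ext \<Omega> (\<lambda>x. m j x *\<^sub>R A j x)) \<le> norm (ext \<Omega> (\<lambda>x. ?k * \<bar>m j x\<bar>))"
      unfolding mat_L2_norm(2)[OF mA_L2]
    proof (rule L2_dominated(2)[OF L2_meas[OF mat_L2_norm(1)[OF mA_L2]] L2_scale[OF L2_abs[OF m_L2]]])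
      show "AE x in lebesgue_on \<Omega>. \<bar>norm (m j x *\<^sub>R A j x)\<bar> \<le> ?k * \<bar>m j x\<bar>"
        using AE_in_domain
      proof eventually_elim
        case (elim x)
        have "norm (A j x) * \<bar>m j x\<bar> \<le> ?k * \<bar>m j x\<bar>"
          using A_norm[OF elim, of j] by (intro mult_right_mono) linarith+
        then show ?case by (simp add: mult.commute)
      qed
    qed
    also have "\<dots> = ?k * norm (ext \<Omega> (m j))" unfolding ext_scale[OF L2_abs[OF m_L2]] norm_scaleR norm_ext_abs[OF m_L2] abs_abs ..
    also have "\<dots> \<le> ?k * K" by (rule mult_left_mono[OF K abs_ge_zero])
    finally show ?thesis .
  qed
  then show ?thesis by (rule that)
qed

end

section \<open>Extraction of weak limits and properties inherited by the limit Hamiltonian\<close>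

context bounded_domain
begin

lemma L2_indicator:
  assumes E: "E \<in> sets (lebesgue_on \<Omega>)" and f: "f \<in> L2 \<Omega>"
  shows "(\<lambda>x. indicator E x * f x) \<in> L2 \<Omega>"
proof (rule L2_dominated(1)[OF _ L2_abs[OF f]])
  show "(\<lambda>x. indicator E x * f x) \<in> borel_measurable (lebesgue_on \<Omega>)"
    using L2_meas[OF f] E by measurable
qed (auto simp: indicator_def)

lemma mat_L2_indicator:
  assumes E: "E \<in> sets (lebesgue_on \<Omega>)" and B: "B \<in> mat_L2 \<Omega>"
  shows "(\<lambda>x. indicator E x *\<^sub>R B x) \<in> mat_L2 \<Omega>"
  using L2_indicator[OF E mat_L2_nth[OF B]] by (simp add: mat_L2_def)

lemma mat_ext_mono:
  assumes "B \<in> mat_L2 \<Omega>" "D \<in> mat_L2 \<Omega>" "\<And>x. norm (B x) \<le> norm (D x)"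
  shows "norm (mat_ext \<Omega> B) \<le> norm (mat_ext \<Omega> D)"
  unfolding mat_L2_norm(2)[OF assms(1)] mat_L2_norm(2)[OF assms(2)]
  using assms by (intro L2_dominated(2) L2_meas mat_L2_norm) auto

lemma inner_mat_ext_fun_of:
  assumes W: "W \<in> mat_L2 \<Omega>"
  shows "(\<lambda>x. \<chi> i k. fun_of (z $ i $ k) x) \<in> mat_L2 \<Omega>"
    "inner z (mat_ext \<Omega> W) = inner (mat_ext \<Omega> (\<lambda>x. \<chi> i k. fun_of (z $ i $ k) x)) (mat_ext \<Omega> W)"
  using inner_ext_fun_of[OF mat_L2_nth[OF W]]
  by (simp_all add: mat_L2_def fun_of_L2 inner_vec_def mat_ext_def)

end

context regularized_sequence
begin

text \<open>The three bounded sequences are combined into one sequence in a product Hilbert space,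
  so a single subsequence serves all of them.\<close>

lemma weak_limits:
  obtains r m0 A0 B0 where "strict_mono (r :: nat \<Rightarrow> nat)" "m0 \<in> L2 \<Omega>" "A0 \<in> mat_L2 \<Omega>" "B0 \<in> mat_L2 \<Omega>"
    "\<And>w. w \<in> L2 \<Omega> \<Longrightarrow> (\<lambda>j. inner (ext \<Omega> (m (r j))) (ext \<Omega> w)) \<longlonglongrightarrow> inner (ext \<Omega> m0) (ext \<Omega> w)"
    "\<And>W. W \<in> mat_L2 \<Omega> \<Longrightarrow> (\<lambda>j. inner (mat_ext \<Omega> (A (r j))) (mat_ext \<Omega> W)) \<longlonglongrightarrow> inner (mat_ext \<Omega> A0) (mat_ext \<Omega> W)"
    "\<And>W. W \<in> mat_L2 \<Omega> \<Longrightarrow> (\<lambda>j. inner (mat_ext \<Omega> (\<lambda>x. m (r j) x *\<^sub>R A (r j) x)) (mat_ext \<Omega> W)) \<longlonglongrightarrow> inner (mat_ext \<Omega> B0) (mat_ext \<Omega> W)"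
proof -
  obtain K where K: "\<And>j. norm (ext \<Omega> (m j)) \<le> K" using m_bounded by blast
  obtain KA where KA: "\<And>j. norm (mat_ext \<Omega> (A j)) \<le> KA" using A_bounded by blast
  obtain KB where KB: "\<And>j. norm (mat_ext \<Omega> (\<lambda>x. m j x *\<^sub>R A j x)) \<le> KB" using mA_bounded by blast
  define X where "X j = (ext \<Omega> (m j), mat_ext \<Omega> (A j), mat_ext \<Omega> (\<lambda>x. m j x *\<^sub>R A j x))" for j
  have "norm (X j) \<le> K + (KA + KB)" for j
    unfolding X_def by (intro order_trans[OF norm_Pair_le] add_mono K KA KB)
  from weakly_convergent_subsequence[of X, OF this]
  obtain r z where r: "strict_mono r" and z: "\<And>y. (\<lambda>n. inner (X (r n)) y) \<longlonglongrightarrow> inner z y"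
    by metis
  obtain z1 z2 z3 where zz: "z = (z1, z2, z3)" by (cases z) auto
  show ?thesis
  proof (rule that[OF r fun_of_L2[of z1] inner_mat_ext_fun_of(1)[OF A_L2[of 0], of z2] inner_mat_ext_fun_of(1)[OF A_L2[of 0], of z3]])
    fix w assume w: "w \<in> L2 \<Omega>"
    show "(\<lambda>j. inner (ext \<Omega> (m (r j))) (ext \<Omega> w)) \<longlonglongrightarrow> inner (ext \<Omega> (fun_of z1)) (ext \<Omega> w)"
      using z[of "(ext \<Omega> w, 0, 0)"] unfolding inner_ext_fun_of[OF w, of z1, symmetric] by (simp add: X_def zz)
  next
    fix W assume W: "W \<in> mat_L2 \<Omega>"
    show "(\<lambda>j. inner (mat_ext \<Omega> (A (r j))) (mat_ext \<Omega> W)) \<longlonglongrightarrow> inner (mat_ext \<Omega> (\<lambda>x. \<chi> i k. fun_of (z2 $ i $ k) x)) (mat_ext \<Omega> W)"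
      using z[of "(0, mat_ext \<Omega> W, 0)"] unfolding inner_mat_ext_fun_of(2)[OF W, of z2, symmetric] by (simp add: X_def zz)
    show "(\<lambda>j. inner (mat_ext \<Omega> (\<lambda>x. m (r j) x *\<^sub>R A (r j) x)) (mat_ext \<Omega> W)) \<longlonglongrightarrow> inner (mat_ext \<Omega> (\<lambda>x. \<chi> i k. fun_of (z3 $ i $ k) x)) (mat_ext \<Omega> W)"
      using z[of "(0, 0, mat_ext \<Omega> W)"] unfolding inner_mat_ext_fun_of(2)[OF W, of z3, symmetric] by (simp add: X_def zz)
  qed
qed

lemma H_tendsto: "x \<in> \<Omega> \<Longrightarrow> M \<in> sym_matrices \<Longrightarrow> (\<lambda>j. h j x M) \<longlonglongrightarrow> H x M"
proof -
  assume x: "x \<in> \<Omega>" "M \<in> sym_matrices"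
  have "(\<lambda>j. h j x M - H x M) \<longlonglongrightarrow> 0"
    by (rule LIMSEQ_norm_0[OF _ \<omega>_tendsto]) (use h_approx[OF in_closure] x in simp)
  then show ?thesis by (simp add: LIM_zero_iff)
qed

text \<open>Inherited from the uniform Lipschitz bound of the \<open>h j\<close> through pointwise
  convergence.\<close>

lemma H_lipschitz:
  assumes x: "x \<in> \<Omega>" and M: "M \<in> sym_matrices" and N: "N \<in> sym_matrices"
  shows "\<bar>H x M - H x N\<bar> \<le> \<bar>C\<bar> * norm (M - N)"
proof (rule LIMSEQ_le_const2)
  show "(\<lambda>j. \<bar>h j x M - h j x N\<bar>) \<longlonglongrightarrow> \<bar>H x M - H x N\<bar>"
    by (intro tendsto_intros H_tendsto assms)
  have "\<bar>h j x M - h j x N\<bar> \<le> \<bar>C\<bar> * norm (M - N)" for j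
    by (rule order_trans[OF h_lipschitz[OF in_closure[OF x] M N] mult_right_mono]) auto
  then show "\<exists>n0. \<forall>n\<ge>n0. \<bar>h n x M - h n x N\<bar> \<le> \<bar>C\<bar> * norm (M - N)" by blast
qed

lemma H_measurable:
  assumes g: "g \<in> borel_measurable (lebesgue_on \<Omega>)" "\<And>x. g x \<in> sym_matrices"
  shows "(\<lambda>x. H x (g x)) \<in> borel_measurable (lebesgue_on \<Omega>)"
proof (rule borel_measurable_LIMSEQ_real)
  fix x assume "x \<in> space (lebesgue_on \<Omega>)"
  then show "(\<lambda>j. h j x (g x)) \<longlonglongrightarrow> H x (g x)" by (intro H_tendsto g) simp
qed (rule measurable_symmetric_compose[OF h_continuous g])

text \<open>At the Hessian of \<open>u j\<close> the value of \<open>h j\<close> is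
  \<open>F (m j)\<close>, which is square-integrable; the Lipschitz bound in the matrix argument
  transfers this to any fixed matrix.\<close>

lemma h_const_L2:
  assumes N: "N \<in> sym_matrices"
  shows "(\<lambda>x. h j x N) \<in> L2 \<Omega>"
proof (rule L2_dominated(1))
  show "(\<lambda>x. h j x N) \<in> borel_measurable (lebesgue_on \<Omega>)"
    using N by (intro measurable_symmetric_compose[OF h_continuous]) auto
  show "(\<lambda>x. \<bar>F (m j) x\<bar> + \<bar>C\<bar> * norm (N - weak_hessian \<Omega> (u j) x)) \<in> L2 \<Omega>"
    by (intro L2_add L2_scale L2_abs F_L2 m_L2 mat_L2_norm(1) mat_L2_diff mat_L2_const mat_L2_hessian u_V)
  show "AE x in lebesgue_on \<Omega>. \<bar>h j x N\<bar> \<le> \<bar>F (m j) x\<bar> + \<bar>C\<bar> * norm (N - weak_hessian \<Omega> (u j) x)"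
    using u_equation[of j] sym_hessian_AE[OF u_V[of j]] AE_in_domain
  proof eventually_elim
    case (elim x)
    have "\<bar>h j x N - h j x (S j x)\<bar> \<le> \<bar>C\<bar> * norm (N - S j x)"
      by (rule order_trans[OF h_lipschitz[OF in_closure[OF elim(3)] N sym_hessian_sym] mult_right_mono]) auto
    then show ?case using elim by simp
  qed
qed

end

text \<open>The sequence here is already the extracted subsequence. \<open>B0\<close> is the weak
  limit of the products and need not be \<open>m0\<close> times \<open>A0\<close>.\<close>

locale regularized_limit = regularized_sequence +
  fixes m0 :: "real^'a \<Rightarrow> real" and A0 B0 :: "real^'a \<Rightarrow> real^'a^'a"
  assumes m0_L2: "m0 \<in> L2 \<Omega>" and A0_L2: "A0 \<in> mat_L2 \<Omega>" and B0_L2: "B0 \<in> mat_L2 \<Omega>"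
    and m_weak: "\<And>w. w \<in> L2 \<Omega> \<Longrightarrow> (\<lambda>j. inner (ext \<Omega> (m j)) (ext \<Omega> w)) \<longlonglongrightarrow> inner (ext \<Omega> m0) (ext \<Omega> w)"
    and A_weak: "\<And>W. W \<in> mat_L2 \<Omega> \<Longrightarrow> (\<lambda>j. inner (mat_ext \<Omega> (A j)) (mat_ext \<Omega> W)) \<longlonglongrightarrow> inner (mat_ext \<Omega> A0) (mat_ext \<Omega> W)"
    and mA_weak: "\<And>W. W \<in> mat_L2 \<Omega> \<Longrightarrow> (\<lambda>j. inner (mat_ext \<Omega> (\<lambda>x. m j x *\<^sub>R A j x)) (mat_ext \<Omega> W)) \<longlonglongrightarrow> inner (mat_ext \<Omega> B0) (mat_ext \<Omega> W)"
begin

lemma m_weak_tendsto: "L2_weak_tendsto \<Omega> m m0"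
  unfolding L2_weak_tendsto_def using m_weak by (simp add: L2_inner_ext m_L2 m0_L2)

lemma F_tendsto: "(\<lambda>j. ext \<Omega> (F (m j))) \<longlonglongrightarrow> ext \<Omega> (F m0)"
proof -
  have "(\<lambda>j. L2_norm \<Omega> (\<lambda>x. F (m j) x - F m0 x)) \<longlonglongrightarrow> 0"
    using F_completely_continuous m_L2 m0_L2 m_weak_tendsto unfolding completely_continuous_def by blast
  then have "(\<lambda>j. norm (ext \<Omega> (F (m j)) - ext \<Omega> (F m0))) \<longlonglongrightarrow> 0"
    by (simp add: L2_norm_ext L2_diff ext_diff F_L2 m_L2 m0_L2)
  then show ?thesis by (simp add: LIM_zero_iff tendsto_norm_zero_iff)
qed

lemma m0_nonneg: "AE x in lebesgue_on \<Omega>. 0 \<le> m0 x"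
proof (rule AE_nonneg_if_integrals_nonneg)
  show "integrable (lebesgue_on \<Omega>) m0" using L2_integrable_mult[OF m0_L2 L2_const, of 1] by simp
  fix E assume E: "E \<in> sets (lebesgue_on \<Omega>)"
  have w: "(\<lambda>x. indicator E x) \<in> L2 \<Omega>" using L2_indicator[OF E L2_const, of 1] by simp
  have i: "inner (ext \<Omega> g) (ext \<Omega> (\<lambda>x. indicator E x)) = (LINT x|lebesgue_on \<Omega>. indicator E x * g x)" if "g \<in> L2 \<Omega>" for g
    using L2_inner_ext[OF that w] by (simp add: L2_inner_def mult.commute)
  have "0 \<le> inner (ext \<Omega> (m j)) (ext \<Omega> (\<lambda>x. indicator E x))" for j
    unfolding i[OF m_L2] using m_nonneg[of j] by (intro integral_nonneg_AE) (auto elim!: eventually_mono)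
  then show "0 \<le> (LINT x|lebesgue_on \<Omega>. indicator E x * m0 x)"
    unfolding i[OF m0_L2, symmetric] by (intro LIMSEQ_le_const[OF m_weak[OF w]]) blast
qed

lemma u_converges:
  obtains u0 where "u0 \<in> V_space \<Omega>" "(\<lambda>j. H2_norm \<Omega> (\<lambda>x. u j x - u0 x)) \<longlonglongrightarrow> 0"
    "(\<lambda>j. hess_ext \<Omega> (u j)) \<longlonglongrightarrow> hess_ext \<Omega> u0"
proof (rule V_complete[OF u_V])
  define s g0 where "s = sqrt (1 - \<epsilon>)" and "g0 = real CARD('a) * \<nu>u / \<nu>l\<^sup>2"
  have s: "s < 1" using cordes_params by (simp add: s_def)
  obtain CV where CV: "0 \<le> CV" "\<And>v. v \<in> V_space \<Omega> \<Longrightarrow> H2_norm \<Omega> v \<le> CV * norm (ext \<Omega> (\<lambda>x. trace (weak_hessian \<Omega> v x)))"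
    using H2_norm_le_trace by metis
  let ?n = "norm (ext \<Omega> (\<lambda>x. 1))"
  \<comment> \<open>Splitting the difference of \<open>F (m j)\<close> and \<open>F (m k)\<close> at
    \<open>F m0\<close> turns the two-index bound into a sum of two null sequences.\<close>
  let ?b = "\<lambda>j. norm (ext \<Omega> (F (m j)) - ext \<Omega> (F m0)) + \<omega> j * ?n"
  have b: "(\<lambda>j. CV / (1 - s) * g0 * ?b j) \<longlonglongrightarrow> CV / (1 - s) * g0 * (0 + 0 * ?n)"
    using F_tendsto by (intro tendsto_intros \<omega>_tendsto) (simp add: LIM_zero_iff tendsto_norm_zero_iff)
  obtain x0 where x0: "x0 \<in> \<Omega>" using nonempty_domain by blast
  have g0: "0 \<le> g0" using cordes_scaled(1,2)[OF cordes_params A_cordes[OF x0, of 0]] unfolding g0_def by linarith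
  have le: "H2_norm \<Omega> (\<lambda>x. u j x - u k x) \<le> CV / (1 - s) * g0 * ?b j + CV / (1 - s) * g0 * ?b k" for j k
  proof -
    have v: "(\<lambda>x. u j x - u k x) \<in> V_space \<Omega>" by (intro V_diff u_V)
    let ?T = "norm (ext \<Omega> (\<lambda>x. trace (weak_hessian \<Omega> (\<lambda>x. u j x - u k x) x)))"
    have "(1 - s) * ?T \<le> g0 * (norm (ext \<Omega> (F (m j)) - ext \<Omega> (F (m k))) + (\<omega> j + \<omega> k) * ?n)"
      unfolding s_def g0_def by (rule hessian_difference_bound)
    also have "\<dots> \<le> g0 * (?b j + ?b k)"
      using norm_triangle_ineq4[of "ext \<Omega> (F (m j)) - ext \<Omega> (F m0)" "ext \<Omega> (F (m k)) - ext \<Omega> (F m0)"]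
      by (intro mult_left_mono g0) (simp add: algebra_simps)
    finally have "?T \<le> g0 * (?b j + ?b k) / (1 - s)" using s by (simp add: field_simps)
    then have "CV * ?T \<le> CV * (g0 * (?b j + ?b k) / (1 - s))" by (rule mult_left_mono[OF _ CV(1)])
    with CV(2)[OF v] have "H2_norm \<Omega> (\<lambda>x. u j x - u k x) \<le> CV * (g0 * (?b j + ?b k) / (1 - s))" by linarith
    also have "\<dots> = CV / (1 - s) * g0 * ?b j + CV / (1 - s) * g0 * ?b k" by (simp add: add_divide_distrib algebra_simps)
    finally show ?thesis .
  qed
  fix e :: real assume e: "0 < e"
  have "eventually (\<lambda>j. CV / (1 - s) * g0 * ?b j < e / 2) sequentially"
    using e by (intro order_tendstoD(2)[OF b]) simp
  then obtain N where N: "\<And>j. N \<le> j \<Longrightarrow> CV / (1 - s) * g0 * ?b j < e / 2" unfolding eventually_sequentially by blast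
  have "H2_norm \<Omega> (\<lambda>x. u j x - u k x) < e" if "N \<le> j" "N \<le> k" for j k
    using le[of j k] N[OF that(1)] N[OF that(2)] by linarith
  then show "\<exists>N. \<forall>j\<ge>N. \<forall>k\<ge>N. H2_norm \<Omega> (\<lambda>x. u j x - u k x) < e" by blast
qed (rule that)

end

section \<open>Identification of the limit as a solution\<close>

context regularized_limit
begin

context
  fixes u0 :: "real^'a \<Rightarrow> real"
  assumes u0_V: "u0 \<in> V_space \<Omega>" and hessian_tendsto: "(\<lambda>j. hess_ext \<Omega> (u j)) \<longlonglongrightarrow> hess_ext \<Omega> u0"
begin

abbreviation "W0 \<equiv> weak_hessian \<Omega> u0"

lemma hessian_difference_tendsto: "(\<lambda>j. norm (mat_ext \<Omega> (\<lambda>x. W0 x - weak_hessian \<Omega> (u j) x))) \<longlonglongrightarrow> 0"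
proof -
  have "(\<lambda>j. norm (hess_ext \<Omega> u0 - hess_ext \<Omega> (u j))) \<longlonglongrightarrow> norm (hess_ext \<Omega> u0 - hess_ext \<Omega> u0)"
    by (intro tendsto_intros hessian_tendsto)
  then show ?thesis by (simp add: mat_ext_diff mat_L2_hessian u_V u0_V mat_ext_hessian)
qed

lemma F_difference_tendsto:
  "(\<lambda>j. norm (ext \<Omega> (\<lambda>x. \<omega> j + \<bar>F (m j) x - F m0 x\<bar>))) \<longlonglongrightarrow> 0"
proof (rule LIMSEQ_norm_0)
  show "(\<lambda>j. \<bar>\<omega> j\<bar> * norm (ext \<Omega> (\<lambda>x. 1)) + norm (ext \<Omega> (F (m j)) - ext \<Omega> (F m0))) \<longlonglongrightarrow> 0"
    using tendsto_add[OF tendsto_mult_left_zero[OF tendsto_rabs_zero[OF \<omega>_tendsto]] tendsto_norm_zero[OF LIM_zero[OF F_tendsto]]] by simp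
  fix j
  have d: "(\<lambda>x. F (m j) x - F m0 x) \<in> L2 \<Omega>" by (intro L2_diff F_L2 m_L2 m0_L2)
  have "ext \<Omega> (\<lambda>x. \<omega> j + \<bar>F (m j) x - F m0 x\<bar>) = \<omega> j *\<^sub>R ext \<Omega> (\<lambda>x. 1) + ext \<Omega> (\<lambda>x. \<bar>F (m j) x - F m0 x\<bar>)"
    using ext_scale[OF L2_const, of "\<omega> j" 1] ext_add[OF L2_const L2_abs[OF d]] by simp
  then have "norm (ext \<Omega> (\<lambda>x. \<omega> j + \<bar>F (m j) x - F m0 x\<bar>)) \<le> norm (\<omega> j *\<^sub>R ext \<Omega> (\<lambda>x. 1)) + norm (ext \<Omega> (\<lambda>x. \<bar>F (m j) x - F m0 x\<bar>))"
    by (simp only: norm_triangle_ineq)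
  then show "norm (norm (ext \<Omega> (\<lambda>x. \<omega> j + \<bar>F (m j) x - F m0 x\<bar>))) \<le> \<bar>\<omega> j\<bar> * norm (ext \<Omega> (\<lambda>x. 1)) + norm (ext \<Omega> (F (m j)) - ext \<Omega> (F m0))"
    by (simp add: norm_ext_abs[OF d] ext_diff F_L2 m_L2 m0_L2)
qed

text \<open>The defect of the limit is bounded, for every j, by \<open>\<omega> j\<close>, the
  difference of the \<open>F\<close> values, and the Lipschitz constant times the difference of the
  Hessians; all three tend to zero in L^2.\<close>

lemma limit_equation: "AE x in lebesgue_on \<Omega>. H x (W0 x) = F m0 x"
proof -
  let ?D = "\<lambda>x. H x (sym_hessian \<Omega> u0 x) - F m0 x"
  let ?R = "\<lambda>j x. (\<omega> j + \<bar>F (m j) x - F m0 x\<bar>) + \<bar>C\<bar> * norm (W0 x - weak_hessian \<Omega> (u j) x)"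
  have D: "?D \<in> borel_measurable (lebesgue_on \<Omega>)"
    by (intro borel_measurable_diff H_measurable sym_hessian_meas sym_hessian_sym u0_V L2_meas F_L2 m0_L2)
  have W: "(\<lambda>x. W0 x - weak_hessian \<Omega> (u j) x) \<in> mat_L2 \<Omega>" for j by (intro mat_L2_diff mat_L2_hessian u_V u0_V)
  have R1: "(\<lambda>x. \<omega> j + \<bar>F (m j) x - F m0 x\<bar>) \<in> L2 \<Omega>" for j by (intro L2_add L2_const L2_abs L2_diff F_L2 m_L2 m0_L2)
  have R: "?R j \<in> L2 \<Omega>" for j by (intro L2_add[OF R1] L2_scale mat_L2_norm(1)[OF W])
  have le: "AE x in lebesgue_on \<Omega>. \<bar>?D x\<bar> \<le> ?R j x" for j
    using AE_in_domain u_equation[of j] sym_hessian_AE[OF u_V[of j]] sym_hessian_AE[OF u0_V]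
  proof eventually_elim
    case (elim x)
    have "\<bar>H x (sym_hessian \<Omega> u0 x) - H x (S j x)\<bar> \<le> \<bar>C\<bar> * norm (sym_hessian \<Omega> u0 x - S j x)"
      by (rule H_lipschitz[OF elim(1) sym_hessian_sym sym_hessian_sym])
    moreover have "\<bar>h j x (S j x) - H x (S j x)\<bar> \<le> \<omega> j" by (rule h_approx[OF in_closure[OF elim(1)] sym_hessian_sym])
    ultimately show ?case using elim by simp
  qed
  have D2: "?D \<in> L2 \<Omega>" by (rule L2_dominated(1)[OF D R[of 0] le])
  have "norm (ext \<Omega> ?D) \<le> norm (ext \<Omega> (\<lambda>x. \<omega> j + \<bar>F (m j) x - F m0 x\<bar>)) + \<bar>C\<bar> * norm (mat_ext \<Omega> (\<lambda>x. W0 x - weak_hessian \<Omega> (u j) x))" for j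
  proof -
    have "norm (ext \<Omega> ?D) \<le> norm (ext \<Omega> (?R j))" by (rule L2_dominated(2)[OF D R le])
    also have "ext \<Omega> (?R j) = ext \<Omega> (\<lambda>x. \<omega> j + \<bar>F (m j) x - F m0 x\<bar>) + \<bar>C\<bar> *\<^sub>R ext \<Omega> (\<lambda>x. norm (W0 x - weak_hessian \<Omega> (u j) x))"
      by (subst ext_add[OF R1 L2_scale[OF mat_L2_norm(1)[OF W]]]) (simp add: ext_scale mat_L2_norm(1)[OF W])
    also have "norm \<dots> \<le> norm (ext \<Omega> (\<lambda>x. \<omega> j + \<bar>F (m j) x - F m0 x\<bar>)) + \<bar>C\<bar> * norm (mat_ext \<Omega> (\<lambda>x. W0 x - weak_hessian \<Omega> (u j) x))"
      by (rule order_trans[OF norm_triangle_ineq]) (simp add: mat_L2_norm(2)[OF W])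
    finally show ?thesis .
  qed
  moreover have "(\<lambda>j. norm (ext \<Omega> (\<lambda>x. \<omega> j + \<bar>F (m j) x - F m0 x\<bar>)) + \<bar>C\<bar> * norm (mat_ext \<Omega> (\<lambda>x. W0 x - weak_hessian \<Omega> (u j) x))) \<longlonglongrightarrow> 0"
    using tendsto_add[OF F_difference_tendsto tendsto_mult_right_zero[OF hessian_difference_tendsto]] by simp
  ultimately have "norm (ext \<Omega> ?D) \<le> 0" by (intro LIMSEQ_le_const) blast+
  then have "ext \<Omega> ?D = ext \<Omega> (\<lambda>x. 0)" by (simp add: ext_def zero_l2_def[symmetric])
  then have "AE x in lebesgue_on \<Omega>. ?D x = 0" by (simp add: ext_eq_iff[OF D2 L2_zero])
  with sym_hessian_AE[OF u0_V] show ?thesis by eventually_elim simp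
qed

text \<open>The general weight \<open>p\<close> covers both the constant 1 and \<open>m\<close>. For
  fixed \<open>N\<close> the factors \<open>h j x N - F (m j) x\<close> and
  \<open>N - weak_hessian \<Omega> (u j) x\<close> converge in norm, so each side pairs them with a
  weakly convergent factor. A measurable set \<open>E\<close> is absorbed into the norm-convergent
  factors.\<close>

lemma limit_inequality:
  assumes p: "\<And>j. p j \<in> L2 \<Omega>" "\<And>j. AE x in lebesgue_on \<Omega>. 0 \<le> p j x" "\<And>j. norm (ext \<Omega> (p j)) \<le> K"
    and pA: "\<And>j. (\<lambda>x. p j x *\<^sub>R A j x) \<in> mat_L2 \<Omega>" "\<And>j. norm (mat_ext \<Omega> (\<lambda>x. p j x *\<^sub>R A j x)) \<le> K'"
    and P0: "p0 \<in> L2 \<Omega>" "P0 \<in> mat_L2 \<Omega>"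
    and pw: "\<And>w. w \<in> L2 \<Omega> \<Longrightarrow> (\<lambda>j. inner (ext \<Omega> (p j)) (ext \<Omega> w)) \<longlonglongrightarrow> inner (ext \<Omega> p0) (ext \<Omega> w)"
    and pAw: "\<And>W. W \<in> mat_L2 \<Omega> \<Longrightarrow> (\<lambda>j. inner (mat_ext \<Omega> (\<lambda>x. p j x *\<^sub>R A j x)) (mat_ext \<Omega> W)) \<longlonglongrightarrow> inner (mat_ext \<Omega> P0) (mat_ext \<Omega> W)"
    and N: "N \<in> sym_matrices"
  shows "AE x in lebesgue_on \<Omega>. P0 x \<bullet> (N - W0 x) \<le> p0 x * (H x N - F m0 x)"
proof -
  let ?W = "\<lambda>j. weak_hessian \<Omega> (u j)"
  have HN: "(\<lambda>x. H x N) \<in> L2 \<Omega>"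
  proof (rule L2_dominated(1)[OF H_measurable])
    show "(\<lambda>x. \<bar>h 0 x N\<bar> + \<omega> 0) \<in> L2 \<Omega>" by (intro L2_add L2_abs L2_const h_const_L2 N)
    show "AE x in lebesgue_on \<Omega>. \<bar>H x N\<bar> \<le> \<bar>h 0 x N\<bar> + \<omega> 0"
      using AE_in_domain
    proof eventually_elim
      case (elim x)
      then show ?case using h_approx[OF in_closure N, of x 0] by simp
    qed
  qed (use N in auto)
  have gL: "(\<lambda>x. h j x N - F (m j) x) \<in> L2 \<Omega>" "(\<lambda>x. H x N - F m0 x) \<in> L2 \<Omega>" for j
    by (intro L2_diff h_const_L2 N F_L2 m_L2 m0_L2 HN)+
  have yL: "(\<lambda>x. N - ?W j x) \<in> mat_L2 \<Omega>" "(\<lambda>x. N - W0 x) \<in> mat_L2 \<Omega>" for j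
    by (intro mat_L2_diff mat_L2_const mat_L2_hessian u_V u0_V)+
  have i: "integrable (lebesgue_on \<Omega>) (\<lambda>x. p0 x * (H x N - F m0 x))" "integrable (lebesgue_on \<Omega>) (\<lambda>x. P0 x \<bullet> (N - W0 x))"
    by (intro L2_integrable_mult P0 gL inner_mat_ext(2) yL)+
  have "AE x in lebesgue_on \<Omega>. 0 \<le> p0 x * (H x N - F m0 x) - P0 x \<bullet> (N - W0 x)"
  proof (rule AE_nonneg_if_integrals_nonneg[OF Bochner_Integration.integrable_diff[OF i]])
    fix E assume E: "E \<in> sets (lebesgue_on \<Omega>)"
    let ?g = "\<lambda>j x. indicator E x * (h j x N - F (m j) x)" and ?gl = "\<lambda>x. indicator E x * (H x N - F m0 x)"
    let ?y = "\<lambda>j x. indicator E x *\<^sub>R (N - ?W j x)" and ?yl = "\<lambda>x. indicator E x *\<^sub>R (N - W0 x)"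
    have g: "?g j \<in> L2 \<Omega>" "?gl \<in> L2 \<Omega>" for j by (intro L2_indicator[OF E] gL)+
    have y: "?y j \<in> mat_L2 \<Omega>" "?yl \<in> mat_L2 \<Omega>" for j by (intro mat_L2_indicator[OF E] yL)+
    have pos: "0 \<le> inner (ext \<Omega> (p j)) (ext \<Omega> (?g j)) - inner (mat_ext \<Omega> (\<lambda>x. p j x *\<^sub>R A j x)) (mat_ext \<Omega> (?y j))" for j
    proof -
      have "inner (mat_ext \<Omega> (\<lambda>x. p j x *\<^sub>R A j x)) (mat_ext \<Omega> (?y j)) = (LINT x|lebesgue_on \<Omega>. (p j x *\<^sub>R A j x) \<bullet> ?y j x)"
        by (rule inner_mat_ext(1)[OF pA(1) y(1)])
      also have "\<dots> \<le> (LINT x|lebesgue_on \<Omega>. p j x * ?g j x)"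
      proof (rule integral_mono_AE)
        show "AE x in lebesgue_on \<Omega>. (p j x *\<^sub>R A j x) \<bullet> ?y j x \<le> p j x * ?g j x"
          using AE_in_domain u_equation[of j] sym_hessian_AE[OF u_V[of j]] p(2)[of j]
        proof eventually_elim
          case (elim x)
          have "h j x (S j x) + partial_M (h j) x (S j x) \<bullet> (N - S j x) \<le> h j x N"
            by (rule partial_M_subgradient[where h = "h j", OF h_differentiable[OF in_closure[OF elim(1)]] h_convex[OF in_closure[OF elim(1)]] sym_hessian_sym N])
          then have "A j x \<bullet> (N - ?W j x) \<le> h j x N - F (m j) x" using elim by (simp add: policy_def)
          then have "p j x * (A j x \<bullet> (N - ?W j x)) \<le> p j x * (h j x N - F (m j) x)" by (rule mult_left_mono[OF _ elim(4)])
          then show ?case by (simp add: indicator_def)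
        qed
      qed (intro inner_mat_ext(2)[OF pA(1) y(1)] L2_integrable_mult p g)+
      also have "\<dots> = inner (ext \<Omega> (p j)) (ext \<Omega> (?g j))" using L2_inner_ext[OF p(1) g(1)] by (simp add: L2_inner_def)
      finally show ?thesis by simp
    qed
    have gl: "(\<lambda>j. ext \<Omega> (?g j)) \<longlonglongrightarrow> ext \<Omega> ?gl"
    proof (rule LIM_zero_cancel, rule LIMSEQ_norm_0[OF _ F_difference_tendsto])
      fix j
      have "norm (ext \<Omega> (\<lambda>x. ?g j x - ?gl x)) \<le> norm (ext \<Omega> (\<lambda>x. \<omega> j + \<bar>F (m j) x - F m0 x\<bar>))"
      proof (rule L2_dominated(2)[OF L2_meas[OF L2_diff[OF g]]])
        show "(\<lambda>x. \<omega> j + \<bar>F (m j) x - F m0 x\<bar>) \<in> L2 \<Omega>" by (intro L2_add L2_const L2_abs L2_diff F_L2 m_L2 m0_L2)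
        show "AE x in lebesgue_on \<Omega>. \<bar>?g j x - ?gl x\<bar> \<le> \<omega> j + \<bar>F (m j) x - F m0 x\<bar>"
          using AE_in_domain
        proof eventually_elim
          case (elim x)
          have "\<bar>h j x N - H x N\<bar> \<le> \<omega> j" by (rule h_approx[OF in_closure[OF elim] N])
          then show ?case by (auto simp: indicator_def)
        qed
      qed
      then show "norm (ext \<Omega> (?g j) - ext \<Omega> ?gl) \<le> norm (ext \<Omega> (\<lambda>x. \<omega> j + \<bar>F (m j) x - F m0 x\<bar>))"
        by (simp only: ext_diff[OF g])
    qed
    have yl: "(\<lambda>j. mat_ext \<Omega> (?y j)) \<longlonglongrightarrow> mat_ext \<Omega> ?yl"
    proof (rule LIM_zero_cancel, rule LIMSEQ_norm_0[OF _ hessian_difference_tendsto])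
      fix j
      have "norm (mat_ext \<Omega> (\<lambda>x. ?y j x - ?yl x)) \<le> norm (mat_ext \<Omega> (\<lambda>x. W0 x - ?W j x))"
        by (rule mat_ext_mono[OF mat_L2_diff[OF y]]) (auto simp: indicator_def intro!: mat_L2_diff mat_L2_hessian u_V u0_V)
      then show "norm (mat_ext \<Omega> (?y j) - mat_ext \<Omega> ?yl) \<le> norm (mat_ext \<Omega> (\<lambda>x. W0 x - ?W j x))"
        by (simp only: mat_ext_diff[OF y])
    qed
    have "0 \<le> inner (ext \<Omega> p0) (ext \<Omega> ?gl) - inner (mat_ext \<Omega> P0) (mat_ext \<Omega> ?yl)"
      using pos by (intro LIMSEQ_le_const[OF tendsto_diff[OF
          weak_strong_inner_tendsto[OF pw[OF g(2)] p(3) gl] weak_strong_inner_tendsto[OF pAw[OF y(2)] pA(2) yl]]]) blast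
    also have "\<dots> = (LINT x|lebesgue_on \<Omega>. p0 x * ?gl x) - (LINT x|lebesgue_on \<Omega>. P0 x \<bullet> ?yl x)"
      using L2_inner_ext[OF P0(1) g(2)] by (simp add: L2_inner_def inner_mat_ext(1)[OF P0(2) y(2)])
    also have "\<dots> = (LINT x|lebesgue_on \<Omega>. p0 x * ?gl x - P0 x \<bullet> ?yl x)"
      by (rule Bochner_Integration.integral_diff[symmetric]) (intro L2_integrable_mult inner_mat_ext(2) P0 g y)+
    finally show "0 \<le> (LINT x|lebesgue_on \<Omega>. indicator E x * (p0 x * (H x N - F m0 x) - P0 x \<bullet> (N - W0 x)))"
      by (simp add: algebra_simps)
  qed
  then show ?thesis by eventually_elim simp
qed

text \<open>The exceptional null set may depend on \<open>N\<close>. A countable dense set of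
  symmetric matrices yields one common null set, and Lipschitz continuity of \<open>H\<close> in the
  matrix extends the inequality to all of them.\<close>

lemma AE_all_symmetric:
  assumes "\<And>N. N \<in> sym_matrices \<Longrightarrow> AE x in lebesgue_on \<Omega>. P0 x \<bullet> (N - W0 x) \<le> p0 x * (H x N - F m0 x)"
  shows "AE x in lebesgue_on \<Omega>. \<forall>N\<in>sym_matrices. P0 x \<bullet> (N - W0 x) \<le> p0 x * (H x N - F m0 x)"
proof -
  obtain T :: "(real^'a^'a) set" where T: "countable T" "T \<subseteq> sym_matrices" "sym_matrices \<subseteq> closure T"
    using separable by metis
  have "AE x in lebesgue_on \<Omega>. \<forall>N\<in>T. P0 x \<bullet> (N - W0 x) \<le> p0 x * (H x N - F m0 x)"
    using T assms by (subst AE_ball_countable) auto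
  with AE_in_domain show ?thesis
  proof eventually_elim
    case (elim x)
    show ?case
    proof
      fix N :: "real^'a^'a" assume N: "N \<in> sym_matrices"
      then obtain f where f: "\<And>n. f n \<in> T" "f \<longlonglongrightarrow> N" using T(3) closure_sequential by blast
      have "(\<lambda>n. norm (f n - N)) \<longlonglongrightarrow> 0" by (rule tendsto_norm_zero[OF LIM_zero[OF f(2)]])
      from tendsto_mult_right_zero[OF this, of "\<bar>C\<bar>"] have "(\<lambda>n. H x (f n) - H x N) \<longlonglongrightarrow> 0"
        by (rule LIMSEQ_norm_0[rotated]) (use H_lipschitz[OF elim(1) _ N] f(1) T(2) in auto)
      then have H: "(\<lambda>n. H x (f n)) \<longlonglongrightarrow> H x N" by (rule LIM_zero_cancel)
      show "P0 x \<bullet> (N - W0 x) \<le> p0 x * (H x N - F m0 x)"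
      proof (rule LIMSEQ_le)
        show "(\<lambda>n. P0 x \<bullet> (f n - W0 x)) \<longlonglongrightarrow> P0 x \<bullet> (N - W0 x)" by (intro tendsto_intros f)
        show "(\<lambda>n. p0 x * (H x (f n) - F m0 x)) \<longlonglongrightarrow> p0 x * (H x N - F m0 x)" by (intro tendsto_intros H)
        show "\<exists>n0. \<forall>n\<ge>n0. P0 x \<bullet> (f n - W0 x) \<le> p0 x * (H x (f n) - F m0 x)" using elim(2) f(1) by blast
      qed
    qed
  qed
qed

lemma A0_subgradient: "AE x in lebesgue_on \<Omega>. \<forall>N\<in>sym_matrices. A0 x \<bullet> (N - W0 x) \<le> 1 * (H x N - F m0 x)"
proof (rule AE_all_symmetric)
  fix N :: "real^'a^'a" assume N: "N \<in> sym_matrices"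
  obtain K where K: "\<And>j. norm (mat_ext \<Omega> (A j)) \<le> K" using A_bounded by blast
  show "AE x in lebesgue_on \<Omega>. A0 x \<bullet> (N - W0 x) \<le> 1 * (H x N - F m0 x)"
    by (rule limit_inequality[where p = "\<lambda>j x. 1" and K' = K, OF L2_const _ order_refl _ _ L2_const A0_L2 tendsto_const _ N])
      (auto simp: A_L2 K A_weak)
qed

lemma B0_subgradient: "AE x in lebesgue_on \<Omega>. \<forall>N\<in>sym_matrices. B0 x \<bullet> (N - W0 x) \<le> m0 x * (H x N - F m0 x)"
proof (rule AE_all_symmetric)
  fix N :: "real^'a^'a" assume N: "N \<in> sym_matrices"
  obtain K where K: "\<And>j. norm (mat_ext \<Omega> (\<lambda>x. m j x *\<^sub>R A j x)) \<le> K" using mA_bounded by blast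
  obtain K' where K': "\<And>j. norm (ext \<Omega> (m j)) \<le> K'" using m_bounded by blast
  show "AE x in lebesgue_on \<Omega>. B0 x \<bullet> (N - W0 x) \<le> m0 x * (H x N - F m0 x)"
    by (rule limit_inequality[OF m_L2 m_nonneg K' mA_L2 K m0_L2 B0_L2 m_weak mA_weak N])
qed

text \<open>Where \<open>m0\<close> vanishes, \<open>B0\<close> is orthogonal to all symmetric matrices, so any subgradient may be chosen there.\<close>

definition limit_policy :: "real^'a \<Rightarrow> real^'a^'a" where
  "limit_policy x = sym_part (if 0 < m0 x then (1 / m0 x) *\<^sub>R B0 x else A0 x)"

lemma limit_policy_subgradient:
  "AE x in lebesgue_on \<Omega>. limit_policy x \<in> subdifferential_M H x (W0 x)"
  using A0_subgradient B0_subgradient limit_equation weak_hessian_symmetric[OF u0_V]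
proof eventually_elim
  case (elim x)
  have "H x (W0 x) + limit_policy x \<bullet> (N - W0 x) \<le> H x N" if N: "N \<in> sym_matrices" for N
  proof -
    have e: "limit_policy x \<bullet> (N - W0 x) = (if 0 < m0 x then (1 / m0 x) *\<^sub>R B0 x else A0 x) \<bullet> (N - W0 x)"
      unfolding limit_policy_def by (rule inner_sym_part[OF sym_matrices_diff[OF N elim(4)]])
    show ?thesis
    proof (cases "0 < m0 x")
      case True
      have "B0 x \<bullet> (N - W0 x) \<le> m0 x * (H x N - F m0 x)" using elim(2) N by blast
      then have "m0 x * (limit_policy x \<bullet> (N - W0 x)) \<le> m0 x * (H x N - H x (W0 x))" using True elim(3) by (simp add: e)
      then show ?thesis using True by simp
    qed (use elim(1,3) N e in auto)
  qed
  then show ?case by (simp add: subdifferential_M_def limit_policy_def sym_part_sym)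
qed

lemma limit_policy_measurable: "limit_policy \<in> borel_measurable (lebesgue_on \<Omega>)"
proof (rule measurable_matrix_nth)
  fix i k
  have [measurable]: "(\<lambda>x. A0 x $ i $ k) \<in> borel_measurable (lebesgue_on \<Omega>)" "(\<lambda>x. B0 x $ i $ k) \<in> borel_measurable (lebesgue_on \<Omega>)"
    "m0 \<in> borel_measurable (lebesgue_on \<Omega>)" for i k
    using L2_meas[OF mat_L2_nth[OF A0_L2]] L2_meas[OF mat_L2_nth[OF B0_L2]] L2_meas[OF m0_L2] by auto
  have "(\<lambda>x. ((if 0 < m0 x then 1 / m0 x * B0 x $ i $ k else A0 x $ i $ k) + (if 0 < m0 x then 1 / m0 x * B0 x $ k $ i else A0 x $ k $ i)) / 2)
      \<in> borel_measurable (lebesgue_on \<Omega>)" by measurable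
  then show "(\<lambda>x. limit_policy x $ i $ k) \<in> borel_measurable (lebesgue_on \<Omega>)"
    by (rule measurable_cong[THEN iffD1, rotated]) (simp add: limit_policy_def sym_part_nth)
qed

text \<open>Division by \<open>m0\<close> alone gives no essential bound. It comes from the
  subgradient inequality tested with W0 + B for B the limit policy itself: |B|^2 \<le> H(W0 + B) -
  H(W0) \<le> |C| |B|.\<close>

lemma limit_policy_D_H: "limit_policy \<in> D_H \<Omega> H u0"
proof -
  have "AE x in lebesgue_on \<Omega>. norm (limit_policy x) \<le> \<bar>C\<bar>"
    using limit_policy_subgradient AE_in_domain weak_hessian_symmetric[OF u0_V]
  proof eventually_elim
    case (elim x)
    let ?B = "limit_policy x"
    have B: "?B \<in> sym_matrices" by (simp add: limit_policy_def sym_part_sym)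
    then have WB: "W0 x + ?B \<in> sym_matrices" using elim(3) by (intro sym_matrices_add)
    have "H x (W0 x) + ?B \<bullet> ((W0 x + ?B) - W0 x) \<le> H x (W0 x + ?B)"
      using elim(1) WB unfolding subdifferential_M_def by blast
    then have "norm ?B * norm ?B \<le> \<bar>H x (W0 x + ?B) - H x (W0 x)\<bar>"
      by (simp add: power2_norm_eq_inner[symmetric] power2_eq_square)
    also have "\<dots> \<le> \<bar>C\<bar> * norm ?B" using H_lipschitz[OF elim(2) WB elim(3)] by simp
    finally show ?case by (cases "norm ?B = 0") (auto simp: mult_le_cancel_right)
  qed
  then show ?thesis unfolding D_H_def using limit_policy_measurable limit_policy_subgradient by blast
qed

lemma limit_policy_equation:
  assumes v: "v \<in> V_space \<Omega>"
  shows "L2_inner \<Omega> m0 (\<lambda>x. limit_policy x \<bullet> weak_hessian \<Omega> v x) = G v"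
proof -
  have "(\<lambda>j. G v) \<longlonglongrightarrow> inner (mat_ext \<Omega> B0) (mat_ext \<Omega> (weak_hessian \<Omega> v))"
    using mA_weak[OF mat_L2_hessian[OF v]] unfolding inner_mat_ext(1)[OF mA_L2 mat_L2_hessian[OF v]] m_equation[OF v] .
  then have "G v = inner (mat_ext \<Omega> B0) (mat_ext \<Omega> (weak_hessian \<Omega> v))" by (simp add: LIMSEQ_const_iff)
  also have "\<dots> = (LINT x|lebesgue_on \<Omega>. B0 x \<bullet> weak_hessian \<Omega> v x)" by (rule inner_mat_ext(1)[OF B0_L2 mat_L2_hessian[OF v]])
  also have "\<dots> = L2_inner \<Omega> m0 (\<lambda>x. limit_policy x \<bullet> weak_hessian \<Omega> v x)"
    unfolding L2_inner_def
  proof (rule integral_cong_AE)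
    have [measurable]: "limit_policy \<in> borel_measurable (lebesgue_on \<Omega>)" "weak_hessian \<Omega> v \<in> borel_measurable (lebesgue_on \<Omega>)"
      "m0 \<in> borel_measurable (lebesgue_on \<Omega>)" "B0 \<in> borel_measurable (lebesgue_on \<Omega>)"
      by (intro limit_policy_measurable mat_L2_meas mat_L2_hessian v L2_meas m0_L2 B0_L2)+
    show "(\<lambda>x. B0 x \<bullet> weak_hessian \<Omega> v x) \<in> borel_measurable (lebesgue_on \<Omega>)" by measurable
    show "(\<lambda>x. m0 x * (limit_policy x \<bullet> weak_hessian \<Omega> v x)) \<in> borel_measurable (lebesgue_on \<Omega>)" by measurable
    show "AE x in lebesgue_on \<Omega>. B0 x \<bullet> weak_hessian \<Omega> v x = m0 x * (limit_policy x \<bullet> weak_hessian \<Omega> v x)"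
      using m0_nonneg B0_subgradient weak_hessian_symmetric[OF u0_V] weak_hessian_symmetric[OF v]
    proof eventually_elim
      case (elim x)
      let ?Z = "weak_hessian \<Omega> v x"
      have e: "limit_policy x \<bullet> ?Z = (if 0 < m0 x then (1 / m0 x) *\<^sub>R B0 x else A0 x) \<bullet> ?Z"
        unfolding limit_policy_def by (rule inner_sym_part[OF elim(4)])
      show ?case
      proof (cases "0 < m0 x")
        case True
        then show ?thesis by (simp add: e)
      next
        case False
        then have m: "m0 x = 0" using elim(1) by simp
        \<comment> \<open>Where the weight is zero the right-hand side vanishes for every symmetric
          matrix; c = 1 and c = -1 together force B0 : Z = 0.\<close>
        have "B0 x \<bullet> (W0 x + c *\<^sub>R ?Z - W0 x) \<le> m0 x * (H x (W0 x + c *\<^sub>R ?Z) - F m0 x)" for c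
          using elim(2) sym_matrices_lin[OF elim(3,4), of c] by blast
        from this[of 1] this[of "-1"] show ?thesis by (simp add: m)
      qed
    qed
  qed
  finally show ?thesis by simp
qed

lemma limit_PDI: "PDI_solution \<Omega> H F G u0 m0"
  unfolding PDI_solution_def
proof (intro conjI u0_V m0_L2 limit_equation exI[of _ "\<lambda>x. - limit_policy x"] ballI)
  show "(\<lambda>x. - (- limit_policy x)) \<in> D_H \<Omega> H u0" using limit_policy_D_H by simp
  fix v assume "v \<in> V_space \<Omega>"
  from limit_policy_equation[OF this] show "L2_inner \<Omega> m0 (\<lambda>x. - (- limit_policy x) \<bullet> weak_hessian \<Omega> v x) = G v" by simp
qed

text \<open>The linear equation is tested with v - u0, and the subgradient inequality at
  \<open>u0\<close> is multiplied by the nonnegative \<open>m0\<close>. The Lipschitz bound of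
  \<open>H\<close> and the essential bound of the limit policy make both sides integrable.\<close>

lemma limit_VI: "VI_solution \<Omega> H F G u0 m0"
  unfolding VI_solution_def
proof (intro conjI u0_V limit_equation ballI)
  show "m0 \<in> L2_nonneg \<Omega>" using m0_L2 m0_nonneg by (simp add: L2_nonneg_def)
  fix v assume v: "v \<in> V_space \<Omega>"
  let ?d = "\<lambda>x. v x - u0 x"
  have d: "?d \<in> V_space \<Omega>" by (rule V_diff[OF v u0_V])
  obtain K where K: "AE x in lebesgue_on \<Omega>. norm (limit_policy x) \<le> K" using limit_policy_D_H by (auto simp: D_H_def)
  have lp: "(\<lambda>x. limit_policy x \<bullet> weak_hessian \<Omega> ?d x) \<in> L2 \<Omega>"
  proof (rule L2_dominated(1)[OF _ L2_scale[OF mat_L2_norm(1)[OF mat_L2_hessian[OF d]]]])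
    show "AE x in lebesgue_on \<Omega>. \<bar>limit_policy x \<bullet> weak_hessian \<Omega> ?d x\<bar> \<le> K * norm (weak_hessian \<Omega> ?d x)"
      using K by eventually_elim (rule order_trans[OF Cauchy_Schwarz_ineq2 mult_right_mono[OF _ norm_ge_zero]])
    have [measurable]: "limit_policy \<in> borel_measurable (lebesgue_on \<Omega>)" "weak_hessian \<Omega> ?d \<in> borel_measurable (lebesgue_on \<Omega>)"
      by (intro limit_policy_measurable mat_L2_meas mat_L2_hessian d)+
    show "(\<lambda>x. limit_policy x \<bullet> weak_hessian \<Omega> ?d x) \<in> borel_measurable (lebesgue_on \<Omega>)" by measurable
  qed
  have Hd: "(\<lambda>x. H x (weak_hessian \<Omega> v x) - H x (W0 x)) \<in> L2 \<Omega>"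
  proof (rule L2_dominated(1)[OF _ L2_scale[OF mat_L2_norm(1)[OF mat_L2_diff[OF mat_L2_hessian[OF v] mat_L2_hessian[OF u0_V]]], of "\<bar>C\<bar>"]])
    show "(\<lambda>x. H x (weak_hessian \<Omega> v x) - H x (W0 x)) \<in> borel_measurable (lebesgue_on \<Omega>)"
    proof (rule measurable_AE_cong)
      show "(\<lambda>x. H x (sym_hessian \<Omega> v x) - H x (sym_hessian \<Omega> u0 x)) \<in> borel_measurable (lebesgue_on \<Omega>)"
        by (intro borel_measurable_diff H_measurable sym_hessian_meas sym_hessian_sym v u0_V)
      show "AE x in lebesgue_on \<Omega>. H x (sym_hessian \<Omega> v x) - H x (sym_hessian \<Omega> u0 x) = H x (weak_hessian \<Omega> v x) - H x (W0 x)"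
        using sym_hessian_AE[OF v] sym_hessian_AE[OF u0_V] by eventually_elim simp
    qed
    show "AE x in lebesgue_on \<Omega>. \<bar>H x (weak_hessian \<Omega> v x) - H x (W0 x)\<bar> \<le> \<bar>C\<bar> * norm (weak_hessian \<Omega> v x - W0 x)"
      using AE_in_domain weak_hessian_symmetric[OF v] weak_hessian_symmetric[OF u0_V] by eventually_elim (rule H_lipschitz)
  qed
  have "G ?d = (LINT x|lebesgue_on \<Omega>. m0 x * (limit_policy x \<bullet> weak_hessian \<Omega> ?d x))"
    using limit_policy_equation[OF d] by (simp add: L2_inner_def)
  also have "\<dots> \<le> (LINT x|lebesgue_on \<Omega>. m0 x * (H x (weak_hessian \<Omega> v x) - H x (W0 x)))"
  proof (rule integral_mono_AE)
    show "AE x in lebesgue_on \<Omega>. m0 x * (limit_policy x \<bullet> weak_hessian \<Omega> ?d x) \<le> m0 x * (H x (weak_hessian \<Omega> v x) - H x (W0 x))"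
      using m0_nonneg limit_policy_subgradient weak_hessian_symmetric[OF v] weak_hessian_diff[OF v u0_V]
    proof eventually_elim
      case (elim x)
      have "H x (W0 x) + limit_policy x \<bullet> (weak_hessian \<Omega> v x - W0 x) \<le> H x (weak_hessian \<Omega> v x)"
        using elim(2,3) unfolding subdifferential_M_def by blast
      then show ?case using elim(1,4) by (intro mult_left_mono) auto
    qed
  qed (intro L2_integrable_mult m0_L2 lp Hd)+
  finally show "G ?d \<le> L2_inner \<Omega> m0 (\<lambda>x. H x (weak_hessian \<Omega> v x) - H x (W0 x))" by (simp add: L2_inner_def)
qed

end

end

lemma (in regularized_sequence) converging_subsequence:
  obtains r u0 m0 where "strict_mono (r :: nat \<Rightarrow> nat)" "PDI_solution \<Omega> H F G u0 m0" "VI_solution \<Omega> H F G u0 m0"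
    "(\<lambda>j. H2_norm \<Omega> (\<lambda>x. u (r j) x - u0 x)) \<longlonglongrightarrow> 0" "L2_weak_tendsto \<Omega> (\<lambda>j. m (r j)) m0"
proof -
  obtain r m0 A0 B0 where r: "strict_mono (r :: nat \<Rightarrow> nat)" and L: "m0 \<in> L2 \<Omega>" "A0 \<in> mat_L2 \<Omega>" "B0 \<in> mat_L2 \<Omega>"
    "\<And>w. w \<in> L2 \<Omega> \<Longrightarrow> (\<lambda>j. inner (ext \<Omega> (m (r j))) (ext \<Omega> w)) \<longlonglongrightarrow> inner (ext \<Omega> m0) (ext \<Omega> w)"
    "\<And>W. W \<in> mat_L2 \<Omega> \<Longrightarrow> (\<lambda>j. inner (mat_ext \<Omega> (A (r j))) (mat_ext \<Omega> W)) \<longlonglongrightarrow> inner (mat_ext \<Omega> A0) (mat_ext \<Omega> W)"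
    "\<And>W. W \<in> mat_L2 \<Omega> \<Longrightarrow> (\<lambda>j. inner (mat_ext \<Omega> (\<lambda>x. m (r j) x *\<^sub>R A (r j) x)) (mat_ext \<Omega> W)) \<longlonglongrightarrow> inner (mat_ext \<Omega> B0) (mat_ext \<Omega> W)"
    using weak_limits by blast
  have \<omega>: "(\<lambda>j. \<omega> (r j)) \<longlonglongrightarrow> 0" using LIMSEQ_subseq_LIMSEQ[OF \<omega>_tendsto r] by (simp add: o_def)
  \<comment> \<open>The policies along the subsequence are the subsequence of the policies, so the
    extracted weak limits satisfy the assumptions of the second locale.\<close>
  have A: "policy \<Omega> (\<lambda>j. h (r j)) (\<lambda>j. u (r j)) = (\<lambda>j. A (r j))" by (simp add: policy_def fun_eq_iff)
  interpret sub: regularized_limit \<Omega> H "\<lambda>j. h (r j)" "\<lambda>j. \<omega> (r j)" C \<nu>l \<nu>u \<epsilon> F G "\<lambda>j. u (r j)" "\<lambda>j. m (r j)" m0 A0 B0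
    using L \<omega> cordes_params
    by unfold_locales (simp_all only: A h_continuous h_lipschitz h_convex h_differentiable h_approx h_cordes
        F_operator F_completely_continuous G_dual solution)
  obtain u0 where "u0 \<in> V_space \<Omega>" "(\<lambda>j. H2_norm \<Omega> (\<lambda>x. u (r j) x - u0 x)) \<longlonglongrightarrow> 0" "(\<lambda>j. hess_ext \<Omega> (u (r j))) \<longlonglongrightarrow> hess_ext \<Omega> u0"
    by (rule sub.u_converges)
  with that r sub.limit_PDI sub.limit_VI sub.m_weak_tendsto show ?thesis by blast
qed

theorem theorem7p2:
  fixes \<Omega> :: "(real^'n) set"
    and \<A> :: "'a::metric_space set"
    and a :: "real^'n \<Rightarrow> 'a \<Rightarrow> real^'n^'n"
    and f :: "real^'n \<Rightarrow> 'a \<Rightarrow> real"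
    and \<nu>l \<nu>u \<epsilon> :: real
    and F :: "(real^'n \<Rightarrow> real) \<Rightarrow> real^'n \<Rightarrow> real"
    and G :: "(real^'n \<Rightarrow> real) \<Rightarrow> real"
    and H :: "real^'n \<Rightarrow> real^'n^'n \<Rightarrow> real"
    and Hr :: "real \<Rightarrow> real^'n \<Rightarrow> real^'n^'n \<Rightarrow> real"
    and ur mr :: "real \<Rightarrow> real^'n \<Rightarrow> real"
  assumes "open \<Omega>" "bounded \<Omega>" "convex \<Omega>" "\<Omega> \<noteq> {}"
    and "compact \<A>" "\<A> \<noteq> {}"
    and "0 < \<nu>l" "\<nu>l \<le> \<nu>u" "0 < \<epsilon>" "\<epsilon> \<le> 1"
    and "continuous_on (closure \<Omega> \<times> \<A>) (\<lambda>(x, \<alpha>). a x \<alpha>)"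
    and "\<forall>x\<in>closure \<Omega>. \<forall>\<alpha>\<in>\<A>. a x \<alpha> \<in> cordes_class \<nu>l \<nu>u \<epsilon>"
    and "continuous_on (closure \<Omega> \<times> \<A>) (\<lambda>(x, \<alpha>). f x \<alpha>)"
    and "L2_operator \<Omega> F" "completely_continuous \<Omega> F"
    and "G \<in> V_dual \<Omega>" "nonneg_functional \<Omega> G"
    and H_def: "H = hamiltonian \<A> a f"
    and "admissible_regularization \<Omega> H \<nu>l \<nu>u \<epsilon> Hr"
    and "\<forall>l\<in>{0<..1}. regularized_solution \<Omega> (Hr l) F G (ur l) (mr l)"
  shows "\<exists>(ls :: nat \<Rightarrow> real) u m.
      (\<forall>j. ls j \<in> {0<..1}) \<and> ls \<longlonglongrightarrow> 0 \<and>
      u \<in> V_space \<Omega> \<and> m \<in> L2_nonneg \<Omega> \<and>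
      PDI_solution \<Omega> H F G u m \<and> VI_solution \<Omega> H F G u m \<and>
      (\<lambda>j. H2_norm \<Omega> (\<lambda>x. ur (ls j) x - u x)) \<longlonglongrightarrow> 0 \<and>
      L2_weak_tendsto \<Omega> (\<lambda>j. mr (ls j)) m"
  proof -
  note reg = assms(19)[unfolded admissible_regularization_def]
  obtain C where C: "\<forall>l\<in>{0<..1}. \<forall>x\<in>closure \<Omega>. \<forall>M\<in>sym_matrices. \<forall>N\<in>sym_matrices. \<bar>Hr l x M - Hr l x N\<bar> \<le> C * norm (M - N)"
    using reg[THEN conjunct2, THEN conjunct1] ..
  obtain \<omega> where \<omega>: "continuous_on {0..1} \<omega>" "\<omega> 0 = 0"
    "\<forall>l\<in>{0<..1}. \<forall>x\<in>closure \<Omega>. \<forall>M\<in>sym_matrices. \<bar>Hr l x M - H x M\<bar> \<le> \<omega> l"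
    using reg[THEN conjunct2, THEN conjunct2, THEN conjunct2, THEN conjunct1] by (elim exE conjE)
  \<comment> \<open>A null sequence inside (0, 1]; continuity of the modulus \<omega> at 0 makes the
    approximation error vanish along it.\<close>
  define l :: "nat \<Rightarrow> real" where "l j = inverse (real (Suc j))" for j
  have l: "l j \<in> {0<..1}" for j by (simp add: l_def inverse_le_1_iff)
  have l0: "l \<longlonglongrightarrow> 0" unfolding l_def by (rule LIMSEQ_inverse_real_of_nat)
  have \<omega>l: "(\<lambda>j. \<omega> (l j)) \<longlonglongrightarrow> 0"
    using continuous_on_tendsto_compose[OF \<omega>(1) l0] l \<omega>(2) by (simp add: less_imp_le)
  interpret regularized_sequence \<Omega> H "\<lambda>j. Hr (l j)" "\<lambda>j. \<omega> (l j)" C \<nu>l \<nu>u \<epsilon> F G "\<lambda>j. ur (l j)" "\<lambda>j. mr (l j)"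
  proof
    show "open \<Omega>" "bounded \<Omega>" "convex \<Omega>" "\<Omega> \<noteq> {}" "0 < \<nu>l" "0 < \<epsilon>" "\<epsilon> \<le> 1"
      "L2_operator \<Omega> F" "completely_continuous \<Omega> F" "G \<in> V_dual \<Omega>" by fact+
    show "(\<lambda>j. \<omega> (l j)) \<longlonglongrightarrow> 0" by (rule \<omega>l)
    show "\<And>j x M N. x \<in> closure \<Omega> \<Longrightarrow> M \<in> sym_matrices \<Longrightarrow> N \<in> sym_matrices \<Longrightarrow> \<bar>Hr (l j) x M - Hr (l j) x N\<bar> \<le> C * norm (M - N)"
      using C l by blast
    show "\<And>j x M. x \<in> closure \<Omega> \<Longrightarrow> M \<in> sym_matrices \<Longrightarrow> \<bar>Hr (l j) x M - H x M\<bar> \<le> \<omega> (l j)"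
      using \<omega>(3) l by blast
  qed (use l reg assms(20) in blast)+
  obtain r u m where r: "strict_mono (r :: nat \<Rightarrow> nat)" and um: "PDI_solution \<Omega> H F G u m" "VI_solution \<Omega> H F G u m"
    "(\<lambda>j. H2_norm \<Omega> (\<lambda>x. ur (l (r j)) x - u x)) \<longlonglongrightarrow> 0" "L2_weak_tendsto \<Omega> (\<lambda>j. mr (l (r j))) m"
    using converging_subsequence by blast
  have "(\<lambda>j. l (r j)) \<longlonglongrightarrow> 0" using LIMSEQ_subseq_LIMSEQ[OF l0 r] by (simp add: o_def)
  then show ?thesis using l um by (intro exI[of _ "\<lambda>j. l (r j)"] exI[of _ u] exI[of _ m]) (simp add: VI_solution_def)
qed

end
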